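(* Let $0<n<m$. The local picture and the particle picture are isomorphic as crystals. That is, for all integers $0\le a,a'\le m-n$ and $0\le b,b'\le n$, the crystal $P_{a,b;a',b'}$ of doubly infinite paths is isomorphic to the disjoint union, over all $M,N\ge0$, of the crystal parts of $\mathcal A/\mathcal R$, where $\mathcal A$ is spanned by the sequences of $M$ spin-$\frac12$ and $N$ spin-$0$ particles initiating at the domain $(a',b')$ and terminating at the domain $(a,b)$ and $\mathcal R$ is the subspace of relations.
   Context: Local picture. For $k\in\mathbb Z$ let $\bar p(k;a,b)=n-b$ if $k$ is odd, $a+b$ if $k\equiv0\pmod4$, $m-n-a+b$ if $k\equiv2\pmod4$. $P_{a,b;a',b'}$ is the set of sequences $|p\rangle=\cdots p(2)p(1)p(0)p(-1)\cdots$ with $p(k)\in\{0,\dots,n\}$ for $k$ odd, $p(k)\in\{0,\dots,m\}$ for $k$ even, $p(k)=\bar p(k;a,b)$ for $k\gg0$ and $p(k)=\bar p(k;a',b')$ for $k\ll0$. Crystal structure: with $N_k=n$ ($k$ odd), $N_k=m$ ($k$ even), replace each $p(k)$ by the word $1^x0^y$ with $(x,y)=(p(k),N_k-p(k))$ for $i=1$ and $(N_k-p(k),p(k))$ for $i=0$, concatenate in the order of decreasing $k$, and remove repeatedly all adjacent pairs $01$; finitely many symbols $1^j0^l$ remain. $\tilde f_i$ changes the leftmost remaining $0$ into $1$ (result $0$ if $l=0$), $\tilde e_i$ changes the rightmost remaining $1$ into $0$ (result $0$ if $j=0$); the removed pairs are put back and the path is rebuilt. Equivalently (via a bijection) paths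 may be described by sequences of domains $(a_i,b_i)$ and domain walls. Particles. A domain is a pair $(a,b)$ with $0\le a\le m-n$, $0\le b\le n$. Spin-$\frac12$ particles are symbols $\psi^{(1/2)s}_{\varepsilon,\kappa}$ with $s\in\{+,-\}$ (identified with $\pm1$), $\varepsilon\in\{0,1\}$, $\kappa\in\mathbb Z$, $s(-1)^{\varepsilon}=(-1)^\kappa$. Spin-$0$ particles are symbols $\psi^{(0)s,t}_\kappa$ with $s,t\in\{+,-\}$, $\kappa\in\mathbb Z$, $-st=(-1)^\kappa$. A particle $\psi^{(1/2)s}_{\varepsilon,\kappa}$ takes the domain $(a,b)$ to $(a+s,b)$; $\psi^{(0)s,t}_\kappa$ takes $(a,b)$ to $(a+s,b+t)$. A sequence (product) of particles acts from right to left starting at an initial domain, and all successive pairs $(a,b)$ so obtained are required to be domains, i.e. to satisfy $0\le a\le m-n$ and $0\le b\le n$. For fixed $M,N$, initial and terminal domains, $\mathcal A$ is the vector space with basis all sequences with exactly $M$ spin-$\frac12$ and $N$ spin-$0$ particles (monomials; the empty sequence is allowed when $M=N=0$ and the two domains agree). Relations. $\mathcal R\subset\mathcal A$ is the span of all differences obtained by applying the following relations to an adjacent pair of particles acting on the domain $(a,b)$: $\psi^{(1/2)s}_{\varepsilon,\kappa}\psi^{(1/2)s'}_{\varepsilon',\kappa'}=-\psi^{(1/2)s}_{\varepsilon,\kappa'+\nu}\psi^{(1/2)s'}_{\varepsilon',\kappa-\nu}$ with $\nu=\delta_{s,s'}+\delta_{\varepsilon,\varepsilon'}$; $\psi^{(0)s,t}_{\kappa}\psi^{(0)s',t'}_{\kappa'}=-\psi^{(0)s,t}_{\kappa'+\nu}\psi^{(0)s',t'}_{\kappa-\nu}$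 with $\nu=\delta_{s,s'}+\delta_{t,t'}$; $\psi^{(0)s,t}_\kappa\psi^{(1/2)s}_{\varepsilon,\kappa'}=\psi^{(1/2)s}_{\varepsilon,\kappa'}\psi^{(0)s,t}_\kappa$; $\psi^{(0)+,t}_\kappa\psi^{(1/2)-}_{\varepsilon,\kappa'}=\psi^{(1/2)-}_{\varepsilon,\kappa'}\psi^{(0)+,t}_\kappa$ if $a\ne m-n$, and $=\psi^{(1/2)+}_{\varepsilon,\kappa'+1}\psi^{(0)-,t}_{\kappa-1}$ if $a=m-n$; $\psi^{(0)-,t}_\kappa\psi^{(1/2)+}_{\varepsilon,\kappa'}=\psi^{(1/2)+}_{\varepsilon,\kappa'}\psi^{(0)-,t}_\kappa$ if $a\ne0$, and $=\psi^{(1/2)-}_{\varepsilon,\kappa'+1}\psi^{(0)+,t}_{\kappa-1}$ if $a=0$. Crystal structure of the particle picture. On monomials of $\mathcal A$: read the $\varepsilon$-indices of the spin-$\frac12$ particles from left to right as a $0$–$1$ word (for $i=1$: $\varepsilon=0\mapsto0$, $\varepsilon=1\mapsto1$; for $i=0$: $\varepsilon=0\mapsto1$, $\varepsilon=1\mapsto0$), remove repeatedly all adjacent pairs $01$, and let $\tilde f_i$ act on the particle of the leftmost remaining $0$ by $\psi^{(1/2)s}_{\varepsilon,\kappa}\mapsto\psi^{(1/2)s}_{1-\varepsilon,\kappa-1}$ (zero if none), $\tilde e_i$ on the particle of the rightmost remaining $1$ by $\psi^{(1/2)s}_{\varepsilon,\kappa}\mapsto\psi^{(1/2)s}_{1-\varepsilon,\kappa+1}$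 (zero if none). This is the tensor product of affine crystals $\mathrm{Aff}(B^{(1)})$ (spin-$\frac12$) and $\mathrm{Aff}(B^{(0)})$ (spin-$0$) in the principal gradation. The set of relations is preserved by this action; the crystal part of $\mathcal A/\mathcal R$ is the set of nonzero images of monomials in $\mathcal A/\mathcal R$, taken modulo sign, with the induced $\tilde e_i,\tilde f_i$ (equivalently, the crystal of separately ordered sequences, see next sentence). A monomial is separately ordered if it has the form $\psi^{(1/2)s'_1}_{\varepsilon_1,\kappa'_1}\cdots\psi^{(1/2)s'_M}_{\varepsilon_M,\kappa'_M}\psi^{(0)s_1,t_1}_{\kappa_1}\cdots\psi^{(0)s_N,t_N}_{\kappa_N}$ with, for each $i$, $\kappa'_i<\kappa'_{i+1}$ or $(\kappa'_i,s'_i,\varepsilon_i)=(\kappa'_{i+1},s'_{i+1},\varepsilon_{i+1})$, and $\kappa_i<\kappa_{i+1}$ or $(\kappa_i,s_i,t_i)=(\kappa_{i+1},s_{i+1},t_{i+1})$. *)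

theory Defs
  imports Complex_Main "HOL-Library.Poly_Mapping"
begin

section \<open>Crystals\<close>

text \<open>
  A crystal is given by a set \<open>B\<close> and, for \<open>i \<in> {0, 1}\<close>, operators \<open>e i\<close>, \<open>f i\<close> whose value
  \<^term>\<open>None\<close> plays the role of the element \<open>0\<close> adjoined to \<open>B\<close>.
\<close>

definition crystal :: "'x set \<Rightarrow> (nat \<Rightarrow> 'x \<Rightarrow> 'x option) \<Rightarrow> (nat \<Rightarrow> 'x \<Rightarrow> 'x option) \<Rightarrow> bool" where
  "crystal B e f \<longleftrightarrow>
     (\<forall>i\<in>{0, 1}. \<forall>x\<in>B.
        (\<forall>y. f i x = Some y \<longrightarrow> y \<in> B \<and> e i y = Some x) \<and>
        (\<forall>y. e i x = Some y \<longrightarrow> y \<in> B \<and> f i y = Some x))"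

definition crystal_iso ::
  "'x set \<Rightarrow> (nat \<Rightarrow> 'x \<Rightarrow> 'x option) \<Rightarrow> (nat \<Rightarrow> 'x \<Rightarrow> 'x option) \<Rightarrow>
   'y set \<Rightarrow> (nat \<Rightarrow> 'y \<Rightarrow> 'y option) \<Rightarrow> (nat \<Rightarrow> 'y \<Rightarrow> 'y option) \<Rightarrow> ('x \<Rightarrow> 'y) \<Rightarrow> bool" where
  "crystal_iso B e f B' e' f' \<phi> \<longleftrightarrow>
     crystal B e f \<and> crystal B' e' f' \<and> bij_betw \<phi> B B' \<and>
     (\<forall>i\<in>{0, 1}. \<forall>x\<in>B.
        e' i (\<phi> x) = map_option \<phi> (e i x) \<and> f' i (\<phi> x) = map_option \<phi> (f i x))"

section \<open>The signature rule\<close>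

text \<open>
  A \<open>0\<close>-\<open>1\<close> word is given by a set \<open>S\<close> of positions, a strict total order \<open>L\<close> on it
  (\<open>L x y\<close>: \<open>x\<close> is to the left of \<open>y\<close>) and the letters \<open>w\<close>.  A letter \<open>0\<close> at \<open>x\<close> and a letter \<open>1\<close>
  at \<open>y\<close> to its right are removed together once they have become adjacent, i.e. once all letters
  strictly between them have been removed, necessarily in pairs lying between \<open>x\<close> and \<open>y\<close>.
  This makes sense for doubly infinite words as well.
\<close>

inductive removed_pair :: "'p set \<Rightarrow> ('p \<Rightarrow> 'p \<Rightarrow> bool) \<Rightarrow> ('p \<Rightarrow> int) \<Rightarrow> 'p \<Rightarrow> 'p \<Rightarrow> bool"
  for S :: "'p set" and L :: "'p \<Rightarrow> 'p \<Rightarrow> bool" and w :: "'p \<Rightarrow> int" where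
  "\<lbrakk>x \<in> S; y \<in> S; L x y; w x = 0; w y = 1;
    \<forall>z\<in>S. L x z \<and> L z y \<longrightarrow>
      (\<exists>z'. L x z' \<and> L z' y \<and> (removed_pair S L w z z' \<or> removed_pair S L w z' z))\<rbrakk>
   \<Longrightarrow> removed_pair S L w x y"

definition remaining :: "'p set \<Rightarrow> ('p \<Rightarrow> 'p \<Rightarrow> bool) \<Rightarrow> ('p \<Rightarrow> int) \<Rightarrow> int \<Rightarrow> 'p set" where
  "remaining S L w c =
     {x\<in>S. w x = c \<and> (\<nexists>y. removed_pair S L w x y \<or> removed_pair S L w y x)}"

definition f_position :: "'p set \<Rightarrow> ('p \<Rightarrow> 'p \<Rightarrow> bool) \<Rightarrow> ('p \<Rightarrow> int) \<Rightarrow> 'p option" where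
  "f_position S L w =
     (let Z = remaining S L w 0 in
      if Z = {} then None else Some (THE x. x \<in> Z \<and> (\<forall>y\<in>Z. y \<noteq> x \<longrightarrow> L x y)))"

definition e_position :: "'p set \<Rightarrow> ('p \<Rightarrow> 'p \<Rightarrow> bool) \<Rightarrow> ('p \<Rightarrow> int) \<Rightarrow> 'p option" where
  "e_position S L w =
     (let U = remaining S L w 1 in
      if U = {} then None else Some (THE x. x \<in> U \<and> (\<forall>y\<in>U. y \<noteq> x \<longrightarrow> L y x)))"

section \<open>The local picture\<close>

type_synonym domain = "int \<times> int"

definition domains :: "int \<Rightarrow> int \<Rightarrow> domain set" where
  "domains m n = {0..m - n} \<times> {0..n}"

definition ground_path :: "int \<Rightarrow> int \<Rightarrow> domain \<Rightarrow> int \<Rightarrow> int" where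
  "ground_path m n d k = (case d of (a, b) \<Rightarrow>
     if odd k then n - b else if k mod 4 = 0 then a + b else m - n - a + b)"

definition block_length :: "int \<Rightarrow> int \<Rightarrow> int \<Rightarrow> int" where
  "block_length m n k = (if odd k then n else m)"

definition paths :: "int \<Rightarrow> int \<Rightarrow> domain \<Rightarrow> domain \<Rightarrow> (int \<Rightarrow> int) set" where
  "paths m n d d' =
     {p. (\<forall>k. p k \<in> {0..block_length m n k}) \<and>
         (\<forall>\<^sub>F k in at_top. p k = ground_path m n d k) \<and>
         (\<forall>\<^sub>F k in at_bot. p k = ground_path m n d' k)}"

text \<open>Position \<open>(k, j)\<close> is the \<open>j\<close>-th letter (counted from \<open>0\<close>) of the word \<open>1\<^sup>x0\<^sup>y\<close> replacing \<open>p k\<close>.\<close>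

definition path_positions :: "int \<Rightarrow> int \<Rightarrow> (int \<times> int) set" where
  "path_positions m n = {(k, j). 0 \<le> j \<and> j < block_length m n k}"

definition path_left_of :: "int \<times> int \<Rightarrow> int \<times> int \<Rightarrow> bool" where
  "path_left_of = (\<lambda>(k, j) (k', j'). k > k' \<or> (k = k' \<and> j < j'))"

definition path_word :: "int \<Rightarrow> int \<Rightarrow> nat \<Rightarrow> (int \<Rightarrow> int) \<Rightarrow> int \<times> int \<Rightarrow> int" where
  "path_word m n i p = (\<lambda>(k, j).
     if j < (if i = 1 then p k else block_length m n k - p k) then 1 else 0)"

text \<open>
  The inverse of \<^const>\<open>path_word\<close>: \<open>p k\<close> is the number of letters \<open>1\<close> (for \<open>i = 1\<close>),
  respectively \<open>0\<close> (for \<open>i = 0\<close>), in block \<open>k\<close>.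
\<close>

definition path_of_word :: "int \<Rightarrow> int \<Rightarrow> nat \<Rightarrow> (int \<times> int \<Rightarrow> int) \<Rightarrow> int \<Rightarrow> int" where
  "path_of_word m n i w k =
     int (card {j \<in> {0..<block_length m n k}. w (k, j) = (if i = 1 then 1 else 0)})"

definition path_f :: "int \<Rightarrow> int \<Rightarrow> nat \<Rightarrow> (int \<Rightarrow> int) \<Rightarrow> (int \<Rightarrow> int) option" where
  "path_f m n i p =
     (let w = path_word m n i p
      in map_option (\<lambda>x. path_of_word m n i (w(x := 1)))
           (f_position (path_positions m n) path_left_of w))"

definition path_e :: "int \<Rightarrow> int \<Rightarrow> nat \<Rightarrow> (int \<Rightarrow> int) \<Rightarrow> (int \<Rightarrow> int) option" where
  "path_e m n i p =
     (let w = path_word m n i p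
      in map_option (\<lambda>x. path_of_word m n i (w(x := 0)))
           (e_position (path_positions m n) path_left_of w))"

section \<open>The particle picture\<close>

text \<open>
  \<open>Half s \<epsilon> \<kappa>\<close> and \<open>Null s t \<kappa>\<close> stand for the symbols \<open>\<psi>\<^bsup>(1/2)s\<^esup>\<^bsub>\<epsilon>,\<kappa>\<^esub>\<close> and \<open>\<psi>\<^bsup>(0)s,t\<^esup>\<^bsub>\<kappa>\<^esub>\<close>,
  with signs \<open>s\<close>, \<open>t\<close> written as \<open>\<plusminus>1\<close>; the constraints on the indices are in \<open>is_particle\<close>.
\<close>

datatype particle = Half int int int | Null int int int

definition parity_sign :: "int \<Rightarrow> int" where
  "parity_sign k = (if even k then 1 else - 1)"

fun is_particle :: "particle \<Rightarrow> bool" where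
  "is_particle (Half s \<epsilon> \<kappa>) \<longleftrightarrow>
     s \<in> {1, - 1} \<and> \<epsilon> \<in> {0, 1} \<and> s * parity_sign \<epsilon> = parity_sign \<kappa>"
| "is_particle (Null s t \<kappa>) \<longleftrightarrow>
     s \<in> {1, - 1} \<and> t \<in> {1, - 1} \<and> - (s * t) = parity_sign \<kappa>"

fun is_half :: "particle \<Rightarrow> bool" where
  "is_half (Half s \<epsilon> \<kappa>) \<longleftrightarrow> True"
| "is_half (Null s t \<kappa>) \<longleftrightarrow> False"

fun move :: "particle \<Rightarrow> domain \<Rightarrow> domain" where
  "move (Half s \<epsilon> \<kappa>) (a, b) = (a + s, b)"
| "move (Null s t \<kappa>) (a, b) = (a + s, b + t)"

text \<open>
  The basis of \<open>\<A>\<close>: sequences, listed from left to right and hence acting from the end of the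
  list, with initial domain \<open>d'\<close> and terminal domain \<open>d\<close>.
\<close>

definition monomials :: "int \<Rightarrow> int \<Rightarrow> nat \<Rightarrow> nat \<Rightarrow> domain \<Rightarrow> domain \<Rightarrow> particle list set" where
  "monomials m n M N d d' =
     {w. (\<forall>x\<in>set w. is_particle x) \<and>
         length (filter is_half w) = M \<and>
         length (filter (\<lambda>x. \<not> is_half x) w) = N \<and>
         (\<forall>j\<le>length w. foldr move (drop j w) d' \<in> domains m n) \<and>
         foldr move w d' = d}"

text \<open>
  Vectors are finitely supported functions on sequences of particles; a sequence \<open>w\<close> is
  identified with \<^term>\<open>Poly_Mapping.single w 1\<close>.
\<close>

definition scale :: "'k::field \<Rightarrow> ('x \<Rightarrow>\<^sub>0 'k) \<Rightarrow> ('x \<Rightarrow>\<^sub>0 'k)" where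
  "scale c v = Poly_Mapping.map (\<lambda>x. c * x) v"

lemma lookup_scale: "Poly_Mapping.lookup (scale c v) x = c * Poly_Mapping.lookup v x"
  unfolding scale_def by transfer (simp add: when_def)

interpretation free: vector_space "scale :: 'k::field \<Rightarrow> ('x \<Rightarrow>\<^sub>0 'k) \<Rightarrow> ('x \<Rightarrow>\<^sub>0 'k)"
  by (standard; rule poly_mapping_eqI) (simp_all add: lookup_scale lookup_add algebra_simps)

definition delta :: "int \<Rightarrow> int \<Rightarrow> int" where
  "delta x y = (if x = y then 1 else 0)"

text \<open>
  \<open>exchange m n a (x, y) c (x', y')\<close> is the relation \<open>x y = c x' y'\<close> on a domain with first
  component \<open>a\<close>, where \<open>c = \<plusminus>1\<close>.
\<close>

inductive exchange ::
  "int \<Rightarrow> int \<Rightarrow> int \<Rightarrow> particle \<times> particle \<Rightarrow> int \<Rightarrow> particle \<times> particle \<Rightarrow> bool"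
  for m n a :: int where
  half_half:
    "\<nu> = delta s s' + delta \<epsilon> \<epsilon>' \<Longrightarrow>
     exchange m n a (Half s \<epsilon> \<kappa>, Half s' \<epsilon>' \<kappa>') (- 1)
       (Half s \<epsilon> (\<kappa>' + \<nu>), Half s' \<epsilon>' (\<kappa> - \<nu>))"
| null_null:
    "\<nu> = delta s s' + delta t t' \<Longrightarrow>
     exchange m n a (Null s t \<kappa>, Null s' t' \<kappa>') (- 1)
       (Null s t (\<kappa>' + \<nu>), Null s' t' (\<kappa> - \<nu>))"
| null_half_same:
    "exchange m n a (Null s t \<kappa>, Half s \<epsilon> \<kappa>') 1 (Half s \<epsilon> \<kappa>', Null s t \<kappa>)"
| null_plus_half_minus:
    "a \<noteq> m - n \<Longrightarrow>
     exchange m n a (Null 1 t \<kappa>, Half (- 1) \<epsilon> \<kappa>') 1 (Half (- 1) \<epsilon> \<kappa>', Null 1 t \<kappa>)"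
| null_plus_half_minus_boundary:
    "a = m - n \<Longrightarrow>
     exchange m n a (Null 1 t \<kappa>, Half (- 1) \<epsilon> \<kappa>') 1
       (Half 1 \<epsilon> (\<kappa>' + 1), Null (- 1) t (\<kappa> - 1))"
| null_minus_half_plus:
    "a \<noteq> 0 \<Longrightarrow>
     exchange m n a (Null (- 1) t \<kappa>, Half 1 \<epsilon> \<kappa>') 1 (Half 1 \<epsilon> \<kappa>', Null (- 1) t \<kappa>)"
| null_minus_half_plus_boundary:
    "a = 0 \<Longrightarrow>
     exchange m n a (Null (- 1) t \<kappa>, Half 1 \<epsilon> \<kappa>') 1
       (Half (- 1) \<epsilon> (\<kappa>' + 1), Null 1 t (\<kappa> - 1))"

definition relations ::
  "int \<Rightarrow> int \<Rightarrow> nat \<Rightarrow> nat \<Rightarrow> domain \<Rightarrow> domain \<Rightarrow> (particle list \<Rightarrow>\<^sub>0 'k::field) set" where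
  "relations m n M N d d' = free.span
     {v. \<exists>u r x y c x' y'.
        u @ [x, y] @ r \<in> monomials m n M N d d' \<and>
        u @ [x', y'] @ r \<in> monomials m n M N d d' \<and>
        exchange m n (fst (foldr move r d')) (x, y) c (x', y') \<and>
        v = Poly_Mapping.single (u @ [x, y] @ r) 1
              - scale (of_int c) (Poly_Mapping.single (u @ [x', y'] @ r) 1)}"

text \<open>
  The image of a vector in \<open>\<A>/\<R>\<close> taken modulo sign, i.e. the union of the cosets of \<open>v\<close> and
  \<open>- v\<close>.  The image is zero if and only if this union is \<open>\<R>\<close> itself.
\<close>

definition signed_class :: "('x \<Rightarrow>\<^sub>0 'k::field) set \<Rightarrow> ('x \<Rightarrow>\<^sub>0 'k) \<Rightarrow> ('x \<Rightarrow>\<^sub>0 'k) set" where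
  "signed_class R v = {u. u - v \<in> R \<or> u + v \<in> R}"

definition crystal_part ::
  "int \<Rightarrow> int \<Rightarrow> nat \<Rightarrow> nat \<Rightarrow> domain \<Rightarrow> domain \<Rightarrow> (particle list \<Rightarrow>\<^sub>0 'k::field) set set" where
  "crystal_part m n M N d d' =
     (let R = relations m n M N d d' in
      {signed_class R (Poly_Mapping.single w 1) | w.
         w \<in> monomials m n M N d d' \<and> Poly_Mapping.single w 1 \<notin> R})"

definition half_positions :: "particle list \<Rightarrow> nat set" where
  "half_positions w = {j. j < length w \<and> is_half (w ! j)}"

fun half_letter :: "nat \<Rightarrow> particle \<Rightarrow> int" where
  "half_letter i (Half s \<epsilon> \<kappa>) = (if i = 1 then \<epsilon> else 1 - \<epsilon>)"
| "half_letter i (Null s t \<kappa>) = undefined"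

fun flip_half :: "int \<Rightarrow> particle \<Rightarrow> particle" where
  "flip_half c (Half s \<epsilon> \<kappa>) = Half s (1 - \<epsilon>) (\<kappa> + c)"
| "flip_half c (Null s t \<kappa>) = Null s t \<kappa>"

definition monomial_f :: "nat \<Rightarrow> particle list \<Rightarrow> particle list option" where
  "monomial_f i w =
     map_option (\<lambda>j. w[j := flip_half (- 1) (w ! j)])
       (f_position (half_positions w) (<) (\<lambda>j. half_letter i (w ! j)))"

definition monomial_e :: "nat \<Rightarrow> particle list \<Rightarrow> particle list option" where
  "monomial_e i w =
     map_option (\<lambda>j. w[j := flip_half 1 (w ! j)])
       (e_position (half_positions w) (<) (\<lambda>j. half_letter i (w ! j)))"

text \<open>
  The operator on the crystal part induced by an operator \<open>F\<close> on monomials.  The union collects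
  the classes of \<open>F w\<close> for all monomials \<open>w\<close> representing \<open>C\<close>; they coincide because \<open>F\<close>
  preserves the relations, so that no representative has to be chosen.
\<close>

definition induced ::
  "(particle list \<Rightarrow> particle list option) \<Rightarrow> int \<Rightarrow> int \<Rightarrow> nat \<Rightarrow> nat \<Rightarrow> domain \<Rightarrow> domain \<Rightarrow>
   (particle list \<Rightarrow>\<^sub>0 'k::field) set \<Rightarrow> (particle list \<Rightarrow>\<^sub>0 'k) set option" where
  "induced F m n M N d d' C =
     (let R = relations m n M N d d';
          D = (\<Union>w \<in> {w \<in> monomials m n M N d d'. signed_class R (Poly_Mapping.single w 1) = C}.
                case F w of None \<Rightarrow> R | Some w' \<Rightarrow> signed_class R (Poly_Mapping.single w' 1))
      in if D = R then None else Some D)"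

definition particle_crystal ::
  "int \<Rightarrow> int \<Rightarrow> domain \<Rightarrow> domain \<Rightarrow> (nat \<times> nat \<times> (particle list \<Rightarrow>\<^sub>0 'k::field) set) set" where
  "particle_crystal m n d d' = {(M, N, C). C \<in> crystal_part m n M N d d'}"

definition particle_e ::
  "int \<Rightarrow> int \<Rightarrow> domain \<Rightarrow> domain \<Rightarrow> nat \<Rightarrow> nat \<times> nat \<times> (particle list \<Rightarrow>\<^sub>0 'k::field) set \<Rightarrow>
   (nat \<times> nat \<times> (particle list \<Rightarrow>\<^sub>0 'k) set) option" where
  "particle_e m n d d' i = (\<lambda>(M, N, C).
     map_option (\<lambda>D. (M, N, D)) (induced (monomial_e i) m n M N d d' C))"

definition particle_f ::
  "int \<Rightarrow> int \<Rightarrow> domain \<Rightarrow> domain \<Rightarrow> nat \<Rightarrow> nat \<times> nat \<times> (particle list \<Rightarrow>\<^sub>0 'k::field) set \<Rightarrow>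
   (nat \<times> nat \<times> (particle list \<Rightarrow>\<^sub>0 'k) set) option" where
  "particle_f m n d d' i = (\<lambda>(M, N, C).
     map_option (\<lambda>D. (M, N, D)) (induced (monomial_f i) m n M N d d' C))"

end

theory Submission
  imports Defs "HOL-Library.Countable_Set" "HOL-Library.Multiset"
begin

text \<open>
  Both crystals fibre over the configurations \<open>A : \<int> \<rightarrow> {0, \<dots>, m - n}\<close>.  On the side of paths, iterating the
  combinatorial \<open>R\<close>-matrix moves the spin-\<open>0\<close> content to the far right, and \<open>A\<close> is read off the level
  \<open>m - n\<close> path left behind.  On the side of particles, every monomial is \<open>\<plusminus>\<close> an ordered one or zero in
  \<open>\<A>/\<R>\<close>; distinct ordered monomials have distinct nonzero classes, because sorting the straightened indices
  (with the sign of the sorting permutation) is invariant under the relations.  Here \<open>A k\<close> is the first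
  coordinate of the domain reached by the spin-\<open>0\<close> particles and the spin-\<open>1/2\<close> particles with index at
  least \<open>k\<close>.

  In both pictures \<open>f\<^sub>i\<close> changes \<open>A\<close> by one at the last minimum of a height function that depends on \<open>A\<close>
  only, and it preserves the spin-\<open>0\<close> data.  The possible spin-\<open>0\<close> data over \<open>A\<close> form a countably infinite
  set that is constant along the operators, so arbitrary bijections between these sets yield the
  isomorphism.
\<close>

section \<open>The signature rule and heights\<close>

text \<open>In a general path the two kinds of content overlap, and spin-0 content meeting a full or
  empty site may be reflected; so domain walls cannot be read off site by site. The evolution
  disentangles them because it is injective, commutes with the crystal operators and carries spin-0
  content along with speed one. The crux is that reflections stop: as long as sites keep reflecting,
  the variation up to the first reflection grows by a unit from each site to the next, whereas it is
  bounded by the spin-0 input, which does not grow from site to site.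

  The spin-0 data of the two pictures are not compared with each other, and the isomorphism is not
  claimed to be canonical. Infinitude of the fibres comes from translating one walk with diagonal
  steps between domains. Such a walk forces the parity condition in the base, because a spin-0
  particle changes both coordinates of a domain by one.

  The case \<open>i = 0\<close> on paths follows from \<open>i = 1\<close> by complementing every
  block. Characteristic zero is used to divide by two when a monomial equals its own negative in the
  quotient.\<close>

text \<open>
  Reading a letter \<open>0\<close> as an up-step and a letter \<open>1\<close> as a down-step, the removed pairs are the
  matching brackets of the height function \<open>g\<close>.  So the leftmost remaining \<open>0\<close> follows
  the last global minimum of \<open>g\<close>, and the rightmost remaining \<open>1\<close> precedes the first one.
\<close>

locale signature_word =
  fixes S :: "'p set" and L :: "'p \<Rightarrow> 'p \<Rightarrow> bool" and w :: "'p \<Rightarrow> int"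
    and idx :: "'p \<Rightarrow> int" and g :: "int \<Rightarrow> int"
  assumes inj: "inj_on idx S"
    and conv: "\<And>x y t. x \<in> S \<Longrightarrow> y \<in> S \<Longrightarrow> idx x \<le> t \<Longrightarrow> t \<le> idx y \<Longrightarrow> t \<in> idx ` S"
    and L_iff: "\<And>x y. x \<in> S \<Longrightarrow> y \<in> S \<Longrightarrow> L x y \<longleftrightarrow> idx x < idx y"
    and letters: "\<And>x. x \<in> S \<Longrightarrow> w x = 0 \<or> w x = 1"
    and step0: "\<And>x. x \<in> S \<Longrightarrow> w x = 0 \<Longrightarrow> g (idx x + 1) = g (idx x) + 1"
    and step1: "\<And>x. x \<in> S \<Longrightarrow> w x = 1 \<Longrightarrow> g (idx x + 1) = g (idx x) - 1"
begin

definition cuts :: "int set" where "cuts = idx ` S \<union> (\<lambda>x. idx x + 1) ` S"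

text \<open>Every letter between \<open>x\<close> and \<open>y\<close> belongs to a removed pair
  nested between them. Working from the left, this gives heights at least
  \<open>g (idx x) + 1\<close>; working from the right, at least \<open>g (idx y)\<close>. The two
  bounds at the ends force equality.\<close>

lemma removed_pair_heights:
  assumes "removed_pair S L w x y"
  shows "x \<in> S \<and> y \<in> S \<and> idx x < idx y \<and> w x = 0 \<and> w y = 1 \<and>
    g (idx y + 1) = g (idx x) \<and> (\<forall>t. idx x < t \<and> t \<le> idx y \<longrightarrow> g (idx x) < g t)"
  using assms
proof (induction rule: removed_pair.induct)
  case (1 x y)
  have xy: "idx x < idx y" using 1 L_iff by auto
  have inner: "\<exists>z z'. z \<in> S \<and> z' \<in> S \<and> idx x < idx z \<and> idx z' < idx y \<and> w z = 0 \<and> w z' = 1 \<and>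
      idx z < idx z' \<and> g (idx z' + 1) = g (idx z) \<and> (c = idx z \<or> c = idx z')"
    if c: "idx x < c" "c < idx y" for c
  proof -
    obtain v where v: "v \<in> S" "idx v = c" using conv[of x y c] 1 c by auto
    have "L x v \<and> L v y" using v c 1 L_iff by auto
    then obtain z' where z': "L x z'" "L z' y"
      "removed_pair S L w v z' \<or> removed_pair S L w z' v"
      and zz: "(z' \<in> S \<and> v \<in> S \<and> idx v < idx z' \<and> w v = 0 \<and> w z' = 1 \<and> g (idx z' + 1) = g (idx v)) \<or>
         (z' \<in> S \<and> v \<in> S \<and> idx z' < idx v \<and> w z' = 0 \<and> w v = 1 \<and> g (idx v + 1) = g (idx z'))"
      using 1 v by blast
    have "z' \<in> S" using zz by auto
    then have "idx x < idx z'" "idx z' < idx y" using z' 1 L_iff by auto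
    with zz v c show ?thesis by metis
  qed
  \<comment> \<open>A cut follows either the opening letter of an inner pair, hence an up-step, or a
    closing letter; in the latter case it has the height of the cut before the opening letter, which
    lies further left.\<close>
  have up: "g c \<ge> g (idx x) + 1" if "idx x + 1 \<le> c" "c \<le> idx y" for c
    using that
  proof (induction "nat (c - idx x)" arbitrary: c rule: less_induct)
    case less
    show ?case
    proof (cases "c = idx x + 1")
      case True then show ?thesis using step0[of x] 1 by auto
    next
      case False
      then have "idx x < c - 1" "c - 1 < idx y" using less by auto
      from inner[OF this] obtain z z' where z: "z \<in> S" "z' \<in> S" "idx x < idx z" "idx z' < idx y"
         "w z = 0" "w z' = 1" "idx z < idx z'" "g (idx z' + 1) = g (idx z)" "c - 1 = idx z \<or> c - 1 = idx z'"
        by blast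
      from z(9) show ?thesis
      proof
        assume e: "c - 1 = idx z"
        have "g (c - 1) \<ge> g (idx x) + 1" using less(1)[of "c-1"] less False by auto
        then show ?thesis using step0[of z] z e by (metis diff_add_cancel add_increasing2 zero_le_one)
      next
        assume e: "c - 1 = idx z'"
        have "g (idx z) \<ge> g (idx x) + 1" using less(1)[of "idx z"] less z e by auto
        then show ?thesis using z e by (metis diff_add_cancel)
      qed
    qed
  qed
  have dn: "g c \<ge> g (idx y)" if "idx x + 1 \<le> c" "c \<le> idx y" for c
    using that
  proof (induction "nat (idx y - c)" arbitrary: c rule: less_induct)
    case less
    show ?case
    proof (cases "c = idx y")
      case False
      then have "idx x < c" "c < idx y" using less by auto
      from inner[OF this] obtain z z' where z: "z \<in> S" "z' \<in> S" "idx x < idx z" "idx z' < idx y"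
         "w z = 0" "w z' = 1" "idx z < idx z'" "g (idx z' + 1) = g (idx z)" "c = idx z \<or> c = idx z'"
        by blast
      from z(9) show ?thesis
      proof
        assume e: "c = idx z"
        have "g (idx z' + 1) \<ge> g (idx y)" using less(1)[of "idx z' + 1"] less z e by auto
        then show ?thesis using z e by simp
      next
        assume e: "c = idx z'"
        have "g (c + 1) \<ge> g (idx y)" using less(1)[of "c+1"] less False by auto
        then show ?thesis using step1[of z'] z e by simp
      qed
    qed simp
  qed
  have "g (idx x + 1) = g (idx x) + 1" using step0 1 by auto
  moreover have "g (idx x + 1) \<ge> g (idx y)" using dn[of "idx x + 1"] xy by auto
  moreover have "g (idx y) \<ge> g (idx x) + 1" using up[of "idx y"] xy by auto
  ultimately have "g (idx y + 1) = g (idx x)" using step1[of y] 1 by auto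
  moreover have "\<forall>t. idx x < t \<and> t \<le> idx y \<longrightarrow> g (idx x) < g t"
  proof (intro allI impI)
    fix t assume "idx x < t \<and> t \<le> idx y"
    then show "g (idx x) < g t" using up[of t] by linarith
  qed
  ultimately show ?case using xy 1 by auto
qed

lemma step_bound:
  assumes "x \<in> S" shows "\<bar>g (idx x + 1) - g (idx x)\<bar> = 1"
  using letters[OF assms] step0[OF assms] step1[OF assms] by auto

text \<open>Converse of \<open>removed_pair_heights\<close>. An inner letter is matched with its
  nearest return in height, to the right for an up-step and to the left for a down-step; the pairs
  found are shorter, so induction applies. The end condition is an inequality because a return is
  found as the nearest cut that is not higher.\<close>

lemma removed_pairI:
  assumes "x \<in> S" "y \<in> S" "idx x < idx y" "g (idx y + 1) \<le> g (idx x)"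
    "\<And>t. idx x < t \<Longrightarrow> t \<le> idx y \<Longrightarrow> g (idx x) < g t"
  shows "removed_pair S L w x y"
  using assms
proof (induction "nat (idx y - idx x)" arbitrary: x y rule: less_induct)
  case less
  have wx: "w x = 0"
    using less.prems(5)[of "idx x + 1"] less.prems(1,3) letters[of x] step1[of x] by linarith
  have gy: "g (idx x) < g (idx y)" using less.prems by auto
  have wy: "w y = 1" using gy less.prems(2,4) letters[of y] step0[of y] by linarith
  have gy': "g (idx y) = g (idx x) + 1" using step1[OF less.prems(2) wy] less.prems(4) gy by auto
  show ?case
  proof (rule removed_pair.intros[OF less.prems(1,2) _ wx wy], goal_cases)
    case 1 then show ?case using L_iff less.prems by auto
  next
    case 2
    show ?case
    proof (intro ballI impI)
      fix z assume z: "z \<in> S" "L x z \<and> L z y"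
      then have iz: "idx x < idx z" "idx z < idx y" using L_iff less.prems by auto
      show "\<exists>z'. L x z' \<and> L z' y \<and> (removed_pair S L w z z' \<or> removed_pair S L w z' z)"
      proof (cases "w z = 0")
        case True
        let ?P = "\<lambda>k::nat. g (idx z + 1 + int k) \<le> g (idx z)"
        \<comment> \<open>The return occurs no later than the cut before \<open>y\<close>: that cut
          is only one above \<open>g (idx x)\<close>, hence not above
          \<open>g (idx z)\<close>.\<close>
        have "?P (nat (idx y - idx z - 1))" using iz gy' less.prems(5)[of "idx z"] by auto
        define k where "k = (LEAST k. ?P k)"
        have k: "?P k" "\<And>k'. k' < k \<Longrightarrow> \<not> ?P k'" "k \<le> nat (idx y - idx z - 1)"
          unfolding k_def using LeastI[of ?P, OF \<open>?P (nat (idx y - idx z - 1))\<close>] not_less_Least[of _ ?P]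
            Least_le[of ?P, OF \<open>?P (nat (idx y - idx z - 1))\<close>] by blast+
        have "k \<noteq> 0" using k(1) step0[OF z(1) True] by (intro notI) auto
        have "idx z + int k < idx y" using k(3) iz by auto
        then obtain z' where z': "z' \<in> S" "idx z' = idx z + int k"
          using conv[of z y "idx z + int k"] z less.prems by auto
        have 1: "removed_pair S L w z z'"
        proof (rule less.hyps)
          show "nat (idx z' - idx z) < nat (idx y - idx x)" using z' iz \<open>idx z + int k < idx y\<close> by auto
          show "g (idx z' + 1) \<le> g (idx z)" using k(1) z' by (simp add: add_ac)
          show "g (idx z) < g t" if "idx z < t" "t \<le> idx z'" for t
          proof -
            have "nat (t - idx z - 1) < k" using that z' by linarith
            then show ?thesis using k(2)[of "nat (t - idx z - 1)"] that by simp
          qed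
        qed (use z z' \<open>k \<noteq> 0\<close> in auto)
        have "idx z' < idx y" using z' \<open>idx z + int k < idx y\<close> by simp
        then have "L x z' \<and> L z' y" using z' L_iff less.prems iz by auto
        with 1 show ?thesis by blast
      next
        case False
        then have wz: "w z = 1" using letters z by auto
        have gz: "g (idx z + 1) > g (idx x)" using less.prems(5)[of "idx z + 1"] iz by auto
        let ?P = "\<lambda>k::nat. g (idx z - int k) \<le> g (idx z + 1)"
        have "g (idx x + 1) = g (idx x) + 1" using step0 wx less.prems by auto
        then have P: "?P (nat (idx z - idx x - 1))" using iz gz by (auto simp: algebra_simps)
        define k where "k = (LEAST k. ?P k)"
        have k: "?P k" "\<And>k'. k' < k \<Longrightarrow> \<not> ?P k'" "k \<le> nat (idx z - idx x - 1)"
          unfolding k_def using LeastI[of ?P, OF P] not_less_Least[of _ ?P] Least_le[of ?P, OF P] by blast+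
        have "k \<noteq> 0" using k(1) step1[OF z(1) wz] by (intro notI) auto
        have lt: "idx z - int k > idx x" using k(3) iz by auto
        then obtain z' where z': "z' \<in> S" "idx z' = idx z - int k"
          using conv[of x z "idx z - int k"] z less.prems by auto
        have gz': "g (idx z' + 1) > g (idx z + 1)"
        proof -
          have "idx z' + 1 = idx z - int (k - 1)" using \<open>k \<noteq> 0\<close> z' by (simp add: of_nat_diff)
          then show ?thesis using k(2)[of "k - 1"] \<open>k \<noteq> 0\<close> by (metis diff_less linorder_not_le neq0_conv zero_less_one)
        qed
        have 1: "removed_pair S L w z' z"
        proof (rule less.hyps)
          show "nat (idx z - idx z') < nat (idx y - idx x)" using z' iz lt by auto
          have "g (idx z' + 1) \<le> g (idx z') + 1" using step_bound[OF z'(1)] by auto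
          then show "g (idx z + 1) \<le> g (idx z')" using gz' by simp
          show "g (idx z') < g t" if "idx z' < t" "t \<le> idx z" for t
          proof -
            have "nat (idx z - t) < k" using that z' by linarith
            then show ?thesis using k(2)[of "nat (idx z - t)"] k(1) that z' by simp
          qed
        qed (use z z' \<open>k \<noteq> 0\<close> in auto)
        have "L x z' \<and> L z' y" using z' L_iff less.prems iz lt by auto
        with 1 show ?thesis by blast
      qed
    qed
  qed
qed

lemma cuts_le:
  assumes "x \<in> S" "t \<in> cuts" "idx x < t" shows "t - 1 \<in> idx ` S"
  using assms conv unfolding cuts_def by force

lemma cuts_ge:
  assumes "x \<in> S" "t \<in> cuts" "t \<le> idx x" shows "t \<in> idx ` S"
  using assms conv unfolding cuts_def by force

text \<open>A \<open>0\<close> is matched as soon as some later cut is not higher than the cut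
  before it: the letter ending at the first such cut is its partner.\<close>

lemma remaining_0_iff:
  "x \<in> remaining S L w 0 \<longleftrightarrow> x \<in> S \<and> (\<forall>t\<in>cuts. idx x < t \<longrightarrow> g (idx x) < g t)"
proof (intro iffI conjI ballI impI)
  assume a: "x \<in> remaining S L w 0"
  then show "x \<in> S" by (simp add: remaining_def)
  fix t assume t: "t \<in> cuts" "idx x < t"
  show "g (idx x) < g t"
  proof (rule ccontr)
    assume "\<not> g (idx x) < g t"
    have x: "x \<in> S" "w x = 0" using a by (auto simp: remaining_def)
    let ?P = "\<lambda>k::nat. g (idx x + 1 + int k) \<le> g (idx x)"
    have P: "?P (nat (t - idx x - 1))" using \<open>\<not> g (idx x) < g t\<close> t by auto
    define k where "k = (LEAST k. ?P k)"
    have k: "?P k" "\<And>k'. k' < k \<Longrightarrow> \<not> ?P k'" "k \<le> nat (t - idx x - 1)"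
      unfolding k_def using LeastI[of ?P, OF P] not_less_Least[of _ ?P] Least_le[of ?P, OF P] by blast+
    have "k \<noteq> 0" using k(1) step0[OF x] by (intro notI) auto
    have "t - 1 \<in> idx ` S" using cuts_le x t by auto
    then obtain v where "v \<in> S" "idx v = t - 1" by auto
    then have "idx x + int k \<in> idx ` S" using x k(3) t by (intro conv[of x v]) auto
    then obtain y where y: "y \<in> S" "idx y = idx x + int k" by (metis imageE)
    have "removed_pair S L w x y"
    proof (rule removed_pairI)
      show "g (idx y + 1) \<le> g (idx x)" using k(1) y by (simp add: add_ac)
      show "g (idx x) < g t" if "idx x < t" "t \<le> idx y" for t
      proof -
        have "nat (t - idx x - 1) < k" using that y by linarith
        then show ?thesis using k(2)[of "nat (t - idx x - 1)"] that by simp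
      qed
    qed (use x y \<open>k \<noteq> 0\<close> in auto)
    then show False using a by (auto simp: remaining_def)
  qed
next
  assume a: "x \<in> S \<and> (\<forall>t\<in>cuts. idx x < t \<longrightarrow> g (idx x) < g t)"
  have "idx x + 1 \<in> cuts" using a by (auto simp: cuts_def)
  then have "w x = 0" using a letters[of x] step1[of x] by auto
  moreover have "\<not> removed_pair S L w x y" for y
  proof
    assume "removed_pair S L w x y"
    from removed_pair_heights[OF this] have "y \<in> S" "idx x < idx y" "g (idx y + 1) = g (idx x)" by auto
    moreover from this have "idx y + 1 \<in> cuts" by (auto simp: cuts_def)
    ultimately show False using a by fastforce
  qed
  moreover have "\<not> removed_pair S L w y x" for y
    using removed_pair_heights[of y x] \<open>w x = 0\<close> by auto
  ultimately show "x \<in> remaining S L w 0" using a by (auto simp: remaining_def)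
qed

lemma remaining_1_iff:
  "x \<in> remaining S L w 1 \<longleftrightarrow> x \<in> S \<and> (\<forall>t\<in>cuts. t \<le> idx x \<longrightarrow> g (idx x + 1) < g t)"
proof (intro iffI conjI ballI impI)
  assume a: "x \<in> remaining S L w 1"
  then show "x \<in> S" by (simp add: remaining_def)
  fix t assume t: "t \<in> cuts" "t \<le> idx x"
  show "g (idx x + 1) < g t"
  proof (rule ccontr)
    assume nt: "\<not> g (idx x + 1) < g t"
    have x: "x \<in> S" "w x = 1" using a by (auto simp: remaining_def)
    let ?P = "\<lambda>k::nat. g (idx x - int k) \<le> g (idx x + 1)"
    have P: "?P (nat (idx x - t))" using nt t by auto
    define k where "k = (LEAST k. ?P k)"
    have k: "?P k" "\<And>k'. k' < k \<Longrightarrow> \<not> ?P k'" "k \<le> nat (idx x - t)"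
      unfolding k_def using LeastI[of ?P, OF P] not_less_Least[of _ ?P] Least_le[of ?P, OF P] by blast+
    have "k \<noteq> 0" using k(1) step1[OF x] by (intro notI) auto
    obtain v where "v \<in> S" "idx v = t" using cuts_ge[OF x(1) t] by blast
    then have "idx x - int k \<in> idx ` S" using x k(3) t by (intro conv[of v x]) auto
    then obtain y where y: "y \<in> S" "idx y = idx x - int k" by (metis imageE)
    have gy: "g (idx y + 1) > g (idx x + 1)"
    proof -
      have "idx y + 1 = idx x - int (k - 1)" using \<open>k \<noteq> 0\<close> y by (simp add: of_nat_diff)
      then show ?thesis using k(2)[of "k - 1"] \<open>k \<noteq> 0\<close> by (metis diff_less linorder_not_le neq0_conv zero_less_one)
    qed
    have "removed_pair S L w y x"
    proof (rule removed_pairI)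
      have "g (idx y + 1) \<le> g (idx y) + 1" using step_bound[OF y(1)] by auto
      then show "g (idx x + 1) \<le> g (idx y)" using gy by simp
      show "g (idx y) < g t" if "idx y < t" "t \<le> idx x" for t
      proof -
        have "nat (idx x - t) < k" using that y by linarith
        then show ?thesis using k(2)[of "nat (idx x - t)"] k(1) that y by simp
      qed
    qed (use x y \<open>k \<noteq> 0\<close> in auto)
    then show False using a by (auto simp: remaining_def)
  qed
next
  assume a: "x \<in> S \<and> (\<forall>t\<in>cuts. t \<le> idx x \<longrightarrow> g (idx x + 1) < g t)"
  have "idx x \<in> cuts" using a by (auto simp: cuts_def)
  then have "w x = 1" using a letters[of x] step0[of x] by auto
  moreover have "\<not> removed_pair S L w y x" for y
  proof
    assume "removed_pair S L w y x"
    from removed_pair_heights[OF this] have "y \<in> S" "idx y < idx x" "g (idx x + 1) = g (idx y)" by auto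
    moreover from this have "idx y \<in> cuts" by (auto simp: cuts_def)
    ultimately show False using a by fastforce
  qed
  moreover have "\<not> removed_pair S L w x y" for y
    using removed_pair_heights[of x y] \<open>w x = 1\<close> by auto
  ultimately show "x \<in> remaining S L w 1" using a by (auto simp: remaining_def)
qed

lemma exists_min_height:
  assumes "t0 \<in> cuts" "\<And>t. t \<in> cuts \<Longrightarrow> c \<le> g t"
  obtains t where "t \<in> cuts" "\<And>t'. t' \<in> cuts \<Longrightarrow> g t \<le> g t'"
proof -
  obtain t where "t \<in> cuts" "\<forall>t'. t' \<in> cuts \<longrightarrow> nat (g t - c) \<le> nat (g t' - c)"
    using ex_has_least_nat[of "\<lambda>t. t \<in> cuts" t0 "\<lambda>t. nat (g t - c)"] assms by blast
  then show ?thesis using assms by (intro that[of t]) force+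
qed

text \<open>A remaining \<open>0\<close> lies below all later cuts, so it confines the minimal cuts
  on the right and a last one exists; a remaining \<open>0\<close> to the left of that minimum would
  lie below it. The bound \<open>c\<close> supplies the global minimum on infinite words.\<close>

lemma f_position_iff:
  assumes bounded: "\<And>t. t \<in> cuts \<Longrightarrow> c \<le> g t"
  shows "f_position S L w = Some x \<longleftrightarrow>
    x \<in> S \<and> (\<forall>t\<in>cuts. g (idx x) \<le> g t \<and> (idx x < t \<longrightarrow> g (idx x) < g t))"
    (is "_ \<longleftrightarrow> ?R x")
proof -
  have 1: "f_position S L w = Some x" if x: "?R x" for x
  proof -
    have xZ: "x \<in> remaining S L w 0" using x remaining_0_iff by auto
    have uniq: "L x y" if "y \<in> remaining S L w 0" "y \<noteq> x" for y
    proof -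
      have y: "y \<in> S" "\<forall>t\<in>cuts. idx y < t \<longrightarrow> g (idx y) < g t" using that remaining_0_iff by auto
      have "idx x \<in> cuts" "idx y \<in> cuts" using x y by (auto simp: cuts_def)
      then have "g (idx x) \<le> g (idx y)" "idx y < idx x \<longrightarrow> g (idx y) < g (idx x)"
        using x y by blast+
      then have "\<not> idx y < idx x" by linarith
      then show ?thesis using inj that y x L_iff by (metis inj_onD linorder_less_linear)
    qed
    have asym: "\<not> L y x" if "y \<in> remaining S L w 0" "y \<noteq> x" for y
      using uniq[OF that] L_iff[of x y] L_iff[of y x] x that remaining_0_iff[of y] by auto
    have "(THE z. z \<in> remaining S L w 0 \<and> (\<forall>y\<in>remaining S L w 0. y \<noteq> z \<longrightarrow> L z y)) = x"
    proof (rule the_equality)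
      fix z assume z: "z \<in> remaining S L w 0 \<and> (\<forall>y\<in>remaining S L w 0. y \<noteq> z \<longrightarrow> L z y)"
      then show "z = x" using asym[of z] xZ by metis
    qed (use xZ uniq in simp)
    then show ?thesis using xZ by (auto simp: f_position_def Let_def)
  qed
  have 2: "\<exists>x. ?R x" if nn: "f_position S L w = Some y" for y
  proof -
    obtain z where z: "z \<in> remaining S L w 0"
      using nn by (auto simp: f_position_def Let_def split: if_splits)
    then have zS: "z \<in> S" "\<forall>t\<in>cuts. idx z < t \<longrightarrow> g (idx z) < g t" using remaining_0_iff by auto
    have "idx z \<in> cuts" using zS by (auto simp: cuts_def)
    then obtain t where t: "t \<in> cuts" "\<And>t'. t' \<in> cuts \<Longrightarrow> g t \<le> g t'"
      using exists_min_height[OF _ bounded] by blast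
    have t_le: "t' \<le> idx z" if "t' \<in> cuts" "g t' \<le> g t" for t'
      using zS that t(2)[OF \<open>idx z \<in> cuts\<close>] by force
    let ?A = "{t'. t \<le> t' \<and> t' \<in> cuts \<and> g t' \<le> g t}"
    have "?A \<subseteq> {t..idx z}" using t_le by auto
    then have fin: "finite ?A" using finite_subset by blast
    have "t \<in> ?A" using t by auto
    define u where "u = Max ?A"
    have u: "u \<in> ?A" "\<And>t'. t' \<in> ?A \<Longrightarrow> t' \<le> u"
      unfolding u_def using Max_in[OF fin] Max_ge[OF fin] \<open>t \<in> ?A\<close> by blast+
    obtain x where x: "x \<in> S" "idx x = u" using cuts_ge[of z u] zS u t_le by auto
    have "?R x"
    proof (intro conjI ballI impI)
      fix t' assume t': "t' \<in> cuts"
      show "g (idx x) \<le> g t'" using x u t t' by force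
      assume "idx x < t'"
      then have "\<not> g t' \<le> g t" using u(2)[of t'] u(1) x t' by force
      then show "g (idx x) < g t'" using u x by auto
    qed (rule x)
    then show ?thesis by blast
  qed
  show ?thesis using 1 2 by (metis option.inject)
qed

lemma e_position_iff:
  assumes bounded: "\<And>t. t \<in> cuts \<Longrightarrow> c \<le> g t"
  shows "e_position S L w = Some x \<longleftrightarrow>
    x \<in> S \<and> (\<forall>t\<in>cuts. g (idx x + 1) \<le> g t \<and> (t \<le> idx x \<longrightarrow> g (idx x + 1) < g t))"
    (is "_ \<longleftrightarrow> ?R x")
proof -
  have 1: "e_position S L w = Some x" if x: "?R x" for x
  proof -
    have xZ: "x \<in> remaining S L w 1" using x remaining_1_iff by auto
    have uniq: "L y x" if "y \<in> remaining S L w 1" "y \<noteq> x" for y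
    proof -
      have y: "y \<in> S" "\<forall>t\<in>cuts. t \<le> idx y \<longrightarrow> g (idx y + 1) < g t" using that remaining_1_iff by auto
      have "idx x + 1 \<in> cuts" "idx y + 1 \<in> cuts" using x y by (auto simp: cuts_def)
      then have "g (idx x + 1) \<le> g (idx y + 1)" "idx x + 1 \<le> idx y \<longrightarrow> g (idx y + 1) < g (idx x + 1)"
        using x y by blast+
      then have "\<not> idx x < idx y" by linarith
      then show ?thesis using inj that y x L_iff by (metis inj_onD linorder_less_linear)
    qed
    have asym: "\<not> L x y" if "y \<in> remaining S L w 1" "y \<noteq> x" for y
      using uniq[OF that] L_iff[of x y] L_iff[of y x] x that remaining_1_iff[of y] by auto
    have "(THE z. z \<in> remaining S L w 1 \<and> (\<forall>y\<in>remaining S L w 1. y \<noteq> z \<longrightarrow> L y z)) = x"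
    proof (rule the_equality)
      fix z assume z: "z \<in> remaining S L w 1 \<and> (\<forall>y\<in>remaining S L w 1. y \<noteq> z \<longrightarrow> L y z)"
      then show "z = x" using asym[of z] xZ by metis
    qed (use xZ uniq in simp)
    then show ?thesis using xZ by (auto simp: e_position_def Let_def)
  qed
  have 2: "\<exists>x. ?R x" if nn: "e_position S L w = Some y" for y
  proof -
    obtain z where z: "z \<in> remaining S L w 1"
      using nn by (auto simp: e_position_def Let_def split: if_splits)
    then have zS: "z \<in> S" "\<forall>t\<in>cuts. t \<le> idx z \<longrightarrow> g (idx z + 1) < g t" using remaining_1_iff by auto
    have zc: "idx z + 1 \<in> cuts" using zS by (auto simp: cuts_def)
    then obtain t where t: "t \<in> cuts" "\<And>t'. t' \<in> cuts \<Longrightarrow> g t \<le> g t'"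
      using exists_min_height[OF _ bounded] by blast
    have t_ge: "t' > idx z" if "t' \<in> cuts" "g t' \<le> g t" for t'
      using zS that t(2)[OF zc] by force
    let ?A = "{t'. t' \<le> t \<and> t' \<in> cuts \<and> g t' \<le> g t}"
    have "?A \<subseteq> {idx z..t}" using t_ge by force
    then have fin: "finite ?A" using finite_subset by blast
    have "t \<in> ?A" using t by auto
    define u where "u = Min ?A"
    have u: "u \<in> ?A" "\<And>t'. t' \<in> ?A \<Longrightarrow> u \<le> t'"
      unfolding u_def using Min_in[OF fin] Min_le[OF fin] \<open>t \<in> ?A\<close> by blast+
    obtain x where x: "x \<in> S" "idx x = u - 1" using cuts_le[of z u] zS u t_ge by auto
    then have xu: "idx x + 1 = u" by simp
    have "?R x"
    proof (intro conjI ballI impI)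
      fix t' assume t': "t' \<in> cuts"
      show "g (idx x + 1) \<le> g t'" using xu u t t' by force
      assume "t' \<le> idx x"
      then have "\<not> g t' \<le> g t" using u(2)[of t'] u(1) x t' by force
      then show "g (idx x + 1) < g t'" using u xu by auto
    qed (rule x)
    then show ?thesis by blast
  qed
  show ?thesis using 1 2 by (metis option.inject)
qed

end

section \<open>Paths and heights\<close>

lemma exists_int_antiderivative:
  fixes d :: "int \<Rightarrow> int"
  shows "\<exists>\<mu>. \<forall>k. \<mu> (k + 1) = \<mu> k + d k"
proof -
  define \<mu> where "\<mu> k = (if k \<ge> 0 then (\<Sum>i\<in>{0..<k}. d i) else - (\<Sum>i\<in>{k..<0}. d i))" for k
  have "\<mu> (k + 1) = \<mu> k + d k" for k
  proof (cases "k \<ge> 0")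
    case True
    have "{0..<k + 1} = insert k {0..<k}" using True by auto
    then show ?thesis using True by (simp add: \<mu>_def)
  next
    case False
    then have "{k..<0} = insert k {k + 1..<0}" by auto
    then show ?thesis using False by (cases "k = -1") (simp_all add: \<mu>_def)
  qed
  then show ?thesis by blast
qed

definition last_min :: "(int \<Rightarrow> int) \<Rightarrow> int \<Rightarrow> bool" where
  "last_min \<mu> k \<longleftrightarrow> (\<forall>k'. \<mu> k \<le> \<mu> k' \<and> (k < k' \<longrightarrow> \<mu> k < \<mu> k'))"

definition first_min :: "(int \<Rightarrow> int) \<Rightarrow> int \<Rightarrow> bool" where
  "first_min \<mu> k \<longleftrightarrow> (\<forall>k'. \<mu> k \<le> \<mu> k' \<and> (k' < k \<longrightarrow> \<mu> k < \<mu> k'))"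

text \<open>Number of the first letter of block \<open>k\<close>, counted from the start of block 0.
  Blocks are read in decreasing \<open>k\<close>, so the offset falls as \<open>k\<close> grows, by
  \<open>m + n\<close> for every two blocks.\<close>

definition block_offset :: "int \<Rightarrow> int \<Rightarrow> int \<Rightarrow> int" where
  "block_offset m n k =
     (if even k then - ((m + n) * (k div 2)) else - ((m + n) * ((k + 1) div 2)) + m)"

definition complement :: "int \<Rightarrow> int \<Rightarrow> (int \<Rightarrow> int) \<Rightarrow> int \<Rightarrow> int" where
  "complement m n p k = block_length m n k - p k"

lemma complement_complement [simp]: "complement m n (complement m n p) = p"
  by (auto simp: complement_def)

text \<open>Reduces \<open>i = 0\<close> to \<open>i = 1\<close>, the only case in which words of
  paths are analysed.\<close>

lemma path_word_0: "path_word m n 0 p = path_word m n 1 (complement m n p)"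
  by (auto simp: path_word_def complement_def)

lemma path_of_word_0:
  assumes "0 \<le> block_length m n k" "\<And>j. w (k, j) = 0 \<or> w (k, j) = 1"
  shows "path_of_word m n 0 w k = block_length m n k - path_of_word m n 1 w k"
proof -
  let ?A = "{j \<in> {0..<block_length m n k}. w (k, j) = 0}"
  let ?B = "{j \<in> {0..<block_length m n k}. w (k, j) = 1}"
  have "?A \<union> ?B = {0..<block_length m n k}" using assms(2) by force
  moreover have "card (?A \<union> ?B) = card ?A + card ?B"
    by (rule card_Un_disjoint) (auto intro: finite_subset[of _ "{0..<block_length m n k}"])
  ultimately have "int (card ?A) + int (card ?B) = block_length m n k" using assms(1) by simp
  then show ?thesis by (simp add: path_of_word_def)
qed

lemma path_f_0:
  assumes "0 < n" "0 < m"
  shows "path_f m n 0 p = map_option (complement m n) (path_f m n 1 (complement m n p))"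
  using assms unfolding path_f_def Let_def path_word_0 option.map_comp
  by (intro option.map_cong0 ext)
     (simp add: complement_def path_of_word_0 block_length_def path_word_def)

lemma path_e_0:
  assumes "0 < n" "0 < m"
  shows "path_e m n 0 p = map_option (complement m n) (path_e m n 1 (complement m n p))"
  using assms unfolding path_e_def Let_def path_word_0 option.map_comp
  by (intro option.map_cong0 ext)
     (simp add: complement_def path_of_word_0 block_length_def path_word_def)

text \<open>\<open>\<mu> k\<close> is the height at the bottom of block \<open>k\<close>, after its
  \<open>p k\<close> letters \<open>1\<close>. From there the word climbs over the zeros of block
  \<open>k\<close> and descends over the ones of block \<open>k - 1\<close>, the next block to be
  read. All minima of the height occur at such bottoms.\<close>

locale path_heights =
  fixes m n :: int and p \<mu> :: "int \<Rightarrow> int" and c :: int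
  assumes n_pos: "0 < n" and m_pos: "0 < m"
    and range: "\<And>k. 0 \<le> p k \<and> p k \<le> block_length m n k"
    and heights: "\<And>k. \<mu> (k - 1) = \<mu> k + (block_length m n k - p k) - p (k - 1)"
    and bounded: "\<And>k. c \<le> \<mu> k"
begin

lemma length_pos: "0 < block_length m n k"
  using n_pos m_pos by (simp add: block_length_def)

lemma offset_step: "block_offset m n (k - 1) = block_offset m n k + block_length m n k"
proof (cases "even k")
  case True
  then show ?thesis by (auto simp: block_offset_def block_length_def)
next
  case False
  then obtain i where "k = 2 * i + 1" by (auto elim: oddE)
  then show ?thesis by (simp add: block_offset_def block_length_def algebra_simps)
qed

lemma offset_mono: "k' < k \<Longrightarrow> block_offset m n k + block_length m n k \<le> block_offset m n k'"
proof (induction "nat (k - k')" arbitrary: k')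
  case (Suc d)
  show ?case
  proof (cases "k' + 1 = k")
    case True then have "k' = k - 1" by simp
    then show ?thesis using offset_step[of k] by simp
  next
    case False
    then have "block_offset m n k + block_length m n k \<le> block_offset m n (k' + 1)"
      using Suc(1)[of "k' + 1"] Suc by auto
    then show ?thesis using offset_step[of "k' + 1"] length_pos[of "k' + 1"] by simp
  qed
qed simp

lemma decode: "\<exists>k j. 0 \<le> j \<and> j < block_length m n k \<and> t = block_offset m n k + j"
proof -
  define i r where "i = - (t div (m + n))" "r = t mod (m + n)"
  have t: "t = - ((m + n) * i) + r" by (simp add: i_r_def)
  have r: "0 \<le> r" "r < m + n" using n_pos m_pos by (auto simp: i_r_def)
  show ?thesis
  proof (cases "r < m")
    case True
    then show ?thesis using t r
      by (intro exI[of _ "2 * i"] exI[of _ r]) (simp add: block_offset_def block_length_def)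
  next
    case False
    then show ?thesis using t r
      by (intro exI[of _ "2 * i - 1"] exI[of _ "r - m"]) (simp add: block_offset_def block_length_def)
  qed
qed

lemma decode_unique:
  assumes "0 \<le> j" "j < block_length m n k" "0 \<le> j'" "j' < block_length m n k'"
    "block_offset m n k + j = block_offset m n k' + j'"
  shows "k = k' \<and> j = j'"
proof (cases k k' rule: linorder_cases)
  case less then show ?thesis using offset_mono[OF less] assms by linarith
next
  case equal then show ?thesis using assms by simp
next
  case greater then show ?thesis using offset_mono[OF greater] assms by linarith
qed

text \<open>Inside a block of the form 1...10...0 the height is V-shaped, with the bottom behind the
  last \<open>1\<close>.\<close>

definition height :: "int \<Rightarrow> int" where
  "height t = (let k = (THE k. block_offset m n k \<le> t \<and> t < block_offset m n k + block_length m n k)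
     in \<mu> k + \<bar>t - block_offset m n k - p k\<bar>)"

text \<open>The end \<open>j = block_length m n k\<close> is included so that the cuts on both sides
  of a letter can be treated in the same block; there \<open>heights\<close> glues consecutive V
  shapes.\<close>

lemma height_eq:
  assumes "0 \<le> j" "j \<le> block_length m n k"
  shows "height (block_offset m n k + j) = \<mu> k + \<bar>j - p k\<bar>"
proof -
  have 1: "height (block_offset m n k + j) = \<mu> k + \<bar>j - p k\<bar>"
    if "0 \<le> j" "j < block_length m n k" for j k
  proof -
    have "(THE k'. block_offset m n k' \<le> block_offset m n k + j \<and>
        block_offset m n k + j < block_offset m n k' + block_length m n k') = k"
    proof (rule the_equality)
      fix k' assume a: "block_offset m n k' \<le> block_offset m n k + j \<and>
        block_offset m n k + j < block_offset m n k' + block_length m n k'"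
      show "k' = k"
        by (rule decode_unique[THEN conjunct1, of "block_offset m n k + j - block_offset m n k'" k' j k])
           (use that a in linarith)+
    qed (use that in auto)
    then show ?thesis by (simp add: height_def)
  qed
  show ?thesis
  proof (cases "j = block_length m n k")
    case True
    have "height (block_offset m n (k - 1) + 0) = \<mu> (k - 1) + \<bar>0 - p (k - 1)\<bar>"
      using 1 length_pos by blast
    then show ?thesis using True offset_step[of k] heights[of k] range[of k] range[of "k - 1"] by simp
  next
    case False then show ?thesis using assms 1 by simp
  qed
qed

lemma height_end_eq: "height (block_offset m n k + p k) = \<mu> k"
  using height_eq[of "p k" k] range by simp

sublocale signature_word "path_positions m n" path_left_of "path_word m n 1 p"
  "\<lambda>(k, j). block_offset m n k + j" height
proof
  show "inj_on (\<lambda>(k, j). block_offset m n k + j) (path_positions m n)"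
    using decode_unique by (auto simp: inj_on_def path_positions_def)
  show "t \<in> (\<lambda>(k, j). block_offset m n k + j) ` path_positions m n" for t
    using decode[of t] by (force simp: path_positions_def)
  show "path_left_of x y \<longleftrightarrow> (case x of (k, j) \<Rightarrow> block_offset m n k + j) <
      (case y of (k, j) \<Rightarrow> block_offset m n k + j)"
    if xy: "x \<in> path_positions m n" "y \<in> path_positions m n" for x y
  proof -
    obtain k j k' j' where [simp]: "x = (k, j)" "y = (k', j')" by (cases x; cases y)
    show ?thesis using xy offset_mono[of k k'] offset_mono[of k' k]
      by (cases k k' rule: linorder_cases) (auto simp: path_positions_def path_left_of_def)
  qed
  show "path_word m n 1 p x = 0 \<or> path_word m n 1 p x = 1" for x
    by (auto simp: path_word_def split: prod.splits)
  show "height ((case x of (k, j) \<Rightarrow> block_offset m n k + j) + 1) =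
      height (case x of (k, j) \<Rightarrow> block_offset m n k + j) + 1"
    if "x \<in> path_positions m n" "path_word m n 1 p x = 0" for x
    using that height_eq[of "snd x" "fst x"] height_eq[of "snd x + 1" "fst x"]
    by (auto simp: path_positions_def path_word_def add.assoc split: prod.splits if_splits)
  show "height ((case x of (k, j) \<Rightarrow> block_offset m n k + j) + 1) =
      height (case x of (k, j) \<Rightarrow> block_offset m n k + j) - 1"
    if "x \<in> path_positions m n" "path_word m n 1 p x = 1" for x
    using that height_eq[of "snd x" "fst x"] height_eq[of "snd x + 1" "fst x"]
    by (auto simp: path_positions_def path_word_def add.assoc split: prod.splits if_splits)
qed

lemma cuts_UNIV: "cuts = UNIV"
proof -
  have "t \<in> cuts" for t using decode[of t] unfolding cuts_def by (force simp: path_positions_def)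
  then show ?thesis by blast
qed

lemma height_ge: "\<exists>k j. 0 \<le> j \<and> j < block_length m n k \<and> t = block_offset m n k + j \<and>
    height t = \<mu> k + \<bar>j - p k\<bar>"
  using decode[of t] height_eq by force

lemma height_bounded: "c \<le> height t"
  using height_ge[of t] bounded by (metis abs_ge_zero add_increasing2)

text \<open>Later letters belong to smaller \<open>k\<close>, so the last minimum is the smallest
  minimising \<open>k\<close>. Being strictly below the bottom of block \<open>k - 1\<close>
  guarantees that block \<open>k\<close> still contains a \<open>0\<close>.\<close>

lemma f_position_path:
  "f_position (path_positions m n) path_left_of (path_word m n 1 p) = Some (k, j) \<longleftrightarrow>
     j = p k \<and> (\<forall>k'. \<mu> k \<le> \<mu> k' \<and> (k' < k \<longrightarrow> \<mu> k < \<mu> k'))" (is "?L \<longleftrightarrow> ?R")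
proof -
  let ?t = "block_offset m n k + j"
  have "?L \<longleftrightarrow> 0 \<le> j \<and> j < block_length m n k \<and>
      (\<forall>t. height ?t \<le> height t \<and> (?t < t \<longrightarrow> height ?t < height t))" (is "_ \<longleftrightarrow> ?M")
    using f_position_iff[of c "(k, j)"] height_bounded
    unfolding cuts_UNIV by (simp add: path_positions_def)
  also have "\<dots> \<longleftrightarrow> ?R"
  proof
    assume M: ?M
    then have h: "height ?t = \<mu> k + \<bar>j - p k\<bar>" using height_eq by auto
    have le: "\<mu> k + \<bar>j - p k\<bar> \<le> \<mu> k'" for k'
      using M h height_end_eq[of k'] by metis
    from le[of k] have j: "j = p k" by simp
    have "\<mu> k < \<mu> k'" if "k' < k" for k'
    proof -
      have "?t < block_offset m n k' + p k'" using offset_mono[OF that] M range[of k'] by linarith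
      then show ?thesis using M h height_end_eq[of k'] j by (metis abs_zero add.right_neutral diff_self)
    qed
    then show ?R using j le by auto
  next
    assume R: ?R
    then have j: "j = p k" by simp
    have h: "height ?t = \<mu> k" using height_end_eq j by simp
    have "\<mu> k < \<mu> (k - 1)" using R by simp
    then have jl: "j < block_length m n k" using heights[of k] range[of "k - 1"] j by linarith
    have "height ?t \<le> height t \<and> (?t < t \<longrightarrow> height ?t < height t)" for t
    proof -
      obtain k' j' where t: "0 \<le> j'" "j' < block_length m n k'" "t = block_offset m n k' + j'"
        "height t = \<mu> k' + \<bar>j' - p k'\<bar>" using height_ge by blast
      have "height ?t \<le> height t" using t R h by (metis abs_ge_zero add_increasing2)
      moreover have "height ?t < height t" if tt: "?t < t"
      proof -
        consider "k' < k" | "k' = k" | "k < k'" by linarith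
        then show ?thesis
        proof cases
          case 1 then have "\<mu> k < \<mu> k'" using R by blast
          then show ?thesis using t h by linarith
        next
          case 2 then show ?thesis using tt t j h by auto
        next
          case 3 then show ?thesis using offset_mono[OF 3] t tt j range[of k] by linarith
        qed
      qed
      ultimately show ?thesis by blast
    qed
    then show ?M using j jl range by auto
  qed
  finally show ?thesis .
qed

lemma e_position_path:
  "e_position (path_positions m n) path_left_of (path_word m n 1 p) = Some (k, j) \<longleftrightarrow>
     j = p k - 1 \<and> (\<forall>k'. \<mu> k \<le> \<mu> k' \<and> (k < k' \<longrightarrow> \<mu> k < \<mu> k'))" (is "?L \<longleftrightarrow> ?R")
proof -
  let ?t = "block_offset m n k + j"
  have "?L \<longleftrightarrow> 0 \<le> j \<and> j < block_length m n k \<and>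
      (\<forall>t. height (?t + 1) \<le> height t \<and> (t \<le> ?t \<longrightarrow> height (?t + 1) < height t))" (is "_ \<longleftrightarrow> ?M")
    using e_position_iff[of c "(k, j)"] height_bounded
    unfolding cuts_UNIV by (simp add: path_positions_def)
  also have "\<dots> \<longleftrightarrow> ?R"
  proof
    assume M: ?M
    then have h: "height (?t + 1) = \<mu> k + \<bar>j + 1 - p k\<bar>" using height_eq[of "j + 1" k] by (simp add: add.assoc)
    have le: "\<mu> k + \<bar>j + 1 - p k\<bar> \<le> \<mu> k'" for k'
      using M h height_end_eq[of k'] by metis
    from le[of k] have j: "j = p k - 1" by simp
    have "\<mu> k < \<mu> k'" if "k < k'" for k'
    proof -
      have "block_offset m n k' + p k' \<le> ?t" using offset_mono[OF that] M range[of k'] by linarith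
      then show ?thesis using M h height_end_eq[of k'] j by (metis abs_zero add.right_neutral diff_self diff_add_cancel)
    qed
    then show ?R using j le by auto
  next
    assume R: ?R
    then have j: "j = p k - 1" by simp
    have h: "height (?t + 1) = \<mu> k" using height_end_eq[of k] j by (simp add: add.assoc)
    have "\<mu> k < \<mu> (k + 1)" using R by simp
    then have jl: "0 \<le> j" using heights[of "k + 1"] range[of "k + 1"] j by (simp; linarith)
    have "height (?t + 1) \<le> height t \<and> (t \<le> ?t \<longrightarrow> height (?t + 1) < height t)" for t
    proof -
      obtain k' j' where t: "0 \<le> j'" "j' < block_length m n k'" "t = block_offset m n k' + j'"
        "height t = \<mu> k' + \<bar>j' - p k'\<bar>" using height_ge by blast
      have "height (?t + 1) \<le> height t" using t R h by (metis abs_ge_zero add_increasing2)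
      moreover have "height (?t + 1) < height t" if tt: "t \<le> ?t"
      proof -
        consider "k < k'" | "k' = k" | "k' < k" by linarith
        then show ?thesis
        proof cases
          case 1 then have "\<mu> k < \<mu> k'" using R by blast
          then show ?thesis using t h by linarith
        next
          case 2 then show ?thesis using tt t j h by auto
        next
          case 3 then show ?thesis using offset_mono[OF 3] t tt j range[of k] by linarith
        qed
      qed
      ultimately show ?thesis by blast
    qed
    moreover have "j < block_length m n k" using j range[of k] by linarith
    ultimately show ?M using jl by auto
  qed
  finally show ?thesis .
qed

text \<open>Changing the first \<open>0\<close> or the last \<open>1\<close> of a block keeps the
  form 1...10...0, so the result is again the word of a path.\<close>

lemma path_of_word_update:
  "(v = 1 \<and> j = p k \<and> j < block_length m n k \<and> y = p k + 1) \<or> (v = 0 \<and> j = p k - 1 \<and> 0 \<le> j \<and> y = p k - 1) \<Longrightarrow>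
   path_of_word m n 1 ((path_word m n 1 p)((k, j) := v)) = p(k := y)"
proof
  fix k' assume a: "(v = 1 \<and> j = p k \<and> j < block_length m n k \<and> y = p k + 1) \<or> (v = 0 \<and> j = p k - 1 \<and> 0 \<le> j \<and> y = p k - 1)"
  have "{j' \<in> {0..<block_length m n k'}. ((path_word m n 1 p)((k, j) := v)) (k', j') = 1} =
      {0..<(p(k := y)) k'}"
    using a range[of k'] by (auto simp: path_word_def split: if_splits)
  moreover have "0 \<le> (p(k := y)) k'" using a range[of k'] by auto
  ultimately show "path_of_word m n 1 ((path_word m n 1 p)((k, j) := v)) k' = (p(k := y)) k'"
    by (simp add: path_of_word_def del: fun_upd_apply)
qed

lemma path_f_1_iff:
  "path_f m n 1 p = Some p' \<longleftrightarrow>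
    (\<exists>k. (\<forall>k'. \<mu> k \<le> \<mu> k' \<and> (k' < k \<longrightarrow> \<mu> k < \<mu> k')) \<and> p' = p(k := p k + 1))"
proof -
  have u: "path_of_word m n 1 ((path_word m n 1 p)((k, p k) := 1)) = p(k := p k + 1)"
    if "\<forall>k'. \<mu> k \<le> \<mu> k' \<and> (k' < k \<longrightarrow> \<mu> k < \<mu> k')" for k
  proof (rule path_of_word_update)
    have "\<mu> k < \<mu> (k - 1)" using that by simp
    then show "1 = (1::int) \<and> p k = p k \<and> p k < block_length m n k \<and> p k + 1 = p k + 1 \<or>
      (1::int) = 0 \<and> p k = p k - 1 \<and> 0 \<le> p k \<and> p k + 1 = p k - 1"
      using heights[of k] range[of "k - 1"] by linarith
  qed
  show ?thesis unfolding path_f_def Let_def map_option_eq_Some split_paired_Ex f_position_path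
    using u by metis
qed

lemma path_e_1_iff:
  "path_e m n 1 p = Some p' \<longleftrightarrow>
    (\<exists>k. (\<forall>k'. \<mu> k \<le> \<mu> k' \<and> (k < k' \<longrightarrow> \<mu> k < \<mu> k')) \<and> p' = p(k := p k - 1))"
proof -
  have u: "path_of_word m n 1 ((path_word m n 1 p)((k, p k - 1) := 0)) = p(k := p k - 1)"
    if "\<forall>k'. \<mu> k \<le> \<mu> k' \<and> (k < k' \<longrightarrow> \<mu> k < \<mu> k')" for k
  proof (rule path_of_word_update)
    have "\<mu> k < \<mu> (k + 1)" using that by simp
    then show "0 = (1::int) \<and> p k - 1 = p k \<and> p k - 1 < block_length m n k \<and> p k - 1 = p k + 1 \<or>
      (0::int) = 0 \<and> p k - 1 = p k - 1 \<and> 0 \<le> p k - 1 \<and> p k - 1 = p k - 1"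
      using heights[of "k + 1"] range[of "k + 1"] by (simp; linarith)
  qed
  show ?thesis unfolding path_e_def Let_def map_option_eq_Some split_paired_Ex e_position_path
    using u by metis
qed

end

section \<open>The time evolution\<close>

type_synonym state = "(int \<Rightarrow> int) \<times> (int \<Rightarrow> int)"

definition clip :: "int \<Rightarrow> int \<Rightarrow> int" where "clip l x = max 0 (min l x)"

text \<open>\<open>X s\<close> and \<open>B s\<close> describe site \<open>s\<close>, formed by the
  blocks at \<open>3 - 2 * s\<close> and \<open>2 - 2 * s\<close> (see \<open>state_of\<close>):
  \<open>B s\<close> counts the zeros of the first, and \<open>X s\<close> is the surplus of ones of
  the second over \<open>B s\<close>. The part of \<open>X s\<close> outside the interval from 0 to
  \<open>l\<close> is handed on. The emitted block of length \<open>n\<close> joins the next site,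
  whence the index \<open>s - 1\<close>, and its ones are converted to zeros, whence the difference
  from \<open>n\<close>.\<close>

definition evolve :: "int \<Rightarrow> int \<Rightarrow> state \<Rightarrow> state" where
  "evolve l n = (\<lambda>(X, B).
     (\<lambda>s. clip l (X s) + (B (s - 1) + (X (s - 1) - clip l (X (s - 1)))) - B s,
      \<lambda>s. n - (B (s - 1) + (X (s - 1) - clip l (X (s - 1))))))"

text \<open>\<open>U s\<close> is the bottom of the odd block of site \<open>s\<close>, and
  \<open>U s - fst S s\<close> that of its even block.\<close>

definition state_heights :: "int \<Rightarrow> state \<Rightarrow> (int \<Rightarrow> int) \<Rightarrow> bool" where
  "state_heights l S U \<longleftrightarrow> (\<forall>s. U (s + 1) = U s + l - 2 * fst S s - snd S s + snd S (s + 1))"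

text \<open>The bottoms are read in the order \<open>U s\<close>, \<open>V s\<close>,
  \<open>U (s + 1)\<close>, and the last minimum is to be \<open>V s\<close>. The three definitions
  below are the analogues for \<open>U s\<close> and for first minima; whether \<open>s < t\<close>
  or \<open>s \<le> t\<close> appears depends on this reading order.\<close>

definition f_even :: "(int \<Rightarrow> int) \<Rightarrow> (int \<Rightarrow> int) \<Rightarrow> int \<Rightarrow> bool" where
  "f_even U V s \<longleftrightarrow> (\<forall>t. V s \<le> U t \<and> V s \<le> V t \<and> (s < t \<longrightarrow> V s < U t \<and> V s < V t))"

definition f_odd :: "(int \<Rightarrow> int) \<Rightarrow> (int \<Rightarrow> int) \<Rightarrow> int \<Rightarrow> bool" where
  "f_odd U V s \<longleftrightarrow>
     (\<forall>t. U s \<le> U t \<and> U s \<le> V t \<and> (s < t \<longrightarrow> U s < U t) \<and> (s \<le> t \<longrightarrow> U s < V t))"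

definition e_even :: "(int \<Rightarrow> int) \<Rightarrow> (int \<Rightarrow> int) \<Rightarrow> int \<Rightarrow> bool" where
  "e_even U V s \<longleftrightarrow>
     (\<forall>t. V s \<le> U t \<and> V s \<le> V t \<and> (t < s \<longrightarrow> V s < V t) \<and> (t \<le> s \<longrightarrow> V s < U t))"

definition e_odd :: "(int \<Rightarrow> int) \<Rightarrow> (int \<Rightarrow> int) \<Rightarrow> int \<Rightarrow> bool" where
  "e_odd U V s \<longleftrightarrow> (\<forall>t. U s \<le> U t \<and> U s \<le> V t \<and> (t < s \<longrightarrow> U s < U t \<and> U s < V t))"

definition state_f :: "int \<Rightarrow> state \<Rightarrow> state \<Rightarrow> bool" where
  "state_f l S S' \<longleftrightarrow> (\<exists>U s. state_heights l S U \<and>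
     (f_even U (\<lambda>t. U t - fst S t) s \<and> S' = ((fst S)(s := fst S s + 1), snd S) \<or>
      f_odd U (\<lambda>t. U t - fst S t) s \<and>
        S' = ((fst S)(s := fst S s + 1), (snd S)(s := snd S s - 1))))"

definition state_e :: "int \<Rightarrow> state \<Rightarrow> state \<Rightarrow> bool" where
  "state_e l S S' \<longleftrightarrow> (\<exists>U s. state_heights l S U \<and>
     (e_even U (\<lambda>t. U t - fst S t) s \<and> S' = ((fst S)(s := fst S s - 1), snd S) \<or>
      e_odd U (\<lambda>t. U t - fst S t) s \<and>
        S' = ((fst S)(s := fst S s - 1), (snd S)(s := snd S s + 1))))"

lemma evolve_simps:
  "fst (evolve l n S) s =
     clip l (fst S s) + (snd S (s - 1) + (fst S (s - 1) - clip l (fst S (s - 1)))) - snd S s"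
  "snd (evolve l n S) s = n - (snd S (s - 1) + (fst S (s - 1) - clip l (fst S (s - 1))))"
  by (simp_all add: evolve_def split_beta)

lemma state_eqI: "(\<And>s. fst S s = fst S' s) \<Longrightarrow> (\<And>s. snd S s = snd S' s) \<Longrightarrow> S = S'" for S S' :: state
  by (cases S; cases S') auto

text \<open>The emitted blocks recover \<open>B s\<close> plus the excess of \<open>X s\<close>, and
  the remaining blocks recover \<open>clip l (X s) - B s\<close>. The sum of the two is
  \<open>X s\<close>.\<close>

lemma evolve_inj:
  assumes "evolve l n S = evolve l n S'"
  shows "S = S'"
proof (rule state_eqI)
  let ?X = "fst S" and ?B = "snd S" and ?X' = "fst S'" and ?B' = "snd S'"
  have b: "?B s + (?X s - clip l (?X s)) = ?B' s + (?X' s - clip l (?X' s))" for s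
    using evolve_simps(2)[of l n S "s + 1"] evolve_simps(2)[of l n S' "s + 1"] assms by simp
  have x: "clip l (?X s) - ?B s = clip l (?X' s) - ?B' s" for s
    using evolve_simps(1)[of l n S s] evolve_simps(1)[of l n S' s] assms b[of "s - 1"] by simp
  show X: "?X s = ?X' s" for s using b[of s] x[of s] by simp
  show "?B s = ?B' s" for s using x[of s] X[of s] by simp
qed

lemma evolve_power_inj: "(evolve l n ^^ k) S = (evolve l n ^^ k) S' \<Longrightarrow> S = S'"
  by (induction k) (auto dest: evolve_inj)

text \<open>
  The evolution applies the combinatorial \<open>R\<close>-matrix to each pair of blocks at an odd position and
  the following even one; reduced words of pairs are preserved, and the heights change as below.
\<close>

lemma evolve_heights:
  assumes "state_heights l S U"
  defines "U' \<equiv> \<lambda>s. U (s - 1) - clip l (fst S (s - 1)) + l - fst S (s - 1)"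
  shows "state_heights l (evolve l n S) U'" "U' s - fst (evolve l n S) s = U s - clip l (fst S s)"
proof -
  have h: "U (s + 1) = U s + l - 2 * fst S s - snd S s + snd S (s + 1)" for s
    using assms by (simp add: state_heights_def)
  show v: "U' s - fst (evolve l n S) s = U s - clip l (fst S s)" for s
    using h[of "s - 1"] by (simp add: U'_def evolve_simps)
  show "state_heights l (evolve l n S) U'"
    unfolding state_heights_def
  proof
    fix s
    show "U' (s + 1) = U' s + l - 2 * fst (evolve l n S) s - snd (evolve l n S) s + snd (evolve l n S) (s + 1)"
      using v[of s] by (simp add: U'_def evolve_simps)
  qed
qed

text \<open>The two bottoms of site \<open>s\<close> are replaced by \<open>V' s\<close> and
  \<open>U' (s + 1)\<close>. A change at site \<open>s\<close> thus becomes a change of the even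
  block of \<open>s\<close>, unless the site is full: then the emitted block is changed, which is
  the odd block of site \<open>s + 1\<close>.\<close>

lemma evolve_f:
  assumes l: "0 \<le> l" and f: "state_f l S S'"
  shows "state_f l (evolve l n S) (evolve l n S')"
proof -
  obtain X B where S: "S = (X, B)" by (cases S)
  obtain U s where U: "state_heights l S U" and
    cases: "f_even U (\<lambda>t. U t - X t) s \<and> S' = (X(s := X s + 1), B) \<or>
      f_odd U (\<lambda>t. U t - X t) s \<and> S' = (X(s := X s + 1), B(s := B s - 1))"
    using f unfolding state_f_def S by auto
  define U' where "U' = (\<lambda>s. U (s - 1) - clip l (fst S (s - 1)) + l - fst S (s - 1))"
  have U': "state_heights l (evolve l n S) U'"
    using evolve_heights(1)[OF U] by (simp add: U'_def)
  define V' where "V' = (\<lambda>t. U' t - fst (evolve l n S) t)"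
  have V': "V' t = U t - clip l (X t)" for t
    using evolve_heights(2)[OF U, where n = n and s = t] by (simp add: V'_def U'_def S)
  have U'': "U' t = U (t - 1) - clip l (X (t - 1)) + l - X (t - 1)" for t by (simp add: U'_def S)
  have fI: "state_f l (evolve l n S) (evolve l n S')"
    if "f_even U' V' t \<and> evolve l n S' = ((fst (evolve l n S))(t := fst (evolve l n S) t + 1), snd (evolve l n S)) \<or>
      f_odd U' V' t \<and> evolve l n S' = ((fst (evolve l n S))(t := fst (evolve l n S) t + 1),
        (snd (evolve l n S))(t := snd (evolve l n S) t - 1))" for t
    unfolding state_f_def using U' that unfolding V'_def by blast
  have "(f_even U' V' s \<and> evolve l n S' = ((fst (evolve l n S))(s := fst (evolve l n S) s + 1), snd (evolve l n S))) \<or>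
    (f_odd U' V' (s + 1) \<and> evolve l n S' = ((fst (evolve l n S))(s + 1 := fst (evolve l n S) (s + 1) + 1),
        (snd (evolve l n S))(s + 1 := snd (evolve l n S) (s + 1) - 1)))"
    using cases
  proof
    assume c: "f_even U (\<lambda>t. U t - X t) s \<and> S' = (X(s := X s + 1), B)"
    then have m: "U s - X s \<le> U t \<and> U s - X s \<le> U t - X t \<and>
        (s < t \<longrightarrow> U s - X s < U t \<and> U s - X s < U t - X t)" for t by (simp add: f_even_def)
    from m[of s] have X0: "0 \<le> X s" by simp
    show ?thesis
    proof (cases "X s < l")
      case True
      have "f_even U' V' s" unfolding f_even_def
      proof (intro allI)
        fix t show "V' s \<le> U' t \<and> V' s \<le> V' t \<and> (s < t \<longrightarrow> V' s < U' t \<and> V' s < V' t)"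
          unfolding V' U'' using m[of t] m[of "t - 1"] X0 True l
          by (cases "t - 1 = s") (auto simp: clip_def)
      qed
      moreover have "evolve l n S' = ((fst (evolve l n S))(s := fst (evolve l n S) s + 1), snd (evolve l n S))"
        using X0 True c by (intro state_eqI) (auto simp: evolve_simps S clip_def)
      ultimately show ?thesis by blast
    next
      case False
      have "f_odd U' V' (s + 1)" unfolding f_odd_def
      proof (intro allI)
        fix t show "U' (s + 1) \<le> U' t \<and> U' (s + 1) \<le> V' t \<and> (s + 1 < t \<longrightarrow> U' (s + 1) < U' t)
            \<and> (s + 1 \<le> t \<longrightarrow> U' (s + 1) < V' t)"
          unfolding V' U'' using m[of t] m[of "t - 1"] X0 False l
          by (auto simp: clip_def)
      qed
      moreover have "evolve l n S' = ((fst (evolve l n S))(s + 1 := fst (evolve l n S) (s + 1) + 1),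
        (snd (evolve l n S))(s + 1 := snd (evolve l n S) (s + 1) - 1))"
        using X0 False c l by (intro state_eqI) (auto simp: evolve_simps S clip_def)
      ultimately show ?thesis by blast
    qed
  next
    assume c: "f_odd U (\<lambda>t. U t - X t) s \<and> S' = (X(s := X s + 1), B(s := B s - 1))"
    then have m: "U s \<le> U t \<and> U s \<le> U t - X t \<and>
        (s < t \<longrightarrow> U s < U t) \<and> (s \<le> t \<longrightarrow> U s < U t - X t)" for t by (simp add: f_odd_def)
    from m[of s] have X0: "X s < 0" by simp
    have "f_even U' V' s" unfolding f_even_def
    proof (intro allI)
      fix t show "V' s \<le> U' t \<and> V' s \<le> V' t \<and> (s < t \<longrightarrow> V' s < U' t \<and> V' s < V' t)"
        unfolding V' U'' using m[of t] m[of "t - 1"] X0 l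
        by (cases "t - 1 = s") (auto simp: clip_def)
    qed
    moreover have "evolve l n S' = ((fst (evolve l n S))(s := fst (evolve l n S) s + 1), snd (evolve l n S))"
      using X0 l c by (intro state_eqI) (auto simp: evolve_simps S clip_def)
    ultimately show ?thesis by blast
  qed
  then show ?thesis using fI by blast
qed

text \<open>The same correspondence of bottoms as in \<open>evolve_f\<close>; here it is an overfull
  site, \<open>X s > l\<close>, for which the emitted block is changed.\<close>

lemma evolve_e:
  assumes l: "0 \<le> l" and f: "state_e l S S'"
  shows "state_e l (evolve l n S) (evolve l n S')"
proof -
  obtain X B where S: "S = (X, B)" by (cases S)
  obtain U s where U: "state_heights l S U" and
    cases: "e_even U (\<lambda>t. U t - X t) s \<and> S' = (X(s := X s - 1), B) \<or>
      e_odd U (\<lambda>t. U t - X t) s \<and> S' = (X(s := X s - 1), B(s := B s + 1))"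
    using f unfolding state_e_def S by auto
  define U' where "U' = (\<lambda>s. U (s - 1) - clip l (fst S (s - 1)) + l - fst S (s - 1))"
  have U': "state_heights l (evolve l n S) U'"
    using evolve_heights(1)[OF U] by (simp add: U'_def)
  define V' where "V' = (\<lambda>t. U' t - fst (evolve l n S) t)"
  have V': "V' t = U t - clip l (X t)" for t
    using evolve_heights(2)[OF U, where n = n and s = t] by (simp add: V'_def U'_def S)
  have U'': "U' t = U (t - 1) - clip l (X (t - 1)) + l - X (t - 1)" for t by (simp add: U'_def S)
  have fI: "state_e l (evolve l n S) (evolve l n S')"
    if "e_even U' V' t \<and> evolve l n S' = ((fst (evolve l n S))(t := fst (evolve l n S) t - 1), snd (evolve l n S)) \<or>
      e_odd U' V' t \<and> evolve l n S' = ((fst (evolve l n S))(t := fst (evolve l n S) t - 1),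
        (snd (evolve l n S))(t := snd (evolve l n S) t + 1))" for t
    unfolding state_e_def using U' that unfolding V'_def by blast
  have "(e_even U' V' s \<and> evolve l n S' = ((fst (evolve l n S))(s := fst (evolve l n S) s - 1), snd (evolve l n S))) \<or>
    (e_odd U' V' (s + 1) \<and> evolve l n S' = ((fst (evolve l n S))(s + 1 := fst (evolve l n S) (s + 1) - 1),
        (snd (evolve l n S))(s + 1 := snd (evolve l n S) (s + 1) + 1)))"
    using cases
  proof
    assume c: "e_even U (\<lambda>t. U t - X t) s \<and> S' = (X(s := X s - 1), B)"
    then have m: "U s - X s \<le> U t \<and> U s - X s \<le> U t - X t \<and>
        (t < s \<longrightarrow> U s - X s < U t - X t) \<and> (t \<le> s \<longrightarrow> U s - X s < U t)" for t by (simp add: e_even_def)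
    from m[of s] have X0: "0 < X s" by simp
    show ?thesis
    proof (cases "X s \<le> l")
      case True
      have "e_even U' V' s" unfolding e_even_def
      proof (intro allI)
        fix t show "V' s \<le> U' t \<and> V' s \<le> V' t \<and> (t < s \<longrightarrow> V' s < V' t) \<and> (t \<le> s \<longrightarrow> V' s < U' t)"
          unfolding V' U'' using m[of t] m[of "t - 1"] X0 True l
          by (auto simp: clip_def)
      qed
      moreover have "evolve l n S' = ((fst (evolve l n S))(s := fst (evolve l n S) s - 1), snd (evolve l n S))"
        using X0 True c by (intro state_eqI) (auto simp: evolve_simps S clip_def)
      ultimately show ?thesis by blast
    next
      case False
      have "e_odd U' V' (s + 1)" unfolding e_odd_def
      proof (intro allI)
        fix t show "U' (s + 1) \<le> U' t \<and> U' (s + 1) \<le> V' t \<and>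
            (t < s + 1 \<longrightarrow> U' (s + 1) < U' t \<and> U' (s + 1) < V' t)"
          unfolding V' U'' using m[of t] m[of "t - 1"] X0 False l
          by (cases "t = s") (auto simp: clip_def)
      qed
      moreover have "evolve l n S' = ((fst (evolve l n S))(s + 1 := fst (evolve l n S) (s + 1) - 1),
        (snd (evolve l n S))(s + 1 := snd (evolve l n S) (s + 1) + 1))"
        using X0 False c l by (intro state_eqI) (auto simp: evolve_simps S clip_def)
      ultimately show ?thesis by blast
    qed
  next
    assume c: "e_odd U (\<lambda>t. U t - X t) s \<and> S' = (X(s := X s - 1), B(s := B s + 1))"
    then have m: "U s \<le> U t \<and> U s \<le> U t - X t \<and> (t < s \<longrightarrow> U s < U t \<and> U s < U t - X t)" for t
      by (simp add: e_odd_def)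
    from m[of s] have X0: "X s \<le> 0" by simp
    have "e_even U' V' s" unfolding e_even_def
    proof (intro allI)
      fix t show "V' s \<le> U' t \<and> V' s \<le> V' t \<and> (t < s \<longrightarrow> V' s < V' t) \<and> (t \<le> s \<longrightarrow> V' s < U' t)"
        unfolding V' U'' using m[of t] m[of "t - 1"] X0 l
        by (auto simp: clip_def)
    qed
    moreover have "evolve l n S' = ((fst (evolve l n S))(s := fst (evolve l n S) s - 1), snd (evolve l n S))"
      using X0 l c by (intro state_eqI) (auto simp: evolve_simps S clip_def)
    ultimately show ?thesis by blast
  qed
  then show ?thesis using fI by blast
qed

lemma evolve_power_f:
  "0 \<le> l \<Longrightarrow> state_f l S S' \<Longrightarrow> state_f l ((evolve l n ^^ k) S) ((evolve l n ^^ k) S')"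
  by (induction k) (auto intro: evolve_f)

lemma evolve_power_e:
  "0 \<le> l \<Longrightarrow> state_e l S S' \<Longrightarrow> state_e l ((evolve l n ^^ k) S) ((evolve l n ^^ k) S')"
  by (induction k) (auto intro: evolve_e)

section \<open>Separated states\<close>

text \<open>Bottoms of a path all of whose blocks have length \<open>l\<close>: climb over
  \<open>l - q s\<close> zeros, descend over \<open>q (s + 1)\<close> ones.\<close>

definition q_heights :: "int \<Rightarrow> (int \<Rightarrow> int) \<Rightarrow> (int \<Rightarrow> int) \<Rightarrow> bool" where
  "q_heights l q \<mu> \<longleftrightarrow> (\<forall>s. \<mu> (s + 1) = \<mu> s + l - q s - q (s + 1))"

definition q_f :: "int \<Rightarrow> (int \<Rightarrow> int) \<Rightarrow> (int \<Rightarrow> int) \<Rightarrow> bool" where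
  "q_f l q q' \<longleftrightarrow> (\<exists>\<mu> s. q_heights l q \<mu> \<and> last_min \<mu> s \<and> q' = q(s := q s + 1))"

definition q_e :: "int \<Rightarrow> (int \<Rightarrow> int) \<Rightarrow> (int \<Rightarrow> int) \<Rightarrow> bool" where
  "q_e l q q' \<longleftrightarrow> (\<exists>\<mu> s. q_heights l q \<mu> \<and> first_min \<mu> s \<and> q' = q(s := q s - 1))"

text \<open>
  In a separated state, all spin-\<open>0\<close> particles are to the right of \<open>s\<^sub>0\<close> and all spin-\<open>1/2\<close>
  particles, which are described by the level \<open>m - n\<close> path \<open>q\<close>, to its left.
\<close>

definition separated :: "int \<Rightarrow> (int \<Rightarrow> int) \<Rightarrow> int \<Rightarrow> state \<Rightarrow> bool" where
  "separated l q s0 S \<longleftrightarrow>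
     (\<forall>s\<le>s0. fst S s = q s \<and> snd S s = snd S s0) \<and>
     (\<forall>s\<ge>s0. 0 \<le> fst S s \<and> fst S s \<le> l \<and> fst S s + snd S s - snd S (s + 1) + fst S (s + 1) = l) \<and>
     (\<forall>s. 0 \<le> q s \<and> q s \<le> l) \<and> (\<forall>s\<ge>s0. q s + q (s + 1) = l)"

lemma separatedD:
  assumes "separated l q s0 S"
  shows "s \<le> s0 \<Longrightarrow> fst S s = q s \<and> snd S s = snd S s0"
    "s0 \<le> s \<Longrightarrow> 0 \<le> fst S s \<and> fst S s \<le> l \<and> fst S s + snd S s - snd S (s + 1) + fst S (s + 1) = l"
    "0 \<le> q s \<and> q s \<le> l" "s0 \<le> s \<Longrightarrow> q s + q (s + 1) = l"
  using assms unfolding separated_def by blast+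

lemma separated_range: "separated l q s0 S \<Longrightarrow> 0 \<le> fst S s \<and> fst S s \<le> l"
  unfolding separated_def by (cases "s \<le> s0") auto

lemma separated_evolve_eq:
  assumes "separated l q s0 S"
  shows "fst (evolve l n S) s = fst S s + snd S (s - 1) - snd S s"
    "snd (evolve l n S) s = n - snd S (s - 1)"
  using separated_range[OF assms] by (auto simp: evolve_simps clip_def)

text \<open>All sites lie between 0 and \<open>l\<close>, so nothing is reflected. The left part is
  stationary, and to the right of \<open>s0\<close> each site becomes the complement of its left
  neighbour, \<open>l - fst S (s - 1)\<close>; this is motion with speed one.\<close>

lemma separated_evolve:
  assumes sep: "separated l q s0 S"
  shows "separated l q (s0 + 1) (evolve l n S)"
proof -
  note e = separated_evolve_eq[OF sep, of n]
  have L: "fst S s = q s \<and> snd S s = snd S s0" if "s \<le> s0" for s using separatedD(1)[OF sep that] .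
  have R: "0 \<le> fst S s \<and> fst S s \<le> l \<and> fst S s + snd S s - snd S (s + 1) + fst S (s + 1) = l" if "s \<ge> s0" for s
    using separatedD(2)[OF sep that] .
  have q: "\<forall>s. 0 \<le> q s \<and> q s \<le> l" "\<forall>s\<ge>s0. q s + q (s + 1) = l"
    using separatedD(3,4)[OF sep] by blast+
  have 1: "fst (evolve l n S) s = q s \<and> snd (evolve l n S) s = snd (evolve l n S) (s0 + 1)" if "s \<le> s0 + 1" for s
  proof (cases "s = s0 + 1")
    case True
    have "q s0 + q (s0 + 1) = l" using q(2) by simp
    then show ?thesis using R[of s0] L[of s0] True unfolding e by simp
  next
    case False
    then show ?thesis using L[of s] L[of "s - 1"] that unfolding e by simp
  qed
  have X': "fst (evolve l n S) s = l - fst S (s - 1)" if "s \<ge> s0 + 1" for s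
    using R[of "s - 1"] that unfolding e by simp
  have 2: "0 \<le> fst (evolve l n S) s \<and> fst (evolve l n S) s \<le> l \<and>
    fst (evolve l n S) s + snd (evolve l n S) s - snd (evolve l n S) (s + 1) + fst (evolve l n S) (s + 1) = l"
    if "s \<ge> s0 + 1" for s
  proof -
    have "fst (evolve l n S) (s + 1) = l - fst S s" using X'[of "s + 1"] that by simp
    moreover have "fst (evolve l n S) s + snd (evolve l n S) s - snd (evolve l n S) (s + 1) = fst S s"
      unfolding e by simp
    ultimately show ?thesis using X'[OF that] R[of "s - 1"] that by simp
  qed
  have 1: "\<forall>s\<le>s0 + 1. fst (evolve l n S) s = q s \<and> snd (evolve l n S) s = snd (evolve l n S) (s0 + 1)"
    using 1 by blast
  have 2: "\<forall>s\<ge>s0 + 1. 0 \<le> fst (evolve l n S) s \<and> fst (evolve l n S) s \<le> l \<and>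
    fst (evolve l n S) s + snd (evolve l n S) s - snd (evolve l n S) (s + 1) + fst (evolve l n S) (s + 1) = l"
    using 2 by blast
  have "\<forall>s\<ge>s0 + 1. q s + q (s + 1) = l" using q(2) by simp
  then show ?thesis unfolding separated_def using 1 2 q(1) by (intro conjI)
qed

lemma separated_evolve_power:
  "separated l q s0 S \<Longrightarrow> separated l q (s0 + int k) ((evolve l n ^^ k) S)"
proof (induction k)
  case (Suc k)
  then show ?case using separated_evolve[of l q "s0 + int k" "(evolve l n ^^ k) S" n]
    by (simp add: add_ac)
qed simp

text \<open>In a separated state no odd bottom lies below the even bottoms before and after it, so
  minima may be searched among the \<open>V s\<close>. These are the heights of the level
  \<open>l\<close> path \<open>q\<close>, constant from \<open>s0\<close> on.\<close>

lemma separated_heights: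
  assumes sep: "separated l q s0 S" and U: "state_heights l S U"
    and V_def: "\<And>s. V s = U s - fst S s"
  shows "q_heights l q V" "V s \<le> U s" "V s \<le> U (s + 1)" "s0 \<le> s \<Longrightarrow> V (s + 1) = V s"
proof -
  have L: "fst S s = q s \<and> snd S s = snd S s0" if "s \<le> s0" for s using separatedD(1)[OF sep that] .
  have R: "0 \<le> fst S s \<and> fst S s \<le> l \<and> fst S s + snd S s - snd S (s + 1) + fst S (s + 1) = l" if "s \<ge> s0" for s
    using separatedD(2)[OF sep that] .
  have q: "\<And>s. 0 \<le> q s \<and> q s \<le> l" "\<And>s. s\<ge>s0 \<Longrightarrow> q s + q (s + 1) = l"
    using separatedD(3,4)[OF sep] by blast+
  have h: "U (s + 1) = U s + l - 2 * fst S s - snd S s + snd S (s + 1)" for s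
    using U by (simp add: state_heights_def)
  show c: "s0 \<le> s \<Longrightarrow> V (s + 1) = V s" for s using h[of s] R[of s] by (simp add: V_def)
  show "q_heights l q V" unfolding q_heights_def
  proof
    fix s show "V (s + 1) = V s + l - q s - q (s + 1)"
    proof (cases "s0 \<le> s")
      case True then show ?thesis using c[of s] q(2)[of s] by simp
    next
      case False then show ?thesis using L[of s] L[of "s + 1"] h[of s] by (simp add: V_def)
    qed
  qed
  show "V s \<le> U s" using separated_range[OF sep, of s] by (simp add: V_def)
  show "V s \<le> U (s + 1)"
  proof (cases "s0 \<le> s")
    case True then show ?thesis using c[of s] separated_range[OF sep, of "s + 1"] by (simp add: V_def)
  next
    case False then show ?thesis using L[of s] L[of "s + 1"] h[of s] q(1)[of s] by (simp add: V_def)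
  qed
qed

lemma q_heights_unique:
  assumes "q_heights l q \<mu>" "q_heights l q \<mu>'"
  shows "\<mu>' s = \<mu> s + (\<mu>' 0 - \<mu> 0)"
proof -
  have "\<mu>' (s + 1) - \<mu> (s + 1) = \<mu>' s - \<mu> s" for s using assms by (simp add: q_heights_def)
  then have "\<mu>' s - \<mu> s = \<mu>' 0 - \<mu> 0" for s
    by (induction s rule: int_induct[of _ 0]) (auto, metis diff_add_cancel)
  then show ?thesis by (simp add: algebra_simps)
qed

lemma last_min_shift: "(\<And>s. \<mu>' s = \<mu> s + c) \<Longrightarrow> last_min \<mu>' s \<longleftrightarrow> last_min \<mu> s" for c :: int
  by (simp add: last_min_def)

lemma first_min_shift: "(\<And>s. \<mu>' s = \<mu> s + c) \<Longrightarrow> first_min \<mu>' s \<longleftrightarrow> first_min \<mu> s" for c :: int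
  by (simp add: first_min_def)

lemma last_min_unique: "last_min \<mu> s \<Longrightarrow> last_min \<mu> s' \<Longrightarrow> s = s'"
  unfolding last_min_def by (meson linorder_neqE not_less)

lemma first_min_unique: "first_min \<mu> s \<Longrightarrow> first_min \<mu> s' \<Longrightarrow> s = s'"
  unfolding first_min_def by (meson linorder_neqE not_less)

lemma q_f_iff: "q_heights l q \<mu> \<Longrightarrow> q_f l q q' \<longleftrightarrow> (\<exists>s. last_min \<mu> s \<and> q' = q(s := q s + 1))"
  unfolding q_f_def using q_heights_unique last_min_shift by blast

lemma q_e_iff: "q_heights l q \<mu> \<Longrightarrow> q_e l q q' \<longleftrightarrow> (\<exists>s. first_min \<mu> s \<and> q' = q(s := q s - 1))"
  unfolding q_e_def using q_heights_unique first_min_shift by blast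

lemma exists_state_heights: "\<exists>U. state_heights l S U"
  using exists_int_antiderivative[of "\<lambda>s. l - 2 * fst S s - snd S s + snd S (s + 1)"]
  by (simp add: state_heights_def algebra_simps)

lemma state_heights_unique:
  assumes "state_heights l S U" "state_heights l S U'"
  shows "U' s = U s + (U' 0 - U 0)"
proof -
  have "U' (s + 1) - U (s + 1) = U' s - U s" for s using assms by (simp add: state_heights_def)
  then have "U' s - U s = U' 0 - U 0" for s
    by (induction s rule: int_induct[of _ 0]) (auto, metis diff_add_cancel)
  then show ?thesis by (simp add: algebra_simps)
qed

lemma state_f_iff:
  assumes U: "state_heights l S U"
  shows "state_f l S S' \<longleftrightarrow> (\<exists>s.
     f_even U (\<lambda>t. U t - fst S t) s \<and> S' = ((fst S)(s := fst S s + 1), snd S) \<or>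
      f_odd U (\<lambda>t. U t - fst S t) s \<and>
        S' = ((fst S)(s := fst S s + 1), (snd S)(s := snd S s - 1)))"
proof -
  have 1: "f_even U' (\<lambda>t. U' t - fst S t) s \<longleftrightarrow> f_even U (\<lambda>t. U t - fst S t) s"
    "f_odd U' (\<lambda>t. U' t - fst S t) s \<longleftrightarrow> f_odd U (\<lambda>t. U t - fst S t) s"
    if "state_heights l S U'" for U' s
  proof -
    define c where "c = U' 0 - U 0"
    have "U' = (\<lambda>s. U s + c)" unfolding c_def by (rule ext) (rule state_heights_unique[OF U that])
    then show "f_even U' (\<lambda>t. U' t - fst S t) s \<longleftrightarrow> f_even U (\<lambda>t. U t - fst S t) s"
      "f_odd U' (\<lambda>t. U' t - fst S t) s \<longleftrightarrow> f_odd U (\<lambda>t. U t - fst S t) s"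
      by (simp_all add: f_even_def f_odd_def)
  qed
  show ?thesis unfolding state_f_def using U 1 by blast
qed

lemma state_e_iff:
  assumes U: "state_heights l S U"
  shows "state_e l S S' \<longleftrightarrow> (\<exists>s.
     e_even U (\<lambda>t. U t - fst S t) s \<and> S' = ((fst S)(s := fst S s - 1), snd S) \<or>
      e_odd U (\<lambda>t. U t - fst S t) s \<and>
        S' = ((fst S)(s := fst S s - 1), (snd S)(s := snd S s + 1)))"
proof -
  have 1: "e_even U' (\<lambda>t. U' t - fst S t) s \<longleftrightarrow> e_even U (\<lambda>t. U t - fst S t) s"
    "e_odd U' (\<lambda>t. U' t - fst S t) s \<longleftrightarrow> e_odd U (\<lambda>t. U t - fst S t) s"
    if "state_heights l S U'" for U' s
  proof -
    define c where "c = U' 0 - U 0"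
    have "U' = (\<lambda>s. U s + c)" unfolding c_def by (rule ext) (rule state_heights_unique[OF U that])
    then show "e_even U' (\<lambda>t. U' t - fst S t) s \<longleftrightarrow> e_even U (\<lambda>t. U t - fst S t) s"
      "e_odd U' (\<lambda>t. U' t - fst S t) s \<longleftrightarrow> e_odd U (\<lambda>t. U t - fst S t) s"
      by (simp_all add: e_even_def e_odd_def)
  qed
  show ?thesis unfolding state_e_def using U 1 by blast
qed

text \<open>Ties favour the even blocks: in the reading order \<open>V (s - 1)\<close>,
  \<open>U s\<close>, \<open>V s\<close>, the bottom \<open>U s\<close> is neither strictly below
  its successor, as a last minimum would be, nor strictly below its predecessor, as a first one
  would be.\<close>

lemma separated_f_even:
  assumes sep: "separated l q s0 S" and U: "state_heights l S U"
  shows "f_even U (\<lambda>t. U t - fst S t) s \<longleftrightarrow> last_min (\<lambda>t. U t - fst S t) s"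
    "\<not> f_odd U (\<lambda>t. U t - fst S t) s"
    "e_even U (\<lambda>t. U t - fst S t) s \<longleftrightarrow> first_min (\<lambda>t. U t - fst S t) s"
    "\<not> e_odd U (\<lambda>t. U t - fst S t) s"
proof -
  define V where "V = (\<lambda>t. U t - fst S t)"
  have Vs: "V s = U s - fst S s" for s by (simp add: V_def)
  note h = separated_heights[OF sep U Vs]
  have le: "V t \<le> U t" "V (t - 1) \<le> U t" for t using h(2)[of t] h(3)[of "t - 1"] by simp_all
  show "f_even U (\<lambda>t. U t - fst S t) s \<longleftrightarrow> last_min (\<lambda>t. U t - fst S t) s"
    unfolding V_def[symmetric]
  proof
    assume "f_even U V s" then show "last_min V s" by (simp add: f_even_def last_min_def)
  next
    assume a: "last_min V s"
    show "f_even U V s" unfolding f_even_def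
    proof
      fix t show "V s \<le> U t \<and> V s \<le> V t \<and> (s < t \<longrightarrow> V s < U t \<and> V s < V t)"
        using a[unfolded last_min_def, rule_format, of t] le(1)[of t] by linarith
    qed
  qed
  show "\<not> f_odd U (\<lambda>t. U t - fst S t) s"
    unfolding V_def[symmetric] f_odd_def
  proof
    assume "\<forall>t. U s \<le> U t \<and> U s \<le> V t \<and> (s < t \<longrightarrow> U s < U t) \<and> (s \<le> t \<longrightarrow> U s < V t)"
    from this[rule_format, of s] show False using le(1)[of s] by simp
  qed
  show "e_even U (\<lambda>t. U t - fst S t) s \<longleftrightarrow> first_min (\<lambda>t. U t - fst S t) s"
    unfolding V_def[symmetric]
  proof
    assume "e_even U V s" then show "first_min V s" by (simp add: e_even_def first_min_def)
  next
    assume a: "first_min V s"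
    show "e_even U V s" unfolding e_even_def
    proof
      fix t show "V s \<le> U t \<and> V s \<le> V t \<and> (t < s \<longrightarrow> V s < V t) \<and> (t \<le> s \<longrightarrow> V s < U t)"
        using a[unfolded first_min_def, rule_format, of t] a[unfolded first_min_def, rule_format, of "t - 1"]
          le[of t] by linarith
    qed
  qed
  show "\<not> e_odd U (\<lambda>t. U t - fst S t) s"
    unfolding V_def[symmetric] e_odd_def
  proof
    assume "\<forall>t. U s \<le> U t \<and> U s \<le> V t \<and> (t < s \<longrightarrow> U s < U t \<and> U s < V t)"
    from this[rule_format, of "s - 1"] show False using le(2)[of s] by simp
  qed
qed

lemma separated_update:
  assumes sep: "separated l q s0 S" and "s < s0" "0 \<le> v" "v \<le> l"
  shows "separated l (q(s := v)) s0 ((fst S)(s := v), snd S)"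
  unfolding separated_def
proof (intro conjI allI impI)
  fix t
  show "fst ((fst S)(s := v), snd S) t = (q(s := v)) t" if "t \<le> s0"
    using separatedD(1)[OF sep that] by simp
  show "snd ((fst S)(s := v), snd S) t = snd ((fst S)(s := v), snd S) s0" if "t \<le> s0"
    using separatedD(1)[OF sep that] by simp
  show "fst ((fst S)(s := v), snd S) t + snd ((fst S)(s := v), snd S) t -
      snd ((fst S)(s := v), snd S) (t + 1) + fst ((fst S)(s := v), snd S) (t + 1) = l"
    "0 \<le> fst ((fst S)(s := v), snd S) t" "fst ((fst S)(s := v), snd S) t \<le> l" if "s0 \<le> t"
    using separatedD(2)[OF sep that] that assms by auto
  show "0 \<le> (q(s := v)) t" "(q(s := v)) t \<le> l" using separatedD(3)[OF sep, of t] assms by auto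
  show "(q(s := v)) t + (q(s := v)) (t + 1) = l" if "s0 \<le> t"
    using separatedD(4)[OF sep that] that assms by auto
qed

text \<open>A last minimum is strictly below its successor, whereas the heights are constant from
  \<open>s0\<close> on. So the operator acts to the left of \<open>s0\<close> and leaves the spin-0
  part untouched.\<close>

lemma separated_f:
  assumes sep: "separated l q s0 S" and f: "state_f l S S'"
  shows "\<exists>q'. q_f l q q' \<and> separated l q' s0 S' \<and> (\<forall>t\<ge>s0. q' t = q t \<and> fst S' t = fst S t) \<and> snd S' = snd S"
proof -
  obtain U where U: "state_heights l S U" using exists_state_heights by blast
  define V where "V = (\<lambda>t. U t - fst S t)"
  have Vs: "V s = U s - fst S s" for s by (simp add: V_def)
  note h = separated_heights[OF sep U Vs]
  obtain s where s: "last_min V s" "S' = ((fst S)(s := fst S s + 1), snd S)"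
    using f unfolding state_f_iff[OF U] using separated_f_even[OF sep U] unfolding V_def by blast
  define q' where "q' = q(s := q s + 1)"
  have up: "V s < V (s + 1)" using s(1) by (simp add: last_min_def)
  then have s0: "s < s0" using h(4)[of s] by force
  have "V (s + 1) = V s + l - q s - q (s + 1)" using h(1) by (simp add: q_heights_def)
  moreover have q: "0 \<le> q t \<and> q t \<le> l" for t using separatedD(3)[OF sep] .
  ultimately have "q s + 1 \<le> l" using up q[of "s + 1"] by linarith
  then have "separated l q' s0 S'" using separated_update[OF sep s0, of "q s + 1"] s0 q[of s]
      separatedD(1)[OF sep, of s] by (simp add: q'_def s(2))
  moreover have "q_f l q q'" using q_f_iff[OF h(1)] s(1) q'_def by auto
  ultimately show ?thesis using s0 by (intro exI[of _ q']) (auto simp: q'_def s(2))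
qed

lemma separated_f_exists:
  assumes sep: "separated l q s0 S" and f: "q_f l q q'"
  shows "\<exists>S'. state_f l S S'"
proof -
  obtain U where U: "state_heights l S U" using exists_state_heights by blast
  define V where "V = (\<lambda>t. U t - fst S t)"
  have Vs: "V s = U s - fst S s" for s by (simp add: V_def)
  note h = separated_heights[OF sep U Vs]
  obtain s where "last_min V s" using f q_f_iff[OF h(1)] by blast
  then show ?thesis unfolding state_f_iff[OF U] using separated_f_even(1)[OF sep U] V_def by metis
qed

text \<open>A first minimum could sit at \<open>s0\<close> itself; the condition on
  \<open>q (s0 - 1) + q s0\<close> makes the heights at \<open>s0 - 1\<close> and \<open>s0\<close>
  equal, which excludes this.\<close>

lemma separated_e:
  assumes sep: "separated l q s0 S" and g: "q (s0 - 1) + q s0 = l" and f: "state_e l S S'"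
  shows "\<exists>q'. q_e l q q' \<and> separated l q' s0 S'"
proof -
  obtain U where U: "state_heights l S U" using exists_state_heights by blast
  define V where "V = (\<lambda>t. U t - fst S t)"
  have Vs: "V s = U s - fst S s" for s by (simp add: V_def)
  note h = separated_heights[OF sep U Vs]
  obtain s where s: "first_min V s" "S' = ((fst S)(s := fst S s - 1), snd S)"
    using f unfolding state_e_iff[OF U] using separated_f_even[OF sep U] unfolding V_def by blast
  define q' where "q' = q(s := q s - 1)"
  have up: "V s < V (s - 1)" using s(1) by (simp add: first_min_def)
  have hq: "V s = V (s - 1) + l - q (s - 1) - q s"
    using h(1)[unfolded q_heights_def, rule_format, of "s - 1"] by simp
  have s0: "s < s0"
  proof (rule ccontr)
    assume "\<not> s < s0"
    then have "s = s0 \<or> s0 \<le> s - 1" by auto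
    then show False using up hq g h(4)[of "s - 1"] by auto
  qed
  have q: "0 \<le> q t \<and> q t \<le> l" for t using separatedD(3)[OF sep] .
  have "0 \<le> q s - 1" using up hq q[of "s - 1"] by simp
  then have "separated l q' s0 S'" using separated_update[OF sep s0, of "q s - 1"] s0 q[of s]
      separatedD(1)[OF sep, of s] by (simp add: q'_def s(2))
  moreover have "q_e l q q'" using q_e_iff[OF h(1)] s(1) q'_def by auto
  ultimately show ?thesis by blast
qed

lemma separated_e_exists:
  assumes sep: "separated l q s0 S" and f: "q_e l q q'"
  shows "\<exists>S'. state_e l S S'"
proof -
  obtain U where U: "state_heights l S U" using exists_state_heights by blast
  define V where "V = (\<lambda>t. U t - fst S t)"
  have Vs: "V s = U s - fst S s" for s by (simp add: V_def)
  note h = separated_heights[OF sep U Vs]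
  obtain s where "first_min V s" using f q_e_iff[OF h(1)] by blast
  then show ?thesis unfolding state_e_iff[OF U] using separated_f_even(3)[OF sep U] V_def by metis
qed

text \<open>The evolution of a site depends only on itself and its left neighbour. Beyond
  \<open>s0 + k\<close> agreement follows from this locality; between \<open>s0\<close> and
  \<open>s0 + k\<close> both states are already given by the paths \<open>q\<close>,
  \<open>q'\<close> and by the value of the second component at \<open>s0 + k\<close>.\<close>

lemma separated_agree:
  assumes "separated l q s0 S" "separated l q' s0 S'"
    and "\<And>t. s0 \<le> t \<Longrightarrow> q t = q' t \<and> fst S t = fst S' t \<and> snd S t = snd S' t"
  shows "s0 \<le> t \<Longrightarrow> fst ((evolve l n ^^ k) S) t = fst ((evolve l n ^^ k) S') t \<and>
    snd ((evolve l n ^^ k) S) t = snd ((evolve l n ^^ k) S') t"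
proof -
  note D = separatedD(1)[OF separated_evolve_power[OF assms(1)]] separatedD(1)[OF separated_evolve_power[OF assms(2)]]
  have far: "fst ((evolve l n ^^ k) S) t = fst ((evolve l n ^^ k) S') t \<and>
    snd ((evolve l n ^^ k) S) t = snd ((evolve l n ^^ k) S') t" if "s0 + int k \<le> t" for t k
    using that
  proof (induction k arbitrary: t)
    case (Suc k)
    then show ?case
      using separated_evolve_eq[OF separated_evolve_power[OF assms(1), where k = k and n = n], where n = n and s = t]
        separated_evolve_eq[OF separated_evolve_power[OF assms(2), where k = k and n = n], where n = n and s = t]
      by simp
  qed (use assms in auto)
  show "fst ((evolve l n ^^ k) S) t = fst ((evolve l n ^^ k) S') t \<and>
    snd ((evolve l n ^^ k) S) t = snd ((evolve l n ^^ k) S') t" if "s0 \<le> t"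
  proof (cases "s0 + int k \<le> t")
    case False
    then show ?thesis
      using far[where k = k and t = "s0 + int k"] assms(3)[OF that] D[of t k n] by simp
  qed (use far in simp)
qed

section \<open>Every path becomes separated\<close>

text \<open>
  \<open>x t s\<close> is the state of site \<open>s\<close> at time \<open>t\<close> and \<open>e t s\<close> the spin-\<open>0\<close> content entering it.
  A spin-\<open>0\<close> particle entering a full (or empty) site is reflected; the reflected part leaves one
  time step later.
\<close>

locale columns =
  fixes l :: int and x e :: "nat \<Rightarrow> int \<Rightarrow> int"
  assumes l_pos: "1 \<le> l"
    and x_Suc: "\<And>t s. x (Suc t) s = clip l (x t s) + e t s"
    and e_Suc: "\<And>t s. e (Suc t) (s + 1) =
      - e t s + (x (Suc t) s - clip l (x (Suc t) s)) + (x t s - clip l (x t s))"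
begin

lemma clip_range: "0 \<le> clip l y" "clip l y \<le> l" using l_pos by (auto simp: clip_def)

lemma clip_id: "0 \<le> y \<Longrightarrow> y \<le> l \<Longrightarrow> clip l y = y" by (simp add: clip_def)

text \<open>\<open>clip\<close> is the nearest-point projection onto the interval, hence lies
  between \<open>y\<close> and every point \<open>c\<close> of it.\<close>

lemma clip_split: "0 \<le> c \<Longrightarrow> c \<le> l \<Longrightarrow> \<bar>clip l y - c\<bar> + \<bar>y - clip l y\<bar> = \<bar>y - c\<bar>"
  using l_pos by (auto simp: clip_def min_def max_def)

text \<open>Once the input of a site has stopped, the site is back in range after one step and its
  excess vanishes. Its output, the input of the next site, stops one step after that.\<close>

lemma eventually_no_input:
  assumes left: "\<And>s t. s \<le> sL \<Longrightarrow> e t s = 0"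
  shows "\<exists>T. \<forall>s\<le>s1. \<forall>t\<ge>T. e t s = 0"
proof (cases "s1 \<le> sL")
  case True then show ?thesis using left by auto
next
  case False
  then have "sL \<le> s1" by simp
  then show ?thesis
  proof (induction s1 rule: int_ge_induct)
    case base then show ?case using left by auto
  next
    case (step s1)
    then obtain T where T: "\<And>s t. s \<le> s1 \<Longrightarrow> T \<le> t \<Longrightarrow> e t s = 0" by blast
    have x: "x (Suc t) s1 - clip l (x (Suc t) s1) = 0" if "T \<le> t" for t
      using x_Suc[of t s1] T[of s1 t] that clip_range[of "x t s1"] clip_id by simp
    have "e t (s1 + 1) = 0" if "T + 2 \<le> t" for t
    proof -
      obtain u where u: "t = Suc (Suc u)" "T \<le> u" using \<open>T + 2 \<le> t\<close>
        by (metis Suc_diff_Suc Suc_le_mono add_2_eq_Suc' le_Suc_ex add_Suc add_Suc_right)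
      then show ?thesis using e_Suc[of "Suc u" s1] x[of u] x[of "Suc u"] T[of s1 "Suc u"] by simp
    qed
    then have "e t s = 0" if "s \<le> s1 + 1" "T + 2 \<le> t" for s t
      using T[of s t] that by (cases "s = s1 + 1") auto
    then show ?case by blast
  qed
qed

text \<open>An input splits without cancellation into the change \<open>g t\<close> of the clipped
  site and the new excess \<open>r (Suc t)\<close>, while the output one step later is
  \<open>r t - g t\<close>. Summed over time the excess terms are merely shifted by one step, and
  they start from zero.\<close>

lemma input_mass_decreases:
  assumes "e 0 (s + 1) = 0" "0 \<le> x 0 s" "x 0 s \<le> l"
  shows "(\<Sum>t<Suc T. \<bar>e t (s + 1)\<bar>) \<le> (\<Sum>t<T. \<bar>e t s\<bar>)"
proof -
  define g where "g t = clip l (x (Suc t) s) - clip l (x t s)" for t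
  define r where "r t = x t s - clip l (x t s)" for t
  have e: "e t s = g t + r (Suc t)" for t using x_Suc[of t s] by (simp add: g_def r_def)
  have abs_e: "\<bar>e t s\<bar> = \<bar>g t\<bar> + \<bar>r (Suc t)\<bar>" for t
    unfolding e using clip_split[OF clip_range, of "x (Suc t) s" "x t s"] by (simp add: g_def r_def)
  have "\<bar>e (Suc t) (s + 1)\<bar> \<le> \<bar>g t\<bar> + \<bar>r t\<bar>" for t
    using e_Suc[of t s] e[of t] by (simp add: r_def)
  then have "(\<Sum>t<T. \<bar>e (Suc t) (s + 1)\<bar>) \<le> (\<Sum>t<T. \<bar>g t\<bar> + \<bar>r t\<bar>)" by (rule sum_mono)
  moreover have "(\<Sum>t<T. \<bar>r t\<bar>) \<le> (\<Sum>t<T. \<bar>r (Suc t)\<bar>)"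
  proof -
    have "r 0 = 0" using assms clip_id by (simp add: r_def)
    then have "(\<Sum>t<T. \<bar>r t\<bar>) + \<bar>r T\<bar> = (\<Sum>t<T. \<bar>r (Suc t)\<bar>)"
      by (induction T) auto
    then show ?thesis by linarith
  qed
  moreover have "(\<Sum>t<Suc T. \<bar>e t (s + 1)\<bar>) = (\<Sum>t<T. \<bar>e (Suc t) (s + 1)\<bar>)"
    using assms(1) by (simp only: sum.lessThan_Suc_shift)
  ultimately show ?thesis by (simp add: abs_e sum.distrib)
qed

text \<open>The quantity that makes reflections stop: taken at the first reflection, it increases
  from site to site, but it never exceeds the total input.\<close>

definition variation :: "int \<Rightarrow> nat \<Rightarrow> int" where
  "variation s T = (\<Sum>t<T. \<bar>clip l (x (Suc t) s) - clip l (x t s)\<bar>)"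

lemma variation_mono: "T \<le> T' \<Longrightarrow> variation s T \<le> variation s T'"
  unfolding variation_def by (rule sum_mono2) auto

lemma variation_le: "variation s T \<le> (\<Sum>t<T. \<bar>e t s\<bar>)"
proof -
  have "\<bar>clip l (x (Suc t) s) - clip l (x t s)\<bar> \<le> \<bar>e t s\<bar>" for t
    using x_Suc[of t s] clip_split[OF clip_range, of "x (Suc t) s" "x t s"] by simp
  then show ?thesis unfolding variation_def by (rule sum_mono)
qed

definition reflecting :: "int \<Rightarrow> nat \<Rightarrow> bool" where
  "reflecting s T \<longleftrightarrow> \<not> (0 \<le> x T s \<and> x T s \<le> l) \<and> (\<forall>t<T. 0 \<le> x t s \<and> x t s \<le> l)"

text \<open>While site \<open>s\<close> stays in range, its input passes on with reversed sign, so
  the neighbour repeats its clipped history one step later, complemented. The condition at time zero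
  is that of a ground state tail.\<close>

lemma mirror:
  assumes init: "e 0 (s + 1) = 0" "0 \<le> x 0 (s + 1)" "x 0 (s + 1) \<le> l" "x 0 s + x 0 (s + 1) = l"
    and "\<And>t. t < T \<Longrightarrow> 0 \<le> x t s \<and> x t s \<le> l"
  shows "t \<le> T \<Longrightarrow> x (Suc t) (s + 1) = l - clip l (x t s)"
proof (induction t)
  case 0
  have "0 \<le> x 0 s" "x 0 s \<le> l" using init by auto
  then show ?case using init x_Suc[of 0 "s + 1"] clip_id by simp
next
  case (Suc t)
  then have t: "0 \<le> x t s \<and> x t s \<le> l" using assms(5) by simp
  have "x (Suc (Suc t)) (s + 1) = clip l (x (Suc t) (s + 1)) + e (Suc t) (s + 1)" by (rule x_Suc)
  also have "clip l (x (Suc t) (s + 1)) = l - clip l (x t s)"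
    using Suc clip_range[of "x t s"] clip_id[of "l - clip l (x t s)"] by simp
  finally show ?case using e_Suc[of t s] x_Suc[of t s] t clip_id[of "x t s"] by simp
qed

text \<open>Up to time \<open>T + 1\<close>, site \<open>s + 1\<close> mirrors \<open>s\<close>: it
  stays in range and has collected the same variation. At time \<open>T + 2\<close> it receives the
  excess that site \<open>s\<close> had at time \<open>T\<close>, which moves its clipped value by
  at least one further unit.\<close>

lemma reflecting_variation:
  assumes init: "e 0 (s + 1) = 0" "0 \<le> x 0 (s + 1)" "x 0 (s + 1) \<le> l" "x 0 s + x 0 (s + 1) = l"
    and T: "reflecting s T" and T': "reflecting (s + 1) T'"
  shows "variation (s + 1) T' \<ge> variation s T + 1"
proof -
  have t: "\<And>t. t < T \<Longrightarrow> 0 \<le> x t s \<and> x t s \<le> l" and viol: "\<not> (0 \<le> x T s \<and> x T s \<le> l)"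
    using T by (auto simp: reflecting_def)
  note m = mirror[OF init t]
  have ok: "0 \<le> x t (s + 1) \<and> x t (s + 1) \<le> l" if "t \<le> Suc T" for t
  proof (cases t)
    case (Suc u)
    then show ?thesis using m[of u] that clip_range[of "x u s"] by simp
  qed (use init in simp)
  have T'2: "Suc (Suc T) \<le> T'"
    using T' ok[of T'] unfolding reflecting_def by (metis not_less_eq_eq)
  have c0: "clip l (x 0 (s + 1)) = l - clip l (x 0 s)" using init clip_id[of "x 0 s"] clip_id[of "x 0 (s + 1)"] by simp
  have cS: "clip l (x (Suc t) (s + 1)) = l - clip l (x t s)" if "t \<le> T" for t
    using m[OF _ that] clip_range[of "x t s"] clip_id[of "l - clip l (x t s)"] by simp
  have "variation (s + 1) (Suc T) = (\<Sum>t<T. \<bar>clip l (x (Suc (Suc t)) (s + 1)) - clip l (x (Suc t) (s + 1))\<bar>)"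
    unfolding variation_def sum.lessThan_Suc_shift using c0 cS[of 0] by simp
  also have "\<dots> = variation s T"
    unfolding variation_def by (rule sum.cong) (auto simp: cS)
  finally have v: "variation (s + 1) (Suc T) = variation s T" .
  have "x (Suc (Suc T)) (s + 1) = l - clip l (x T s) + e (Suc T) (s + 1)"
    using x_Suc[of "Suc T" "s + 1"] cS[of T] by simp
  also have "\<dots> = l - clip l (x (Suc T) s) + (x T s - clip l (x T s))"
    using e_Suc[of T s] x_Suc[of T s] by simp
  finally have x2: "x (Suc (Suc T)) (s + 1) = l - clip l (x (Suc T) s) + (x T s - clip l (x T s))" .
  have "1 \<le> \<bar>clip l (x (Suc (Suc T)) (s + 1)) - clip l (x (Suc T) (s + 1))\<bar>"
  proof (cases "x T s < 0")
    case True
    then have "clip l (x T s) = 0" using l_pos by (simp add: clip_def)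
    then show ?thesis using x2 cS[of T] True clip_range[of "x (Suc T) s"] l_pos
      unfolding clip_def[of l "x (Suc (Suc T)) (s + 1)"] by (simp add: min_def max_def)
  next
    case False
    then have "x T s > l" using viol by simp
    then have "clip l (x T s) = l" using l_pos by (simp add: clip_def)
    then show ?thesis using x2 cS[of T] \<open>x T s > l\<close> clip_range[of "x (Suc T) s"] l_pos
      unfolding clip_def[of l "x (Suc (Suc T)) (s + 1)"] by (simp add: min_def max_def)
  qed
  then have "variation (s + 1) (Suc (Suc T)) \<ge> variation s T + 1"
    using v by (simp add: variation_def)
  then show ?thesis using variation_mono[OF T'2, of "s + 1"] by simp
qed

text \<open>If every site from \<open>s1\<close> on reflected, the variation would grow beyond the
  input mass of \<open>s1\<close>, which is finite because that input stops. One site that never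
  reflects suffices, since the sites to its right mirror it successively.\<close>

lemma eventually_not_reflecting:
  assumes left: "\<And>s t. s \<le> sL \<Longrightarrow> e t s = 0"
    and init: "\<And>s. s1 \<le> s \<Longrightarrow> e 0 s = 0 \<and> 0 \<le> x 0 s \<and> x 0 s \<le> l \<and> x 0 s + x 0 (s + 1) = l"
  shows "\<exists>s2\<ge>s1. \<forall>s\<ge>s2. \<forall>t. 0 \<le> x t s \<and> x t s \<le> l"
proof -
  have "\<exists>s2\<ge>s1. \<forall>t. 0 \<le> x t s2 \<and> x t s2 \<le> l"
  proof (rule ccontr)
    assume "\<not> ?thesis"
    then have "\<exists>t. \<not> (0 \<le> x t s \<and> x t s \<le> l)" if "s1 \<le> s" for s using that by blast
    then have ex: "\<exists>T. reflecting s T" if "s1 \<le> s" for s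
      using exists_least_iff[of "\<lambda>t. \<not> (0 \<le> x t s \<and> x t s \<le> l)"] that unfolding reflecting_def by blast
    have grow: "\<exists>T. reflecting (s1 + int i) T \<and> int i \<le> variation (s1 + int i) T" for i
    proof (induction i)
      case 0
      then show ?case using ex[of s1] by (auto simp: variation_def intro: sum_nonneg)
    next
      case (Suc i)
      then obtain T where T: "reflecting (s1 + int i) T" "int i \<le> variation (s1 + int i) T" by blast
      obtain T' where T': "reflecting (s1 + int i + 1) T'" using ex[of "s1 + int i + 1"] by auto
      have "variation (s1 + int i) T + 1 \<le> variation (s1 + int i + 1) T'"
        using reflecting_variation[OF _ _ _ _ T(1) T'] init[of "s1 + int i"] init[of "s1 + int i + 1"] by auto
      then show ?case using T T' by (intro exI[of _ T']) (simp add: add_ac)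
    qed
    \<comment> \<open>The time window grows by one step per site, because output is delayed by one
      step.\<close>
    have mass: "(\<Sum>t<T + i. \<bar>e t (s1 + int i)\<bar>) \<le> (\<Sum>t<T. \<bar>e t s1\<bar>)" for i T
    proof (induction i)
      case (Suc i)
      have "(\<Sum>t<Suc (T + i). \<bar>e t (s1 + int i + 1)\<bar>) \<le> (\<Sum>t<T + i. \<bar>e t (s1 + int i)\<bar>)"
        using input_mass_decreases[of "s1 + int i" "T + i"] init[of "s1 + int i"] init[of "s1 + int i + 1"] by simp
      then show ?case using Suc by (simp add: add_ac)
    qed simp
    obtain T0 where T0: "\<And>t. T0 \<le> t \<Longrightarrow> e t s1 = 0" using eventually_no_input[of sL s1] left by blast
    define N where "N = (\<Sum>t<T0. \<bar>e t s1\<bar>)"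
    have N: "(\<Sum>t<T. \<bar>e t s1\<bar>) \<le> N" for T
    proof (induction T)
      case (Suc T)
      show ?case
      proof (cases "T0 \<le> T")
        case False
        then have "Suc T \<le> T0" by simp
        then show ?thesis unfolding N_def by (intro sum_mono2) auto
      qed (use Suc T0 in simp)
    qed (simp add: N_def sum_nonneg)
    obtain T where T: "int (nat N + 1) \<le> variation (s1 + int (nat N + 1)) T" using grow by blast
    have "variation (s1 + int (nat N + 1)) T \<le> variation (s1 + int (nat N + 1)) (T + (nat N + 1))"
      by (rule variation_mono) simp
    also have "\<dots> \<le> (\<Sum>t<T + (nat N + 1). \<bar>e t (s1 + int (nat N + 1))\<bar>)" by (rule variation_le)
    also have "\<dots> \<le> (\<Sum>t<T. \<bar>e t s1\<bar>)" by (rule mass)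
    also have "\<dots> \<le> N" by (rule N)
    finally show False using T by linarith
  qed
  then obtain s2 where s2: "s1 \<le> s2" "\<And>t. 0 \<le> x t s2 \<and> x t s2 \<le> l" by blast
  have "\<forall>t. 0 \<le> x t s \<and> x t s \<le> l" if "s2 \<le> s" for s
    using that
  proof (induction s rule: int_ge_induct)
    case (step s)
    then have m: "x (Suc t) (s + 1) = l - clip l (x t s)" for t
      using mirror[of s t t] init[of s] init[of "s + 1"] s2 by auto
    have "0 \<le> x t (s + 1) \<and> x t (s + 1) \<le> l" for t
    proof (cases t)
      case (Suc u) then show ?thesis using m[of u] clip_range[of "x u s"] by simp
    qed (use init[of "s + 1"] s2 step in simp)
    then show ?case by blast
  qed (use s2 in auto)
  then show ?thesis using s2(1) by blast
qed

end

text \<open>Beyond some site \<open>s2\<close> nothing is ever reflected, and up to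
  \<open>s2\<close> all input eventually stops. Waiting for the latter leaves a state separated at
  \<open>s2\<close>.\<close>

lemma exists_separated:
  fixes S :: state
  assumes l: "1 \<le> l"
    and left: "\<And>s. s \<le> sL \<Longrightarrow> 0 \<le> fst S s \<and> fst S s \<le> l \<and> snd S s = b"
    and right: "\<And>s. sR \<le> s \<Longrightarrow> 0 \<le> fst S s \<and> fst S s \<le> l \<and> fst S s + fst S (s + 1) = l \<and> snd S s = b'"
  shows "\<exists>K q s0. separated l q s0 ((evolve l n ^^ K) S) \<and> (\<forall>s\<le>sL. q s = fst S s)"
proof -
  define x where "x t s = fst ((evolve l n ^^ t) S) s" for t s
  define B where "B t s = snd ((evolve l n ^^ t) S) s" for t s
  define e where "e t s = B t (s - 1) + (x t (s - 1) - clip l (x t (s - 1))) - B t s" for t s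
  have B_Suc: "B (Suc t) s = n - (B t (s - 1) + (x t (s - 1) - clip l (x t (s - 1))))" for t s
    by (simp add: x_def B_def evolve_simps)
  interpret columns l x e
  proof
    show "x (Suc t) s = clip l (x t s) + e t s" for t s
      by (simp add: x_def e_def B_def evolve_simps)
    show "e (Suc t) (s + 1) =
      - e t s + (x (Suc t) s - clip l (x (Suc t) s)) + (x t s - clip l (x t s))" for t s
      by (simp add: e_def B_Suc)
  qed (rule l)
  have L: "s \<le> sL \<Longrightarrow> x t s = fst S s \<and> B t s = B t sL" for s t
  proof (induction t arbitrary: s)
    case 0 then show ?case using left[of s] left[of sL] by (simp add: x_def B_def)
  next
    case (Suc t)
    have ex: "clip l (x t s') = x t s'" "B t s' = B t sL" if "s' \<le> sL" for s'
      using Suc.IH[OF that] left[OF that] clip_id[of "x t s'"] by simp_all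
    have "e t s = 0" using ex[of s] ex[of "s - 1"] Suc.prems by (simp add: e_def)
    then have "x (Suc t) s = fst S s"
      using x_Suc[of t s] ex[of s] Suc.IH[OF Suc.prems] Suc.prems by simp
    moreover have "B (Suc t) s = B (Suc t) sL"
      using ex[of "s - 1"] ex[of "sL - 1"] Suc.prems by (simp add: B_Suc)
    ultimately show ?case by simp
  qed
  have eL: "e t s = 0" if "s \<le> sL" for t s
  proof -
    have "clip l (x t (s - 1)) = x t (s - 1)" using L[of "s - 1" t] left[of "s - 1"] that clip_id by simp
    then show ?thesis using L[of s t] L[of "s - 1" t] that by (simp add: e_def)
  qed
  have init: "e 0 s = 0 \<and> 0 \<le> x 0 s \<and> x 0 s \<le> l \<and> x 0 s + x 0 (s + 1) = l" if "sR + 1 \<le> s" for s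
    using right[of s] right[of "s - 1"] that by (simp add: e_def x_def B_def clip_id)
  obtain s2 where s2: "sR + 1 \<le> s2" "\<And>s t. s2 \<le> s \<Longrightarrow> 0 \<le> x t s \<and> x t s \<le> l"
    using eventually_not_reflecting[OF eL init] by blast
  obtain T where T: "\<And>s t. s \<le> s2 \<Longrightarrow> T \<le> t \<Longrightarrow> e t s = 0" using eventually_no_input[of sL s2] eL by blast
  define K where "K = Suc T"
  have xK: "0 \<le> x K s \<and> x K s \<le> l" if "s \<le> s2" for s
    using x_Suc[of T s] T[of s T] that clip_range[of "x T s"] by (simp add: K_def)
  \<comment> \<open>Beyond \<open>s2\<close> the path is continued as a ground state; the actual
    sites there still carry the spin-0 content.\<close>
  define q where "q s = (if s \<le> s2 then x K s else if even (s - s2) then x K s2 else l - x K s2)" for s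
  have BK: "B K (s - 1) = B K s" if "s \<le> s2" for s
    using T[of s K] xK[of "s - 1"] that clip_id[of "x K (s - 1)"] by (simp add: e_def K_def)
  have BK2: "B K s = B K s2" if "s \<le> s2" for s
    using that by (induction s rule: int_le_induct) (auto simp: BK)
  have "x K s + B K s - B K (s + 1) + x K (s + 1) = l" if "s2 \<le> s" for s
  proof -
    have m: "x (Suc K) (s + 1) = l - x K s"
      using mirror[of s K K] init[of s] init[of "s + 1"] s2(1) s2(2)[OF that] that clip_id[of "x K s"] by auto
    moreover have "x (Suc K) (s + 1) = x K (s + 1) + (B K s - B K (s + 1))"
      using x_Suc[of K "s + 1"] s2(2)[of s K] s2(2)[of "s + 1" K] that clip_id by (simp add: e_def)
    ultimately show ?thesis by simp
  qed
  moreover have "0 \<le> q s \<and> q s \<le> l" for s using xK[of s] xK[of s2] by (simp add: q_def)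
  moreover have "q s + q (s + 1) = l" if "s2 \<le> s" for s
    using that by (cases "s = s2") (auto simp: q_def)
  moreover have "x K s = q s \<and> B K s = B K s2" if "s \<le> s2" for s
    using that BK2[OF that] by (simp add: q_def)
  ultimately have "separated l q s2 ((evolve l n ^^ K) S)"
    using s2(2) unfolding separated_def x_def[symmetric] B_def[symmetric] by blast
  moreover have "\<forall>s\<le>sL. q s = fst S s"
  proof (intro allI impI)
    fix s assume s: "s \<le> sL"
    show "q s = fst S s"
    proof (cases "s \<le> s2")
      case True then show ?thesis using L[OF s, of K] by (simp add: q_def)
    next
      case False
      \<comment> \<open>The case in which the unchanged left part reaches beyond \<open>s2\<close>:
        there it alternates already and agrees with the continuation.\<close>
      have ground: "x K s' = q s'" if "s2 \<le> s'" "s' \<le> sL" for s'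
        using that
      proof (induction s' rule: int_ge_induct)
        case (step u)
        have "fst S u + fst S (u + 1) = l" using right[of u] step s2(1) by simp
        then show ?case using L[of u K] L[of "u + 1" K] step \<open>\<And>s. s2 \<le> s \<Longrightarrow> q s + q (s + 1) = l\<close>[of u] by simp
      qed (simp add: q_def)
      then show ?thesis using False s L[OF s, of K] by simp
    qed
  qed
  ultimately show ?thesis by blast
qed

text \<open>\<open>evolve_f\<close> leaves open whether an operator that is zero on a state may
  become nonzero after evolution. It cannot, since the lower of the two bottoms of each site is
  preserved.\<close>

lemma evolve_f_back:
  assumes l: "0 \<le> l" and f: "state_f l (evolve l n S) T"
  shows "\<exists>S'. state_f l S S'"
proof -
  obtain X B where S: "S = (X, B)" by (cases S)
  obtain U where U: "state_heights l S U" using exists_state_heights by blast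
  define U' where "U' = (\<lambda>s. U (s - 1) - clip l (fst S (s - 1)) + l - fst S (s - 1))"
  have U': "state_heights l (evolve l n S) U'"
    using evolve_heights(1)[OF U] by (simp add: U'_def)
  define V' where "V' = (\<lambda>t. U' t - fst (evolve l n S) t)"
  define V where "V = (\<lambda>t. U t - X t)"
  have V': "V' t = U t - clip l (X t)" for t
    using evolve_heights(2)[OF U, where n = n and s = t] by (simp add: V'_def U'_def S)
  have U'': "U' (t + 1) = U t - clip l (X t) + l - X t" for t by (simp add: U'_def S)
  have pair: "min (V' t) (U' (t + 1)) = min (U t) (V t)" for t
    unfolding V' U'' V_def using l by (auto simp: clip_def min_def max_def)
  have fI: "\<exists>S'. state_f l S S'" if "f_even U V s \<or> f_odd U V s" for s
    unfolding state_f_iff[OF U] using that by (auto simp: V_def S)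
  have main: "f_even U V s \<or> f_odd U V s"
    if "\<And>t. min (U s) (V s) \<le> min (U t) (V t)" "\<And>t. s < t \<Longrightarrow> min (U s) (V s) < min (U t) (V t)" for s
  proof (cases "V s \<le> U s")
    case True
    have "f_even U V s" unfolding f_even_def
    proof
      fix t show "V s \<le> U t \<and> V s \<le> V t \<and> (s < t \<longrightarrow> V s < U t \<and> V s < V t)"
        using that(1)[of t] that(2)[of t] True by auto
    qed
    then show ?thesis ..
  next
    case False
    have "f_odd U V s" unfolding f_odd_def
    proof
      fix t show "U s \<le> U t \<and> U s \<le> V t \<and> (s < t \<longrightarrow> U s < U t) \<and> (s \<le> t \<longrightarrow> U s < V t)"
        using that(1)[of t] that(2)[of t] False by (cases "s = t") auto
    qed
    then show ?thesis ..
  qed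
  from f obtain s where "f_even U' V' s \<or> f_odd U' V' s"
    unfolding state_f_iff[OF U'] V'_def by blast
  then show ?thesis
  proof
    assume "f_even U' V' s"
    then have h: "V' s \<le> U' t \<and> V' s \<le> V' t \<and> (s < t \<longrightarrow> V' s < U' t \<and> V' s < V' t)" for t
      by (simp add: f_even_def)
    have m: "min (U s) (V s) = V' s" using h[of "s + 1"] pair[of s] by auto
    have "f_even U V s \<or> f_odd U V s"
    proof (rule main)
      show "min (U s) (V s) \<le> min (U t) (V t)" for t
        unfolding m pair[symmetric, of t] using h[of t] h[of "t + 1"] by auto
      show "min (U s) (V s) < min (U t) (V t)" if "s < t" for t
        unfolding m pair[symmetric, of t] using h[of t] h[of "t + 1"] that by auto
    qed
    then show ?thesis using fI by blast
  next
    assume "f_odd U' V' s"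
    then have h: "U' s \<le> U' t \<and> U' s \<le> V' t \<and> (s < t \<longrightarrow> U' s < U' t) \<and> (s \<le> t \<longrightarrow> U' s < V' t)" for t
      by (simp add: f_odd_def)
    have m: "min (U (s - 1)) (V (s - 1)) = U' s" using h[of "s - 1"] pair[of "s - 1"] by auto
    have "f_even U V (s - 1) \<or> f_odd U V (s - 1)"
    proof (rule main)
      show "min (U (s - 1)) (V (s - 1)) \<le> min (U t) (V t)" for t
        unfolding m pair[symmetric, of t] using h[of t] h[of "t + 1"] by auto
      show "min (U (s - 1)) (V (s - 1)) < min (U t) (V t)" if "s - 1 < t" for t
        unfolding m pair[symmetric, of t] using h[of t] h[of "t + 1"] that by auto
    qed
    then show ?thesis using fI by blast
  qed
qed

lemma evolve_e_back:
  assumes l: "0 \<le> l" and f: "state_e l (evolve l n S) T"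
  shows "\<exists>S'. state_e l S S'"
proof -
  obtain X B where S: "S = (X, B)" by (cases S)
  obtain U where U: "state_heights l S U" using exists_state_heights by blast
  define U' where "U' = (\<lambda>s. U (s - 1) - clip l (fst S (s - 1)) + l - fst S (s - 1))"
  have U': "state_heights l (evolve l n S) U'"
    using evolve_heights(1)[OF U] by (simp add: U'_def)
  define V' where "V' = (\<lambda>t. U' t - fst (evolve l n S) t)"
  define V where "V = (\<lambda>t. U t - X t)"
  have V': "V' t = U t - clip l (X t)" for t
    using evolve_heights(2)[OF U, where n = n and s = t] by (simp add: V'_def U'_def S)
  have U'': "U' (t + 1) = U t - clip l (X t) + l - X t" for t by (simp add: U'_def S)
  have pair: "min (V' t) (U' (t + 1)) = min (U t) (V t)" for t
    unfolding V' U'' V_def using l by (auto simp: clip_def min_def max_def)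
  have fI: "\<exists>S'. state_e l S S'" if "e_even U V s \<or> e_odd U V s" for s
    unfolding state_e_iff[OF U] using that by (auto simp: V_def S)
  have main: "e_even U V s \<or> e_odd U V s"
    if "\<And>t. min (U s) (V s) \<le> min (U t) (V t)" "\<And>t. t < s \<Longrightarrow> min (U s) (V s) < min (U t) (V t)" for s
  proof (cases "U s \<le> V s")
    case True
    have "e_odd U V s" unfolding e_odd_def
    proof
      fix t show "U s \<le> U t \<and> U s \<le> V t \<and> (t < s \<longrightarrow> U s < U t \<and> U s < V t)"
        using that(1)[of t] that(2)[of t] True by auto
    qed
    then show ?thesis ..
  next
    case False
    have "e_even U V s" unfolding e_even_def
    proof
      fix t show "V s \<le> U t \<and> V s \<le> V t \<and> (t < s \<longrightarrow> V s < V t) \<and> (t \<le> s \<longrightarrow> V s < U t)"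
        using that(1)[of t] that(2)[of t] False by (cases "s = t") auto
    qed
    then show ?thesis ..
  qed
  from f obtain s where "e_even U' V' s \<or> e_odd U' V' s"
    unfolding state_e_iff[OF U'] V'_def by blast
  then show ?thesis
  proof
    assume "e_even U' V' s"
    then have h: "V' s \<le> U' t \<and> V' s \<le> V' t \<and> (t < s \<longrightarrow> V' s < V' t) \<and> (t \<le> s \<longrightarrow> V' s < U' t)" for t
      by (simp add: e_even_def)
    have m: "min (U s) (V s) = V' s" using h[of "s + 1"] pair[of s] by auto
    have "e_even U V s \<or> e_odd U V s"
    proof (rule main)
      show "min (U s) (V s) \<le> min (U t) (V t)" for t
        unfolding m pair[symmetric, of t] using h[of t] h[of "t + 1"] by auto
      show "min (U s) (V s) < min (U t) (V t)" if "t < s" for t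
        unfolding m pair[symmetric, of t] using h[of t] h[of "t + 1"] that by auto
    qed
    then show ?thesis using fI by blast
  next
    assume "e_odd U' V' s"
    then have h: "U' s \<le> U' t \<and> U' s \<le> V' t \<and> (t < s \<longrightarrow> U' s < U' t \<and> U' s < V' t)" for t
      by (simp add: e_odd_def)
    have m: "min (U (s - 1)) (V (s - 1)) = U' s" using h[of "s - 1"] pair[of "s - 1"] by auto
    have "e_even U V (s - 1) \<or> e_odd U V (s - 1)"
    proof (rule main)
      show "min (U (s - 1)) (V (s - 1)) \<le> min (U t) (V t)" for t
        unfolding m pair[symmetric, of t] using h[of t] h[of "t + 1"] by auto
      show "min (U (s - 1)) (V (s - 1)) < min (U t) (V t)" if "t < s - 1" for t
        unfolding m pair[symmetric, of t] using h[of t] h[of "t + 1"] that by auto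
    qed
    then show ?thesis using fI by blast
  qed
qed

lemma evolve_power_f_back:
  "0 \<le> l \<Longrightarrow> state_f l ((evolve l n ^^ k) S) T \<Longrightarrow> \<exists>S'. state_f l S S'"
  by (induction k arbitrary: T) (auto dest: evolve_f_back)

lemma evolve_power_e_back:
  "0 \<le> l \<Longrightarrow> state_e l ((evolve l n ^^ k) S) T \<Longrightarrow> \<exists>S'. state_e l S S'"
  by (induction k arbitrary: T) (auto dest: evolve_e_back)

section \<open>Paths as states\<close>

text \<open>A site groups an odd block with the even block read after it. On a ground path with
  domain \<open>(a, b)\<close> the second component is \<open>b\<close>, and the first alternates
  between \<open>a\<close> and \<open>m - n - a\<close>.\<close>

definition state_of :: "int \<Rightarrow> (int \<Rightarrow> int) \<Rightarrow> state" where
  "state_of n p = ((\<lambda>s. p (2 - 2 * s) - n + p (3 - 2 * s)), (\<lambda>s. n - p (3 - 2 * s)))"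

definition path_of_state :: "int \<Rightarrow> state \<Rightarrow> int \<Rightarrow> int" where
  "path_of_state n S k = (if odd k then n - snd S ((3 - k) div 2)
     else fst S ((2 - k) div 2) + snd S ((2 - k) div 2))"

lemma state_of_path_of_state: "state_of n (path_of_state n S) = S"
  by (rule state_eqI) (simp_all add: state_of_def path_of_state_def)

lemma path_of_state_of: "path_of_state n (state_of n p) = p"
proof
  fix k show "path_of_state n (state_of n p) k = p k"
  proof (cases "odd k")
    case True
    then have "3 - 2 * ((3 - k) div 2) = k" by presburger
    then show ?thesis using True by (simp add: path_of_state_def state_of_def)
  next
    case False
    then have "2 - 2 * ((2 - k) div 2) = k" by presburger
    then show ?thesis using False by (simp add: path_of_state_def state_of_def)
  qed
qed

lemma state_of_inj: "state_of n p = state_of n p' \<Longrightarrow> p = p'"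
  by (metis path_of_state_of)

lemma state_of_update:
  "state_of n (p(2 - 2 * s := v)) = ((fst (state_of n p))(s := v - n + p (3 - 2 * s)), snd (state_of n p))"
  "state_of n (p(3 - 2 * s := v)) =
     ((fst (state_of n p))(s := p (2 - 2 * s) - n + v), (snd (state_of n p))(s := n - v))"
proof -
  have 1: "3 - 2 * t \<noteq> 2 - 2 * s" "2 - 2 * t \<noteq> 3 - 2 * s" for t :: int by presburger+
  show "state_of n (p(2 - 2 * s := v)) = ((fst (state_of n p))(s := v - n + p (3 - 2 * s)), snd (state_of n p))"
    "state_of n (p(3 - 2 * s := v)) =
     ((fst (state_of n p))(s := p (2 - 2 * s) - n + v), (snd (state_of n p))(s := n - v))"
    using 1 by (auto simp: state_of_def fun_eq_iff)
qed

lemma path_position_cases: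
  obtains s :: int where "k = 2 - 2 * s" | s where "k = 3 - 2 * s"
proof (cases "even k")
  case True
  then have "k = 2 - 2 * ((2 - k) div 2)" by presburger
  then show ?thesis using that by blast
next
  case False
  then have "k = 3 - 2 * ((3 - k) div 2)" by presburger
  then show ?thesis using that by blast
qed

lemma position_less:
  "2 - 2 * s < 2 - 2 * t \<longleftrightarrow> t < s" "3 - 2 * s < 3 - 2 * t \<longleftrightarrow> t < s"
  "3 - 2 * s < 2 - 2 * t \<longleftrightarrow> t < s" "2 - 2 * s < 3 - 2 * t \<longleftrightarrow> t \<le> s" for s t :: int
  by presburger+

locale bounded_path =
  fixes m n :: int and p U :: "int \<Rightarrow> int" and c :: int
  assumes n_pos: "0 < n" and m_pos: "0 < m"
    and range: "\<And>k. 0 \<le> p k \<and> p k \<le> block_length m n k"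
    and U: "state_heights (m - n) (state_of n p) U"
    and bounded: "\<And>s. c \<le> U s \<and> c \<le> U s - fst (state_of n p) s"
begin

definition V where "V s = U s - fst (state_of n p) s"

definition \<mu> where "\<mu> k = (if odd k then U ((3 - k) div 2) else V ((2 - k) div 2))"

lemma \<mu>_simps: "\<mu> (3 - 2 * s) = U s" "\<mu> (2 - 2 * s) = V s"
  by (simp_all add: \<mu>_def)

lemma \<mu>_bounded: "c \<le> \<mu> k" using bounded by (simp add: \<mu>_def V_def)

sublocale path_heights m n p \<mu> c
proof
  show "0 < n" "0 < m" by (rule n_pos m_pos)+
  show "0 \<le> p k \<and> p k \<le> block_length m n k" for k by (rule range)
  show "c \<le> \<mu> k" for k using bounded by (simp add: \<mu>_def V_def)
  show "\<mu> (k - 1) = \<mu> k + (block_length m n k - p k) - p (k - 1)" for k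
  proof (cases rule: path_position_cases[of k])
    case (1 s)
    have "\<mu> (k - 1) = U (s + 1)" using \<mu>_simps(1)[of "s + 1"] 1 by simp
    then show ?thesis using U[unfolded state_heights_def, rule_format, of s] \<mu>_simps(2)[of s] 1
      by (simp add: V_def state_of_def block_length_def)
  next
    case (2 s)
    have "\<mu> (k - 1) = V s" using \<mu>_simps(2)[of s] 2 by simp
    moreover have "odd k" using 2 by simp
    ultimately show ?thesis using \<mu>_simps(1)[of s] 2
      by (simp add: V_def state_of_def block_length_def)
  qed
qed

lemma \<mu>_all: "(\<forall>k. P k (\<mu> k)) \<longleftrightarrow> (\<forall>s. P (2 - 2 * s) (V s) \<and> P (3 - 2 * s) (U s))"
  by (metis \<mu>_simps path_position_cases)

lemma path_f_1_state: "path_f m n 1 p = Some p' \<longleftrightarrow> state_f (m - n) (state_of n p) (state_of n p')"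
proof -
  have e: "(\<forall>k'. \<mu> k \<le> \<mu> k' \<and> (k' < k \<longrightarrow> \<mu> k < \<mu> k')) \<longleftrightarrow> f_even U V s" if "k = 2 - 2 * s" for k s
    using \<mu>_all[of "\<lambda>k' x. \<mu> k \<le> x \<and> (k' < k \<longrightarrow> \<mu> k < x)"]
    unfolding that \<mu>_simps f_even_def position_less by blast
  have o: "(\<forall>k'. \<mu> k \<le> \<mu> k' \<and> (k' < k \<longrightarrow> \<mu> k < \<mu> k')) \<longleftrightarrow> f_odd U V s" if "k = 3 - 2 * s" for k s
    using \<mu>_all[of "\<lambda>k' x. \<mu> k \<le> x \<and> (k' < k \<longrightarrow> \<mu> k < x)"]
    unfolding that \<mu>_simps f_odd_def position_less by blast
  have Ve: "(\<lambda>t. U t - fst (state_of n p) t) = V" by (simp add: V_def fun_eq_iff)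
  show ?thesis
    unfolding path_f_1_iff state_f_iff[OF U] Ve
  proof
    assume "\<exists>k. (\<forall>k'. \<mu> k \<le> \<mu> k' \<and> (k' < k \<longrightarrow> \<mu> k < \<mu> k')) \<and> p' = p(k := p k + 1)"
    then obtain k where k: "\<forall>k'. \<mu> k \<le> \<mu> k' \<and> (k' < k \<longrightarrow> \<mu> k < \<mu> k')" "p' = p(k := p k + 1)" by blast
    show "\<exists>s. f_even U V s \<and> state_of n p' = ((fst (state_of n p))(s := fst (state_of n p) s + 1), snd (state_of n p)) \<or>
      f_odd U V s \<and> state_of n p' = ((fst (state_of n p))(s := fst (state_of n p) s + 1),
         (snd (state_of n p))(s := snd (state_of n p) s - 1))"
    proof (cases rule: path_position_cases[of k])
      case (1 s)
      then show ?thesis using k e[OF 1]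
        by (intro exI[of _ s] disjI1) (simp add: state_of_update, simp add: state_of_def algebra_simps)
    next
      case (2 s)
      then show ?thesis using k o[OF 2]
        by (intro exI[of _ s] disjI2) (simp add: state_of_update, simp add: state_of_def algebra_simps)
    qed
  next
    assume "\<exists>s. f_even U V s \<and> state_of n p' = ((fst (state_of n p))(s := fst (state_of n p) s + 1), snd (state_of n p)) \<or>
      f_odd U V s \<and> state_of n p' = ((fst (state_of n p))(s := fst (state_of n p) s + 1),
         (snd (state_of n p))(s := snd (state_of n p) s - 1))"
    then obtain s where "f_even U V s \<and> state_of n p' = ((fst (state_of n p))(s := fst (state_of n p) s + 1), snd (state_of n p)) \<or>
      f_odd U V s \<and> state_of n p' = ((fst (state_of n p))(s := fst (state_of n p) s + 1),
         (snd (state_of n p))(s := snd (state_of n p) s - 1))" by blast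
    then show "\<exists>k. (\<forall>k'. \<mu> k \<le> \<mu> k' \<and> (k' < k \<longrightarrow> \<mu> k < \<mu> k')) \<and> p' = p(k := p k + 1)"
    proof
      assume a: "f_even U V s \<and> state_of n p' = ((fst (state_of n p))(s := fst (state_of n p) s + 1), snd (state_of n p))"
      have "state_of n p' = state_of n (p(2 - 2 * s := p (2 - 2 * s) + 1))"
        using a by (simp add: state_of_update, simp add: state_of_def algebra_simps)
      then show ?thesis using state_of_inj a e[OF refl] by blast
    next
      assume a: "f_odd U V s \<and> state_of n p' = ((fst (state_of n p))(s := fst (state_of n p) s + 1),
         (snd (state_of n p))(s := snd (state_of n p) s - 1))"
      have "state_of n p' = state_of n (p(3 - 2 * s := p (3 - 2 * s) + 1))"
        using a by (simp add: state_of_update, simp add: state_of_def algebra_simps)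
      then show ?thesis using state_of_inj a o[OF refl] by blast
    qed
  qed
qed

lemma path_e_1_state: "path_e m n 1 p = Some p' \<longleftrightarrow> state_e (m - n) (state_of n p) (state_of n p')"
proof -
  have e: "(\<forall>k'. \<mu> k \<le> \<mu> k' \<and> (k < k' \<longrightarrow> \<mu> k < \<mu> k')) \<longleftrightarrow> e_even U V s" if "k = 2 - 2 * s" for k s
    using \<mu>_all[of "\<lambda>k' x. \<mu> k \<le> x \<and> (k < k' \<longrightarrow> \<mu> k < x)"]
    unfolding that \<mu>_simps e_even_def position_less by blast
  have o: "(\<forall>k'. \<mu> k \<le> \<mu> k' \<and> (k < k' \<longrightarrow> \<mu> k < \<mu> k')) \<longleftrightarrow> e_odd U V s" if "k = 3 - 2 * s" for k s
    using \<mu>_all[of "\<lambda>k' x. \<mu> k \<le> x \<and> (k < k' \<longrightarrow> \<mu> k < x)"]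
    unfolding that \<mu>_simps e_odd_def position_less by blast
  have Ve: "(\<lambda>t. U t - fst (state_of n p) t) = V" by (simp add: V_def fun_eq_iff)
  show ?thesis
    unfolding path_e_1_iff state_e_iff[OF U] Ve
  proof
    assume "\<exists>k. (\<forall>k'. \<mu> k \<le> \<mu> k' \<and> (k < k' \<longrightarrow> \<mu> k < \<mu> k')) \<and> p' = p(k := p k - 1)"
    then obtain k where k: "\<forall>k'. \<mu> k \<le> \<mu> k' \<and> (k < k' \<longrightarrow> \<mu> k < \<mu> k')" "p' = p(k := p k - 1)" by blast
    show "\<exists>s. e_even U V s \<and> state_of n p' = ((fst (state_of n p))(s := fst (state_of n p) s - 1), snd (state_of n p)) \<or>
      e_odd U V s \<and> state_of n p' = ((fst (state_of n p))(s := fst (state_of n p) s - 1),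
         (snd (state_of n p))(s := snd (state_of n p) s + 1))"
    proof (cases rule: path_position_cases[of k])
      case (1 s)
      then show ?thesis using k e[OF 1]
        by (intro exI[of _ s] disjI1) (simp add: state_of_update, simp add: state_of_def algebra_simps)
    next
      case (2 s)
      then show ?thesis using k o[OF 2]
        by (intro exI[of _ s] disjI2) (simp add: state_of_update, simp add: state_of_def algebra_simps)
    qed
  next
    assume "\<exists>s. e_even U V s \<and> state_of n p' = ((fst (state_of n p))(s := fst (state_of n p) s - 1), snd (state_of n p)) \<or>
      e_odd U V s \<and> state_of n p' = ((fst (state_of n p))(s := fst (state_of n p) s - 1),
         (snd (state_of n p))(s := snd (state_of n p) s + 1))"
    then obtain s where "e_even U V s \<and> state_of n p' = ((fst (state_of n p))(s := fst (state_of n p) s - 1), snd (state_of n p)) \<or>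
      e_odd U V s \<and> state_of n p' = ((fst (state_of n p))(s := fst (state_of n p) s - 1),
         (snd (state_of n p))(s := snd (state_of n p) s + 1))" by blast
    then show "\<exists>k. (\<forall>k'. \<mu> k \<le> \<mu> k' \<and> (k < k' \<longrightarrow> \<mu> k < \<mu> k')) \<and> p' = p(k := p k - 1)"
    proof
      assume a: "e_even U V s \<and> state_of n p' = ((fst (state_of n p))(s := fst (state_of n p) s - 1), snd (state_of n p))"
      have "state_of n p' = state_of n (p(2 - 2 * s := p (2 - 2 * s) - 1))"
        using a by (simp add: state_of_update, simp add: state_of_def algebra_simps)
      then show ?thesis using state_of_inj a e[OF refl] by blast
    next
      assume a: "e_odd U V s \<and> state_of n p' = ((fst (state_of n p))(s := fst (state_of n p) s - 1),
         (snd (state_of n p))(s := snd (state_of n p) s + 1))"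
      have "state_of n p' = state_of n (p(3 - 2 * s := p (3 - 2 * s) - 1))"
        using a by (simp add: state_of_update, simp add: state_of_def algebra_simps)
      then show ?thesis using state_of_inj a o[OF refl] by blast
    qed
  qed
qed

lemma path_f_1_inverse:
  assumes "path_f m n 1 p = Some p'"
  shows "(\<forall>k. 0 \<le> p' k \<and> p' k \<le> block_length m n k) \<and> path_e m n 1 p' = Some p"
proof -
  obtain k where k: "\<forall>k'. \<mu> k \<le> \<mu> k' \<and> (k' < k \<longrightarrow> \<mu> k < \<mu> k')" "p' = p(k := p k + 1)"
    using assms unfolding path_f_1_iff by blast
  have "\<mu> k < \<mu> (k - 1)" using k(1) by simp
  then have pk: "p k < block_length m n k" using heights[of k] range[of "k - 1"] by linarith
  have r: "0 \<le> p' j \<and> p' j \<le> block_length m n j" for j using pk range[of j] range[of k] k(2) by auto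
  \<comment> \<open>Turning the first \<open>0\<close> of block \<open>k\<close> into a
    \<open>1\<close> moves the bottom of block \<open>k\<close> down by one and lowers everything
    read later, i.e. the blocks of smaller index, by two.\<close>
  define \<mu>' where "\<mu>' j = (if k < j then \<mu> j else if j = k then \<mu> k - 1 else \<mu> j - 2)" for j
  interpret p': path_heights m n p' \<mu>' "c - 2"
  proof
    show "\<mu>' (j - 1) = \<mu>' j + (block_length m n j - p' j) - p' (j - 1)" for j
    proof -
      have "j < k \<or> j = k \<or> j = k + 1 \<or> j > k + 1" by linarith
      then show ?thesis using heights[of j] k(2) by (auto simp: \<mu>'_def)
    qed
    show "c - 2 \<le> \<mu>' j" for j using \<mu>_bounded[of j] \<mu>_bounded[of k] by (simp add: \<mu>'_def)
  qed (use n_pos m_pos r in auto)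
  have "\<mu>' k \<le> \<mu>' j \<and> (k < j \<longrightarrow> \<mu>' k < \<mu>' j)" for j
    using k(1)[rule_format, of j] by (auto simp: \<mu>'_def)
  then have "path_e m n 1 p' = Some (p'(k := p' k - 1))" using p'.path_e_1_iff by blast
  moreover have "p'(k := p' k - 1) = p" using k(2) by auto
  ultimately show ?thesis using r by simp
qed

lemma path_e_1_inverse:
  assumes "path_e m n 1 p = Some p'"
  shows "(\<forall>k. 0 \<le> p' k \<and> p' k \<le> block_length m n k) \<and> path_f m n 1 p' = Some p"
proof -
  obtain k where k: "\<forall>k'. \<mu> k \<le> \<mu> k' \<and> (k < k' \<longrightarrow> \<mu> k < \<mu> k')" "p' = p(k := p k - 1)"
    using assms unfolding path_e_1_iff by blast
  have "\<mu> k < \<mu> (k + 1)" using k(1) by simp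
  then have pk: "0 < p k" using heights[of "k + 1"] range[of "k + 1"] by simp
  have r: "0 \<le> p' j \<and> p' j \<le> block_length m n j" for j using pk range[of j] range[of k] k(2) by auto
  define \<mu>' where "\<mu>' j = (if k < j then \<mu> j else if j = k then \<mu> k + 1 else \<mu> j + 2)" for j
  interpret p': path_heights m n p' \<mu>' c
  proof
    show "\<mu>' (j - 1) = \<mu>' j + (block_length m n j - p' j) - p' (j - 1)" for j
    proof -
      have "j < k \<or> j = k \<or> j = k + 1 \<or> j > k + 1" by linarith
      then show ?thesis using heights[of j] k(2) by (auto simp: \<mu>'_def)
    qed
    show "c \<le> \<mu>' j" for j using \<mu>_bounded[of j] \<mu>_bounded[of k] by (simp add: \<mu>'_def)
  qed (use n_pos m_pos r in auto)
  have "\<mu>' k \<le> \<mu>' j \<and> (j < k \<longrightarrow> \<mu>' k < \<mu>' j)" for j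
    using k(1)[rule_format, of j] by (auto simp: \<mu>'_def)
  then have "path_f m n 1 p' = Some (p'(k := p' k + 1))" using p'.path_f_1_iff by blast
  moreover have "p'(k := p' k + 1) = p" using k(2) by auto
  ultimately show ?thesis using r by simp
qed

end

text \<open>A ground state of level \<open>l\<close> alternates between \<open>a\<close> and
  \<open>l - a\<close>; this involution turns it into a constant and back.\<close>

definition alternating :: "int \<Rightarrow> (int \<Rightarrow> int) \<Rightarrow> int \<Rightarrow> int" where
  "alternating l A s = (if even s then l - A s else A s)"

lemma alternating_alternating [simp]: "alternating l (alternating l A) = A"
  by (auto simp: alternating_def)

lemma alternating_const_step: "alternating l (\<lambda>_. a) (s + 1) = l - alternating l (\<lambda>_. a) s"
  by (simp add: alternating_def)

lemma ground_path_state: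
  "ground_path m n (a, b) (3 - 2 * s) = n - b"
  "ground_path m n (a, b) (2 - 2 * s) = alternating (m - n) (\<lambda>_. a) s + b"
proof -
  show "ground_path m n (a, b) (3 - 2 * s) = n - b" by (simp add: ground_path_def)
  have "(2 - 2 * s) mod 4 = 0 \<longleftrightarrow> odd s" by presburger
  then show "ground_path m n (a, b) (2 - 2 * s) = alternating (m - n) (\<lambda>_. a) s + b"
    by (simp add: ground_path_def alternating_def)
qed

lemma mem_paths_iff:
  "p \<in> paths m n (a, b) (a', b') \<longleftrightarrow>
     (\<forall>k. 0 \<le> p k \<and> p k \<le> block_length m n k) \<and>
     (\<exists>sL. \<forall>s\<le>sL. fst (state_of n p) s = alternating (m - n) (\<lambda>_. a) s \<and> snd (state_of n p) s = b) \<and>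
     (\<exists>sR. \<forall>s\<ge>sR. fst (state_of n p) s = alternating (m - n) (\<lambda>_. a') s \<and> snd (state_of n p) s = b')"
proof -
  have st: "fst (state_of n p) s = alternating (m - n) (\<lambda>_. a) s \<and> snd (state_of n p) s = b \<longleftrightarrow>
      p (3 - 2 * s) = ground_path m n (a, b) (3 - 2 * s) \<and> p (2 - 2 * s) = ground_path m n (a, b) (2 - 2 * s)"
    for a b s unfolding ground_path_state by (auto simp: state_of_def)
  have 1: "(\<forall>\<^sub>F k in at_top. p k = ground_path m n (a, b) k) \<longleftrightarrow>
    (\<exists>sL. \<forall>s\<le>sL. fst (state_of n p) s = alternating (m - n) (\<lambda>_. a) s \<and> snd (state_of n p) s = b)"
    unfolding st eventually_at_top_linorder
  proof
    assume "\<exists>K. \<forall>k\<ge>K. p k = ground_path m n (a, b) k"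
    then obtain K where K: "\<And>k. K \<le> k \<Longrightarrow> p k = ground_path m n (a, b) k" by blast
    have "p (3 - 2 * s) = ground_path m n (a, b) (3 - 2 * s) \<and> p (2 - 2 * s) = ground_path m n (a, b) (2 - 2 * s)"
      if "s \<le> - \<bar>K\<bar>" for s using that by (intro conjI K) linarith+
    then show "\<exists>sL. \<forall>s\<le>sL. p (3 - 2 * s) = ground_path m n (a, b) (3 - 2 * s) \<and> p (2 - 2 * s) = ground_path m n (a, b) (2 - 2 * s)"
      by blast
  next
    assume "\<exists>sL. \<forall>s\<le>sL. p (3 - 2 * s) = ground_path m n (a, b) (3 - 2 * s) \<and> p (2 - 2 * s) = ground_path m n (a, b) (2 - 2 * s)"
    then obtain sL where sL: "\<And>s. s \<le> sL \<Longrightarrow> p (3 - 2 * s) = ground_path m n (a, b) (3 - 2 * s) \<and> p (2 - 2 * s) = ground_path m n (a, b) (2 - 2 * s)"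
      by blast
    have "p k = ground_path m n (a, b) k" if "2 - 2 * sL \<le> k" for k
    proof (cases rule: path_position_cases[of k])
      case (1 s) then show ?thesis using sL[of s] that by simp
    next
      case (2 s) then have "s \<le> sL" using that by presburger
      then show ?thesis using sL[of s] 2 by simp
    qed
    then show "\<exists>K. \<forall>k\<ge>K. p k = ground_path m n (a, b) k" by blast
  qed
  have 2: "(\<forall>\<^sub>F k in at_bot. p k = ground_path m n (a', b') k) \<longleftrightarrow>
    (\<exists>sR. \<forall>s\<ge>sR. fst (state_of n p) s = alternating (m - n) (\<lambda>_. a') s \<and> snd (state_of n p) s = b')"
    unfolding st eventually_at_bot_linorder
  proof
    assume "\<exists>K. \<forall>k\<le>K. p k = ground_path m n (a', b') k"
    then obtain K where K: "\<And>k. k \<le> K \<Longrightarrow> p k = ground_path m n (a', b') k" by blast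
    have "p (3 - 2 * s) = ground_path m n (a', b') (3 - 2 * s) \<and> p (2 - 2 * s) = ground_path m n (a', b') (2 - 2 * s)"
      if "\<bar>K\<bar> + 2 \<le> s" for s using that by (intro conjI K) linarith+
    then show "\<exists>sR. \<forall>s\<ge>sR. p (3 - 2 * s) = ground_path m n (a', b') (3 - 2 * s) \<and> p (2 - 2 * s) = ground_path m n (a', b') (2 - 2 * s)"
      by blast
  next
    assume "\<exists>sR. \<forall>s\<ge>sR. p (3 - 2 * s) = ground_path m n (a', b') (3 - 2 * s) \<and> p (2 - 2 * s) = ground_path m n (a', b') (2 - 2 * s)"
    then obtain sR where sR: "\<And>s. sR \<le> s \<Longrightarrow> p (3 - 2 * s) = ground_path m n (a', b') (3 - 2 * s) \<and> p (2 - 2 * s) = ground_path m n (a', b') (2 - 2 * s)"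
      by blast
    have "p k = ground_path m n (a', b') k" if "k \<le> 2 - 2 * sR" for k
    proof (cases rule: path_position_cases[of k])
      case (1 s) then show ?thesis using sR[of s] that by simp
    next
      case (2 s) then have "sR \<le> s" using that by presburger
      then show ?thesis using sR[of s] 2 by simp
    qed
    then show "\<exists>K. \<forall>k\<le>K. p k = ground_path m n (a', b') k" by blast
  qed
  show ?thesis unfolding paths_def using 1 2 by simp
qed

lemma bounded_below_tails:
  fixes h :: "int \<Rightarrow> int"
  assumes "\<And>s. s \<le> sL \<Longrightarrow> c1 \<le> h s" "\<And>s. sR \<le> s \<Longrightarrow> c2 \<le> h s"
  shows "\<exists>c. \<forall>s. c \<le> h s"
proof -
  define M where "M = Min (insert 0 (h ` {sL..sR}))"
  have M: "M \<le> h s" if "s \<in> {sL..sR}" for s unfolding M_def using that by (intro Min_le) auto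
  have "min M (min c1 c2) \<le> h s" for s
  proof -
    consider "s \<le> sL" | "sR \<le> s" | "s \<in> {sL..sR}" by force
    then show ?thesis using assms M by cases (force simp: min_le_iff_disj)+
  qed
  then show ?thesis by blast
qed

section \<open>Paths with fixed boundary domains and the limits of their evolution\<close>

locale path_crystal =
  fixes m n a b a' b' :: int
  assumes n_pos: "0 < n" and nm: "n < m"
    and a: "0 \<le> a" "a \<le> m - n" and a': "0 \<le> a'" "a' \<le> m - n"
    and b: "0 \<le> b" "b \<le> n" and b': "0 \<le> b'" "b' \<le> n"
begin

abbreviation l where "l \<equiv> m - n"
abbreviation P where "P \<equiv> paths m n (a, b) (a', b')"

text \<open>In both ground tails the even bottoms have constant height, and the odd bottoms are at
  least as high there because the first component of the state is nonnegative. Only finitely many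
  sites remain.\<close>

lemma path_bounded:
  assumes p: "p \<in> P" and U: "state_heights l (state_of n p) U"
  shows "\<exists>c. \<forall>s. c \<le> U s \<and> c \<le> U s - fst (state_of n p) s"
proof -
  let ?X = "fst (state_of n p)" and ?B = "snd (state_of n p)"
  obtain sL where sL: "\<And>s. s\<le>sL \<Longrightarrow> ?X s = alternating l (\<lambda>_. a) s \<and> ?B s = b"
    using p mem_paths_iff by blast
  obtain sR where sR: "\<And>s. sR \<le> s \<Longrightarrow> ?X s = alternating l (\<lambda>_. a') s \<and> ?B s = b'"
    using p mem_paths_iff by blast
  define V where "V s = U s - ?X s" for s
  have V: "V (s + 1) = V s + l - ?X s - ?X (s + 1) - ?B s + ?B (s + 1)" for s
    using U[unfolded state_heights_def, rule_format, of s] by (simp add: V_def)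
  have VL: "V s = V sL" if "s \<le> sL" for s
    using that
  proof (induction s rule: int_le_induct)
    case (step s)
    then have "V s = V sL" "s \<le> sL" "s - 1 \<le> sL" by simp_all
    then show ?case
      using V[of "s - 1"] sL[of s] sL[of "s - 1"] alternating_const_step[of l a "s - 1"] by (simp; linarith)
  qed simp
  have VR: "V s = V sR" if "sR \<le> s" for s
    using that
  proof (induction s rule: int_ge_induct)
    case (step s)
    then have "V s = V sR" "sR \<le> s" "sR \<le> s + 1" by simp_all
    then show ?case
      using V[of s] sR[of s] sR[of "s + 1"] alternating_const_step[of l a' s] by simp
  qed simp
  have "\<exists>c. \<forall>s. c \<le> V s"
  proof (rule bounded_below_tails)
    show "V sL \<le> V s" if "s \<le> sL" for s using VL[OF that] by linarith
    show "V sR \<le> V s" if "sR \<le> s" for s using VR[OF that] by linarith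
  qed
  then obtain c where c: "\<And>s. c \<le> V s" by blast
  have "\<exists>c'. \<forall>s. c' \<le> U s"
  proof (rule bounded_below_tails)
    show "V sL \<le> U s" if "s \<le> sL" for s
    proof -
      have "0 \<le> fst (state_of n p) s" using sL[OF that] a by (auto simp: alternating_def)
      then show ?thesis using VL[OF that] V_def[of s] by linarith
    qed
    show "V sR \<le> U s" if "sR \<le> s" for s
    proof -
      have "0 \<le> fst (state_of n p) s" using sR[OF that] a' by (auto simp: alternating_def)
      then show ?thesis using VR[OF that] V_def[of s] by linarith
    qed
  qed
  then obtain c' where "\<And>s. c' \<le> U s" by blast
  then show ?thesis using c by (intro exI[of _ "min c c'"]) (auto simp: V_def min_le_iff_disj)
qed

lemma bounded_path:
  assumes p: "p \<in> P"
  obtains U c where "bounded_path m n p U c"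
proof -
  obtain U where U: "state_heights l (state_of n p) U" using exists_state_heights by blast
  obtain c where "\<forall>s. c \<le> U s \<and> c \<le> U s - fst (state_of n p) s" using path_bounded[OF p U] by blast
  then have "bounded_path m n p U c"
    unfolding bounded_path_def using p n_pos nm U by (auto simp: mem_paths_iff)
  then show ?thesis by (rule that)
qed

lemma path_f_1_state:
  "p \<in> P \<Longrightarrow> path_f m n 1 p = Some p' \<longleftrightarrow> state_f l (state_of n p) (state_of n p')"
  using bounded_path bounded_path.path_f_1_state by metis

lemma path_e_1_state:
  "p \<in> P \<Longrightarrow> path_e m n 1 p = Some p' \<longleftrightarrow> state_e l (state_of n p) (state_of n p')"
  using bounded_path bounded_path.path_e_1_state by metis

lemma paths_finite_change:
  assumes "p \<in> P" "\<And>k. 0 \<le> p' k \<and> p' k \<le> block_length m n k" "\<And>k. k \<noteq> k0 \<Longrightarrow> p' k = p k"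
  shows "p' \<in> P"
proof -
  have "\<forall>\<^sub>F k in at_top. k \<noteq> k0" "\<forall>\<^sub>F k in at_bot. k \<noteq> k0"
    by (auto simp: eventually_at_top_linorder eventually_at_bot_linorder intro: exI[of _ "k0 + 1"] exI[of _ "k0 - 1"])
  note ne = this
  have g: "\<forall>\<^sub>F k in at_top. p k = ground_path m n (a, b) k"
    "\<forall>\<^sub>F k in at_bot. p k = ground_path m n (a', b') k" using assms(1) by (simp_all add: paths_def)
  have "\<forall>\<^sub>F k in at_top. p' k = ground_path m n (a, b) k"
    by (rule eventually_elim2[OF ne(1) g(1)]) (simp add: assms(3))
  moreover have "\<forall>\<^sub>F k in at_bot. p' k = ground_path m n (a', b') k"
    by (rule eventually_elim2[OF ne(2) g(2)]) (simp add: assms(3))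
  ultimately show ?thesis using assms(2) by (simp add: paths_def)
qed

lemma path_f_1_mem:
  assumes p: "p \<in> P" and f: "path_f m n 1 p = Some p'"
  shows "p' \<in> P \<and> path_e m n 1 p' = Some p"
proof -
  obtain U c where "bounded_path m n p U c" using bounded_path p by blast
  then interpret bounded_path m n p U c .
  obtain k where "p' = p(k := p k + 1)" using f unfolding path_f_1_iff by blast
  then have "p' j = p j" if "j \<noteq> k" for j using that by simp
  then have "p' \<in> P" using paths_finite_change[OF p] path_f_1_inverse[OF f] by blast
  then show ?thesis using path_f_1_inverse[OF f] by blast
qed

lemma path_e_1_mem:
  assumes p: "p \<in> P" and f: "path_e m n 1 p = Some p'"
  shows "p' \<in> P \<and> path_f m n 1 p' = Some p"
proof -
  obtain U c where "bounded_path m n p U c" using bounded_path p by blast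
  then interpret bounded_path m n p U c .
  obtain k where "p' = p(k := p k - 1)" using f unfolding path_e_1_iff by blast
  then have "p' j = p j" if "j \<noteq> k" for j using that by simp
  then have "p' \<in> P" using paths_finite_change[OF p] path_e_1_inverse[OF f] by blast
  then show ?thesis using path_e_1_inverse[OF f] by blast
qed

text \<open>Stands for equal spin-0 data, which are thus never extracted explicitly: from some time
  on, the two evolutions coincide on a half-line to the right. The half-line is fixed, while spin-0
  particles travel into it.\<close>

definition agree :: "state \<Rightarrow> state \<Rightarrow> bool" where
  "agree S S' \<longleftrightarrow> (\<exists>s0 K. \<forall>k\<ge>K. \<forall>s\<ge>s0.
     fst ((evolve l n ^^ k) S) s = fst ((evolve l n ^^ k) S') s \<and>
     snd ((evolve l n ^^ k) S) s = snd ((evolve l n ^^ k) S') s)"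

lemma agree_refl: "agree S S" by (simp add: agree_def)

lemma agree_sym: "agree S S' \<Longrightarrow> agree S' S" unfolding agree_def by metis

lemma agree_trans:
  assumes "agree S S'" "agree S' S''" shows "agree S S''"
proof -
  obtain s0 K where 1: "\<And>k s. K \<le> k \<Longrightarrow> s0 \<le> s \<Longrightarrow>
     fst ((evolve l n ^^ k) S) s = fst ((evolve l n ^^ k) S') s \<and>
     snd ((evolve l n ^^ k) S) s = snd ((evolve l n ^^ k) S') s" using assms(1) agree_def by blast
  obtain s1 K1 where 2: "\<And>k s. K1 \<le> k \<Longrightarrow> s1 \<le> s \<Longrightarrow>
     fst ((evolve l n ^^ k) S') s = fst ((evolve l n ^^ k) S'') s \<and>
     snd ((evolve l n ^^ k) S') s = snd ((evolve l n ^^ k) S'') s" using assms(2) agree_def by blast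
  show ?thesis unfolding agree_def
    by (rule exI[of _ "max s0 s1"], rule exI[of _ "max K K1"]) (use 1 2 in auto)
qed

definition limit_config :: "state \<Rightarrow> (int \<Rightarrow> int) \<Rightarrow> bool" where
  "limit_config S q \<longleftrightarrow> (\<exists>K s0. separated l q s0 ((evolve l n ^^ K) S))"

lemma separated_later:
  assumes "separated l q s0 ((evolve l n ^^ K) S)" "K \<le> k"
  shows "separated l q (s0 + int (k - K)) ((evolve l n ^^ k) S)"
proof -
  have "(evolve l n ^^ k) S = (evolve l n ^^ (k - K)) ((evolve l n ^^ K) S)"
    using assms(2) by (metis comp_apply funpow_add le_add_diff_inverse2)
  then show ?thesis using separated_evolve_power[OF assms(1), where k = "k - K" and n = n] by simp
qed

text \<open>At late times both separation points lie to the right of any given site.\<close>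

lemma limit_config_unique:
  assumes "limit_config S q" "limit_config S q'"
  shows "q = q'"
proof
  fix s
  obtain K s0 where 1: "separated l q s0 ((evolve l n ^^ K) S)" using assms limit_config_def by blast
  obtain K' s0' where 2: "separated l q' s0' ((evolve l n ^^ K') S)" using assms limit_config_def by blast
  define k where "k = K + K' + nat \<bar>s - s0\<bar> + nat \<bar>s - s0'\<bar>"
  have "separated l q (s0 + int (k - K)) ((evolve l n ^^ k) S)" by (rule separated_later[OF 1]) (simp add: k_def)
  moreover have "separated l q' (s0' + int (k - K')) ((evolve l n ^^ k) S)" by (rule separated_later[OF 2]) (simp add: k_def)
  moreover have "s \<le> s0 + int (k - K)" "s \<le> s0' + int (k - K')" by (auto simp: k_def)
  ultimately show "q s = q' s" using separatedD(1) by metis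
qed

text \<open>At a late time both states are separated beyond \<open>t0\<close>. To the left they are
  given by \<open>q\<close> and a constant second component, whose value is read off at
  \<open>t0\<close>; to the right they agree. Injectivity of the evolution carries the equality back
  to time zero.\<close>

lemma limit_config_agree_inj:
  assumes "limit_config S q" "limit_config S' q" "agree S S'"
  shows "S = S'"
proof -
  obtain K s0 where 1: "separated l q s0 ((evolve l n ^^ K) S)" using assms limit_config_def by blast
  obtain K' s0' where 2: "separated l q s0' ((evolve l n ^^ K') S')" using assms limit_config_def by blast
  obtain t0 K'' where 3: "\<And>k s. K'' \<le> k \<Longrightarrow> t0 \<le> s \<Longrightarrow>
     fst ((evolve l n ^^ k) S) s = fst ((evolve l n ^^ k) S') s \<and>
     snd ((evolve l n ^^ k) S) s = snd ((evolve l n ^^ k) S') s" using assms(3) agree_def by blast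
  define k where "k = K + K' + K'' + nat \<bar>t0 - s0\<bar> + nat \<bar>t0 - s0'\<bar>"
  have s1: "separated l q (s0 + int (k - K)) ((evolve l n ^^ k) S)" by (rule separated_later[OF 1]) (simp add: k_def)
  have s2: "separated l q (s0' + int (k - K')) ((evolve l n ^^ k) S')" by (rule separated_later[OF 2]) (simp add: k_def)
  have t0: "t0 \<le> s0 + int (k - K)" "t0 \<le> s0' + int (k - K')" by (auto simp: k_def)
  have kK: "K'' \<le> k" by (simp add: k_def)
  have "(evolve l n ^^ k) S = (evolve l n ^^ k) S'"
  proof (rule state_eqI)
    fix s
    show "fst ((evolve l n ^^ k) S) s = fst ((evolve l n ^^ k) S') s"
    proof (cases "t0 \<le> s")
      case False
      then show ?thesis using separatedD(1)[OF s1, of s] separatedD(1)[OF s2, of s] t0 by simp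
    qed (use 3 kK in simp)
    show "snd ((evolve l n ^^ k) S) s = snd ((evolve l n ^^ k) S') s"
    proof (cases "t0 \<le> s")
      case False
      then have "snd ((evolve l n ^^ k) S) s = snd ((evolve l n ^^ k) S) t0"
        using separatedD(1)[OF s1, of s] separatedD(1)[OF s1, of t0] t0 by simp
      moreover have "snd ((evolve l n ^^ k) S') s = snd ((evolve l n ^^ k) S') t0"
        using False separatedD(1)[OF s2, of s] separatedD(1)[OF s2, of t0] t0 by simp
      ultimately show ?thesis using 3[OF kK, of t0] by simp
    qed (use 3 kK in simp)
  qed
  then show ?thesis by (rule evolve_power_inj)
qed

lemma agree_later:
  assumes "\<And>t k. s0 \<le> t \<Longrightarrow> fst ((evolve l n ^^ k) ((evolve l n ^^ K) S)) t = fst ((evolve l n ^^ k) ((evolve l n ^^ K) S')) t \<and>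
    snd ((evolve l n ^^ k) ((evolve l n ^^ K) S)) t = snd ((evolve l n ^^ k) ((evolve l n ^^ K) S')) t"
  shows "agree S S'"
  unfolding agree_def
proof (intro exI allI impI)
  fix k s assume k: "K \<le> k" "s0 \<le> s"
  have "(evolve l n ^^ k) T = (evolve l n ^^ (k - K)) ((evolve l n ^^ K) T)" for T
    using k(1) by (metis comp_apply funpow_add le_add_diff_inverse2)
  then show "fst ((evolve l n ^^ k) S) s = fst ((evolve l n ^^ k) S') s \<and>
     snd ((evolve l n ^^ k) S) s = snd ((evolve l n ^^ k) S') s" using assms[OF k(2), of "k - K"] by simp
qed

lemma l_nonneg: "0 \<le> l" using nm by simp

lemma limit_config_f:
  assumes lim: "limit_config S q" and f: "state_f l S S'"
  shows "\<exists>q'. q_f l q q' \<and> limit_config S' q' \<and> agree S S'"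
proof -
  obtain K s0 where sep: "separated l q s0 ((evolve l n ^^ K) S)" using lim limit_config_def by blast
  obtain q' where q': "q_f l q q'" "separated l q' s0 ((evolve l n ^^ K) S')"
    "\<And>t. s0 \<le> t \<Longrightarrow> q' t = q t \<and> fst ((evolve l n ^^ K) S') t = fst ((evolve l n ^^ K) S) t"
    "snd ((evolve l n ^^ K) S') = snd ((evolve l n ^^ K) S)"
    using separated_f[OF sep evolve_power_f[OF l_nonneg f]] by blast
  have "agree S S'"
    by (rule agree_later[where ?s0.0 = s0 and K = K], rule separated_agree[OF sep q'(2)]) (use q'(3,4) in auto)
  then show ?thesis using q' limit_config_def by blast
qed

lemma limit_config_f_exists:
  assumes lim: "limit_config S q" and f: "q_f l q q'"
  shows "\<exists>S'. state_f l S S'"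
proof -
  obtain K s0 where sep: "separated l q s0 ((evolve l n ^^ K) S)" using lim limit_config_def by blast
  show ?thesis using separated_f_exists[OF sep f] evolve_power_f_back[OF l_nonneg] by blast
qed

lemma limit_config_e:
  assumes lim: "limit_config S q" and f: "state_e l S S'"
  shows "\<exists>q'. q_e l q q' \<and> limit_config S' q'"
proof -
  obtain K s0 where sep: "separated l q s0 ((evolve l n ^^ K) S)" using lim limit_config_def by blast
  \<comment> \<open>One more time step moves the separation point into the region where
    \<open>q\<close> is a ground state, as \<open>separated_e\<close> requires.\<close>
  have sep': "separated l q (s0 + 1) ((evolve l n ^^ Suc K) S)" using separated_evolve[OF sep] by simp
  have "q (s0 + 1 - 1) + q (s0 + 1) = l" using separatedD(4)[OF sep, of s0] by simp
  then show ?thesis using separated_e[OF sep' _ evolve_power_e[OF l_nonneg f]] limit_config_def by blast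
qed

lemma limit_config_e_exists:
  assumes lim: "limit_config S q" and f: "q_e l q q'"
  shows "\<exists>S'. state_e l S S'"
proof -
  obtain K s0 where sep: "separated l q s0 ((evolve l n ^^ K) S)" using lim limit_config_def by blast
  show ?thesis using separated_e_exists[OF sep f] evolve_power_e_back[OF l_nonneg] by blast
qed

lemma q_e_functional: "q_e l q q' \<Longrightarrow> q_e l q q'' \<Longrightarrow> q' = q''"
  using q_e_iff first_min_unique unfolding q_e_def by metis

lemma q_f_imp_q_e:
  assumes "q_f l q q'" shows "q_e l q' q"
proof -
  obtain \<mu> s where \<mu>: "q_heights l q \<mu>" "last_min \<mu> s" "q' = q(s := q s + 1)" using assms q_f_def by blast
  \<comment> \<open>Raising \<open>q s\<close> by one moves the bottom of block \<open>s\<close>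
    down by one and all later bottoms by two.\<close>
  define \<mu>' where "\<mu>' t = (if t < s then \<mu> t else if t = s then \<mu> s - 1 else \<mu> t - 2)" for t
  have "q_heights l q' \<mu>'" unfolding q_heights_def
  proof
    fix t show "\<mu>' (t + 1) = \<mu>' t + l - q' t - q' (t + 1)"
      using \<mu>(1)[unfolded q_heights_def, rule_format, of t] \<mu>(3) by (auto simp: \<mu>'_def)
  qed
  moreover have "first_min \<mu>' s" unfolding first_min_def
  proof
    fix t show "\<mu>' s \<le> \<mu>' t \<and> (t < s \<longrightarrow> \<mu>' s < \<mu>' t)"
      using \<mu>(2)[unfolded last_min_def, rule_format, of t] by (auto simp: \<mu>'_def)
  qed
  moreover have "q = q'(s := q' s - 1)" using \<mu>(3) by auto
  ultimately show ?thesis using q_e_def by blast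
qed

lemma path_limit_f:
  assumes "p \<in> P" "path_f m n 1 p = Some p'" "limit_config (state_of n p) q"
  shows "\<exists>q'. q_f l q q' \<and> limit_config (state_of n p') q' \<and> agree (state_of n p) (state_of n p')"
  using assms limit_config_f path_f_1_state by blast

lemma path_limit_f_exists:
  assumes "p \<in> P" "limit_config (state_of n p) q" "q_f l q q'"
  shows "\<exists>p'. path_f m n 1 p = Some p'"
  using limit_config_f_exists[OF assms(2,3)] path_f_1_state[OF assms(1)] state_of_path_of_state by metis

text \<open>Since \<open>q_e\<close> is defined on the limit of \<open>p'\<close>, so is the
  operator \<open>e\<close> on \<open>p'\<close>; that \<open>q_e\<close> is single-valued
  identifies the limit of the result.\<close>

lemma path_limit_f_lift:
  assumes p': "p' \<in> P" and lim: "limit_config (state_of n p') q'" and q: "q_f l q q'"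
  shows "\<exists>p\<in>P. path_f m n 1 p = Some p' \<and> limit_config (state_of n p) q"
proof -
  have e: "q_e l q' q" by (rule q_f_imp_q_e[OF q])
  obtain p where p: "path_e m n 1 p' = Some p"
    using limit_config_e_exists[OF lim e] path_e_1_state[OF p'] state_of_path_of_state by metis
  obtain q'' where q'': "q_e l q' q''" "limit_config (state_of n p) q''"
    using limit_config_e[OF lim] p path_e_1_state[OF p'] by blast
  show ?thesis using q'' q_e_functional[OF e q''(1)] path_e_1_mem[OF p' p] by auto
qed

end

section \<open>Diagonal walks\<close>

definition diagonal_step :: "int \<Rightarrow> int \<Rightarrow> domain \<Rightarrow> domain \<Rightarrow> bool" where
  "diagonal_step l n d d' \<longleftrightarrow> d \<in> {0..l} \<times> {0..n} \<and> d' \<in> {0..l} \<times> {0..n} \<and>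
     \<bar>fst d' - fst d\<bar> = 1 \<and> \<bar>snd d' - snd d\<bar> = 1"

text \<open>Induction on the distance. If one coordinate already agrees, parity makes the other
  differ by at least two; two steps reduce it while the first coordinate moves away and back, for
  which both sides of the rectangle must have length at least one.\<close>

lemma diagonal_reach:
  assumes ln: "1 \<le> l" "1 \<le> n"
    and "0 \<le> x" "x \<le> l" "0 \<le> y" "y \<le> n" "0 \<le> x'" "x' \<le> l" "0 \<le> y'" "y' \<le> n" "even (x + y + x' + y')"
  shows "(diagonal_step l n)\<^sup>*\<^sup>* (x, y) (x', y')"
  using assms(3-)
proof (induction "nat (\<bar>x' - x\<bar> + \<bar>y' - y\<bar>)" arbitrary: x y rule: less_induct)
  case less
  have go: ?case if "(diagonal_step l n)\<^sup>*\<^sup>* (x, y) (x1, y1)" "\<bar>x' - x1\<bar> + \<bar>y' - y1\<bar> < \<bar>x' - x\<bar> + \<bar>y' - y\<bar>"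
    "0 \<le> x1" "x1 \<le> l" "0 \<le> y1" "y1 \<le> n" "even (x1 + y1 + x' + y')" for x1 y1
  proof -
    have "(diagonal_step l n)\<^sup>*\<^sup>* (x1, y1) (x', y')"
      by (rule less.hyps) (use that less.prems in linarith)+
    then show ?thesis using that(1) by simp
  qed
  have step: "diagonal_step l n (x1, y1) (x2, y2)"
    if "0 \<le> x1" "x1 \<le> l" "0 \<le> y1" "y1 \<le> n" "0 \<le> x2" "x2 \<le> l" "0 \<le> y2" "y2 \<le> n"
      "x2 = x1 + 1 \<or> x2 = x1 - 1" "y2 = y1 + 1 \<or> y2 = y1 - 1" for x1 y1 x2 y2
    using that by (auto simp: diagonal_step_def)
  define sx where "sx = (if x < x' then 1 else - 1 :: int)"
  define sy where "sy = (if y < y' then 1 else - 1 :: int)"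
  define nx where "nx = (if x < l then x + 1 else x - 1)"
  define ny where "ny = (if y < n then y + 1 else y - 1)"
  consider "x = x'" "y = y'" | "x \<noteq> x'" "y \<noteq> y'" | "x = x'" "y \<noteq> y'" | "x \<noteq> x'" "y = y'" by blast
  then show ?case
  proof cases
    case 1 then show ?thesis by simp
  next
    case 2
    show ?thesis
    proof (rule go[of "x + sx" "y + sy"])
      show "(diagonal_step l n)\<^sup>*\<^sup>* (x, y) (x + sx, y + sy)"
        by (rule r_into_rtranclp, rule step) (use 2 less.prems in \<open>auto simp: sx_def sy_def\<close>)
    qed (use 2 less.prems in \<open>auto simp: sx_def sy_def\<close>)
  next
    case 3
    have e: "even (y + y')" using 3(1) less.prems(9) by presburger
    then have far: "y + 2 \<le> y' \<or> y' \<le> y - 2" using 3 by presburger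
    show ?thesis
    proof (rule go[of x "y + 2 * sy"])
      have "diagonal_step l n (x, y) (nx, y + sy)"
        by (rule step) (use 3 less.prems ln far in \<open>auto simp: sy_def nx_def\<close>)
      moreover have "diagonal_step l n (nx, y + sy) (x, y + 2 * sy)"
        by (rule step) (use 3 less.prems ln far in \<open>auto simp: sy_def nx_def\<close>)
      ultimately show "(diagonal_step l n)\<^sup>*\<^sup>* (x, y) (x, y + 2 * sy)" by (meson converse_rtranclp_into_rtranclp r_into_rtranclp)
    qed (use 3 less.prems far in \<open>auto simp: sy_def\<close>)
  next
    case 4
    have e: "even (x + x')" using 4(2) less.prems(9) by presburger
    then have far: "x + 2 \<le> x' \<or> x' \<le> x - 2" using 4 by presburger
    show ?thesis
    proof (rule go[of "x + 2 * sx" y])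
      have "diagonal_step l n (x, y) (x + sx, ny)"
        by (rule step) (use 4 less.prems ln far in \<open>auto simp: sx_def ny_def\<close>)
      moreover have "diagonal_step l n (x + sx, ny) (x + 2 * sx, y)"
        by (rule step) (use 4 less.prems ln far in \<open>auto simp: sx_def ny_def\<close>)
      ultimately show "(diagonal_step l n)\<^sup>*\<^sup>* (x, y) (x + 2 * sx, y)" by (meson converse_rtranclp_into_rtranclp r_into_rtranclp)
    qed (use 4 less.prems far in \<open>auto simp: sx_def\<close>)
  qed
qed

text \<open>At least one step is enforced, even between equal end points, so that translates of the
  walk can be told apart.\<close>

lemma diagonal_walk:
  assumes ln: "1 \<le> l" "1 \<le> n"
    and "0 \<le> x" "x \<le> l" "0 \<le> y" "y \<le> n" "0 \<le> x'" "x' \<le> l" "0 \<le> y'" "y' \<le> n" "even (x + y + x' + y')"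
  obtains w :: "nat \<Rightarrow> domain" and J where "w 0 = (x, y)" "1 \<le> J" "\<And>j. J \<le> j \<Longrightarrow> w j = (x', y')"
    "\<And>j. j < J \<Longrightarrow> diagonal_step l n (w j) (w (Suc j))"
proof -
  define x1 where "x1 = (if x < l then x + 1 else x - 1)"
  define y1 where "y1 = (if y < n then y + 1 else y - 1)"
  have s: "diagonal_step l n (x, y) (x1, y1)" using assms by (auto simp: diagonal_step_def x1_def y1_def)
  have "(diagonal_step l n)\<^sup>*\<^sup>* (x1, y1) (x', y')"
    by (rule diagonal_reach) (use assms in \<open>auto simp: x1_def y1_def\<close>)
  then have "(diagonal_step l n)\<^sup>+\<^sup>+ (x, y) (x', y')" using s by (rule rtranclp_into_tranclp2[rotated])
  then obtain J where J: "0 < J" "(diagonal_step l n ^^ J) (x, y) (x', y')" using tranclp_power by metis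
  then obtain f where f: "f 0 = (x, y)" "f J = (x', y')" "\<forall>i<J. diagonal_step l n (f i) (f (Suc i))"
    unfolding relpowp_fun_conv by blast
  show ?thesis
    by (rule that[of "\<lambda>j. f (min j J)" J]) (use f J in \<open>auto simp: min_def\<close>)
qed

section \<open>The fibres over level \<open>m - n\<close> paths\<close>

definition config_f :: "int \<Rightarrow> (int \<Rightarrow> int) \<Rightarrow> (int \<Rightarrow> int) \<Rightarrow> bool" where
  "config_f \<theta> A A' \<longleftrightarrow> (\<exists>\<mu> s. (\<forall>t. \<mu> (t + 1) = \<mu> t + \<theta> * parity_sign t * (A t - A (t + 1))) \<and>
     last_min \<mu> s \<and> A' = A(s := A s - \<theta> * parity_sign s))"

lemma q_f_alternating: "q_f l (alternating l A) (alternating l A') \<longleftrightarrow> config_f 1 A A'"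
proof -
  have 1: "q_heights l (alternating l A) \<mu> \<longleftrightarrow> (\<forall>t. \<mu> (t + 1) = \<mu> t + 1 * parity_sign t * (A t - A (t + 1)))" for \<mu>
    unfolding q_heights_def by (intro iff_allI) (auto simp: alternating_def parity_sign_def)
  have 2: "alternating l A' = (alternating l A)(s := alternating l A s + 1) \<longleftrightarrow> A' = A(s := A s - 1 * parity_sign s)" for s
    unfolding fun_eq_iff by (intro iff_allI) (auto simp: alternating_def parity_sign_def)
  show ?thesis unfolding q_f_def config_f_def 1 2 ..
qed

lemma config_f_complement: "config_f 1 (\<lambda>s. l - A s) (\<lambda>s. l - A' s) \<longleftrightarrow> config_f (- 1) A A'"
proof -
  have 1: "(\<forall>t. \<mu> (t + 1) = \<mu> t + 1 * parity_sign t * (l - A t - (l - A (t + 1)))) \<longleftrightarrow>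
      (\<forall>t. \<mu> (t + 1) = \<mu> t + - 1 * parity_sign t * (A t - A (t + 1)))" for \<mu>
    by (intro iff_allI) (auto simp: algebra_simps)
  have 2: "(\<lambda>s. l - A' s) = (\<lambda>s. l - A s)(s := l - A s - 1 * parity_sign s) \<longleftrightarrow> A' = A(s := A s - - 1 * parity_sign s)" for s
    unfolding fun_eq_iff by (intro iff_allI) auto
  show ?thesis unfolding config_f_def 1 2 ..
qed

text \<open>With \<open>c\<close> the value at the right end, \<open>(c, b)\<close> is the domain
  between the spin-1/2 and the spin-0 particles, since spin-1/2 particles do not change
  \<open>b\<close>. The parity condition says that diagonal steps can connect it with the initial
  domain.\<close>

definition configs :: "int \<Rightarrow> int \<Rightarrow> domain \<Rightarrow> domain \<Rightarrow> (int \<Rightarrow> int) set" where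
  "configs m n d d' = {A. (\<forall>s. 0 \<le> A s \<and> A s \<le> m - n) \<and> (\<exists>sL. \<forall>s\<le>sL. A s = fst d) \<and>
     (\<exists>c sR. (\<forall>s\<ge>sR. A s = c) \<and> even (c + snd d + fst d' + snd d'))}"

lemma evolve_local:
  assumes "0 \<le> fst S (s - 1)" "fst S (s - 1) \<le> l" "0 \<le> fst S s" "fst S s \<le> l" "snd S (s - 1) = snd S s"
  shows "fst (evolve l n S) s = fst S s \<and> snd (evolve l n S) s = n - snd S s"
  using assms by (simp add: evolve_simps clip_def)

section \<open>Existence of limit configurations and infinitude of their fibres\<close>

context path_crystal begin

definition limitA :: "(int \<Rightarrow> int) \<Rightarrow> (int \<Rightarrow> int) \<Rightarrow> bool" where
  "limitA p A \<longleftrightarrow> limit_config (state_of n p) (alternating l A)"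

text \<open>The right end of the disturbed region moves by one site per time step, and in the tails
  every step replaces the second component by its complement with respect to
  \<open>n\<close>.\<close>

lemma evolve_power_tails:
  assumes left: "\<And>s. s \<le> sL \<Longrightarrow> fst S s = alternating l (\<lambda>_. a) s \<and> snd S s = b"
    and right: "\<And>s. sR \<le> s \<Longrightarrow> fst S s = alternating l (\<lambda>_. a') s \<and> snd S s = b'"
  shows "s \<le> sL \<Longrightarrow> fst ((evolve l n ^^ k) S) s = alternating l (\<lambda>_. a) s \<and>
      snd ((evolve l n ^^ k) S) s = (if even k then b else n - b)" (is "_ \<Longrightarrow> ?L k s")
    and "sR + int k \<le> s \<Longrightarrow> fst ((evolve l n ^^ k) S) s = alternating l (\<lambda>_. a') s \<and>
      snd ((evolve l n ^^ k) S) s = (if even k then b' else n - b')" (is "_ \<Longrightarrow> ?R k s")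
proof -
  have alt: "0 \<le> alternating l (\<lambda>_. c) s" "alternating l (\<lambda>_. c) s \<le> l" if "0 \<le> c" "c \<le> l" for c s
    using that by (auto simp: alternating_def)
  show "s \<le> sL \<Longrightarrow> ?L k s"
  proof (induction k arbitrary: s)
    case (Suc k)
    have "?L k (s - 1)" "?L k s" using Suc by auto
    then show ?case
      using evolve_local[of "(evolve l n ^^ k) S" s l n] alt[OF a, of s] alt[OF a, of "s - 1"] by simp
  qed (use left in simp)
  show "sR + int k \<le> s \<Longrightarrow> ?R k s"
  proof (induction k arbitrary: s)
    case (Suc k)
    have "?R k (s - 1)" "?R k s" using Suc by auto
    then show ?case
      using evolve_local[of "(evolve l n ^^ k) S" s l n] alt[OF a', of s] alt[OF a', of "s - 1"] by simp
  qed (use right in simp)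
qed

lemma exists_limitA:
  assumes p: "p \<in> P"
  shows "\<exists>A\<in>configs m n (a, b) (a', b'). limitA p A"
proof -
  define S where "S = state_of n p"
  obtain sL where sL: "\<And>s. s\<le>sL \<Longrightarrow> fst S s = alternating l (\<lambda>_. a) s \<and> snd S s = b"
    using p mem_paths_iff S_def by blast
  obtain sR where sR: "\<And>s. sR \<le> s \<Longrightarrow> fst S s = alternating l (\<lambda>_. a') s \<and> snd S s = b'"
    using p mem_paths_iff S_def by blast
  note tails = evolve_power_tails[where S = S and sL = sL and sR = sR, OF sL sR]
  have "\<exists>K q s0. separated l q s0 ((evolve l n ^^ K) S) \<and> (\<forall>s\<le>sL. q s = fst S s)"
  proof (rule exists_separated)
    show "1 \<le> l" using nm by simp
    show "0 \<le> fst S s \<and> fst S s \<le> l \<and> snd S s = b" if "s \<le> sL" for s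
      using sL[OF that] a by (auto simp: alternating_def)
    show "0 \<le> fst S s \<and> fst S s \<le> l \<and> fst S s + fst S (s + 1) = l \<and> snd S s = b'" if "sR \<le> s" for s
      using sR[OF that] sR[of "s + 1"] that a' alternating_const_step[of l a' s]
      by (auto simp: alternating_def)
  qed
  then obtain K q s0 where sep: "separated l q s0 ((evolve l n ^^ K) S)" and qL: "\<And>s. s \<le> sL \<Longrightarrow> q s = fst S s"
    by blast
  define T where "T = (evolve l n ^^ K) S"
  note sep = sep[folded T_def]
  define A where "A = alternating l q"
  have "limitA p A" unfolding limitA_def limit_config_def A_def using sep by (auto simp: T_def S_def)
  moreover have "A \<in> configs m n (a, b) (a', b')"
  proof -
    have range: "0 \<le> A s \<and> A s \<le> l" for s using separatedD(3)[OF sep, of s] by (auto simp: A_def alternating_def)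
    have left: "A s = a" if "s \<le> sL" for s
      using qL[OF that] sL[OF that] by (auto simp: A_def alternating_def)
    have right: "A s = A s0" if "s0 \<le> s" for s
      using that
    proof (induction s rule: int_ge_induct)
      case (step s)
      then show ?case using separatedD(4)[OF sep, of s] by (auto simp: A_def alternating_def split: if_splits)
    qed simp
    \<comment> \<open>To the right of \<open>s0\<close> the two domain coordinates change by equal
      or by opposite amounts from site to site, so the parity of their sum is constant.\<close>
    have par: "even (alternating l (fst T) s + snd T s - (A s0 + snd T s0))" if "s0 \<le> s" for s
      using that
    proof (induction s rule: int_ge_induct)
      case base
      have "fst T s0 = q s0" using separatedD(1)[OF sep, of s0] by simp
      then show ?case by (simp add: A_def alternating_def)
    next
      case (step s)
      have st: "fst T s + snd T s - snd T (s + 1) + fst T (s + 1) = l" using separatedD(2)[OF sep step(1)] by blast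
      have "even (alternating l (fst T) (s + 1) + snd T (s + 1) - (alternating l (fst T) s + snd T s))"
      proof (cases "even s")
        case True
        then have "alternating l (fst T) (s + 1) + snd T (s + 1) - (alternating l (fst T) s + snd T s)
            = 2 * (snd T (s + 1) - snd T s)" using st by (simp add: alternating_def)
        then show ?thesis by (metis dvd_triv_left)
      next
        case False
        then have "alternating l (fst T) (s + 1) + snd T (s + 1) - (alternating l (fst T) s + snd T s) = 0"
          using st by (simp add: alternating_def)
        then show ?thesis by (simp only: dvd_0_right)
      qed
      then show ?case using step(2) by presburger
    qed
    \<comment> \<open>A site that lies both in the separated right part and in the undisturbed
      ground tail. If \<open>K\<close> is odd, both second components are complemented and
      \<open>n\<close> drops out modulo two.\<close>
    define t where "t = max s0 (sR + int K)"
    have "alternating l (fst T) t = a'" "snd T t = (if even K then b' else n - b')"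
      using tails(2)[where k = K and s = t] by (auto simp: T_def t_def alternating_def)
    moreover have "snd T s0 = (if even K then b else n - b)"
      using tails(1)[where k = K and s = "min s0 sL"] separatedD(1)[OF sep, of "min s0 sL"]
      by (auto simp: T_def)
    ultimately have "even (A s0 + b + a' + b')" using par[of t] by (auto simp: t_def split: if_splits)
    then show ?thesis
      unfolding configs_def mem_Collect_eq fst_conv snd_conv using range left right by blast
  qed
  ultimately show ?thesis by blast
qed

lemma countable_paths: "countable P"
proof -
  define F where "F = (\<lambda>(K :: nat, xs :: int list). \<lambda>k :: int.
    if int K \<le> k then ground_path m n (a, b) k else if k \<le> - int K then ground_path m n (a', b') k
    else xs ! nat (k + int K))"
  have "p \<in> range F" if "p \<in> P" for p
  proof -
    have "\<exists>K1. \<forall>k\<ge>K1. p k = ground_path m n (a, b) k" "\<exists>K2. \<forall>k\<le>K2. p k = ground_path m n (a', b') k"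
      using that unfolding paths_def eventually_at_top_linorder eventually_at_bot_linorder by blast+
    then obtain K1 K2 where K: "\<And>k. K1 \<le> k \<Longrightarrow> p k = ground_path m n (a, b) k"
      "\<And>k. k \<le> K2 \<Longrightarrow> p k = ground_path m n (a', b') k" by blast
    define K where "K = nat \<bar>K1\<bar> + nat \<bar>K2\<bar> + 1"
    have "p k = F (K, map (\<lambda>j. p (int j - int K)) [0..<2 * K]) k" for k
    proof -
      consider "int K \<le> k" | "k \<le> - int K" | "- int K < k" "k < int K" by linarith
      then show ?thesis
      proof cases
        case 3
        then have "nat (k + int K) < 2 * K" "int (nat (k + int K)) - int K = k" by linarith+
        then show ?thesis using 3 by (simp add: F_def)
      qed (use K in \<open>auto simp: F_def K_def\<close>)
    qed
    then show ?thesis by blast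
  qed
  then have "P \<subseteq> range F" by blast
  then show ?thesis by (rule countable_subset) simp
qed

lemma limitA_unique: "limitA p A \<Longrightarrow> limitA p A' \<Longrightarrow> A = A'"
  unfolding limitA_def using limit_config_unique alternating_alternating by metis

text \<open>A separated state is written down directly: \<open>A\<close> on the left, and from site
  \<open>2 * r\<close> on a diagonal walk from \<open>(c, b)\<close> to \<open>(a', b')\<close>.
  Different \<open>r\<close> give different paths.\<close>

lemma infinite_fibre:
  assumes A: "A \<in> configs m n (a, b) (a', b')"
  shows "infinite {p \<in> P. limitA p A}"
proof -
  have rA: "0 \<le> A s \<and> A s \<le> l" for s using A by (simp add: configs_def)
  obtain sL where sL: "\<And>s. s \<le> sL \<Longrightarrow> A s = a" using A by (auto simp: configs_def)
  obtain c sR where sR: "\<And>s. sR \<le> s \<Longrightarrow> A s = c" and par: "even (c + b + a' + b')"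
    using A by (auto simp: configs_def)
  have c: "0 \<le> c" "c \<le> l" using rA[of sR] sR[of sR] by auto
  obtain w J where w: "w 0 = (c, b)" "1 \<le> J" "\<And>j. J \<le> j \<Longrightarrow> w j = (a', b')"
    "\<And>j. j < J \<Longrightarrow> diagonal_step l n (w j) (w (Suc j))"
    using diagonal_walk[of l n c b a' b'] c b a' b' par n_pos nm by auto
  have rw: "0 \<le> fst (w j) \<and> fst (w j) \<le> l \<and> 0 \<le> snd (w j) \<and> snd (w j) \<le> n" for j
  proof (cases "j < J")
    case True then show ?thesis using w(4)[of j] by (auto simp: diagonal_step_def)
  next
    case False then show ?thesis using w(3)[of j] a' b' by simp
  qed
  define par_step where "par_step j \<longleftrightarrow> fst (w (Suc j)) - fst (w j) = snd (w (Suc j)) - snd (w j)" for j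
  have anti: "fst (w (Suc j)) - fst (w j) = - (snd (w (Suc j)) - snd (w j))" if "\<not> par_step j" for j
  proof (cases "j < J")
    case True then show ?thesis using w(4)[of j] that by (auto simp: diagonal_step_def par_step_def)
  next
    case False then show ?thesis using w(3)[of j] w(3)[of "Suc j"] by simp
  qed
  \<comment> \<open>The domain at site \<open>s\<close>. Separation allows the coordinates to change
    in parallel only from an even to the next odd site, and in opposite directions only from an odd
    to the next even site; therefore each step of the walk is given two sites.\<close>
  define D where "D r s = (if s < 2 * r then w 0 else
     if even s \<or> \<not> par_step (nat ((s - 2 * r) div 2)) then w (nat ((s - 2 * r) div 2))
     else w (Suc (nat ((s - 2 * r) div 2))))" for r s :: int
  have D_even: "D r (2 * r + 2 * int j) = w j" for r j by (simp add: D_def)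
  have D_odd: "D r (2 * r + 2 * int j + 1) = (if par_step j then w (Suc j) else w j)" for r j
    by (simp add: D_def)
  have D_split: "\<exists>j. s = 2 * r + 2 * int j \<or> s = 2 * r + 2 * int j + 1" if "2 * r \<le> s" for r s :: int
  proof -
    have "int (nat ((s - 2 * r) div 2)) = (s - 2 * r) div 2" using that by simp
    moreover have "s = 2 * r + 2 * ((s - 2 * r) div 2) \<or> s = 2 * r + 2 * ((s - 2 * r) div 2) + 1" by presburger
    ultimately show ?thesis by metis
  qed
  have D_step: "fst (D r (s + 1)) - fst (D r s) =
      (if even s then snd (D r (s + 1)) - snd (D r s) else - (snd (D r (s + 1)) - snd (D r s)))"
    if rs: "2 * r \<le> s" for r s
  proof -
    obtain j where "s = 2 * r + 2 * int j \<or> s = 2 * r + 2 * int j + 1"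
      using D_split[OF rs] by blast
    then show ?thesis
    proof
      assume s: "s = 2 * r + 2 * int j"
      then show ?thesis using D_even[of r j] D_odd[of r j] by (auto simp: par_step_def)
    next
      assume s: "s = 2 * r + 2 * int j + 1"
      have "D r (s + 1) = w (Suc j)" using D_even[of r "Suc j"] s by (simp add: algebra_simps)
      then show ?thesis using D_odd[of r j] s anti[of j] by auto
    qed
  qed
  define S where "S r = (alternating l (\<lambda>s. if s < 2 * r then A s else fst (D r s)), \<lambda>s. snd (D r s))" for r
  define path where "path r = path_of_state n (S r)" for r
  have rD: "0 \<le> fst (D r s) \<and> fst (D r s) \<le> l \<and> 0 \<le> snd (D r s) \<and> snd (D r s) \<le> n" for r s
    using rw by (simp add: D_def)
  have st: "state_of n (path r) = S r" for r by (simp add: path_def state_of_path_of_state)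
  have main: "path r \<in> P \<and> limitA (path r) A" if r: "sR \<le> 2 * r" for r
  proof -
    have Dl: "D r s = (c, b)" if "s \<le> 2 * r" for s
    proof (cases "s = 2 * r")
      case True then show ?thesis using D_even[of r 0] w(1) by simp
    qed (use that w(1) in \<open>simp add: D_def\<close>)
    have X2: "(if s < 2 * r then A s else fst (D r s)) = A s" if "s \<le> 2 * r" for s
      using Dl[of s] that sR[of s] r by (cases "s = 2 * r") auto
    have X: "0 \<le> fst (S r) s \<and> fst (S r) s \<le> l" for s
      using rA[of s] rD[of r s] by (auto simp: S_def alternating_def)
    have "0 \<le> path r k \<and> path r k \<le> block_length m n k" for k
    proof (cases "odd k")
      case True
      then show ?thesis using rD[of r "(3 - k) div 2"] by (simp add: path_def path_of_state_def S_def block_length_def)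
    next
      case False
      then show ?thesis using rD[of r "(2 - k) div 2"] X[of "(2 - k) div 2"]
        by (simp add: path_def path_of_state_def block_length_def) (simp add: S_def)
    qed
    moreover have "fst (S r) s = alternating l (\<lambda>_. a) s \<and> snd (S r) s = b" if "s \<le> min sL (2 * r - 1)" for s
      using that sL[of s] Dl[of s] by (simp add: S_def alternating_def)
    moreover have "fst (S r) s = alternating l (\<lambda>_. a') s \<and> snd (S r) s = b'" if s: "2 * r + 2 * int J \<le> s" for s
    proof -
      obtain j where j: "s = 2 * r + 2 * int j \<or> s = 2 * r + 2 * int j + 1" using D_split[of r s] s by auto
      then have "J \<le> j" using s by auto
      then have "D r s = (a', b')" using j D_even[of r j] D_odd[of r j] w(3)[of j] w(3)[of "Suc j"] by auto
      then show ?thesis using s by (simp add: S_def alternating_def)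
    qed
    ultimately have "path r \<in> P" unfolding mem_paths_iff st by blast
    moreover have "separated l (alternating l A) (2 * r) (S r)"
      unfolding separated_def
    proof (intro conjI allI impI)
      fix s
      show "fst (S r) s = alternating l A s" "snd (S r) s = snd (S r) (2 * r)" if "s \<le> 2 * r"
        using X2[OF that] Dl[OF that] Dl[of "2 * r"] that by (auto simp: S_def alternating_def)
      show "0 \<le> fst (S r) s" "fst (S r) s \<le> l" using X by auto
      show "0 \<le> alternating l A s" "alternating l A s \<le> l" using rA[of s] by (auto simp: alternating_def)
      show "alternating l A s + alternating l A (s + 1) = l" if "2 * r \<le> s"
        using sR[of s] sR[of "s + 1"] that r by (auto simp: alternating_def)
      show "fst (S r) s + snd (S r) s - snd (S r) (s + 1) + fst (S r) (s + 1) = l" if "2 * r \<le> s"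
        using D_step[OF that] that by (auto simp: S_def alternating_def split: if_splits)
    qed
    then have "limitA (path r) A" unfolding limitA_def limit_config_def st
      by (intro exI[of _ 0] exI[of _ "2 * r"]) simp
    ultimately show ?thesis by blast
  qed
  have inj: "r = r'" if "path r = path r'" for r r'
  proof -
    have ne: False if "r < r'" "S r = S r'" for r r'
    proof -
      \<comment> \<open>At this site the walk started at \<open>2 * r\<close> has made its first
        step and the one started later has not; the second coordinate shows the difference.\<close>
      have "D r (2 * r + 2) = w 1" using D_even[of r 1] by simp
      moreover have "D r' (2 * r + 2) = w 0"
      proof (cases "r' = r + 1")
        case True then show ?thesis using D_even[of r' 0] by (simp add: algebra_simps)
      next
        case False then show ?thesis using that(1) by (simp add: D_def)
      qed
      moreover have "snd (S r) (2 * r + 2) = snd (S r') (2 * r + 2)" using that(2) by simp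
      ultimately have "snd (w 1) = snd (w 0)" by (simp add: S_def)
      then show False using w(4)[of 0] w(2) by (auto simp: diagonal_step_def)
    qed
    have "S r = S r'" using that st by metis
    then show ?thesis using ne by (metis linorder_neqE)
  qed
  have "path ` {max 0 sR..} \<subseteq> {p \<in> P. limitA p A}" using main by auto
  moreover have "infinite (path ` {max 0 sR..})"
  proof
    assume "finite (path ` {max 0 sR..})"
    moreover have "inj_on path {max 0 sR..}" using inj by (auto intro: inj_onI)
    ultimately have "finite {max 0 sR..}" using finite_imageD by blast
    then show False by (simp add: infinite_Ici)
  qed
  ultimately show ?thesis using finite_subset by blast
qed

end

section \<open>The complement, which exchanges \<open>i = 0\<close> and \<open>i = 1\<close> for
  paths\<close>

definition co_state :: "int \<Rightarrow> int \<Rightarrow> state \<Rightarrow> state" where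
  "co_state l n S = ((\<lambda>s. l - fst S s), (\<lambda>s. n - snd S s))"

lemma co_state_simps [simp]: "fst (co_state l n S) s = l - fst S s" "snd (co_state l n S) s = n - snd S s"
  by (simp_all add: co_state_def)

lemma evolve_co_state:
  assumes "0 \<le> l" shows "evolve l n (co_state l n S) = co_state l n (evolve l n S)"
proof -
  have "clip l (l - x) = l - clip l x" for x using assms by (auto simp: clip_def min_def max_def)
  then show ?thesis by (intro state_eqI) (simp_all add: evolve_simps)
qed

lemma evolve_power_co_state:
  "0 \<le> l \<Longrightarrow> (evolve l n ^^ k) (co_state l n S) = co_state l n ((evolve l n ^^ k) S)"
  by (induction k) (simp_all add: evolve_co_state)

lemma separated_co_state:
  assumes "separated l q s0 S"
  shows "separated l (\<lambda>s. l - q s) s0 (co_state l n S)"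
  unfolding separated_def co_state_simps
proof (intro conjI allI impI)
  fix s
  show "l - fst S s = l - q s" "n - snd S s = n - snd S s0" if "s \<le> s0"
    using separatedD(1)[OF assms that] by simp_all
  show "0 \<le> l - fst S s" "l - fst S s \<le> l"
    "l - fst S s + (n - snd S s) - (n - snd S (s + 1)) + (l - fst S (s + 1)) = l" if "s0 \<le> s"
    using separatedD(2)[OF assms that] by simp_all
  show "0 \<le> l - q s" "l - q s \<le> l" using separatedD(3)[OF assms, of s] by simp_all
  show "l - q s + (l - q (s + 1)) = l" if "s0 \<le> s" using separatedD(4)[OF assms that] by simp
qed

lemma state_of_complement: "state_of n (complement m n p) = co_state (m - n) n (state_of n p)"
  by (rule state_eqI) (simp_all add: state_of_def complement_def block_length_def)

lemma alternating_complement: "alternating l (\<lambda>s. l - A s) = (\<lambda>s. l - alternating l A s)"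
  by (simp add: alternating_def fun_eq_iff)

lemma ground_path_complement:
  "ground_path m n (m - n - a, n - b) k = block_length m n k - ground_path m n (a, b) k"
  by (auto simp: ground_path_def block_length_def)

definition crystal_sign :: "nat \<Rightarrow> int" where "crystal_sign i = (if i = 1 then 1 else - 1)"

context path_crystal begin

lemma limitA_f_1:
  assumes "p \<in> P" "path_f m n 1 p = Some p'" "limitA p A"
  shows "\<exists>A'. config_f 1 A A' \<and> limitA p' A' \<and> agree (state_of n p) (state_of n p')"
proof -
  obtain q where q: "q_f l (alternating l A) q" "limit_config (state_of n p') q" "agree (state_of n p) (state_of n p')"
    using path_limit_f assms unfolding limitA_def by blast
  have "q = alternating l (alternating l q)" by simp
  then show ?thesis using q unfolding limitA_def by (metis q_f_alternating)
qed

lemma limitA_f_exists_1: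
  assumes "p \<in> P" "limitA p A" "config_f 1 A A'"
  shows "\<exists>p'. path_f m n 1 p = Some p'"
  using path_limit_f_exists assms q_f_alternating unfolding limitA_def by blast

lemma limitA_f_lift_1:
  assumes "p' \<in> P" "limitA p' A'" "config_f 1 A A'"
  shows "\<exists>p\<in>P. path_f m n 1 p = Some p' \<and> limitA p A"
  using path_limit_f_lift assms q_f_alternating unfolding limitA_def by blast

end

context path_crystal begin

text \<open>Complementing a path turns its boundary domains into \<open>(l - a, n - b)\<close> and
  \<open>(l - a', n - b')\<close>, so \<open>i = 1\<close> for these boundaries gives
  \<open>i = 0\<close> for the original ones.\<close>

interpretation co: path_crystal m n "l - a" "n - b" "l - a'" "n - b'"
  by unfold_locales (use n_pos nm a a' b b' in auto)

lemma complement_mem: "p \<in> P \<Longrightarrow> complement m n p \<in> co.P"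
  unfolding paths_def by (auto simp: complement_def ground_path_complement elim: eventually_mono)

lemma complement_mem_back:
  assumes "p \<in> co.P" shows "complement m n p \<in> P"
  using assms unfolding paths_def by (auto simp: complement_def ground_path_complement elim: eventually_mono)

lemma limit_config_co_state:
  "limit_config S q \<Longrightarrow> limit_config (co_state l n S) (\<lambda>s. l - q s)"
  unfolding limit_config_def using evolve_power_co_state[OF l_nonneg] separated_co_state by metis

lemma limitA_complement: "limitA p A \<Longrightarrow> co.limitA (complement m n p) (\<lambda>s. l - A s)"
  unfolding limitA_def co.limitA_def state_of_complement alternating_complement
  by (rule limit_config_co_state)

lemma limitA_complement_back: "co.limitA p A \<Longrightarrow> limitA (complement m n p) (\<lambda>s. l - A s)"
  unfolding limitA_def co.limitA_def state_of_complement alternating_complement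
  by (rule limit_config_co_state)

lemma agree_co_state: "agree (co_state l n S) (co_state l n S') \<longleftrightarrow> agree S S'"
  unfolding agree_def evolve_power_co_state[OF l_nonneg] co_state_simps by simp

lemma path_f_0_iff: "path_f m n 0 p = Some p' \<longleftrightarrow> path_f m n 1 (complement m n p) = Some (complement m n p')"
proof -
  have "0 < m" using n_pos nm by simp
  then show ?thesis unfolding path_f_0[OF n_pos \<open>0 < m\<close>] map_option_eq_Some
    by (metis complement_complement)
qed

lemma path_e_0_iff: "path_e m n 0 p = Some p' \<longleftrightarrow> path_e m n 1 (complement m n p) = Some (complement m n p')"
proof -
  have "0 < m" using n_pos nm by simp
  then show ?thesis unfolding path_e_0[OF n_pos \<open>0 < m\<close>] map_option_eq_Some
    by (metis complement_complement)
qed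

lemma crystal_paths: "crystal P (path_e m n) (path_f m n)"
  unfolding crystal_def
proof (intro ballI conjI allI impI)
  fix i x y assume i: "i \<in> {0, 1 :: nat}" and x: "x \<in> P"
  have c: "complement m n x \<in> co.P" using complement_mem[OF x] .
  show "y \<in> P" "path_e m n i y = Some x" if f: "path_f m n i x = Some y"
  proof -
    have "y \<in> P \<and> path_e m n i y = Some x"
    proof (cases "i = 1")
      case True then show ?thesis using path_f_1_mem[OF x] f by simp
    next
      case False
      then have i0: "i = 0" using i by simp
      have "path_f m n 1 (complement m n x) = Some (complement m n y)" using f path_f_0_iff i0 by simp
      from co.path_f_1_mem[OF c this] show ?thesis
        using complement_mem_back[of "complement m n y"] i0 path_e_0_iff by simp
    qed
    then show "y \<in> P" "path_e m n i y = Some x" by auto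
  qed
  show "y \<in> P" "path_f m n i y = Some x" if f: "path_e m n i x = Some y"
  proof -
    have "y \<in> P \<and> path_f m n i y = Some x"
    proof (cases "i = 1")
      case True then show ?thesis using path_e_1_mem[OF x] f by simp
    next
      case False
      then have i0: "i = 0" using i by simp
      have "path_e m n 1 (complement m n x) = Some (complement m n y)" using f path_e_0_iff i0 by simp
      from co.path_e_1_mem[OF c this] show ?thesis
        using complement_mem_back[of "complement m n y"] i0 path_f_0_iff by simp
    qed
    then show "y \<in> P" "path_f m n i y = Some x" by auto
  qed
qed

lemma limitA_f:
  assumes i: "i \<in> {0, 1}" and p: "p \<in> P" and f: "path_f m n i p = Some p'" and A: "limitA p A"
  shows "\<exists>A'. config_f (crystal_sign i) A A' \<and> limitA p' A' \<and> agree (state_of n p) (state_of n p')"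
proof (cases "i = 1")
  case True then show ?thesis using limitA_f_1[OF p _ A] f by (simp add: crystal_sign_def)
next
  case False
  then have i0: "i = 0" using i by simp
  have "path_f m n 1 (complement m n p) = Some (complement m n p')" using f path_f_0_iff i0 by simp
  from co.limitA_f_1[OF complement_mem[OF p] this limitA_complement[OF A]]
  obtain A' where A': "config_f 1 (\<lambda>s. l - A s) A'" "co.limitA (complement m n p') A'"
    "agree (state_of n (complement m n p)) (state_of n (complement m n p'))" by blast
  have "config_f (- 1) A (\<lambda>s. l - A' s)" using A'(1) config_f_complement[of l A "\<lambda>s. l - A' s"] by simp
  moreover have "limitA p' (\<lambda>s. l - A' s)" using limitA_complement_back[OF A'(2)] by simp
  moreover have "agree (state_of n p) (state_of n p')" using A'(3) by (simp add: state_of_complement agree_co_state)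
  ultimately show ?thesis using i0 by (auto simp: crystal_sign_def)
qed

lemma limitA_f_exists:
  assumes i: "i \<in> {0, 1}" and p: "p \<in> P" and A: "limitA p A" and f: "config_f (crystal_sign i) A A'"
  shows "\<exists>p'. path_f m n i p = Some p'"
proof (cases "i = 1")
  case True then show ?thesis using limitA_f_exists_1[OF p A] f by (simp add: crystal_sign_def)
next
  case False
  then have i0: "i = 0" using i by simp
  have "config_f 1 (\<lambda>s. l - A s) (\<lambda>s. l - A' s)" using f i0 config_f_complement by (simp add: crystal_sign_def)
  from co.limitA_f_exists_1[OF complement_mem[OF p] limitA_complement[OF A] this]
  obtain p' where "path_f m n 1 (complement m n p) = Some p'" by blast
  then show ?thesis using path_f_0_iff[of p "complement m n p'"] i0 by auto
qed

lemma limitA_f_lift: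
  assumes i: "i \<in> {0, 1}" and p: "p' \<in> P" and A: "limitA p' A'" and f: "config_f (crystal_sign i) A A'"
  shows "\<exists>p\<in>P. path_f m n i p = Some p' \<and> limitA p A"
proof (cases "i = 1")
  case True then show ?thesis using limitA_f_lift_1[OF p A] f by (simp add: crystal_sign_def)
next
  case False
  then have i0: "i = 0" using i by simp
  have "config_f 1 (\<lambda>s. l - A s) (\<lambda>s. l - A' s)" using f i0 config_f_complement by (simp add: crystal_sign_def)
  from co.limitA_f_lift_1[OF complement_mem[OF p] limitA_complement[OF A] this]
  obtain p where p: "p \<in> co.P" "path_f m n 1 p = Some (complement m n p')" "co.limitA p (\<lambda>s. l - A s)" by blast
  have "path_f m n i (complement m n p) = Some p'" using p(2) path_f_0_iff i0 by simp
  moreover have "limitA (complement m n p) A" using limitA_complement_back[OF p(3)] by simp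
  ultimately show ?thesis using complement_mem_back[OF p(1)] by blast
qed

lemma limitA_agree_inj:
  assumes "limitA p A" "limitA p' A" "agree (state_of n p) (state_of n p')"
  shows "p = p'"
  using limit_config_agree_inj assms state_of_inj unfolding limitA_def by blast

end

lemma config_f_functional:
  assumes "config_f \<theta> A A'" "config_f \<theta> A A''"
  shows "A' = A''"
proof -
  obtain \<mu> s where 1: "\<forall>t. \<mu> (t + 1) = \<mu> t + \<theta> * parity_sign t * (A t - A (t + 1))"
    "last_min \<mu> s" "A' = A(s := A s - \<theta> * parity_sign s)" using assms(1) config_f_def by auto
  obtain \<mu>' s' where 2: "\<forall>t. \<mu>' (t + 1) = \<mu>' t + \<theta> * parity_sign t * (A t - A (t + 1))"
    "last_min \<mu>' s'" "A'' = A(s' := A s' - \<theta> * parity_sign s')" using assms(2) config_f_def by auto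
  have "\<mu>' (t + 1) - \<mu> (t + 1) = \<mu>' t - \<mu> t" for t using 1(1) 2(1) by simp
  then have "\<mu>' t - \<mu> t = \<mu>' 0 - \<mu> 0" for t
    by (induction t rule: int_induct[of _ 0]) (auto, metis diff_add_cancel)
  then have "\<mu>' t = \<mu> t + (\<mu>' 0 - \<mu> 0)" for t by (simp add: algebra_simps)
  then have "last_min \<mu> s'" using last_min_shift 2(2) by blast
  then show ?thesis using last_min_unique 1 2 by blast
qed

section \<open>Normal ordering of particles\<close>

fun sg :: "particle \<Rightarrow> int" where
  "sg (Half s \<epsilon> \<kappa>) = s" | "sg (Null s t \<kappa>) = s"

fun tag :: "particle \<Rightarrow> int" where
  "tag (Half s \<epsilon> \<kappa>) = \<epsilon>" | "tag (Null s t \<kappa>) = t"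

fun kap :: "particle \<Rightarrow> int" where
  "kap (Half s \<epsilon> \<kappa>) = \<kappa>" | "kap (Null s t \<kappa>) = \<kappa>"

fun with_kap :: "int \<Rightarrow> particle \<Rightarrow> particle" where
  "with_kap k (Half s \<epsilon> \<kappa>) = Half s \<epsilon> k" | "with_kap k (Null s t \<kappa>) = Null s t k"

fun turn :: "int \<Rightarrow> particle \<Rightarrow> particle" where
  "turn d (Half s \<epsilon> \<kappa>) = Half (- s) \<epsilon> (\<kappa> + d)" | "turn d (Null s t \<kappa>) = Null (- s) t (\<kappa> + d)"

text \<open>Because \<open>tag\<close> is \<epsilon> for spin 1/2 and \<open>t\<close> for spin 0,
  this covers the \<nu> of both exchange relations.\<close>

definition nu :: "particle \<Rightarrow> particle \<Rightarrow> int" where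
  "nu x y = delta (sg x) (sg y) + delta (tag x) (tag y)"

abbreviation signed :: "particle \<Rightarrow> bool" where "signed x \<equiv> sg x = 1 \<or> sg x = - 1"

lemma with_kap_simps [simp]:
  "sg (with_kap k x) = sg x" "tag (with_kap k x) = tag x" "kap (with_kap k x) = k"
  "is_half (with_kap k x) = is_half x" "with_kap k (with_kap k' x) = with_kap k x"
  "with_kap (kap x) x = x" "move (with_kap k x) = move x"
  by (cases x; auto simp: fun_eq_iff)+

lemma nu_with_kap [simp]: "nu (with_kap k x) y = nu x y" "nu x (with_kap k y) = nu x y"
  by (simp_all add: nu_def)

lemma turn_simps [simp]:
  "sg (turn d x) = - sg x" "tag (turn d x) = tag x" "kap (turn d x) = kap x + d"
  "is_half (turn d x) = is_half x" "turn d (with_kap k x) = with_kap (k + d) (turn d x)"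
  by (cases x; auto)+

lemma particle_eqI:
  "is_half x = is_half y \<Longrightarrow> sg x = sg y \<Longrightarrow> tag x = tag y \<Longrightarrow> kap x = kap y \<Longrightarrow> x = y"
  by (cases x; cases y; auto)

lemma is_particle_signed: "is_particle x \<Longrightarrow> signed x"
  by (cases x) auto

text \<open>The case in which the spin-0 particle, acting first on the coordinate \<open>a\<close>,
  would leave the strip from 0 to \<open>l\<close>.\<close>

definition turns :: "int \<Rightarrow> int \<Rightarrow> particle \<Rightarrow> particle \<Rightarrow> bool" where
  "turns l a x h \<longleftrightarrow> sg x \<noteq> sg h \<and> \<not> (sg x = 1 \<and> a \<noteq> l) \<and> \<not> (sg x = - 1 \<and> a \<noteq> 0)"

definition cross :: "int \<Rightarrow> int \<Rightarrow> particle \<Rightarrow> particle \<Rightarrow> particle \<times> particle" where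
  "cross l a x h = (if turns l a x h then (turn 1 h, turn (- 1) x) else (h, x))"

text \<open>The relations reduce to two shapes: an exchange of indices for equal spins, and a spin-0
  particle passing a spin-1/2 particle.\<close>

lemma exchange_cases:
  assumes "exchange m n a (x, y) c (x', y')" "is_particle x" "is_particle y"
  shows "(is_half x = is_half y \<and> c = - 1 \<and> x' = with_kap (kap y + nu x y) x \<and> y' = with_kap (kap x - nu x y) y) \<or>
    (\<not> is_half x \<and> is_half y \<and> c = 1 \<and> (x', y') = cross (m - n) a x y)"
  using assms
  by (cases rule: exchange.cases) (auto simp: nu_def cross_def turns_def)

lemma exchange_same_kind:
  assumes "is_half x = is_half y"
  shows "exchange m n a (x, y) (- 1) (with_kap (kap y + nu x y) x, with_kap (kap x - nu x y) y)"
  using assms by (cases x; cases y) (auto simp: nu_def intro: exchange.intros)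

lemma exchange_cross:
  assumes "\<not> is_half x" "is_half y" "is_particle x" "is_particle y"
  shows "exchange m n a (x, y) 1 (cross (m - n) a x y)"
proof -
  obtain s t k where x: "x = Null s t k" using assms by (cases x) auto
  obtain s' e k' where y: "y = Half s' e k'" using assms by (cases y) auto
  have "s = 1 \<or> s = - 1" "s' = 1 \<or> s' = - 1" using assms x y by auto
  then show ?thesis unfolding x y
    by (elim disjE; cases "a = 0"; cases "a = m - n")
       (auto simp: cross_def turns_def intro: exchange.intros)
qed

definition drift :: "particle list \<Rightarrow> int" where "drift w = sum_list (map sg w)"

lemma drift_simps [simp]: "drift [] = 0" "drift (x # w) = sg x + drift w" "drift (u @ w) = drift u + drift w"
  by (simp_all add: drift_def)

lemma fst_foldr_move: "fst (foldr move w d) = fst d + drift w"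
proof (induction w)
  case (Cons x w)
  have "fst (move x e) = fst e + sg x" for e by (cases x; cases e) auto
  then show ?case using Cons by simp
qed simp

text \<open>Only the first coordinate is followed, since the case distinctions in the relations
  depend on nothing else.\<close>

fun walk_ok :: "int \<Rightarrow> int \<Rightarrow> particle list \<Rightarrow> bool" where
  "walk_ok l a [] \<longleftrightarrow> 0 \<le> a \<and> a \<le> l"
| "walk_ok l a (x # w) \<longleftrightarrow> 0 \<le> a + drift (x # w) \<and> a + drift (x # w) \<le> l \<and> walk_ok l a w"

lemma walk_ok_start: "walk_ok l a w \<Longrightarrow> 0 \<le> a + drift w \<and> a + drift w \<le> l"
  by (cases w) auto

lemma walk_ok_end: "walk_ok l a w \<Longrightarrow> 0 \<le> a \<and> a \<le> l"
  by (induction w) auto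

lemma cross_drift: "signed x \<Longrightarrow> signed h \<Longrightarrow> sg (fst (cross l a x h)) + sg (snd (cross l a x h)) = sg x + sg h"
  by (auto simp: cross_def turns_def)

lemma cross_signed:
  "signed x \<Longrightarrow> signed h \<Longrightarrow> signed (fst (cross l a x h))"
  "signed x \<Longrightarrow> signed h \<Longrightarrow> signed (snd (cross l a x h))"
  by (auto simp: cross_def)

lemma cross_walk:
  assumes "1 \<le> l" "signed x" "signed h" "0 \<le> a" "a \<le> l" "0 \<le> a + sg h" "a + sg h \<le> l"
  shows "0 \<le> a + sg (snd (cross l a x h))" "a + sg (snd (cross l a x h)) \<le> l"
  using assms by (auto simp: cross_def turns_def)

text \<open>Products act from the right, so \<open>x\<close>, standing to the left of the list,
  crosses the head first, on the domain reached after the rest of the list has acted.\<close>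

fun pass :: "int \<Rightarrow> int \<Rightarrow> particle \<Rightarrow> particle list \<Rightarrow> particle list \<times> particle" where
  "pass l a x [] = ([], x)"
| "pass l a x (h # hs) = (let c = cross l (a + drift hs) x h; r = pass l a (snd c) hs in (fst c # fst r, snd r))"

text \<open>Only crossings are applied and neither spin is reordered internally; the invariants are
  read off from the two resulting lists.\<close>

fun normal :: "int \<Rightarrow> int \<Rightarrow> particle list \<Rightarrow> particle list \<times> particle list" where
  "normal l a [] = ([], [])"
| "normal l a (x # w) = (let r = normal l a w in
     if is_half x then (x # fst r, snd r)
     else let q = pass l (a + drift (snd r)) x (fst r) in (fst q, snd q # snd r))"

lemma pass_signed:
  "signed x \<Longrightarrow> (\<forall>h\<in>set hs. signed h) \<Longrightarrow>
    (\<forall>h\<in>set (fst (pass l a x hs)). signed h) \<and> signed (snd (pass l a x hs))"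
proof (induction hs arbitrary: x)
  case (Cons h hs)
  have c: "signed (fst (cross l (a + drift hs) x h))" "signed (snd (cross l (a + drift hs) x h))"
    using cross_signed Cons.prems by auto
  then show ?case using Cons.IH[OF c(2)] Cons.prems by (simp add: Let_def)
qed simp

lemma pass_drift:
  "signed x \<Longrightarrow> (\<forall>h\<in>set hs. signed h) \<Longrightarrow>
    drift (fst (pass l a x hs)) + sg (snd (pass l a x hs)) = sg x + drift hs"
proof (induction hs arbitrary: x)
  case (Cons h hs)
  have c: "signed (snd (cross l (a + drift hs) x h))" using cross_signed(2) Cons.prems by auto
  have t: "sg (fst (cross l (a + drift hs) x h)) + sg (snd (cross l (a + drift hs) x h)) = sg x + sg h"
    using cross_drift[of x h l "a + drift hs"] Cons.prems by simp
  then show ?case using Cons.IH[OF c] Cons.prems by (simp add: Let_def)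
qed simp

lemma pass_walk:
  assumes "1 \<le> l"
  shows "signed x \<Longrightarrow> (\<forall>h\<in>set hs. signed h) \<Longrightarrow> walk_ok l a (x # hs) \<Longrightarrow>
    walk_ok l (a + sg (snd (pass l a x hs))) (fst (pass l a x hs))"
proof (induction hs arbitrary: x)
  case (Cons h hs)
  define c where "c = cross l (a + drift hs) x h"
  have s: "signed x" "signed h" using Cons.prems by auto
  have sc: "signed (snd c)" "signed (fst c)" using cross_signed[OF s] by (auto simp: c_def)
  have w: "walk_ok l a hs" "walk_ok l a (h # hs)" using Cons.prems by auto
  have "walk_ok l a (snd c # hs)"
    using cross_walk[OF assms s, of "a + drift hs"] walk_ok_start[OF w(1)] walk_ok_start[OF w(2)] w(1)
    by (simp add: c_def algebra_simps)
  from Cons.IH[OF sc(1) _ this] have IH: "walk_ok l (a + sg (snd (pass l a (snd c) hs))) (fst (pass l a (snd c) hs))"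
    using Cons.prems by simp
  have "sg (fst c) + (sg (snd c) + drift hs) = sg x + (sg h + drift hs)"
    using cross_drift[OF s] by (simp add: c_def)
  moreover have "drift (fst (pass l a (snd c) hs)) + sg (snd (pass l a (snd c) hs)) = sg (snd c) + drift hs"
    using pass_drift[OF sc(1)] Cons.prems by simp
  ultimately have "sg (snd (pass l a (snd c) hs)) + (sg (fst c) + drift (fst (pass l a (snd c) hs))) = sg x + (sg h + drift hs)"
    by simp
  then show ?case using IH Cons.prems by (simp add: Let_def c_def[symmetric] add.assoc)
qed simp

lemma normal_signed_drift:
  "(\<forall>x\<in>set w. signed x) \<Longrightarrow> (\<forall>h\<in>set (fst (normal l a w)). signed h) \<and>
     (\<forall>h\<in>set (snd (normal l a w)). signed h) \<and> drift (fst (normal l a w)) + drift (snd (normal l a w)) = drift w"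
proof (induction w)
  case (Cons x w)
  then have "signed x" by simp
  then show ?case
  proof (cases "is_half x")
    case True then show ?thesis using Cons by (auto simp: Let_def)
  next
    case False
    define r where "r = normal l a w"
    define q where "q = pass l (a + drift (snd r)) x (fst r)"
    have IH: "\<forall>h\<in>set (fst r). signed h" "\<forall>h\<in>set (snd r). signed h" "drift (fst r) + drift (snd r) = drift w"
      using Cons by (simp_all add: r_def)
    have n: "normal l a (x # w) = (fst q, snd q # snd r)" using False by (simp add: r_def q_def Let_def)
    have q: "\<forall>h\<in>set (fst q). signed h" "signed (snd q)" "drift (fst q) + sg (snd q) = sg x + drift (fst r)"
      using pass_signed[OF \<open>signed x\<close> IH(1), of l "a + drift (snd r)"]
        pass_drift[OF \<open>signed x\<close> IH(1), of l "a + drift (snd r)"] by (simp_all add: q_def)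
    have "drift (fst q) + (sg (snd q) + drift (snd r)) = sg x + drift w" using q(3) IH(3) by linarith
    then show ?thesis unfolding n fst_conv snd_conv drift_simps list.set using q IH by blast
  qed
qed simp

lemma normal_walk:
  assumes "1 \<le> l"
  shows "(\<forall>x\<in>set w. signed x) \<Longrightarrow> walk_ok l a w \<Longrightarrow>
    walk_ok l a (snd (normal l a w)) \<and> walk_ok l (a + drift (snd (normal l a w))) (fst (normal l a w))"
proof (induction w)
  case (Cons x w)
  define r where "r = normal l a w"
  have IH: "walk_ok l a (snd r)" "walk_ok l (a + drift (snd r)) (fst r)" using Cons by (auto simp: r_def)
  have s: "(\<forall>h\<in>set (fst r). signed h)" "drift (fst r) + drift (snd r) = drift w"
    using normal_signed_drift[of w l a] Cons.prems by (auto simp: r_def)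
  have x: "walk_ok l (a + drift (snd r)) (x # fst r)"
  proof -
    have "0 \<le> a + drift (x # w)" "a + drift (x # w) \<le> l" using Cons.prems(2) by auto
    moreover have "a + drift (snd r) + drift (x # fst r) = a + drift (x # w)"
      unfolding drift_simps using s(2) by linarith
    ultimately show ?thesis using IH(2) by simp
  qed
  show ?case
  proof (cases "is_half x")
    case True then show ?thesis using x IH(1) by (simp add: r_def[symmetric])
  next
    case False
    have "walk_ok l (a + drift (snd r) + sg (snd (pass l (a + drift (snd r)) x (fst r)))) (fst (pass l (a + drift (snd r)) x (fst r)))"
      by (rule pass_walk[OF assms _ s(1) x]) (use Cons.prems in auto)
    moreover from walk_ok_end[OF this] have "walk_ok l a (snd (pass l (a + drift (snd r)) x (fst r)) # snd r)"
      using IH(1) by (simp add: algebra_simps)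
    ultimately show ?thesis using False by (simp add: r_def[symmetric] Let_def algebra_simps)
  qed
qed simp

lemma normal_ordered:
  "(\<forall>x\<in>set hs. is_half x) \<Longrightarrow> (\<forall>x\<in>set ns. \<not> is_half x) \<Longrightarrow> normal l a (hs @ ns) = (hs, ns)"
proof (induction hs)
  case Nil then show ?case by (induction ns) (auto simp: Let_def)
qed (simp add: Let_def)

section \<open>Straightened positions\<close>

text \<open>
  After adding the accumulated shifts \<open>\<nu>\<close> to the indices \<open>\<kappa>\<close>, the exchange of two particles of
  the same spin becomes the transposition of two neighbouring entries.
\<close>

fun nu_head :: "particle \<Rightarrow> particle list \<Rightarrow> int" where
  "nu_head x [] = 0" | "nu_head x (y # w) = nu x y"

fun straight :: "int \<Rightarrow> particle list \<Rightarrow> int list" where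
  "straight c [] = []"
| "straight c (x # w) = (kap x + c) # straight (c + nu_head x w) w"

definition shape :: "particle \<Rightarrow> particle" where "shape x = with_kap 0 x"

lemma shape_eq_iff: "shape x = shape y \<longleftrightarrow> is_half x = is_half y \<and> sg x = sg y \<and> tag x = tag y"
  by (cases x; cases y) (auto simp: shape_def)

lemma shape_with_kap [simp]: "shape (with_kap k x) = shape x" by (simp add: shape_def)

lemma straight_add: "straight (c + d) w = map (\<lambda>u. u + d) (straight c w)"
proof (induction w arbitrary: c)
  case (Cons x w)
  have e: "c + d + nu_head x w = (c + nu_head x w) + d" by simp
  have "straight (c + d + nu_head x w) w = map (\<lambda>u. u + d) (straight (c + nu_head x w) w)"
    unfolding e by (rule Cons.IH)
  then show ?case by simp
qed simp

lemma straight_0: "straight c w = map (\<lambda>u. u + c) (straight 0 w)"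
  using straight_add[of 0 c w] by simp

lemma nu_shape: "shape x = shape x' \<Longrightarrow> shape y = shape y' \<Longrightarrow> nu x y = nu x' y'"
  by (simp add: shape_eq_iff nu_def)

lemma nu_head_shape: "shape x = shape x' \<Longrightarrow> map shape w = map shape w' \<Longrightarrow> nu_head x w = nu_head x' w'"
  by (cases w; cases w') (auto intro: nu_shape)

lemma straight_inj:
  "map shape w = map shape w' \<Longrightarrow> straight c w = straight c w' \<Longrightarrow> w = w'"
proof (induction w arbitrary: c w')
  case (Cons x w)
  then obtain y v where w': "w' = y # v" by (cases w') auto
  have sh: "shape x = shape y" "map shape w = map shape v" using Cons.prems w' by auto
  have k: "kap x = kap y" using Cons.prems w' by simp
  have "x = y" using sh(1) k by (auto simp: shape_eq_iff intro: particle_eqI)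
  moreover have "w = v" using Cons.IH[OF sh(2), of "c + nu_head x w"] Cons.prems(2) w' nu_head_shape[OF sh] by simp
  ultimately show ?case using w' by simp
qed simp

lemma drift_shape: "map shape w = map shape w' \<Longrightarrow> drift w = drift w'"
proof (induction w arbitrary: w')
  case (Cons x w)
  then obtain y v where w': "w' = y # v" by (cases w') auto
  have "shape x = shape y" "map shape w = map shape v" using Cons.prems w' by auto
  then show ?case using Cons.IH[of v] w' by (simp add: shape_eq_iff)
qed simp

lemma cross_shape:
  assumes "shape h = shape h'"
  shows "shape (fst (cross l a x h)) = shape (fst (cross l a x h'))" "snd (cross l a x h) = snd (cross l a x h')"
  using assms by (auto simp: shape_eq_iff cross_def turns_def)

lemma pass_shape:
  "map shape hs = map shape hs' \<Longrightarrow>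
    map shape (fst (pass l a x hs)) = map shape (fst (pass l a x hs')) \<and> snd (pass l a x hs) = snd (pass l a x hs')"
proof (induction hs arbitrary: x hs')
  case (Cons h hs)
  then obtain h' v where hs': "hs' = h' # v" by (cases hs') auto
  have sh: "shape h = shape h'" "map shape hs = map shape v" using Cons.prems hs' by auto
  show ?case using Cons.IH[OF sh(2)] cross_shape[OF sh(1)] drift_shape[OF sh(2)]
    by (simp add: hs' Let_def)
qed simp

text \<open>A crossing never looks at the index of the spin-0 particle, so an index shift is carried
  through unchanged.\<close>

lemma pass_with_kap:
  "pass l a (with_kap (kap x + d) x) hs =
    (fst (pass l a x hs), with_kap (kap (snd (pass l a x hs)) + d) (snd (pass l a x hs)))"
proof (induction hs arbitrary: x)
  case (Cons h hs)
  have t: "turns l b (with_kap (kap x + d) x) h = turns l b x h" for b by (simp add: turns_def)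
  have "snd (cross l b (with_kap (kap x + d) x) h) = with_kap (kap (snd (cross l b x h)) + d) (snd (cross l b x h))" for b
    by (auto simp: cross_def turns_def algebra_simps)
  moreover have "fst (cross l b (with_kap (kap x + d) x) h) = fst (cross l b x h)" for b
    by (simp add: cross_def t)
  ultimately show ?case using Cons.IH by (simp add: Let_def)
qed simp

definition cost :: "int \<Rightarrow> int \<Rightarrow> particle \<Rightarrow> particle \<Rightarrow> int" where
  "cost l a x h = (if turns l a x h then 1 else 0)"

text \<open>The local identity behind \<open>pass_straight\<close>: when a spin-0 particle crosses
  the neighbours \<open>h\<close> and \<open>k\<close>, the change of their \<open>nu\<close> equals
  the difference of their index gains. It is a finite check over signs and boundary
  positions.\<close>

lemma cross_nu:
  assumes "1 \<le> l" "signed x" "signed h" "signed k" "0 \<le> a" "a \<le> l"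
    "0 \<le> a + sg k" "a + sg k \<le> l" "0 \<le> a + sg k + sg h" "a + sg k + sg h \<le> l"
    "0 \<le> a + sg k + sg h + sg x" "a + sg k + sg h + sg x \<le> l"
  defines "c \<equiv> cross l (a + sg k) x h"
  shows "nu (fst c) (fst (cross l a (snd c) k)) + cost l a (snd c) k = nu h k + cost l (a + sg k) x h"
  using assms unfolding c_def nu_def delta_def cost_def cross_def turns_def
  by - (elim disjE; auto split: if_splits)

text \<open>By \<open>cross_nu\<close> the index gains telescope, and all straightened positions
  move by the gain of the first particle crossed. A uniform shift is compatible with transposing
  neighbours.\<close>

lemma pass_straight:
  assumes l: "1 \<le> l"
  shows "signed x \<Longrightarrow> (\<forall>h\<in>set hs. signed h) \<Longrightarrow> walk_ok l a (x # hs) \<Longrightarrow>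
    straight c (fst (pass l a x hs)) =
      map (\<lambda>u. u + (case hs of [] \<Rightarrow> 0 | h # r \<Rightarrow> cost l (a + drift r) x h)) (straight c hs)"
proof (induction hs arbitrary: x c)
  case (Cons h hs)
  define q where "q = cross l (a + drift hs) x h"
  have s: "signed x" "signed h" using Cons.prems by auto
  have sq: "signed (snd q)" using cross_signed[OF s] by (auto simp: q_def)
  have w: "walk_ok l a hs" "walk_ok l a (h # hs)" using Cons.prems by auto
  have wq: "walk_ok l a (snd q # hs)"
    using cross_walk[OF l s, of "a + drift hs"] walk_ok_start[OF w(1)] walk_ok_start[OF w(2)] w(1)
    by (simp add: q_def algebra_simps)
  have k: "kap (fst q) = kap h + cost l (a + drift hs) x h" by (simp add: q_def cross_def cost_def)
  show ?case
  proof (cases hs)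
    case Nil then show ?thesis using k by (simp add: q_def Let_def)
  next
    case hs: (Cons h2 r)
    have IH: "straight c' (fst (pass l a (snd q) hs)) = map (\<lambda>u. u + cost l (a + drift r) (snd q) h2) (straight c' hs)" for c'
      using Cons.IH[OF sq _ wq, of c'] Cons.prems hs by simp
    have wr: "walk_ok l a r" using w hs by simp
    have nu: "nu (fst q) (fst (cross l (a + drift r) (snd q) h2)) + cost l (a + drift r) (snd q) h2 =
        nu h h2 + cost l (a + drift hs) x h"
    proof -
      have e: "a + drift r + sg h2 = a + drift hs" using hs by simp
      show ?thesis
        using cross_nu[OF l s, of h2 "a + drift r"] Cons.prems hs walk_ok_start[OF wr]
        unfolding e q_def by (simp add: algebra_simps)
    qed
    have "nu_head (fst q) (fst (pass l a (snd q) hs)) = nu (fst q) (fst (cross l (a + drift r) (snd q) h2))"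
      by (simp add: hs Let_def)
    then have "straight (c + nu_head (fst q) (fst (pass l a (snd q) hs))) (fst (pass l a (snd q) hs)) =
        map (\<lambda>u. u + cost l (a + drift r) (snd q) h2)
          (straight (c + nu (fst q) (fst (cross l (a + drift r) (snd q) h2))) hs)"
      using IH by simp
    also have "\<dots> = straight (c + nu (fst q) (fst (cross l (a + drift r) (snd q) h2)) + cost l (a + drift r) (snd q) h2) hs"
      by (rule straight_add[symmetric])
    also have "\<dots> = straight (c + nu h h2 + cost l (a + drift hs) x h) hs" using nu by (simp add: add.assoc)
    also have "\<dots> = map (\<lambda>u. u + cost l (a + drift hs) x h) (straight (c + nu h h2) hs)"
      by (rule straight_add)
    finally have st: "straight (c + nu_head (fst q) (fst (pass l a (snd q) hs))) (fst (pass l a (snd q) hs)) =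
        map (\<lambda>u. u + cost l (a + drift hs) x h) (straight (c + nu h h2) hs)" .
    have p: "pass l a x (h # hs) = (fst q # fst (pass l a (snd q) hs), snd (pass l a (snd q) hs))"
      by (simp add: q_def Let_def)
    have nh: "nu_head h hs = nu h h2" using hs by simp
    show ?thesis unfolding p fst_conv straight.simps list.map list.case st k nh by simp
  qed
qed simp

text \<open>The case of a single spin-1/2 particle in \<open>pass_pair\<close>: \<open>c\<close> is
  its crossing with \<open>y\<close>, and \<open>c'\<close> the subsequent one with
  \<open>x\<close>.\<close>

lemma cross_pair_nu:
  assumes "1 \<le> l" "signed x" "signed y" "signed h" "0 \<le> a" "a \<le> l"
    "0 \<le> a + sg h" "a + sg h \<le> l" "0 \<le> a + sg h + sg y" "a + sg h + sg y \<le> l"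
    "0 \<le> a + sg h + sg y + sg x" "a + sg h + sg y + sg x \<le> l"
  defines "c \<equiv> cross l a y h"
  defines "c' \<equiv> cross l (a + sg (snd c)) x (fst c)"
  shows "kap (snd c) - kap y + nu (snd c') (snd c) - nu x y = kap (snd c') - kap x"
  using assms unfolding c_def c'_def nu_def delta_def cross_def turns_def
  by - (elim disjE; auto split: if_splits)

text \<open>When two spin-0 particles pass the same spin-1/2 particles, their straightened positions
  \<open>kap x\<close> and \<open>kap y + nu x y\<close> are shifted by the same amount. Hence an
  exchange before the passage becomes an exchange after it.\<close>

lemma pass_pair:
  assumes l: "1 \<le> l"
  shows "signed x \<Longrightarrow> signed y \<Longrightarrow> (\<forall>h\<in>set hs. signed h) \<Longrightarrow> walk_ok l a (x # y # hs) \<Longrightarrow>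
    kap (snd (pass l a y hs)) - kap y +
      nu (snd (pass l (a + sg (snd (pass l a y hs))) x (fst (pass l a y hs)))) (snd (pass l a y hs)) - nu x y
    = kap (snd (pass l (a + sg (snd (pass l a y hs))) x (fst (pass l a y hs)))) - kap x"
proof (induction hs arbitrary: x y)
  case (Cons h hs)
  define c where "c = cross l (a + drift hs) y h"
  define r where "r = pass l a (snd c) hs"
  define c' where "c' = cross l (a + drift hs + sg (snd c)) x (fst c)"
  have s: "signed x" "signed y" "signed h" using Cons.prems by auto
  have sc: "signed (fst c)" "signed (snd c)" using cross_signed[OF s(2,3)] by (auto simp: c_def)
  have sc': "signed (snd c')" using cross_signed(2)[OF s(1) sc(1)] by (simp add: c'_def)
  have py: "pass l a y (h # hs) = (fst c # fst r, snd r)" by (simp add: c_def r_def Let_def)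
  have tr: "drift (fst r) + sg (snd r) = sg (snd c) + drift hs"
    using pass_drift[OF sc(2)] Cons.prems by (simp add: r_def)
  have px: "pass l (a + sg (snd r)) x (fst c # fst r) = (fst c' # fst (pass l (a + sg (snd r)) (snd c') (fst r)),
      snd (pass l (a + sg (snd r)) (snd c') (fst r)))"
  proof -
    have e: "a + sg (snd r) + drift (fst r) = a + drift hs + sg (snd c)" using tr by simp
    show ?thesis unfolding pass.simps e c'_def[symmetric] Let_def by (rule refl)
  qed
  have w: "walk_ok l a hs" "walk_ok l a (h # hs)" "walk_ok l a (y # h # hs)" using Cons.prems by auto
  have wc: "0 \<le> a + drift hs + sg (snd c)" "a + drift hs + sg (snd c) \<le> l"
    using cross_walk[OF l s(2,3), of "a + drift hs"] walk_ok_start[OF w(1)] walk_ok_start[OF w(2)]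
    by (simp_all add: c_def algebra_simps)
  have tc: "sg (fst c) + sg (snd c) = sg y + sg h" using cross_drift[OF s(2,3)] by (simp add: c_def)
  have wc': "0 \<le> a + drift hs + sg (snd c) + sg (snd c')" "a + drift hs + sg (snd c) + sg (snd c') \<le> l"
  proof -
    have "a + drift hs + sg (snd c) + sg (fst c) = a + drift (y # h # hs)" using tc by simp
    then show "0 \<le> a + drift hs + sg (snd c) + sg (snd c')" "a + drift hs + sg (snd c) + sg (snd c') \<le> l"
      using cross_walk[OF l s(1) sc(1) wc] walk_ok_start[OF w(3)] by (simp_all add: c'_def)
  qed
  have "walk_ok l a (snd c' # snd c # hs)" using wc wc' w(1) by (simp add: algebra_simps)
  from Cons.IH[OF sc' sc(2) _ this]
  have IH: "kap (snd r) - kap (snd c) + nu (snd (pass l (a + sg (snd r)) (snd c') (fst r))) (snd r) - nu (snd c') (snd c) =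
      kap (snd (pass l (a + sg (snd r)) (snd c') (fst r))) - kap (snd c')"
    using Cons.prems by (simp add: r_def)
  have loc: "kap (snd c) - kap y + nu (snd c') (snd c) - nu x y = kap (snd c') - kap x"
    unfolding c_def c'_def
    by (rule cross_pair_nu[OF l s]) (use walk_ok_start[OF w(1)] walk_ok_start[OF w(2)] walk_ok_start[OF w(3)]
        walk_ok_start[OF Cons.prems(4)] in \<open>simp_all add: algebra_simps\<close>)
  show ?case unfolding py px fst_conv snd_conv using IH loc by simp
qed simp

section \<open>Invariants of the exchange relations\<close>

definition adj :: "int list \<Rightarrow> int list \<Rightarrow> bool" where
  "adj us us' \<longleftrightarrow> (\<exists>p x y r. us = p @ [x, y] @ r \<and> us' = p @ [y, x] @ r)"

lemma adj_map: "adj us us' \<Longrightarrow> adj (map f us) (map f us')"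
  unfolding adj_def by force

lemma adj_Cons: "adj us us' \<Longrightarrow> adj (u # us) (u # us')"
  unfolding adj_def by (metis append_Cons)

lemma adj_sort: "adj\<^sup>*\<^sup>* us (sort us)"
proof (induction us)
  case (Cons u us)
  have cons: "adj\<^sup>*\<^sup>* vs ws \<Longrightarrow> adj\<^sup>*\<^sup>* (v # vs) (v # ws)" for v vs ws
    by (induction rule: rtranclp_induct) (auto intro: adj_Cons rtranclp.rtrancl_into_rtrancl)
  have ins: "adj\<^sup>*\<^sup>* (v # vs) (insort v vs)" for v vs
  proof (induction vs)
    case (Cons w ws)
    have "adj (v # w # ws) (w # v # ws)" unfolding adj_def by (rule exI[of _ "[]"]) auto
    then show ?case using cons[OF Cons, of w] by (auto intro: converse_rtranclp_into_rtranclp)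
  qed simp
  show ?case using cons[OF Cons, of u] ins[of u "sort us"] by simp
qed simp

text \<open>The sign of the permutation sorting the list, and zero if an entry is repeated.\<close>

fun sort_sign :: "int list \<Rightarrow> int" where
  "sort_sign [] = 1"
| "sort_sign (x # us) = prod_list (map (\<lambda>y. sgn (y - x)) us) * sort_sign us"

lemma sort_sign_adj:
  assumes "adj us us'" shows "sort_sign us' = - sort_sign us"
proof -
  obtain p x y r where u: "us = p @ [x, y] @ r" "us' = p @ [y, x] @ r" using assms adj_def by auto
  have e: "sgn (x - y) = - sgn (y - x)" by (simp add: sgn_if)
  have "sort_sign (p @ [y, x] @ r) = - sort_sign (p @ [x, y] @ r)"
  proof (induction p)
    case Nil show ?case by (simp add: e mult.left_commute)
  next
    case (Cons u p)
    then show ?case by (simp add: mult.left_commute)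
  qed
  then show ?thesis using u by simp
qed

lemma sort_sign_sorted: "sorted_wrt (<) us \<Longrightarrow> sort_sign us = 1"
proof (induction us)
  case (Cons u us)
  have "map (\<lambda>y. sgn (y - u)) us = map (\<lambda>_. 1) us" using Cons.prems by (auto simp: sgn_if)
  then have "prod_list (map (\<lambda>y. sgn (y - u)) us) = 1" by (simp only: map_replicate_const prod_list_replicate power_one)
  then show ?case using Cons by simp
qed simp

text \<open>Equal entries of a sorted list can be found next to each other, and transposing them
  changes nothing.\<close>

lemma sorted_not_distinct:
  "sorted us \<Longrightarrow> \<not> distinct us \<Longrightarrow> adj us us" for us :: "int list"
proof (induction us)
  case (Cons u us)
  show ?case
  proof (cases "distinct us")
    case False then show ?thesis using Cons adj_Cons by auto
  next
    case True
    then have "u \<in> set us" using Cons.prems by auto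
    then obtain v vs where us: "us = v # vs" by (cases us) auto
    then have "v = u" using Cons.prems \<open>u \<in> set us\<close> by (auto intro: antisym)
    then show ?thesis unfolding adj_def us by (intro exI[of _ "[]"]) auto
  qed
qed simp

definition swap_adj :: "particle list \<Rightarrow> particle list \<Rightarrow> bool" where
  "swap_adj w w' \<longleftrightarrow> map shape w = map shape w' \<and> adj (straight 0 w) (straight 0 w')"

lemma swap_adj_Cons:
  assumes "swap_adj w w'" shows "swap_adj (x # w) (x # w')"
proof -
  have sh: "map shape w = map shape w'" using assms by (simp add: swap_adj_def)
  have "nu_head x w = nu_head x w'" by (rule nu_head_shape[OF refl sh])
  moreover have "adj (straight c w) (straight c w')" for c
    using assms adj_map unfolding swap_adj_def straight_0[of c] by blast
  ultimately show ?thesis using sh by (auto simp: swap_adj_def intro: adj_Cons)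
qed

lemma swap_adj_pair:
  "swap_adj (x # y # w) (with_kap (kap y + nu x y) x # with_kap (kap x - nu x y) y # w)"
proof -
  have "nu_head (with_kap k y) w = nu_head y w" for k by (cases w) auto
  then show ?thesis unfolding swap_adj_def adj_def
    by (intro conjI exI[of _ "[]"] exI[of _ "kap x"] exI[of _ "kap y + nu x y"] exI) auto
qed

text \<open>The effect that a relation with sign \<open>c\<close> has on normal forms: none for a
  crossing, one transposition of straightened positions in one of the two lists for an
  exchange.\<close>

definition related :: "int \<Rightarrow> particle list \<times> particle list \<Rightarrow> particle list \<times> particle list \<Rightarrow> bool" where
  "related c r r' \<longleftrightarrow> (c = 1 \<and> r = r') \<or> (c = - 1 \<and>
     ((swap_adj (fst r) (fst r') \<and> snd r = snd r') \<or> (fst r = fst r' \<and> swap_adj (snd r) (snd r'))))"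

text \<open>A spin-0 particle put in front has to pass the spin-1/2 list. By
  \<open>pass_shape\<close> what emerges does not depend on the indices passed, and by
  \<open>pass_straight\<close> the positions undergo a uniform shift, so a transposition stays
  one.\<close>

lemma related_Cons:
  assumes l: "1 \<le> l" and s: "\<forall>y\<in>set (x # w). signed y" "\<forall>y\<in>set (x # w'). signed y"
    and ok: "walk_ok l a (x # w)" "walk_ok l a (x # w')"
    and rel: "related c (normal l a w) (normal l a w')"
  shows "related c (normal l a (x # w)) (normal l a (x # w'))"
proof -
  define r r' where "r = normal l a w" and "r' = normal l a w'"
  note rel = rel[folded r_def r'_def]
  have x: "signed x" using s by simp
  have pre: "\<forall>h\<in>set (fst r). signed h" "walk_ok l (a + drift (snd r)) (x # fst r)"
    if "r = normal l a w" "\<forall>y\<in>set (x # w). signed y" "walk_ok l a (x # w)" for r w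
  proof -
    have s: "\<forall>x\<in>set w. signed x" and k: "walk_ok l a w" using that by auto
    show "\<forall>h\<in>set (fst r). signed h" using normal_signed_drift[OF s] that(1) by blast
    have "drift (fst r) + drift (snd r) = drift w" using normal_signed_drift[OF s] that(1) by blast
    moreover have "walk_ok l (a + drift (snd r)) (fst r)" using normal_walk[OF l s k] that(1) by blast
    ultimately show "walk_ok l (a + drift (snd r)) (x # fst r)" using that(3) by simp
  qed
  show ?thesis
  proof (cases "c = 1")
    case True then show ?thesis using rel by (simp add: related_def r_def r'_def)
  next
    case False
    then have c: "c = - 1" and alt: "(swap_adj (fst r) (fst r') \<and> snd r = snd r') \<or> (fst r = fst r' \<and> swap_adj (snd r) (snd r'))"
      using rel by (auto simp: related_def)
    show ?thesis
    proof (cases "is_half x")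
      case True
      then show ?thesis using alt c swap_adj_Cons by (auto simp: related_def r_def r'_def Let_def)
    next
      case nh: False
      define b where "b = a + drift (snd r)"
      have n: "normal l a (x # w) = (fst (pass l b x (fst r)), snd (pass l b x (fst r)) # snd r)"
        using nh by (simp add: r_def b_def Let_def)
      from alt show ?thesis
      proof
        assume h: "swap_adj (fst r) (fst r') \<and> snd r = snd r'"
        have n': "normal l a (x # w') = (fst (pass l b x (fst r')), snd (pass l b x (fst r')) # snd r')"
          using nh h by (simp add: r'_def b_def Let_def)
        have bb: "b = a + drift (snd r')" using h by (simp add: b_def)
        have sh: "map shape (fst r) = map shape (fst r')" using h by (simp add: swap_adj_def)
        have sh': "map shape (fst (pass l b x (fst r))) = map shape (fst (pass l b x (fst r')))"
          "snd (pass l b x (fst r)) = snd (pass l b x (fst r'))" using pass_shape[OF sh] by auto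
        define k where "k hs = (case hs of [] \<Rightarrow> 0 | h # v \<Rightarrow> cost l (b + drift v) x h)" for hs
        \<comment> \<open>The cost of the first crossing depends on shapes only, and these
          agree.\<close>
        have "k (fst r) = k (fst r')"
        proof (cases "fst r")
          case (Cons h1 v1)
          then obtain h2 v2 where 2: "fst r' = h2 # v2" using sh by (cases "fst r'") auto
          have "shape h1 = shape h2" "map shape v1 = map shape v2" using sh Cons 2 by auto
          then show ?thesis using Cons 2 drift_shape[of v1 v2]
            by (simp add: k_def cost_def turns_def shape_eq_iff)
        qed (use sh in auto)
        moreover have "straight 0 (fst (pass l b x (fst r))) = map (\<lambda>u. u + k (fst r)) (straight 0 (fst r))"
          unfolding k_def b_def by (rule pass_straight[OF l x pre[OF r_def s(1) ok(1)]])
        moreover have "straight 0 (fst (pass l b x (fst r'))) = map (\<lambda>u. u + k (fst r')) (straight 0 (fst r'))"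
          unfolding k_def bb by (rule pass_straight[OF l x pre[OF r'_def s(2) ok(2)]])
        ultimately have "swap_adj (fst (pass l b x (fst r))) (fst (pass l b x (fst r')))"
          using sh' h by (auto simp: swap_adj_def intro: adj_map)
        then show ?thesis unfolding related_def n n' fst_conv snd_conv using c sh'(2) h by metis
      next
        assume h: "fst r = fst r' \<and> swap_adj (snd r) (snd r')"
        then have "drift (snd r) = drift (snd r')"
          using drift_shape[of "snd r" "snd r'"] unfolding swap_adj_def by blast
        then have bb: "b = a + drift (snd r')" by (simp add: b_def)
        have n': "normal l a (x # w') = (fst (pass l b x (fst r')), snd (pass l b x (fst r')) # snd r')"
          using nh by (simp add: r'_def bb Let_def)
        show ?thesis unfolding related_def n n' fst_conv snd_conv using c h swap_adj_Cons by metis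
      qed
    qed
  qed
qed

text \<open>A relation at the head of the product. For two spin-0 particles,
  \<open>pass_pair\<close> turns the exchanged indices into an exchange of the particles that
  emerge; a crossing is already a step of the normal ordering itself.\<close>

lemma related_exchange:
  assumes l: "1 \<le> m - n" and s: "\<forall>z\<in>set (x # y # r). signed z" and p: "is_particle x" "is_particle y"
    and ok: "walk_ok (m - n) a (x # y # r)"
    and ex: "exchange m n (a + drift r) (x, y) c (x', y')"
  shows "related c (normal (m - n) a (x # y # r)) (normal (m - n) a (x' # y' # r))"
proof -
  define l where "l = m - n"
  define q where "q = normal l a r"
  have l1: "1 \<le> l" using assms(1) by (simp add: l_def)
  have sr: "\<forall>z\<in>set r. signed z" and okr: "walk_ok l a r" using s ok by (auto simp: l_def)
  have sq: "\<forall>h\<in>set (fst q). signed h" "drift (fst q) + drift (snd q) = drift r"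
    using normal_signed_drift[OF sr] by (auto simp: q_def)
  have okq: "walk_ok l (a + drift (snd q)) (fst q)" using normal_walk[OF l1 sr okr] by (simp add: q_def)
  define b where "b = a + drift (snd q)"
  from exchange_cases[OF ex p] show ?thesis
  proof
    assume e: "is_half x = is_half y \<and> c = - 1 \<and> x' = with_kap (kap y + nu x y) x \<and> y' = with_kap (kap x - nu x y) y"
    show ?thesis
    proof (cases "is_half x")
      case True
      then have "normal l a (x # y # r) = (x # y # fst q, snd q)" "normal l a (x' # y' # r) = (x' # y' # fst q, snd q)"
        using e by (simp_all add: q_def Let_def)
      then show ?thesis using swap_adj_pair[of x y "fst q"] e by (simp add: related_def l_def)
    next
      case False
      then have nh: "\<not> is_half x" "\<not> is_half y" "\<not> is_half x'" "\<not> is_half y'" using e by auto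
      define y1 where "y1 = snd (pass l b y (fst q))"
      define hs1 where "hs1 = fst (pass l b y (fst q))"
      define x1 where "x1 = snd (pass l (b + sg y1) x hs1)"
      define hs2 where "hs2 = fst (pass l (b + sg y1) x hs1)"
      have n: "normal l a (x # y # r) = (hs2, x1 # y1 # snd q)"
        using nh by (simp add: q_def[symmetric] Let_def b_def hs1_def y1_def hs2_def x1_def algebra_simps)
      have y': "y' = with_kap (kap y + (kap x - nu x y - kap y)) y" using e by simp
      have x': "x' = with_kap (kap x + (kap y + nu x y - kap x)) x" using e by simp
      have py: "pass l b y' (fst q) = (hs1, with_kap (kap y1 + (kap x - nu x y - kap y)) y1)"
        unfolding y' by (simp only: pass_with_kap hs1_def y1_def)
      have px: "pass l (b + sg y1) x' hs1 = (hs2, with_kap (kap x1 + (kap y + nu x y - kap x)) x1)"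
        unfolding x' by (simp only: pass_with_kap hs2_def x1_def)
      have n': "normal l a (x' # y' # r) = (hs2, with_kap (kap x1 + (kap y + nu x y - kap x)) x1 #
          with_kap (kap y1 + (kap x - nu x y - kap y)) y1 # snd q)"
      proof -
        have 1: "normal l a (y' # r) = (hs1, with_kap (kap y1 + (kap x - nu x y - kap y)) y1 # snd q)"
          using nh py by (simp add: q_def[symmetric] b_def[symmetric] Let_def)
        have 2: "a + drift (with_kap (kap y1 + (kap x - nu x y - kap y)) y1 # snd q) = b + sg y1" by (simp add: b_def)
        show ?thesis using nh(3) px unfolding normal.simps(2)[of l a x'] 1 fst_conv snd_conv 2 Let_def by simp
      qed
      have "kap y1 - kap y + nu x1 y1 - nu x y = kap x1 - kap x"
        unfolding x1_def y1_def hs1_def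
      proof (rule pass_pair[OF l1])
        show "walk_ok l b (x # y # fst q)" using ok okq sq(2) by (simp add: b_def l_def)
      qed (use s sq in auto)
      then have e1: "kap x1 + (kap y + nu x y - kap x) = kap y1 + nu x1 y1"
        and e2: "kap y1 + (kap x - nu x y - kap y) = kap x1 - nu x1 y1" by simp_all
      show ?thesis unfolding l_def[symmetric] n n'[unfolded e1 e2] related_def
        using swap_adj_pair[of x1 y1 "snd q"] e by simp
    qed
  next
    assume e: "\<not> is_half x \<and> is_half y \<and> c = 1 \<and> (x', y') = cross (m - n) (a + drift r) x y"
    then have k: "is_half x'" "\<not> is_half y'" by (auto simp: cross_def split: if_splits)
    have c: "cross l (b + drift (fst q)) x y = (x', y')" using e sq(2) by (simp add: b_def l_def algebra_simps)
    have "normal l a (x # y # r) = normal l a (x' # y' # r)"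
      using conjunct1[OF e] conjunct1[OF conjunct2[OF e]] k c
      by (simp add: q_def[symmetric] b_def[symmetric] Let_def)
    then show ?thesis using e by (simp add: related_def l_def)
  qed
qed

fun inside :: "domain set \<Rightarrow> domain \<Rightarrow> particle list \<Rightarrow> bool" where
  "inside D d [] \<longleftrightarrow> d \<in> D"
| "inside D d (x # w) \<longleftrightarrow> foldr move (x # w) d \<in> D \<and> inside D d w"

lemma inside_iff: "(\<forall>j\<le>length w. foldr move (drop j w) d \<in> D) \<longleftrightarrow> inside D d w"
proof (induction w)
  case (Cons x w)
  have "(\<forall>j\<le>length (x # w). foldr move (drop j (x # w)) d \<in> D) \<longleftrightarrow>
      foldr move (x # w) d \<in> D \<and> (\<forall>j\<le>length w. foldr move (drop j w) d \<in> D)"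
  proof
    assume a: "\<forall>j\<le>length (x # w). foldr move (drop j (x # w)) d \<in> D"
    show "foldr move (x # w) d \<in> D \<and> (\<forall>j\<le>length w. foldr move (drop j w) d \<in> D)"
    proof (intro conjI allI impI)
      show "foldr move (x # w) d \<in> D" using a[rule_format, of 0] by simp
      fix j assume "j \<le> length w"
      then show "foldr move (drop j w) d \<in> D" using a[rule_format, of "Suc j"] by simp
    qed
  next
    assume a: "foldr move (x # w) d \<in> D \<and> (\<forall>j\<le>length w. foldr move (drop j w) d \<in> D)"
    show "\<forall>j\<le>length (x # w). foldr move (drop j (x # w)) d \<in> D"
    proof (intro allI impI)
      fix j assume "j \<le> length (x # w)"
      then show "foldr move (drop j (x # w)) d \<in> D" using a by (cases j) auto
    qed
  qed
  then show ?case using Cons by simp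
qed simp

lemma monomials_iff:
  "w \<in> monomials m n M N d d' \<longleftrightarrow> (\<forall>x\<in>set w. is_particle x) \<and> length (filter is_half w) = M \<and>
     length (filter (\<lambda>x. \<not> is_half x) w) = N \<and> inside (domains m n) d' w \<and> foldr move w d' = d"
  unfolding monomials_def mem_Collect_eq inside_iff by (rule refl)

lemma inside_append: "inside D d (u @ w) \<longleftrightarrow> inside D (foldr move w d) u \<and> inside D d w"
proof (induction u)
  case Nil
  have "inside D d w \<Longrightarrow> foldr move w d \<in> D" by (cases w) auto
  then show ?case by auto
qed auto

lemma inside_start: "inside D d w \<Longrightarrow> foldr move w d \<in> D"
  by (cases w) auto

lemma inside_walk:
  assumes "inside (domains m n) d w" shows "walk_ok (m - n) (fst d) w"
  using assms
proof (induction w)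
  case Nil then show ?case by (cases d) (simp add: domains_def)
next
  case (Cons x w)
  have "fst (foldr move (x # w) d) = fst d + drift (x # w)" by (rule fst_foldr_move)
  moreover have "foldr move (x # w) d \<in> domains m n" using Cons.prems by simp
  ultimately have "0 \<le> fst d + drift (x # w)" "fst d + drift (x # w) \<le> m - n"
    unfolding domains_def by (auto simp: mem_Times_iff)
  then show ?case using Cons by simp
qed

lemma monomials_signed: "w \<in> monomials m n M N d d' \<Longrightarrow> \<forall>x\<in>set w. signed x"
  unfolding monomials_iff using is_particle_signed by blast

lemma monomials_walk: "w \<in> monomials m n M N d d' \<Longrightarrow> walk_ok (m - n) (fst d') w"
  unfolding monomials_iff using inside_walk by blast

definition step :: "int \<Rightarrow> int \<Rightarrow> nat \<Rightarrow> nat \<Rightarrow> domain \<Rightarrow> domain \<Rightarrow> int \<Rightarrow> particle list \<Rightarrow> particle list \<Rightarrow> bool" where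
  "step m n M N d d' c w w' \<longleftrightarrow> (\<exists>u r x y x' y'. w = u @ [x, y] @ r \<and> w' = u @ [x', y'] @ r \<and>
     w \<in> monomials m n M N d d' \<and> w' \<in> monomials m n M N d d' \<and>
     exchange m n (fst (foldr move r d')) (x, y) c (x', y'))"

lemma relations_alt:
  "relations m n M N d d' = free.span {Poly_Mapping.single w 1 - scale (of_int c) (Poly_Mapping.single w' 1) | w c w'.
     step m n M N d d' c w w'}"
  unfolding relations_def step_def by (rule arg_cong[where f = free.span]) blast

lemma step_related:
  assumes l: "1 \<le> m - n" and st: "step m n M N d d' c w w'"
  shows "related c (normal (m - n) (fst d') w) (normal (m - n) (fst d') w')"
proof -
  obtain u r x y x' y' where w: "w = u @ [x, y] @ r" "w' = u @ [x', y'] @ r"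
    "w \<in> monomials m n M N d d'" "w' \<in> monomials m n M N d d'"
    "exchange m n (fst (foldr move r d')) (x, y) c (x', y')" using st unfolding step_def by blast
  have s: "\<forall>z\<in>set w. signed z" "\<forall>z\<in>set w'. signed z" using monomials_signed w by blast+
  have k: "walk_ok (m - n) (fst d') w" "walk_ok (m - n) (fst d') w'" using monomials_walk w by blast+
  have p: "is_particle x" "is_particle y" using w by (auto simp: monomials_iff)
  have "related c (normal (m - n) (fst d') (v @ [x, y] @ r)) (normal (m - n) (fst d') (v @ [x', y'] @ r))"
    if "\<forall>z\<in>set (v @ [x, y] @ r). signed z" "\<forall>z\<in>set (v @ [x', y'] @ r). signed z"
      "walk_ok (m - n) (fst d') (v @ [x, y] @ r)" "walk_ok (m - n) (fst d') (v @ [x', y'] @ r)" for v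
    using that
  proof (induction v)
    case Nil
    show ?case
      using related_exchange[OF l _ p, of r "fst d'" c x' y'] Nil w(5) unfolding fst_foldr_move by simp
  next
    case (Cons z v)
    then show ?case using related_Cons[OF l, of z "v @ [x, y] @ r" "v @ [x', y'] @ r"] by simp
  qed
  then show ?thesis using s k unfolding w(1,2) by blast
qed

section \<open>Invariants of the relations and the linear functionals built from them\<close>

definition key :: "int \<Rightarrow> int \<Rightarrow> particle list \<Rightarrow> particle list \<times> particle list \<times> int multiset \<times> int multiset" where
  "key l a w = (let r = normal l a w in
     (map shape (fst r), map shape (snd r), mset (straight 0 (fst r)), mset (straight 0 (snd r))))"

definition weight :: "int \<Rightarrow> int \<Rightarrow> particle list \<Rightarrow> int" where
  "weight l a w = sort_sign (straight 0 (fst (normal l a w))) * sort_sign (straight 0 (snd (normal l a w)))"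

lemma adj_mset: "adj us us' \<Longrightarrow> mset us = mset us'"
  unfolding adj_def by auto

lemma step_key:
  assumes "1 \<le> m - n" "step m n M N d d' c w w'"
  shows "key (m - n) (fst d') w = key (m - n) (fst d') w' \<and>
    weight (m - n) (fst d') w = c * weight (m - n) (fst d') w' \<and> (c = 1 \<or> c = - 1)"
  using step_related[OF assms] unfolding related_def swap_adj_def key_def weight_def Let_def
  by (auto dest: adj_mset sort_sign_adj)

text \<open>A linear functional for each key \<open>K\<close>. It vanishes on the relations, because
  each of them preserves the key and multiplies the weight by its own sign.\<close>

definition pairing :: "int \<Rightarrow> int \<Rightarrow> particle list \<times> particle list \<times> int multiset \<times> int multiset \<Rightarrow>
    (particle list \<Rightarrow>\<^sub>0 'k::field) \<Rightarrow> 'k" where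
  "pairing l a K v = (\<Sum>w\<in>Poly_Mapping.keys v. Poly_Mapping.lookup v w * (if key l a w = K then of_int (weight l a w) else 0))"

lemma pairing_superset:
  assumes "finite A" "Poly_Mapping.keys v \<subseteq> A"
  shows "pairing l a K v = (\<Sum>w\<in>A. Poly_Mapping.lookup v w * (if key l a w = K then of_int (weight l a w) else 0))"
  unfolding pairing_def using assms
  by (intro sum.mono_neutral_left) (auto simp: in_keys_iff)

lemma pairing_add: "pairing l a K (u + v) = pairing l a K u + pairing l a K v"
proof -
  let ?A = "Poly_Mapping.keys u \<union> Poly_Mapping.keys v"
  have "Poly_Mapping.keys (u + v) \<subseteq> ?A" by (rule Poly_Mapping.keys_add)
  then have "pairing l a K (u + v) =
      (\<Sum>w\<in>?A. Poly_Mapping.lookup (u + v) w * (if key l a w = K then of_int (weight l a w) else 0))"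
    by (intro pairing_superset) auto
  moreover have "pairing l a K u = (\<Sum>w\<in>?A. Poly_Mapping.lookup u w * (if key l a w = K then of_int (weight l a w) else 0))"
    "pairing l a K v = (\<Sum>w\<in>?A. Poly_Mapping.lookup v w * (if key l a w = K then of_int (weight l a w) else 0))"
    by (intro pairing_superset; auto)+
  ultimately show ?thesis by (simp add: lookup_add distrib_right sum.distrib)
qed

lemma pairing_scale: "pairing l a K (scale c v) = c * pairing l a K v"
proof -
  have "Poly_Mapping.keys (scale c v) \<subseteq> Poly_Mapping.keys v" by (auto simp: in_keys_iff lookup_scale)
  then have "pairing l a K (scale c v) =
      (\<Sum>w\<in>Poly_Mapping.keys v. Poly_Mapping.lookup (scale c v) w * (if key l a w = K then of_int (weight l a w) else 0))"
    by (intro pairing_superset) auto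
  then show ?thesis by (simp add: lookup_scale pairing_def sum_distrib_left mult.assoc)
qed

lemma pairing_single: "pairing l a K (Poly_Mapping.single w 1) = (if key l a w = K then of_int (weight l a w) else 0)"
  by (simp add: pairing_def)

lemma minus_eq_scale: "u - v = u + scale (- 1) v" for u v :: "'x \<Rightarrow>\<^sub>0 'k::field"
  by (rule poly_mapping_eqI) (simp add: lookup_add lookup_minus lookup_scale)

lemma pairing_diff: "pairing l a K (u - v) = pairing l a K u - pairing l a K v"
proof -
  have "pairing l a K (u - v) = pairing l a K (u + scale (- 1) v)" by (simp only: minus_eq_scale)
  then show ?thesis unfolding pairing_add pairing_scale by simp
qed

lemma pairing_relations:
  assumes l: "1 \<le> m - n" and v: "v \<in> relations m n M N d d'"
  shows "pairing (m - n) (fst d') K v = 0"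
  using v unfolding relations_alt
proof (induction rule: free.span_induct)
  case base
  have "pairing (m - n) (fst d') K (0 :: particle list \<Rightarrow>\<^sub>0 'a) = 0" by (simp add: pairing_def)
  then show ?case unfolding free.subspace_def mem_Collect_eq by (simp add: pairing_add pairing_scale)
next
  case (step v)
  then obtain w c w' where v: "v = Poly_Mapping.single w 1 - scale (of_int c) (Poly_Mapping.single w' 1)"
    "step m n M N d d' c w w'" by auto
  show ?case using step_key[OF l v(2)] unfolding v(1) by (auto simp: pairing_diff pairing_scale pairing_single)
qed

abbreviation vec :: "particle list \<Rightarrow> particle list \<Rightarrow>\<^sub>0 'k::field" where "vec w \<equiv> Poly_Mapping.single w 1"

lemma relations_zero: "0 \<in> relations m n M N d d'"
  unfolding relations_def by (rule free.span_zero)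

lemma relations_add: "u \<in> relations m n M N d d' \<Longrightarrow> v \<in> relations m n M N d d' \<Longrightarrow> u + v \<in> relations m n M N d d'"
  unfolding relations_def by (rule free.span_add)

lemma relations_scale: "v \<in> relations m n M N d d' \<Longrightarrow> scale c v \<in> relations m n M N d d'"
  unfolding relations_def by (rule free.span_scale)

lemma relations_neg: "v \<in> relations m n M N d d' \<Longrightarrow> - v \<in> relations m n M N d d'"
  unfolding relations_def by (rule free.span_neg)

lemma relations_diff: "u \<in> relations m n M N d d' \<Longrightarrow> v \<in> relations m n M N d d' \<Longrightarrow> u - v \<in> relations m n M N d d'"
  unfolding relations_def by (rule free.span_diff)

lemma scale_one: "scale 1 v = v" by (rule poly_mapping_eqI) (simp add: lookup_scale)

lemma scale_neg_one: "scale (- 1) v = - v" by (rule poly_mapping_eqI) (simp add: lookup_scale)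

lemma step_relations:
  assumes "1 \<le> m - n" "step m n M N d d' c w w'"
  shows "(c = 1 \<and> vec w - vec w' \<in> (relations m n M N d d' :: (particle list \<Rightarrow>\<^sub>0 'k::field) set)) \<or>
    (c = - 1 \<and> vec w + vec w' \<in> (relations m n M N d d' :: (particle list \<Rightarrow>\<^sub>0 'k) set))"
proof -
  have "vec w - scale (of_int c) (vec w') \<in> (relations m n M N d d' :: (particle list \<Rightarrow>\<^sub>0 'k) set)"
    unfolding relations_alt using assms(2) by (intro free.span_base) blast
  then show ?thesis using step_key[OF assms] by (auto simp: scale_one scale_neg_one)
qed

lemma signed_class_eqI:
  assumes "u - v \<in> relations m n M N d d' \<or> u + v \<in> relations m n M N d d'"
  shows "signed_class (relations m n M N d d') u = signed_class (relations m n M N d d') v"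
proof -
  have sub: "signed_class (relations m n M N d d') u \<subseteq> signed_class (relations m n M N d d') v"
    if h: "u - v \<in> relations m n M N d d' \<or> u + v \<in> relations m n M N d d'" for u v :: "particle list \<Rightarrow>\<^sub>0 'a"
  proof
    fix x assume "x \<in> signed_class (relations m n M N d d') u"
    then have x: "x - u \<in> relations m n M N d d' \<or> x + u \<in> relations m n M N d d'" by (simp add: signed_class_def)
    have e: "x - v = (x - u) + (u - v)" "x + v = (x - u) + (u + v)" "x + v = (x + u) - (u - v)" "x - v = (x + u) - (u + v)"
      by simp_all
    show "x \<in> signed_class (relations m n M N d d') v"
      unfolding signed_class_def mem_Collect_eq
      using x h relations_add relations_diff e by metis
  qed
  have "v - u = - (u - v)" "v + u = u + v" by (simp_all add: add.commute)
  then have "v - u \<in> relations m n M N d d' \<or> v + u \<in> relations m n M N d d'" using assms relations_neg by metis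
  then show ?thesis using sub[OF assms] sub by blast
qed

lemma signed_class_eqD:
  assumes "signed_class (relations m n M N d d') u = signed_class (relations m n M N d d') v"
  shows "u - v \<in> relations m n M N d d' \<or> u + v \<in> relations m n M N d d'"
proof -
  have "u \<in> signed_class (relations m n M N d d') u" by (simp add: signed_class_def relations_zero)
  then have "u \<in> signed_class (relations m n M N d d') v" unfolding assms .
  then show ?thesis by (simp add: signed_class_def)
qed

lemma vec_relations_weight:
  assumes "1 \<le> m - n" "(vec w :: particle list \<Rightarrow>\<^sub>0 'k::field_char_0) \<in> relations m n M N d d'"
  shows "weight (m - n) (fst d') w = 0"
  using pairing_relations[OF assms, of "key (m - n) (fst d') w"] by (simp add: pairing_single)

text \<open>For different keys, the functional at the key of \<open>w\<close> takes the value of the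
  nonzero weight of \<open>w\<close> on both \<open>vec w - vec w'\<close> and
  \<open>vec w + vec w'\<close>, although one of the two lies in the span of the relations.\<close>

lemma class_eq_key:
  fixes w w' :: "particle list"
  assumes l: "1 \<le> m - n"
    and eq: "signed_class (relations m n M N d d') (vec w :: particle list \<Rightarrow>\<^sub>0 'k::field_char_0) =
      signed_class (relations m n M N d d') (vec w')"
    and wt: "weight (m - n) (fst d') w \<noteq> 0"
  shows "key (m - n) (fst d') w = key (m - n) (fst d') w'"
proof (rule ccontr)
  assume ne: "key (m - n) (fst d') w \<noteq> key (m - n) (fst d') w'"
  define K where "K = key (m - n) (fst d') w"
  have "pairing (m - n) (fst d') K (vec w - vec w' :: particle list \<Rightarrow>\<^sub>0 'k) = 0 \<or>
      pairing (m - n) (fst d') K (vec w + vec w' :: particle list \<Rightarrow>\<^sub>0 'k) = 0"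
    using signed_class_eqD[OF eq] pairing_relations[OF l] by blast
  then show False using ne wt by (auto simp: pairing_diff pairing_add pairing_single K_def)
qed

section \<open>Every monomial can be ordered\<close>

lemma monomials_replace:
  assumes w: "w \<in> monomials m n M N d d'" and "map move w' = map move w" "map is_half w' = map is_half w"
    "\<forall>x\<in>set w'. is_particle x"
  shows "w' \<in> monomials m n M N d d'"
proof -
  have f: "foldr move v' e = foldr move v e \<and> (inside D e v' = inside D e v)" if "map move v' = map move v" for v v' e D
    using that
  proof (induction v arbitrary: v')
    case (Cons x v)
    then obtain y u where v': "v' = y # u" by (cases v') auto
    then show ?case using Cons.IH[of u] Cons.prems by simp
  qed simp
  have h: "length (filter is_half v') = length (filter is_half v) \<and>
      length (filter (\<lambda>x. \<not> is_half x) v') = length (filter (\<lambda>x. \<not> is_half x) v)" if "map is_half v' = map is_half v" for v v'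
    using that
  proof (induction v arbitrary: v')
    case (Cons x v)
    then obtain y u where v': "v' = y # u" by (cases v') auto
    then show ?case using Cons.IH[of u] Cons.prems by simp
  qed simp
  show ?thesis using w f[OF assms(2)] h[OF assms(3)] assms(4) by (simp add: monomials_iff)
qed

lemma parity_sign_simps: "parity_sign (k + 2) = parity_sign k" "parity_sign (k + 1) = - parity_sign k"
  "parity_sign (k - 2) = parity_sign k" "parity_sign (k - 1) = - parity_sign k" "parity_sign 0 = 1" "parity_sign 1 = - 1"
  by (auto simp: parity_sign_def)

lemma parity_sign_cases: "parity_sign k = 1 \<or> parity_sign k = - 1" by (simp add: parity_sign_def)

lemma exchange_particle:
  assumes "is_half x = is_half y" "is_particle x" "is_particle y"
  shows "is_particle (with_kap (kap y + nu x y) x)" "is_particle (with_kap (kap x - nu x y) y)"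
proof -
  have "is_particle (with_kap (kap y + nu x y) x) \<and> is_particle (with_kap (kap x - nu x y) y)"
    using assms
    by (cases x; cases y) (auto simp: nu_def delta_def parity_sign_def split: if_splits)
  then show "is_particle (with_kap (kap y + nu x y) x)" "is_particle (with_kap (kap x - nu x y) y)" by auto
qed

lemma step_same_kind:
  assumes w: "u @ [x, y] @ r \<in> monomials m n M N d d'" and k: "is_half x = is_half y"
  shows "step m n M N d d' (- 1) (u @ [x, y] @ r)
    (u @ [with_kap (kap y + nu x y) x, with_kap (kap x - nu x y) y] @ r)"
proof -
  have p: "is_particle x" "is_particle y" using w by (auto simp: monomials_iff)
  have "u @ [with_kap (kap y + nu x y) x, with_kap (kap x - nu x y) y] @ r \<in> monomials m n M N d d'"
  proof (rule monomials_replace[OF w])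
    have "\<forall>z\<in>set u \<union> set r. is_particle z" using w unfolding monomials_iff by auto
    then show "\<forall>z\<in>set (u @ [with_kap (kap y + nu x y) x, with_kap (kap x - nu x y) y] @ r). is_particle z"
      using exchange_particle[OF k p] by auto
  qed simp_all
  then show ?thesis unfolding step_def using w exchange_same_kind[OF k] by blast
qed

text \<open>Lifts a transposition of integers to an exchange of particles, so that sorting the
  positions becomes a chain of relations.\<close>

lemma adj_straight:
  assumes "adj (straight c w) us"
  shows "\<exists>u x y r. w = u @ [x, y] @ r \<and>
    us = straight c (u @ [with_kap (kap y + nu x y) x, with_kap (kap x - nu x y) y] @ r)"
proof -
  obtain p i j q where eq: "straight c w = p @ [i, j] @ q" and us: "us = p @ [j, i] @ q" using assms adj_def by auto
  from eq have "\<exists>u x y r. w = u @ [x, y] @ r \<and>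
    p @ [j, i] @ q = straight c (u @ [with_kap (kap y + nu x y) x, with_kap (kap x - nu x y) y] @ r)"
  proof (induction p arbitrary: c w)
    case Nil
    then obtain x y r where w: "w = x # y # r" by (cases w; cases "tl w") auto
    have "nu_head (with_kap k y) r = nu_head y r" for k by (cases r) auto
    then show ?case using Nil w by (intro exI[of _ "[]"] exI[of _ x] exI[of _ y] exI[of _ r]) (auto simp: algebra_simps)
  next
    case (Cons k p)
    then obtain z v where w: "w = z # v" by (cases w) auto
    have "straight (c + nu_head z v) v = p @ [i, j] @ q" using Cons.prems w by simp
    from Cons.IH[OF this] obtain u x y r where 1: "v = u @ [x, y] @ r"
      "p @ [j, i] @ q = straight (c + nu_head z v) (u @ [with_kap (kap y + nu x y) x, with_kap (kap x - nu x y) y] @ r)" by blast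
    have "nu_head z (u @ [with_kap (kap y + nu x y) x, with_kap (kap x - nu x y) y] @ r) = nu_head z v"
      by (rule nu_head_shape) (simp_all add: 1)
    then show ?case using Cons.prems w 1 by (intro exI[of _ "z # u"] exI[of _ x] exI[of _ y] exI[of _ r]) auto
  qed
  then show ?thesis using us by blast
qed

text \<open>Signs are forgotten, as classes are taken modulo sign; both directions of a relation are
  allowed.\<close>

definition linked :: "int \<Rightarrow> int \<Rightarrow> nat \<Rightarrow> nat \<Rightarrow> domain \<Rightarrow> domain \<Rightarrow> particle list \<Rightarrow> particle list \<Rightarrow> bool" where
  "linked m n M N d d' = (\<lambda>w w'. \<exists>c. step m n M N d d' c w w' \<or> step m n M N d d' c w' w)\<^sup>*\<^sup>*"

lemma linked_refl: "linked m n M N d d' w w" by (simp add: linked_def)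

lemma linked_trans: "linked m n M N d d' w w' \<Longrightarrow> linked m n M N d d' w' w'' \<Longrightarrow> linked m n M N d d' w w''"
  unfolding linked_def by (rule rtranclp_trans)

lemma linked_step: "step m n M N d d' c w w' \<Longrightarrow> linked m n M N d d' w w'"
  unfolding linked_def by (rule r_into_rtranclp) blast

lemma linked_sym: "linked m n M N d d' w w' \<Longrightarrow> linked m n M N d d' w' w"
  unfolding linked_def
proof (induction rule: rtranclp_induct)
  case (step w' w'')
  then show ?case by (blast intro: converse_rtranclp_into_rtranclp)
qed simp

lemma adj_path_linked:
  assumes kinds: "(\<forall>x\<in>set w. is_half x) \<or> (\<forall>x\<in>set w. \<not> is_half x)"
    and path: "adj\<^sup>*\<^sup>* (straight 0 w) us" and mon: "u @ w @ r \<in> monomials m n M N d d'"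
  shows "\<exists>w'. straight 0 w' = us \<and> map shape w' = map shape w \<and> u @ w' @ r \<in> monomials m n M N d d' \<and>
    linked m n M N d d' (u @ w @ r) (u @ w' @ r)"
  using path
proof (induction rule: rtranclp_induct)
  case base
  then show ?case using mon linked_refl by (intro exI[of _ w]) simp
next
  case (step us us')
  then obtain w' where w': "straight 0 w' = us" "map shape w' = map shape w" "u @ w' @ r \<in> monomials m n M N d d'"
    "linked m n M N d d' (u @ w @ r) (u @ w' @ r)" by blast
  have "adj (straight 0 w') us'" using step(2) w'(1) by simp
  from adj_straight[OF this] obtain v x y s where v: "w' = v @ [x, y] @ s"
    "us' = straight 0 (v @ [with_kap (kap y + nu x y) x, with_kap (kap x - nu x y) y] @ s)" by blast
  define w'' where "w'' = v @ [with_kap (kap y + nu x y) x, with_kap (kap x - nu x y) y] @ s"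
  have h: "map is_half w' = map is_half w"
  proof -
    have "map is_half w' = map is_half (map shape w')" "map is_half w = map is_half (map shape w)" by (auto simp: shape_def)
    then show ?thesis using w'(2) by simp
  qed
  then have "set (map is_half w') = set (map is_half w)" by simp
  then have "is_half x = is_half y" using kinds v(1) by auto
  then have st: "step m n M N d d' (- 1) (u @ w' @ r) (u @ w'' @ r)"
    using step_same_kind[of "u @ v" x y "s @ r" m n M N d d'] w'(3) v(1) by (simp add: w''_def)
  have "map shape w'' = map shape w" using w'(2) v(1) by (simp add: w''_def)
  moreover have "u @ w'' @ r \<in> monomials m n M N d d'" using st unfolding step_def by blast
  ultimately show ?case using v(2) w'(4) linked_step[OF st] linked_trans unfolding w''_def by blast
qed

text \<open>Counts the pairs with a spin-0 particle to the left of a spin-1/2 particle. Every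
  crossing lowers it by one, which makes the ordering terminate.\<close>

fun inversions :: "particle list \<Rightarrow> nat" where
  "inversions [] = 0"
| "inversions (x # w) = (if is_half x then 0 else length (filter is_half w)) + inversions w"

lemma inversions_swap:
  "\<not> is_half x \<Longrightarrow> is_half y \<Longrightarrow> is_half x' \<Longrightarrow> \<not> is_half y' \<Longrightarrow>
    inversions (u @ [x, y] @ r) = Suc (inversions (u @ [x', y'] @ r))"
  by (induction u) auto

lemma not_ordered_cases:
  "(\<exists>hs ns. w = hs @ ns \<and> (\<forall>x\<in>set hs. is_half x) \<and> (\<forall>x\<in>set ns. \<not> is_half x)) \<or>
   (\<exists>u x y r. w = u @ [x, y] @ r \<and> \<not> is_half x \<and> is_half y)"
proof (induction w)
  case (Cons z w)
  then show ?case
  proof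
    assume "\<exists>hs ns. w = hs @ ns \<and> (\<forall>x\<in>set hs. is_half x) \<and> (\<forall>x\<in>set ns. \<not> is_half x)"
    then obtain hs ns where w: "w = hs @ ns" "\<forall>x\<in>set hs. is_half x" "\<forall>x\<in>set ns. \<not> is_half x" by blast
    show ?case
    proof (cases "is_half z")
      case True then show ?thesis using w by (intro disjI1 exI[of _ "z # hs"] exI[of _ ns]) auto
    next
      case False
      show ?thesis
      proof (cases hs)
        case Nil then show ?thesis using w False by (intro disjI1 exI[of _ "[]"] exI[of _ "z # ns"]) auto
      next
        case (Cons h hs') then show ?thesis using w False
          by (intro disjI2 exI[of _ "[]"] exI[of _ z] exI[of _ h] exI[of _ "hs' @ ns"]) auto
      qed
    qed
  next
    assume "\<exists>u x y r. w = u @ [x, y] @ r \<and> \<not> is_half x \<and> is_half y"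
    then show ?case by (metis append_Cons)
  qed
qed simp

text \<open>Where the plain crossing would leave the strip, the boundary relation reverses both
  signs and keeps the walk inside. The second coordinate takes no new value, as only the spin-0
  particle changes it.\<close>

lemma step_cross:
  assumes l: "1 \<le> m - n" and w: "u @ [x, y] @ r \<in> monomials m n M N d d'" and k: "\<not> is_half x" "is_half y"
  shows "\<exists>x' y'. is_half x' \<and> \<not> is_half y' \<and> step m n M N d d' 1 (u @ [x, y] @ r) (u @ [x', y'] @ r)"
proof -
  define e where "e = foldr move r d'"
  obtain x' y' where c: "cross (m - n) (fst e) x y = (x', y')" by fastforce
  have p: "is_particle x" "is_particle y" using w by (auto simp: monomials_iff)
  then have s: "signed x" "signed y" using is_particle_signed by auto
  have k': "is_half x'" "\<not> is_half y'" using c k by (auto simp: cross_def split: if_splits)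
  obtain e1 e2 where e: "e = (e1, e2)" by (cases e)
  obtain sx t kx where x: "x = Null sx t kx" using k by (cases x) auto
  obtain sy \<epsilon> ky where y: "y = Half sy \<epsilon> ky" using k by (cases y) auto
  have ins: "inside (domains m n) d' ([x, y] @ r)" "inside (domains m n) (foldr move ([x, y] @ r) d') u"
    using w unfolding monomials_iff inside_append[of _ _ u] by auto
  have D: "e \<in> domains m n" "move y e \<in> domains m n" "move x (move y e) \<in> domains m n" "inside (domains m n) d' r"
    using ins(1) inside_start[of "domains m n" d' r] by (auto simp: e_def)
  have same: "move x' (move y' e) = move x (move y e)"
    using c s unfolding x y e by (auto simp: cross_def turns_def split: if_splits)
  have "move y' e \<in> domains m n"
  proof -
    have "0 \<le> e1 + sg (snd (cross (m - n) e1 x y))" "e1 + sg (snd (cross (m - n) e1 x y)) \<le> m - n"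
      using cross_walk[OF l s, of e1] D unfolding e x y by (auto simp: domains_def)
    then show ?thesis using D c unfolding e x y
      by (auto simp: domains_def cross_def split: if_splits)
  qed
  then have ins': "inside (domains m n) d' ([x', y'] @ r)" using D same by (simp add: e_def)
  have pp: "is_particle x'" "is_particle y'"
    using c p unfolding x y by (auto simp: cross_def turns_def parity_sign_def split: if_splits)
  have "u @ [x', y'] @ r \<in> monomials m n M N d d'"
  proof -
    have f: "foldr move ([x', y'] @ r) d' = foldr move ([x, y] @ r) d'" using same by (simp add: e_def)
    have "inside (domains m n) d' (u @ [x', y'] @ r)" unfolding inside_append[of _ _ u] f using ins' ins(2) by blast
    moreover have "foldr move (u @ [x', y'] @ r) d' = d"
    proof -
      have "foldr move (u @ v) d' = foldr move u (foldr move v d')" for v by simp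
      then have "foldr move (u @ [x', y'] @ r) d' = foldr move (u @ [x, y] @ r) d'" using f by metis
      then show ?thesis using w by (simp add: monomials_iff)
    qed
    ultimately show ?thesis using w k k' pp unfolding monomials_iff by auto
  qed
  moreover have "exchange m n (fst e) (x, y) 1 (x', y')" using exchange_cross[OF k p, of m n "fst e"] c by simp
  ultimately show ?thesis unfolding step_def using w k' e_def by blast
qed

lemma linked_normal:
  assumes l: "1 \<le> m - n"
  shows "w \<in> monomials m n M N d d' \<Longrightarrow> \<exists>hs ns. hs @ ns \<in> monomials m n M N d d' \<and>
    (\<forall>x\<in>set hs. is_half x) \<and> (\<forall>x\<in>set ns. \<not> is_half x) \<and> linked m n M N d d' w (hs @ ns)"
proof (induction "inversions w" arbitrary: w rule: less_induct)
  case less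
  show ?case using not_ordered_cases[of w]
  proof
    assume "\<exists>hs ns. w = hs @ ns \<and> (\<forall>x\<in>set hs. is_half x) \<and> (\<forall>x\<in>set ns. \<not> is_half x)"
    then show ?thesis using less.prems linked_refl by metis
  next
    assume "\<exists>u x y r. w = u @ [x, y] @ r \<and> \<not> is_half x \<and> is_half y"
    then obtain u x y r where w: "w = u @ [x, y] @ r" "\<not> is_half x" "is_half y" by blast
    obtain x' y' where s: "is_half x'" "\<not> is_half y'" "step m n M N d d' 1 w (u @ [x', y'] @ r)"
      using step_cross[OF l less.prems[unfolded w(1)] w(2,3)] w(1) by blast
    have "inversions (u @ [x', y'] @ r) < inversions w" using inversions_swap[OF w(2,3) s(1,2)] w(1) by simp
    moreover have "u @ [x', y'] @ r \<in> monomials m n M N d d'" using s(3) unfolding step_def by blast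
    ultimately show ?thesis using less.hyps linked_step[OF s(3)] linked_trans by blast
  qed
qed

section \<open>The crystal operators on monomials\<close>

definition half_word :: "nat \<Rightarrow> particle list \<Rightarrow> int list" where
  "half_word i w = map (half_letter i) (filter is_half w)"

definition rise :: "int list \<Rightarrow> nat \<Rightarrow> int" where
  "rise E k = (\<Sum>j<k. if E ! j = 0 then 1 else - 1)"

text \<open>The last minimum of \<open>rise\<close>, provided it is not the end of the word;
  \<open>trail\<close> records the first minimum by the letter in front of it.\<close>

definition lead :: "int list \<Rightarrow> nat \<Rightarrow> bool" where
  "lead E k \<longleftrightarrow> k < length E \<and> (\<forall>j\<le>length E. rise E k \<le> rise E j \<and> (k < j \<longrightarrow> rise E k < rise E j))"

definition trail :: "int list \<Rightarrow> nat \<Rightarrow> bool" where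
  "trail E k \<longleftrightarrow> k < length E \<and> (\<forall>j\<le>length E. rise E (Suc k) \<le> rise E j \<and> (j \<le> k \<longrightarrow> rise E (Suc k) < rise E j))"

text \<open>Here \<open>k\<close> counts spin-1/2 particles only, so it is a position in
  \<open>half_word\<close>; such positions are unaffected by crossings.\<close>

fun flip_nth :: "int \<Rightarrow> nat \<Rightarrow> particle list \<Rightarrow> particle list" where
  "flip_nth c k [] = []"
| "flip_nth c k (x # w) = (if is_half x then (case k of 0 \<Rightarrow> flip_half c x # w | Suc k' \<Rightarrow> x # flip_nth c k' w)
     else x # flip_nth c k w)"

lemma half_letter_01: "is_particle x \<Longrightarrow> is_half x \<Longrightarrow> half_letter i x = 0 \<or> half_letter i x = 1"
  by (cases x) auto

lemma filter_nth_exists: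
  "k < length (filter P w) \<Longrightarrow> \<exists>j<length w. P (w ! j) \<and> length (filter P (take j w)) = k"
proof (induction w arbitrary: k)
  case (Cons x w)
  show ?case
  proof (cases "P x \<and> k = 0")
    case True then show ?thesis by (intro exI[of _ 0]) auto
  next
    case False
    define k' where "k' = (if P x then k - 1 else k)"
    have "k' < length (filter P w)" using Cons.prems False by (auto simp: k'_def split: if_splits)
    from Cons.IH[OF this] obtain j where "j < length w" "P (w ! j)" "length (filter P (take j w)) = k'" by blast
    then show ?thesis using False by (intro exI[of _ "Suc j"]) (auto simp: k'_def)
  qed
qed simp

lemma filter_take_nth:
  "j < length w \<Longrightarrow> P (w ! j) \<Longrightarrow> filter P w ! length (filter P (take j w)) = w ! j \<and>
    length (filter P (take j w)) < length (filter P w) \<and>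
    length (filter P (take (Suc j) w)) = Suc (length (filter P (take j w)))"
proof (induction w arbitrary: j)
  case (Cons x w)
  then show ?case by (cases j) auto
qed simp

lemma filter_take_mono: "j \<le> j' \<Longrightarrow> length (filter P (take j w)) \<le> length (filter P (take j' w))"
proof -
  assume "j \<le> j'"
  then have "take j' w = take j w @ take (j' - j) (drop j w)" by (metis le_add_diff_inverse take_add)
  then show ?thesis by simp
qed

lemma flip_nth_update:
  "j < length w \<Longrightarrow> is_half (w ! j) \<Longrightarrow> flip_nth c (length (filter is_half (take j w))) w = w[j := flip_half c (w ! j)]"
proof (induction w arbitrary: j)
  case (Cons x w)
  then show ?case by (cases j) auto
qed simp

lemma rise_Suc: "rise E (Suc k) = rise E k + (if E ! k = 0 then 1 else - 1)"
  by (simp add: rise_def)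

lemma signature_word_monomial:
  assumes p: "\<forall>x\<in>set w. is_particle x"
  shows "signature_word (half_positions w) (<) (\<lambda>j. half_letter i (w ! j))
    (\<lambda>j. int (length (filter is_half (take j w)))) (\<lambda>t. rise (half_word i w) (nat t))"
proof
  let ?idx = "\<lambda>j. int (length (filter is_half (take j w)))"
  have pos: "j < length w" "is_half (w ! j)" if "j \<in> half_positions w" for j
    using that by (auto simp: half_positions_def)
  have less: "?idx x < ?idx y" if "x \<in> half_positions w" "x < y" for x y
    using filter_take_nth[where P = is_half, OF pos[OF that(1)]] filter_take_mono[of "Suc x" y is_half w] that(2) by simp
  show "inj_on ?idx (half_positions w)"
    by (rule inj_onI) (metis less linorder_neqE_nat order_less_irrefl)
  show "t \<in> ?idx ` half_positions w"
    if "x \<in> half_positions w" "y \<in> half_positions w" "?idx x \<le> t" "t \<le> ?idx y" for x y t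
  proof -
    have "nat t < length (filter is_half w)" using filter_take_nth[where P = is_half, OF pos[OF that(2)]] that(4) by linarith
    from filter_nth_exists[OF this] obtain j where "j < length w" "is_half (w ! j)" "length (filter is_half (take j w)) = nat t"
      by blast
    then show ?thesis using that(3) by (intro image_eqI[of _ _ j]) (auto simp: half_positions_def)
  qed
  show "x < y \<longleftrightarrow> ?idx x < ?idx y" if "x \<in> half_positions w" "y \<in> half_positions w" for x y
    using less[OF that(1), of y] less[OF that(2), of x] by (metis linorder_neqE_nat order_less_asym order_less_irrefl)
  show "half_letter i (w ! x) = 0 \<or> half_letter i (w ! x) = 1" if "x \<in> half_positions w" for x
    using pos[OF that] p half_letter_01 by simp
  have letter: "half_word i w ! length (filter is_half (take x w)) = half_letter i (w ! x)" if "x \<in> half_positions w" for x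
    using filter_take_nth[where P = is_half, OF pos[OF that]] by (simp add: half_word_def)
  show "rise (half_word i w) (nat (?idx x + 1)) = rise (half_word i w) (nat (?idx x)) + 1"
    if "x \<in> half_positions w" "half_letter i (w ! x) = 0" for x
    using letter[OF that(1)] that(2) by (simp add: nat_add_distrib rise_Suc)
  show "rise (half_word i w) (nat (?idx x + 1)) = rise (half_word i w) (nat (?idx x)) - 1"
    if "x \<in> half_positions w" "half_letter i (w ! x) = 1" for x
    using letter[OF that(1)] that(2) by (simp add: nat_add_distrib rise_Suc)
qed

lemma monomial_cuts:
  assumes "j \<in> half_positions w"
  shows "(\<lambda>j. int (length (filter is_half (take j w)))) ` half_positions w \<union>
    (\<lambda>j. int (length (filter is_half (take j w))) + 1) ` half_positions w = int ` {..length (filter is_half w)}"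
    (is "?A \<union> ?B = ?C")
proof
  show "?A \<union> ?B \<subseteq> ?C"
  proof
    fix t assume "t \<in> ?A \<union> ?B"
    then obtain j where j: "j \<in> half_positions w" "t = int (length (filter is_half (take j w))) \<or> t = int (length (filter is_half (take j w))) + 1"
      by blast
    then have "length (filter is_half (take j w)) < length (filter is_half w)"
      using filter_take_nth[of j w is_half] by (simp add: half_positions_def)
    then show "t \<in> ?C" using j(2)
      by (elim disjE) (auto intro: image_eqI[of _ _ "Suc (length (filter is_half (take j w)))"])
  qed
  show "?C \<subseteq> ?A \<union> ?B"
  proof
    fix t assume "t \<in> ?C"
    then obtain k where k: "t = int k" "k \<le> length (filter is_half w)" by auto
    have M: "0 < length (filter is_half w)" using assms filter_take_nth[of j w is_half] by (auto simp: half_positions_def)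
    show "t \<in> ?A \<union> ?B"
    proof (cases "k < length (filter is_half w)")
      case True
      from filter_nth_exists[OF this] obtain j where "j < length w" "is_half (w ! j)" "length (filter is_half (take j w)) = k" by blast
      then have "t \<in> ?A" using k by (intro image_eqI[of _ _ j]) (auto simp: half_positions_def)
      then show ?thesis ..
    next
      case False
      then have "k - 1 < length (filter is_half w)" "k \<noteq> 0" using M k by auto
      from filter_nth_exists[OF this(1)] obtain j where "j < length w" "is_half (w ! j)" "length (filter is_half (take j w)) = k - 1" by blast
      then have "t \<in> ?B" using k \<open>k \<noteq> 0\<close> by (intro image_eqI[of _ _ j]) (auto simp: half_positions_def)
      then show ?thesis ..
    qed
  qed
qed

lemma rise_bounded: "\<exists>c. \<forall>k\<le>L. c \<le> rise E k"
proof -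
  have "- int k \<le> rise E k" for k by (induction k) (auto simp: rise_Suc rise_def)
  then show ?thesis by (intro exI[of _ "- int L"]) (meson le_imp_neg_le of_nat_mono order_trans)
qed

lemma monomial_f_iff:
  assumes p: "\<forall>x\<in>set w. is_particle x"
  shows "monomial_f i w = Some w' \<longleftrightarrow> (\<exists>k. lead (half_word i w) k \<and> w' = flip_nth (- 1) k w)"
proof -
  interpret signature_word "half_positions w" "(<)" "\<lambda>j. half_letter i (w ! j)"
    "\<lambda>j. int (length (filter is_half (take j w)))" "\<lambda>t. rise (half_word i w) (nat t)"
    by (rule signature_word_monomial[OF p])
  define E where "E = half_word i w"
  have lenE: "length E = length (filter is_half w)" by (simp add: E_def half_word_def)
  have cuts: "cuts = int ` {..length E}" if "j \<in> half_positions w" for j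
    unfolding cuts_def lenE by (rule monomial_cuts[OF that])
  obtain c where c: "\<And>k. k \<le> length E \<Longrightarrow> c \<le> rise E k" using rise_bounded by blast
  have bnd: "c \<le> rise (half_word i w) (nat t)" if t: "t \<in> cuts" for t
  proof -
    obtain j where "j \<in> half_positions w" using t unfolding cuts_def by blast
    then have "t \<in> int ` {..length E}" using t cuts by blast
    then show ?thesis using c by (auto simp: E_def)
  qed
  have pos: "f_position (half_positions w) (<) (\<lambda>j. half_letter i (w ! j)) = Some j \<longleftrightarrow>
      j \<in> half_positions w \<and> lead E (length (filter is_half (take j w)))" for j
  proof (cases "j \<in> half_positions w")
    case True
    then have "length (filter is_half (take j w)) < length E"
      using filter_take_nth[of j w is_half] by (simp add: half_positions_def lenE)
    moreover have "f_position (half_positions w) (<) (\<lambda>j. half_letter i (w ! j)) = Some j \<longleftrightarrow>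
        j \<in> half_positions w \<and> (\<forall>t\<in>cuts. rise E (nat (int (length (filter is_half (take j w))))) \<le> rise E (nat t) \<and>
        (int (length (filter is_half (take j w))) < t \<longrightarrow> rise E (nat (int (length (filter is_half (take j w))))) < rise E (nat t)))"
      unfolding E_def by (rule f_position_iff) (rule bnd)
    ultimately show ?thesis unfolding cuts[OF True] using True by (auto simp: lead_def nat_add_distrib)
  next
    case False
    have "f_position (half_positions w) (<) (\<lambda>j. half_letter i (w ! j)) = Some j \<longrightarrow> j \<in> half_positions w"
      using f_position_iff[of c j] bnd by blast
    then show ?thesis using False by blast
  qed
  show ?thesis unfolding monomial_f_def map_option_eq_Some pos E_def[symmetric]
  proof
    assume "\<exists>j. (j \<in> half_positions w \<and> lead E (length (filter is_half (take j w)))) \<and> w[j := flip_half (- 1) (w ! j)] = w'"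
    then show "\<exists>k. lead E k \<and> w' = flip_nth (- 1) k w" using flip_nth_update by (force simp: half_positions_def)
  next
    assume "\<exists>k. lead E k \<and> w' = flip_nth (- 1) k w"
    then obtain k where k: "lead E k" "w' = flip_nth (- 1) k w" by blast
    then have "k < length (filter is_half w)" by (simp add: lead_def lenE)
    from filter_nth_exists[OF this] obtain j where "j < length w" "is_half (w ! j)" "length (filter is_half (take j w)) = k" by blast
    then show "\<exists>j. (j \<in> half_positions w \<and> lead E (length (filter is_half (take j w)))) \<and> w[j := flip_half (- 1) (w ! j)] = w'"
      using k flip_nth_update[of j w "- 1"] by (intro exI[of _ j]) (auto simp: half_positions_def)
  qed
qed

lemma monomial_e_iff:
  assumes p: "\<forall>x\<in>set w. is_particle x"
  shows "monomial_e i w = Some w' \<longleftrightarrow> (\<exists>k. trail (half_word i w) k \<and> w' = flip_nth 1 k w)"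
proof -
  interpret signature_word "half_positions w" "(<)" "\<lambda>j. half_letter i (w ! j)"
    "\<lambda>j. int (length (filter is_half (take j w)))" "\<lambda>t. rise (half_word i w) (nat t)"
    by (rule signature_word_monomial[OF p])
  define E where "E = half_word i w"
  have lenE: "length E = length (filter is_half w)" by (simp add: E_def half_word_def)
  have cuts: "cuts = int ` {..length E}" if "j \<in> half_positions w" for j
    unfolding cuts_def lenE by (rule monomial_cuts[OF that])
  obtain c where c: "\<And>k. k \<le> length E \<Longrightarrow> c \<le> rise E k" using rise_bounded by blast
  have bnd: "c \<le> rise (half_word i w) (nat t)" if t: "t \<in> cuts" for t
  proof -
    obtain j where "j \<in> half_positions w" using t unfolding cuts_def by blast
    then have "t \<in> int ` {..length E}" using t cuts by blast
    then show ?thesis using c by (auto simp: E_def)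
  qed
  have pos: "e_position (half_positions w) (<) (\<lambda>j. half_letter i (w ! j)) = Some j \<longleftrightarrow>
      j \<in> half_positions w \<and> trail E (length (filter is_half (take j w)))" for j
  proof (cases "j \<in> half_positions w")
    case True
    then have "length (filter is_half (take j w)) < length E"
      using filter_take_nth[of j w is_half] by (simp add: half_positions_def lenE)
    moreover have "e_position (half_positions w) (<) (\<lambda>j. half_letter i (w ! j)) = Some j \<longleftrightarrow>
        j \<in> half_positions w \<and> (\<forall>t\<in>cuts. rise E (nat (int (length (filter is_half (take j w))) + 1)) \<le> rise E (nat t) \<and>
        (t \<le> int (length (filter is_half (take j w))) \<longrightarrow> rise E (nat (int (length (filter is_half (take j w))) + 1)) < rise E (nat t)))"
      unfolding E_def by (rule e_position_iff) (rule bnd)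
    ultimately show ?thesis unfolding cuts[OF True] using True by (auto simp: trail_def nat_add_distrib)
  next
    case False
    have "e_position (half_positions w) (<) (\<lambda>j. half_letter i (w ! j)) = Some j \<longrightarrow> j \<in> half_positions w"
      using e_position_iff[of c j] bnd by blast
    then show ?thesis using False by blast
  qed
  show ?thesis unfolding monomial_e_def map_option_eq_Some pos E_def[symmetric]
  proof
    assume "\<exists>j. (j \<in> half_positions w \<and> trail E (length (filter is_half (take j w)))) \<and> w[j := flip_half 1 (w ! j)] = w'"
    then show "\<exists>k. trail E k \<and> w' = flip_nth 1 k w" using flip_nth_update by (force simp: half_positions_def)
  next
    assume "\<exists>k. trail E k \<and> w' = flip_nth 1 k w"
    then obtain k where k: "trail E k" "w' = flip_nth 1 k w" by blast
    then have "k < length (filter is_half w)" by (simp add: trail_def lenE)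
    from filter_nth_exists[OF this] obtain j where "j < length w" "is_half (w ! j)" "length (filter is_half (take j w)) = k" by blast
    then show "\<exists>j. (j \<in> half_positions w \<and> trail E (length (filter is_half (take j w)))) \<and> w[j := flip_half 1 (w ! j)] = w'"
      using k flip_nth_update[of j w 1] by (intro exI[of _ j]) (auto simp: half_positions_def)
  qed
qed

text \<open>The letters next to the one changed by \<open>f\<close> (with \<open>c = - 1\<close>) or \<open>e\<close> (with \<open>c = 1\<close>).\<close>

definition near :: "int \<Rightarrow> int list \<Rightarrow> nat \<Rightarrow> bool" where
  "near c E k \<longleftrightarrow> k < length E \<and> (c = 1 \<or> c = - 1) \<and> E ! k = (if c = 1 then 1 else 0) \<and>
     (0 < k \<longrightarrow> E ! (k - 1) = 1) \<and> (Suc k < length E \<longrightarrow> E ! Suc k = 0)"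

text \<open>Immediately before a last minimum there is a down-step. After it there is an up-step,
  and a second one, since otherwise the minimal height would be attained again.\<close>

lemma lead_near:
  assumes "lead E k" "set E \<subseteq> {0, 1}" shows "near (- 1) E k"
proof -
  have k: "k < length E" and h: "\<And>j. j \<le> length E \<Longrightarrow> rise E k \<le> rise E j \<and> (k < j \<longrightarrow> rise E k < rise E j)"
    using assms by (auto simp: lead_def)
  have b: "E ! j = 0 \<or> E ! j = 1" if "j < length E" for j using assms(2) nth_mem[OF that] by auto
  have 1: "E ! k = 0" using h[of "Suc k"] k by (auto simp: rise_Suc split: if_splits)
  have 2: "E ! (k - 1) = 1" if "0 < k"
  proof -
    have "k - 1 \<le> length E" "k - 1 < length E" "Suc (k - 1) = k" using k that by auto
    then show ?thesis using h[of "k - 1"] rise_Suc[of E "k - 1"] b[of "k - 1"] by (auto split: if_splits)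
  qed
  have 3: "E ! Suc k = 0" if "Suc k < length E"
    using h[of "Suc (Suc k)"] that 1 b[of "Suc k"] by (auto simp: rise_Suc split: if_splits)
  show ?thesis using k 1 2 3 by (simp add: near_def)
qed

lemma trail_near:
  assumes "trail E k" "set E \<subseteq> {0, 1}" shows "near 1 E k"
proof -
  have k: "k < length E" and h: "\<And>j. j \<le> length E \<Longrightarrow> rise E (Suc k) \<le> rise E j \<and> (j \<le> k \<longrightarrow> rise E (Suc k) < rise E j)"
    using assms by (auto simp: trail_def)
  have b: "E ! j = 0 \<or> E ! j = 1" if "j < length E" for j using assms(2) nth_mem[OF that] by auto
  have 1: "E ! k = 1" using h[of k] k b[of k] by (auto simp: rise_Suc split: if_splits)
  have 2: "E ! (k - 1) = 1" if "0 < k"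
  proof -
    have "k - 1 \<le> length E" "k - 1 < length E" "Suc (k - 1) = k" "k - 1 \<le> k" using k that by auto
    then show ?thesis
      using h[of "k - 1"] rise_Suc[of E "k - 1"] rise_Suc[of E k] 1 b[of "k - 1"] by (auto split: if_splits)
  qed
  have 3: "E ! Suc k = 0" if "Suc k < length E"
    using h[of "Suc (Suc k)"] that b[of "Suc k"] by (auto simp: rise_Suc split: if_splits)
  show ?thesis using k 1 2 3 by (simp add: near_def)
qed

lemma rise_update:
  assumes "k < length E" "E ! k = v" "v = 0 \<or> v = 1"
  shows "rise (E[k := 1 - v]) j = rise E j + (if k < j then (if v = 0 then - 2 else 2) else 0)"
proof (induction j)
  case (Suc j)
  then show ?case using assms by (cases "j = k") (auto simp: rise_Suc nth_list_update)
qed (simp add: rise_def)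

text \<open>Turning the up-step behind the last minimum into a down-step lowers everything after it
  by two, so the next cut becomes the first minimum.\<close>

lemma lead_imp_trail:
  assumes "lead E k" "set E \<subseteq> {0, 1}" shows "trail (E[k := 1]) k"
proof -
  have k: "k < length E" "E ! k = 0" using lead_near[OF assms] by (auto simp: near_def)
  have r: "rise (E[k := 1]) j = rise E j + (if k < j then - 2 else 0)" for j
    using rise_update[OF k] by simp
  have h: "rise E k \<le> rise E j \<and> (k < j \<longrightarrow> rise E k < rise E j)" if "j \<le> length E" for j
    using assms(1) that by (simp add: lead_def)
  have "rise (E[k := 1]) (Suc k) \<le> rise (E[k := 1]) j \<and> (j \<le> k \<longrightarrow> rise (E[k := 1]) (Suc k) < rise (E[k := 1]) j)"
    if "j \<le> length E" for j
    using h[OF that] k unfolding r rise_Suc by (cases "k < j") auto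
  then show ?thesis using k by (simp add: trail_def)
qed

lemma trail_imp_lead:
  assumes "trail E k" "set E \<subseteq> {0, 1}" shows "lead (E[k := 0]) k"
proof -
  have k: "k < length E" "E ! k = 1" using trail_near[OF assms] by (auto simp: near_def)
  have r: "rise (E[k := 0]) j = rise E j + (if k < j then 2 else 0)" for j
    using rise_update[OF k] by simp
  have h: "rise E (Suc k) \<le> rise E j \<and> (j \<le> k \<longrightarrow> rise E (Suc k) < rise E j)" if "j \<le> length E" for j
    using assms(1) that by (simp add: trail_def)
  have "rise (E[k := 0]) k \<le> rise (E[k := 0]) j \<and> (k < j \<longrightarrow> rise (E[k := 0]) k < rise (E[k := 0]) j)"
    if "j \<le> length E" for j
    using h[OF that] k unfolding r rise_Suc by (cases "k < j") auto
  then show ?thesis using k by (simp add: lead_def)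
qed

lemma flip_half_simps [simp]:
  "sg (flip_half c x) = sg x" "is_half (flip_half c x) = is_half x" "move (flip_half c x) = move x"
  "is_half x \<Longrightarrow> kap (flip_half c x) = kap x + c" "is_half x \<Longrightarrow> tag (flip_half c x) = 1 - tag x"
  "is_half x \<Longrightarrow> half_letter i (flip_half c x) = 1 - half_letter i x"
  by (cases x; auto simp: fun_eq_iff)+

lemma flip_half_inverse: "is_half x \<Longrightarrow> flip_half (- c) (flip_half c x) = x"
  by (cases x) auto

lemma flip_nth_inverse: "flip_nth (- c) k (flip_nth c k w) = w"
  by (induction w arbitrary: k) (auto simp: flip_half_inverse split: nat.splits)

lemma flip_nth_maps: "map move (flip_nth c k w) = map move w" "map is_half (flip_nth c k w) = map is_half w"
  by (induction w arbitrary: k) (auto split: nat.splits)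

lemma is_particle_flip: "is_particle x \<Longrightarrow> c = 1 \<or> c = - 1 \<Longrightarrow> is_particle (flip_half c x)"
  by (cases x) (auto simp: parity_sign_def split: if_splits)

lemma flip_nth_particles:
  "\<forall>x\<in>set w. is_particle x \<Longrightarrow> c = 1 \<or> c = - 1 \<Longrightarrow> \<forall>x\<in>set (flip_nth c k w). is_particle x"
  by (induction w arbitrary: k) (auto simp: is_particle_flip split: nat.splits)

lemma flip_nth_monomials:
  assumes "w \<in> monomials m n M N d d'" "c = 1 \<or> c = - 1"
  shows "flip_nth c k w \<in> monomials m n M N d d'"
  by (rule monomials_replace[OF assms(1)])
     (use assms flip_nth_particles flip_nth_maps in \<open>auto simp: monomials_iff\<close>)

lemma half_word_flip: "half_word i (flip_nth c k w) = (half_word i w)[k := 1 - half_word i w ! k]"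
proof (induction w arbitrary: k)
  case (Cons x w)
  then show ?case by (cases k) (auto simp: half_word_def)
qed (simp add: half_word_def)

lemma half_word_01: "\<forall>x\<in>set w. is_particle x \<Longrightarrow> set (half_word i w) \<subseteq> {0, 1}"
  using half_letter_01 by (fastforce simp: half_word_def)

lemma flip_nth_append:
  "flip_nth c k (u @ v) = (if k < length (filter is_half u) then flip_nth c k u @ v
     else u @ flip_nth c (k - length (filter is_half u)) v)"
  by (induction u arbitrary: k) (auto split: nat.splits)

lemma half_letter_eq_iff:
  "is_particle x \<Longrightarrow> is_particle y \<Longrightarrow> is_half x \<Longrightarrow> is_half y \<Longrightarrow> half_letter i x = half_letter i y \<longleftrightarrow> tag x = tag y"
  by (cases x; cases y) auto

lemma tag_01: "is_particle x \<Longrightarrow> is_half x \<Longrightarrow> tag x = 0 \<or> tag x = 1"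
  by (cases x) auto

text \<open>The neighbouring letter is known by \<open>near\<close>, so the flip makes equal tags
  different or different tags equal in a predictable way, and \<open>nu\<close> changes by exactly
  the index shift \<open>c\<close>.\<close>

lemma nu_flip_left:
  assumes "is_particle x" "is_particle y" "is_half x" "is_half y" "c = 1 \<or> c = - 1"
    "half_letter i x = (if c = 1 then 1 else 0)" "half_letter i y = 0"
  shows "nu (flip_half c x) y = nu x y + c"
  using half_letter_eq_iff[of x y i] tag_01[of x] tag_01[of y] assms
  by (auto simp: nu_def delta_def split: if_splits)

lemma nu_flip_right:
  assumes "is_particle x" "is_particle y" "is_half x" "is_half y" "c = 1 \<or> c = - 1"
    "half_letter i y = (if c = 1 then 1 else 0)" "half_letter i x = 1"
  shows "nu x (flip_half c y) = nu x y - c"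
  using half_letter_eq_iff[of x y i] tag_01[of x] tag_01[of y] assms
  by (auto simp: nu_def delta_def split: if_splits)

lemma with_kap_flip: "is_half x \<Longrightarrow> with_kap k (flip_half c x) = flip_half c (with_kap (k - c) x)"
  by (cases x) auto

lemma cross_flip: "is_half h \<Longrightarrow> cross l a x (flip_half c h) = (flip_half c (fst (cross l a x h)), snd (cross l a x h))"
  by (cases h) (auto simp: cross_def turns_def)

lemma half_word_append: "half_word i (u @ v) = half_word i u @ half_word i v"
  by (simp add: half_word_def)

lemma foldr_move_flip: "foldr move (flip_nth c k r) d = foldr move r d"
proof -
  have "foldr move v' d = foldr move v d" if "map move v' = map move v" for v v'
    using that
  proof (induction v arbitrary: v')
    case (Cons x v)
    then obtain y u where v': "v' = y # u" by (cases v') auto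
    then show ?case using Cons.IH[of u] Cons.prems by simp
  qed simp
  then show ?thesis using flip_nth_maps(1) by blast
qed

text \<open>Compatibility of the operators with the relations. If the flipped particle belongs to
  the exchanged pair, its index shift is compensated by the change of \<open>nu\<close> with its
  partner; a crossing ignores the letter altogether.\<close>

lemma step_flip:
  assumes st: "step m n M N d d' b w z" and nr: "near c (half_word i w) k"
  shows "half_word i z = half_word i w \<and> step m n M N d d' b (flip_nth c k w) (flip_nth c k z)"
proof -
  obtain u r x y x' y' where w: "w = u @ [x, y] @ r" "z = u @ [x', y'] @ r"
    "w \<in> monomials m n M N d d'" "z \<in> monomials m n M N d d'"
    "exchange m n (fst (foldr move r d')) (x, y) b (x', y')" using st unfolding step_def by blast
  have p: "is_particle x" "is_particle y" using w by (auto simp: monomials_iff)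
  have c: "c = 1 \<or> c = - 1" using nr by (simp add: near_def)
  define a where "a = fst (foldr move r d')"
  note ex = exchange_cases[OF w(5)[folded a_def] p]
  have lw: "half_letter i (with_kap q v) = half_letter i v" if "is_half v" for q v using that by (cases v) auto
  have lt: "half_letter i (turn q v) = half_letter i v" if "is_half v" for q v using that by (cases v) auto
  have hw: "half_word i [x', y'] = half_word i [x, y]"
    using ex by (auto simp: half_word_def lw lt cross_def split: if_splits)
  have eqw: "half_word i z = half_word i w" unfolding w half_word_append hw ..
  define q where "q = length (filter is_half u)"
  have len2: "length (filter is_half [x', y']) = length (filter is_half [x, y])"
    using hw by (metis half_word_def length_map)
  have mon: "flip_nth c k w \<in> monomials m n M N d d'" "flip_nth c k z \<in> monomials m n M N d d'"
    using flip_nth_monomials w(3,4) c by auto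
  have stepI: ?thesis if "flip_nth c k w = u1 @ [x1, y1] @ r1" "flip_nth c k z = u1 @ [x2, y2] @ r1"
     "exchange m n (fst (foldr move r1 d')) (x1, y1) b (x2, y2)" for u1 x1 y1 x2 y2 r1
    using that mon eqw unfolding step_def by blast
  consider "k < q" | "q \<le> k" "k - q < length (filter is_half [x, y])" | "q \<le> k" "length (filter is_half [x, y]) \<le> k - q"
    by linarith
  then show ?thesis
  proof cases
    case 1
    have "flip_nth c k w = flip_nth c k u @ [x, y] @ r" "flip_nth c k z = flip_nth c k u @ [x', y'] @ r"
      using 1 unfolding w flip_nth_append[of c k u] q_def by auto
    then show ?thesis by (rule stepI) (rule w(5))
  next
    case 3
    have "flip_nth c k w = u @ [x, y] @ flip_nth c (k - q - length (filter is_half [x, y])) r"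
      "flip_nth c k z = u @ [x', y'] @ flip_nth c (k - q - length (filter is_half [x, y])) r"
      using 3 len2 unfolding w flip_nth_append[of c k u] q_def[symmetric] flip_nth_append[of c "k - q"] by auto
    then show ?thesis by (rule stepI) (simp only: foldr_move_flip w(5))
  next
    case 2
    have fw: "flip_nth c k w = u @ flip_nth c (k - q) [x, y] @ r" "flip_nth c k z = u @ flip_nth c (k - q) [x', y'] @ r"
      using 2 len2 unfolding w flip_nth_append[of c k u] q_def[symmetric] flip_nth_append[of c "k - q"] by auto
    have E: "half_word i w = half_word i u @ half_word i [x, y] @ half_word i r" unfolding w by (simp only: half_word_append)
    have lenu: "length (half_word i u) = q" by (simp add: half_word_def q_def)
    from ex show ?thesis
    proof
      assume e: "is_half x = is_half y \<and> b = - 1 \<and> x' = with_kap (kap y + nu x y) x \<and> y' = with_kap (kap x - nu x y) y"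
      have h: "is_half x" "is_half y" using 2(2) e by (auto split: if_splits)
      then have h': "is_half x'" "is_half y'" using e by auto
      have Exy: "half_word i [x, y] = [half_letter i x, half_letter i y]" using h by (simp add: half_word_def)
      have "k - q = 0 \<or> k - q = 1" using 2(2) h by auto
      then show ?thesis
      proof
        assume k0: "k - q = 0"
        then have kq: "k = q" using 2 by simp
        have "half_word i w ! k = half_letter i x" "half_word i w ! Suc k = half_letter i y" "Suc k < length (half_word i w)"
          using E Exy lenu kq by (auto simp: nth_append)
        then have l: "half_letter i x = (if c = 1 then 1 else 0)" "half_letter i y = 0"
          using nr by (auto simp: near_def)
        have nu: "nu (flip_half c x) y = nu x y + c" by (rule nu_flip_left[OF p h c l])
        have 1: "flip_nth c k w = u @ [flip_half c x, y] @ r" "flip_nth c k z = u @ [flip_half c x', y'] @ r"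
          using fw k0 h h' by auto
        show ?thesis
        proof (rule stepI[OF 1])
          have "exchange m n (fst (foldr move r d')) (flip_half c x, y) (- 1)
            (with_kap (kap y + nu (flip_half c x) y) (flip_half c x), with_kap (kap (flip_half c x) - nu (flip_half c x) y) y)"
            by (rule exchange_same_kind) (use h in simp)
          then show "exchange m n (fst (foldr move r d')) (flip_half c x, y) b (flip_half c x', y')"
            using e h nu by (simp add: with_kap_flip)
        qed
      next
        assume k1: "k - q = 1"
        then have kq: "k = Suc q" using 2 by simp
        have "half_word i w ! k = half_letter i y" "half_word i w ! (k - 1) = half_letter i x"
          using E Exy lenu kq by (auto simp: nth_append)
        then have l: "half_letter i y = (if c = 1 then 1 else 0)" "half_letter i x = 1"
          using nr kq by (auto simp: near_def)
        have nu: "nu x (flip_half c y) = nu x y - c" by (rule nu_flip_right[OF p h c l])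
        have 1: "flip_nth c k w = u @ [x, flip_half c y] @ r" "flip_nth c k z = u @ [x', flip_half c y'] @ r"
          using fw k1 h h' by auto
        show ?thesis
        proof (rule stepI[OF 1])
          have "exchange m n (fst (foldr move r d')) (x, flip_half c y) (- 1)
            (with_kap (kap (flip_half c y) + nu x (flip_half c y)) x, with_kap (kap x - nu x (flip_half c y)) (flip_half c y))"
            by (rule exchange_same_kind) (use h in simp)
          then show "exchange m n (fst (foldr move r d')) (x, flip_half c y) b (x', flip_half c y')"
            using e h nu by (simp add: with_kap_flip)
        qed
      qed
    next
      assume e: "\<not> is_half x \<and> is_half y \<and> b = 1 \<and> (x', y') = cross (m - n) a x y"
      then have h': "is_half x'" "\<not> is_half y'" by (auto simp: cross_def split: if_splits)
      have k0: "k - q = 0" using 2(2) e by simp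
      have 1: "flip_nth c k w = u @ [x, flip_half c y] @ r" "flip_nth c k z = u @ [flip_half c x', y'] @ r"
        using fw k0 e h' by auto
      show ?thesis
      proof (rule stepI[OF 1])
        have "exchange m n a (x, flip_half c y) 1 (cross (m - n) a x (flip_half c y))"
          by (rule exchange_cross) (use e p c is_particle_flip in auto)
        moreover have "cross (m - n) a x (flip_half c y) = (flip_half c x', y')"
          using cross_flip[of y "m - n" a x c] e by (metis fst_conv snd_conv)
        ultimately show "exchange m n (fst (foldr move r d')) (x, flip_half c y) b (flip_half c x', y')"
          using e by (simp add: a_def)
      qed
    qed
  qed
qed

lemma step_half_word:
  assumes "step m n M N d d' b w z" shows "half_word i z = half_word i w"
proof -
  obtain u r x y x' y' where w: "w = u @ [x, y] @ r" "z = u @ [x', y'] @ r"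
    "w \<in> monomials m n M N d d'" "exchange m n (fst (foldr move r d')) (x, y) b (x', y')"
    using assms unfolding step_def by blast
  have p: "is_particle x" "is_particle y" using w by (auto simp: monomials_iff)
  have lw: "half_letter i (with_kap q v) = half_letter i v" if "is_half v" for q v using that by (cases v) auto
  have lt: "half_letter i (turn q v) = half_letter i v" if "is_half v" for q v using that by (cases v) auto
  have hw: "half_word i [x', y'] = half_word i [x, y]"
    using exchange_cases[OF w(4) p] by (auto simp: half_word_def lw lt cross_def split: if_splits)
  show ?thesis unfolding w half_word_append hw ..
qed

text \<open>The change of \<open>nu\<close> to the left of the flipped particle cancels the change
  of its index, and the change to its right restores the accumulated sum for the later particles. A
  flipped first particle has no left neighbour, which leaves a uniform shift.\<close>

lemma straight_flip:
  "\<forall>x\<in>set w. is_half x \<and> is_particle x \<Longrightarrow> near c (half_word i w) k \<Longrightarrow>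
    straight b (flip_nth c k w) = map (\<lambda>u. u + (if k = 0 then c else 0)) (straight b w)"
proof (induction w arbitrary: k b)
  case (Cons x w)
  have x: "is_half x" "is_particle x" and w: "\<forall>x\<in>set w. is_half x \<and> is_particle x" using Cons.prems by auto
  have E: "half_word i (x # w) = half_letter i x # half_word i w" using x by (simp add: half_word_def)
  have c: "c = 1 \<or> c = - 1" using Cons.prems by (simp add: near_def)
  show ?case
  proof (cases k)
    case 0
    have lx: "half_letter i x = (if c = 1 then 1 else 0)" using Cons.prems(2) 0 E by (simp add: near_def)
    show ?thesis
    proof (cases w)
      case Nil then show ?thesis using 0 x by simp
    next
      case (Cons y v)
      then have y: "is_half y" "is_particle y" using w by auto
      have hw: "half_word i w = half_letter i y # half_word i v" using Cons y by (simp add: half_word_def)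
      have "half_letter i y = 0" using \<open>near c (half_word i (x # w)) k\<close> 0 unfolding E hw near_def by simp
      then have nu: "nu (flip_half c x) y = nu x y + c" using nu_flip_left[of x y c i] x y c lx by simp
      have "straight (b + (nu x y + c)) w = map (\<lambda>u. u + c) (straight (b + nu x y) w)"
        using straight_add[of "b + nu x y" c w] by (simp add: add.assoc)
      then show ?thesis using 0 x Cons nu by (simp add: algebra_simps)
    qed
  next
    case (Suc k')
    have nr: "near c (half_word i w) k'"
      using Cons.prems(2) Suc E unfolding near_def by (cases k') auto
    note IH = Cons.IH[OF w nr]
    have "w \<noteq> []" using nr by (auto simp: near_def half_word_def)
    then obtain y v where w': "w = y # v" by (cases w) auto
    then have y: "is_half y" "is_particle y" using w by auto
    have hw: "half_word i w = half_letter i y # half_word i v" using w' y by (simp add: half_word_def)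
    show ?thesis
    proof (cases k')
      case 0
      have "half_letter i x = 1" using Cons.prems(2) Suc 0 unfolding E hw near_def by simp
      moreover have "half_letter i y = (if c = 1 then 1 else 0)" using nr 0 unfolding hw near_def by simp
      ultimately have nu: "nu x (flip_half c y) = nu x y - c" using nu_flip_right[of x y c i] x y c by simp
      have h: "nu_head x (flip_nth c k' w) = nu_head x w - c" using 0 w' y nu by simp
      have "straight (b + (nu_head x w - c)) (flip_nth c k' w) = map (\<lambda>u. u + c) (straight (b + (nu_head x w - c)) w)"
        using IH 0 by simp
      also have "\<dots> = straight (b + (nu_head x w - c) + c) w" by (rule straight_add[symmetric])
      also have "b + (nu_head x w - c) + c = b + nu_head x w" by simp
      finally show ?thesis using Suc x h by simp
    next
      case (Suc k'')
      then have h: "nu_head x (flip_nth c k' w) = nu_head x w" using w' y by simp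
      show ?thesis using IH h \<open>k = Suc k'\<close> Suc x by simp
    qed
  qed
qed simp

section \<open>Ordered monomials as representatives of the nonzero classes, and the induced
  operators\<close>

definition ordered :: "particle list \<Rightarrow> bool" where
  "ordered w \<longleftrightarrow> (\<exists>hs ns. w = hs @ ns \<and> (\<forall>x\<in>set hs. is_half x) \<and> (\<forall>x\<in>set ns. \<not> is_half x) \<and>
     sorted_wrt (<) (straight 0 hs) \<and> sorted_wrt (<) (straight 0 ns))"

locale particle_space =
  fixes m n :: int and d d' :: domain
  assumes l_pos: "1 \<le> m - n"
begin

abbreviation mon where "mon M N \<equiv> monomials m n M N d d'"
abbreviation R where "R M N \<equiv> relations m n M N d d'"
abbreviation linked' where "linked' M N \<equiv> linked m n M N d d'"

definition cls :: "nat \<Rightarrow> nat \<Rightarrow> particle list \<Rightarrow> (particle list \<Rightarrow>\<^sub>0 'k::field_char_0) set" where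
  "cls M N w = signed_class (R M N) (vec w)"

lemma step_cls: "step m n M N d d' c w z \<Longrightarrow> cls M N w = cls M N z"
  unfolding cls_def using step_relations[OF l_pos] by (intro signed_class_eqI) blast

lemma linked_cls: "linked' M N w z \<Longrightarrow> cls M N w = cls M N z"
  unfolding linked_def
  by (induction rule: rtranclp_induct) (auto dest: step_cls)

lemma zero_class: "signed_class (R M N) v = R M N \<longleftrightarrow> v \<in> R M N"
proof
  assume "signed_class (R M N) v = R M N"
  moreover have "v \<in> signed_class (R M N) v" by (simp add: signed_class_def relations_zero)
  ultimately show "v \<in> R M N" by simp
next
  assume v: "v \<in> R M N"
  have "signed_class (R M N) v = signed_class (R M N) 0" by (rule signed_class_eqI) (use v in simp)
  then show "signed_class (R M N) v = R M N" by (simp add: signed_class_def)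
qed

text \<open>An exchange fixing a monomial makes it equal to its own negative in the quotient, and
  two is invertible.\<close>

lemma step_self_zero:
  assumes "step m n M N d d' (- 1) w w"
  shows "(vec w :: particle list \<Rightarrow>\<^sub>0 'k::field_char_0) \<in> R M N"
proof -
  have "(vec w + vec w :: particle list \<Rightarrow>\<^sub>0 'k) \<in> R M N"
    using step_relations[OF l_pos assms, where 'k = 'k] by simp
  then have "scale (1 / 2) (vec w + vec w :: particle list \<Rightarrow>\<^sub>0 'k) \<in> R M N" by (rule relations_scale)
  moreover have "scale (1 / 2) (vec w + vec w :: particle list \<Rightarrow>\<^sub>0 'k) = vec w"
    by (rule poly_mapping_eqI) (simp add: lookup_scale lookup_add)
  ultimately show ?thesis by simp
qed

text \<open>Transposing two equal neighbouring positions gives back the same positions and shapes,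
  hence the same monomial, but with sign -1.\<close>

lemma sorted_step_self:
  assumes mon: "u @ w @ r \<in> mon M N" and kinds: "(\<forall>x\<in>set w. is_half x) \<or> (\<forall>x\<in>set w. \<not> is_half x)"
    and s: "sorted (straight 0 w)" "\<not> distinct (straight 0 w)"
  shows "step m n M N d d' (- 1) (u @ w @ r) (u @ w @ r)"
proof -
  have "adj (straight 0 w) (straight 0 w)" by (rule sorted_not_distinct[OF s])
  from adj_straight[OF this] obtain v x y t where v: "w = v @ [x, y] @ t"
    "straight 0 w = straight 0 (v @ [with_kap (kap y + nu x y) x, with_kap (kap x - nu x y) y] @ t)" by blast
  define w'' where "w'' = v @ [with_kap (kap y + nu x y) x, with_kap (kap x - nu x y) y] @ t"
  have "map shape w = map shape w''" by (simp add: v(1) w''_def)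
  then have w: "w = w''" using straight_inj v(2) w''_def by blast
  have "is_half x = is_half y" using kinds v(1) by auto
  then have "step m n M N d d' (- 1) (u @ w @ r) (u @ w'' @ r)"
    using step_same_kind[of "u @ v" x y "t @ r" m n M N d d'] mon v(1) by (simp add: w''_def)
  then show ?thesis using w by simp
qed

lemma linked_ordered:
  assumes w: "w \<in> mon M N"
  shows "(\<exists>w0\<in>mon M N. ordered w0 \<and> linked' M N w w0) \<or> (\<exists>w0. linked' M N w w0 \<and> step m n M N d d' (- 1) w0 w0)"
proof -
  obtain hs ns where 1: "hs @ ns \<in> mon M N" "\<forall>x\<in>set hs. is_half x" "\<forall>x\<in>set ns. \<not> is_half x" "linked' M N w (hs @ ns)"
    using linked_normal[OF l_pos w] by blast
  have kind: "(\<forall>x\<in>set v'. is_half x = b)" if "map shape v' = map shape v" "\<forall>x\<in>set v. is_half x = b" for v v' b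
  proof -
    have "map is_half v' = map is_half (map shape v')" "map is_half v = map is_half (map shape v)" by (auto simp: shape_def)
    then have "set (map is_half v') = set (map is_half v)" using that(1) by simp
    then show ?thesis using that(2) by (metis (mono_tags, lifting) image_iff image_set)
  qed
  obtain hs' where 2: "straight 0 hs' = sort (straight 0 hs)" "map shape hs' = map shape hs" "hs' @ ns \<in> mon M N"
    "linked' M N (hs @ ns) (hs' @ ns)"
    using adj_path_linked[of hs "sort (straight 0 hs)" "[]" ns m n M N d d'] 1(1,2) adj_sort
    unfolding append.left_neutral by blast
  obtain ns' where 3: "straight 0 ns' = sort (straight 0 ns)" "map shape ns' = map shape ns" "hs' @ ns' \<in> mon M N"
    "linked' M N (hs' @ ns) (hs' @ ns')"
    using adj_path_linked[of ns "sort (straight 0 ns)" hs' "[]" m n M N d d'] 1(3) 2(3) adj_sort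
    unfolding append.right_neutral by blast
  have k: "\<forall>x\<in>set hs'. is_half x" "\<forall>x\<in>set ns'. \<not> is_half x"
    using kind[OF 2(2), of True] kind[OF 3(2), of False] 1(2,3) by auto
  have lk: "linked' M N w (hs' @ ns')" using 1(4) 2(4) 3(4) linked_trans by blast
  have s: "sorted (straight 0 hs')" "sorted (straight 0 ns')" using 2(1) 3(1) by simp_all
  show ?thesis
  proof (cases "distinct (straight 0 hs') \<and> distinct (straight 0 ns')")
    case True
    then have "ordered (hs' @ ns')" unfolding ordered_def
      using k s by (intro exI[of _ hs'] exI[of _ ns']) (simp add: strict_sorted_iff)
    then show ?thesis using lk 3(3) by blast
  next
    case False
    then have "step m n M N d d' (- 1) (hs' @ ns') (hs' @ ns')"
    proof (cases "distinct (straight 0 hs')")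
      case True
      then show ?thesis using False sorted_step_self[of hs' ns' "[]" M N] 3(3) k(2) s(2) by simp
    next
      case False
      then show ?thesis using sorted_step_self[of "[]" hs' ns' M N] 3(3) k(1) s(1) by simp
    qed
    then show ?thesis using lk by blast
  qed
qed

lemma ordered_weight:
  assumes "ordered w" shows "weight l a w = 1"
proof -
  obtain hs ns where w: "w = hs @ ns" "\<forall>x\<in>set hs. is_half x" "\<forall>x\<in>set ns. \<not> is_half x"
     "sorted_wrt (<) (straight 0 hs)" "sorted_wrt (<) (straight 0 ns)" using assms ordered_def by blast
  then show ?thesis using normal_ordered[OF w(2,3), of l a] by (simp add: weight_def sort_sign_sorted)
qed

lemma ordered_nonzero: "ordered w \<Longrightarrow> (vec w :: particle list \<Rightarrow>\<^sub>0 'k::field_char_0) \<notin> R M N"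
  using vec_relations_weight[OF l_pos] ordered_weight by (metis zero_neq_one)

lemma ordered_key_inj:
  assumes "ordered w" "ordered z" "key l a w = key l a z"
  shows "w = z"
proof -
  obtain hs ns where w: "w = hs @ ns" "\<forall>x\<in>set hs. is_half x" "\<forall>x\<in>set ns. \<not> is_half x"
     "sorted_wrt (<) (straight 0 hs)" "sorted_wrt (<) (straight 0 ns)" using assms ordered_def by blast
  obtain hs' ns' where z: "z = hs' @ ns'" "\<forall>x\<in>set hs'. is_half x" "\<forall>x\<in>set ns'. \<not> is_half x"
     "sorted_wrt (<) (straight 0 hs')" "sorted_wrt (<) (straight 0 ns')" using assms ordered_def by blast
  have k: "map shape hs = map shape hs'" "map shape ns = map shape ns'"
    "mset (straight 0 hs) = mset (straight 0 hs')" "mset (straight 0 ns) = mset (straight 0 ns')"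
    using assms(3) normal_ordered[OF w(2,3), of l a] normal_ordered[OF z(2,3), of l a] w(1) z(1) by (auto simp: key_def)
  have sorted_eq: "us = vs" if "mset us = mset vs" "sorted_wrt (<) us" "sorted_wrt (<) vs" for us vs :: "int list"
    using that by (metis properties_for_sort strict_sorted_iff)
  have "straight 0 hs = straight 0 hs'" "straight 0 ns = straight 0 ns'"
    using sorted_eq k(3,4) w(4,5) z(4,5) by blast+
  then show ?thesis using straight_inj k w(1) z(1) by blast
qed

lemma ordered_cls_inj:
  assumes "ordered w" "ordered z" "(cls M N w :: (particle list \<Rightarrow>\<^sub>0 'k::field_char_0) set) = cls M N z"
  shows "w = z"
proof -
  have "weight (m - n) (fst d') w \<noteq> 0" using ordered_weight[OF assms(1)] by simp
  then have "key (m - n) (fst d') w = key (m - n) (fst d') z"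
    using class_eq_key[OF l_pos] assms(3) unfolding cls_def by blast
  then show ?thesis by (rule ordered_key_inj[OF assms(1,2)])
qed

text \<open>Turns equality of classes, a statement about a linear span, back into a chain of
  relations, along which the operators can be followed. The second alternative of
  \<open>linked_ordered\<close> would make the class zero, contrary to
  \<open>ordered_nonzero\<close>.\<close>

lemma same_cls_linked:
  assumes w: "w \<in> mon M N" "ordered w" and z: "z \<in> mon M N"
    and eq: "(cls M N z :: (particle list \<Rightarrow>\<^sub>0 'k::field_char_0) set) = cls M N w"
  shows "linked' M N z w"
  using linked_ordered[OF z]
proof
  assume "\<exists>w0\<in>mon M N. ordered w0 \<and> linked' M N z w0"
  then obtain w0 where w0: "ordered w0" "linked' M N z w0" by blast
  have "(cls M N w0 :: (particle list \<Rightarrow>\<^sub>0 'k) set) = cls M N w" using linked_cls[OF w0(2)] eq by metis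
  then show ?thesis using ordered_cls_inj[OF w0(1) w(2)] w0(2) by blast
next
  assume "\<exists>w0. linked' M N z w0 \<and> step m n M N d d' (- 1) w0 w0"
  then obtain w0 where w0: "linked' M N z w0" "step m n M N d d' (- 1) w0 w0" by blast
  have "(cls M N w :: (particle list \<Rightarrow>\<^sub>0 'k) set) = cls M N w0" using linked_cls[OF w0(1)] eq by metis
  moreover have "(cls M N w0 :: (particle list \<Rightarrow>\<^sub>0 'k) set) = R M N"
    using step_self_zero[OF w0(2)] zero_class unfolding cls_def by blast
  ultimately have "(vec w :: particle list \<Rightarrow>\<^sub>0 'k) \<in> R M N" using zero_class unfolding cls_def by metis
  then show ?thesis using ordered_nonzero[OF w(2)] by blast
qed

lemma crystal_part_eq:
  "crystal_part m n M N d d' = (cls M N ` {w \<in> mon M N. ordered w} :: (particle list \<Rightarrow>\<^sub>0 'k::field_char_0) set set)"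
proof (intro set_eqI iffI)
  fix C :: "(particle list \<Rightarrow>\<^sub>0 'k) set"
  assume "C \<in> crystal_part m n M N d d'"
  then obtain w where w: "C = cls M N w" "w \<in> mon M N" "(vec w :: particle list \<Rightarrow>\<^sub>0 'k) \<notin> R M N"
    by (auto simp: crystal_part_def Let_def cls_def)
  from linked_ordered[OF w(2)] show "C \<in> cls M N ` {w \<in> mon M N. ordered w}"
  proof
    assume "\<exists>w0\<in>mon M N. ordered w0 \<and> linked' M N w w0"
    then show ?thesis using linked_cls w(1) by blast
  next
    assume "\<exists>w0. linked' M N w w0 \<and> step m n M N d d' (- 1) w0 w0"
    then obtain w0 where w0: "linked' M N w w0" "step m n M N d d' (- 1) w0 w0" by blast
    have "(cls M N w :: (particle list \<Rightarrow>\<^sub>0 'k) set) = R M N"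
      using step_self_zero[OF w0(2)] zero_class linked_cls[OF w0(1)] unfolding cls_def by metis
    then show ?thesis using w(3) zero_class unfolding cls_def by blast
  qed
next
  fix C :: "(particle list \<Rightarrow>\<^sub>0 'k) set"
  assume "C \<in> cls M N ` {w \<in> mon M N. ordered w}"
  then obtain w where w: "C = cls M N w" "w \<in> mon M N" "ordered w" by blast
  then show "C \<in> crystal_part m n M N d d'"
    unfolding crystal_part_def Let_def using ordered_nonzero[OF w(3)] by (auto simp: cls_def)
qed

text \<open>Common description of both operators, with \<open>c = - 1\<close> for \<open>f\<close>
  and \<open>c = 1\<close> for \<open>e\<close>, so that well-definedness on classes is proved
  once.\<close>

definition flips :: "int \<Rightarrow> nat \<Rightarrow> particle list \<Rightarrow> particle list option \<Rightarrow> bool" where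
  "flips c i w v \<longleftrightarrow> (\<forall>w'. v = Some w' \<longleftrightarrow> (\<exists>k. (if c = 1 then trail else lead) (half_word i w) k \<and> w' = flip_nth c k w))"

lemma mon_particles: "w \<in> mon M N \<Longrightarrow> \<forall>x\<in>set w. is_particle x"
  by (simp add: monomials_iff)

lemma flips_f: "w \<in> mon M N \<Longrightarrow> flips (- 1) i w (monomial_f i w)"
  unfolding flips_def using monomial_f_iff[OF mon_particles] by simp

lemma flips_e: "w \<in> mon M N \<Longrightarrow> flips 1 i w (monomial_e i w)"
  unfolding flips_def using monomial_e_iff[OF mon_particles] by simp

lemma flips_near:
  assumes "w \<in> mon M N" "c = 1 \<or> c = - 1" "(if c = 1 then trail else lead) (half_word i w) k"
  shows "near c (half_word i w) k"
  using assms lead_near[OF _ half_word_01[OF mon_particles[OF assms(1)]]] trail_near[OF _ half_word_01[OF mon_particles[OF assms(1)]]]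
  by (auto split: if_splits)

text \<open>The spin-1/2 letters are the same along the chain, so the operator acts at the same
  place on all its monomials or on none; \<open>step_flip\<close> transports the relations.\<close>

lemma flips_linked:
  assumes c: "c = 1 \<or> c = - 1" and F: "\<And>w. w \<in> mon M N \<Longrightarrow> flips c i w (F w)" and lk: "linked' M N w z" and w: "w \<in> mon M N"
  shows "(F w = None \<and> F z = None) \<or> (\<exists>w' z'. F w = Some w' \<and> F z = Some z' \<and> linked' M N w' z')"
  using lk unfolding linked_def
proof (induction rule: rtranclp_induct)
  case base
  show ?case by (cases "F w") auto
next
  case (step y z)
  have y: "y \<in> mon M N" "z \<in> mon M N" using step(2) by (auto simp: step_def)
  have one: "(F u = None \<and> F v = None) \<or> (\<exists>u' v'. F u = Some u' \<and> F v = Some v' \<and> (\<exists>b. step m n M N d d' b u' v'))"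
    if st: "step m n M N d d' b u v" for b u v
  proof -
    have uv: "u \<in> mon M N" "v \<in> mon M N" using st by (auto simp: step_def)
    have hw: "half_word i v = half_word i u" by (rule step_half_word[OF st])
    show ?thesis
    proof (cases "\<exists>k. (if c = 1 then trail else lead) (half_word i u) k")
      case True
      then obtain k where k: "(if c = 1 then trail else lead) (half_word i u) k" by blast
      have "F u = Some (flip_nth c k u)" using F[OF uv(1)] k unfolding flips_def by blast
      moreover have "F v = Some (flip_nth c k v)" using F[OF uv(2)] k hw unfolding flips_def by metis
      moreover have "step m n M N d d' b (flip_nth c k u) (flip_nth c k v)"
        using step_flip[OF st flips_near[OF uv(1) c k]] by blast
      ultimately show ?thesis by blast
    next
      case False
      then have "F u = None" using F[OF uv(1)] unfolding flips_def by (metis not_None_eq)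
      moreover have "F v = None" using F[OF uv(2)] False hw unfolding flips_def by (metis not_None_eq)
      ultimately show ?thesis by blast
    qed
  qed
  from step(2) obtain b where "step m n M N d d' b y z \<or> step m n M N d d' b z y" by blast
  then have "(F y = None \<and> F z = None) \<or> (\<exists>u' v'. F y = Some u' \<and> F z = Some v' \<and>
      (\<exists>b. step m n M N d d' b u' v' \<or> step m n M N d d' b v' u'))"
    using one by blast
  then show ?case
  proof
    assume "F y = None \<and> F z = None" then show ?thesis using step.IH by auto
  next
    assume "\<exists>u' v'. F y = Some u' \<and> F z = Some v' \<and> (\<exists>b. step m n M N d d' b u' v' \<or> step m n M N d d' b v' u')"
    then obtain u' v' where uv: "F y = Some u'" "F z = Some v'"
      "\<exists>b. step m n M N d d' b u' v' \<or> step m n M N d d' b v' u'" by blast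
    then obtain w' where w': "F w = Some w'" "linked' M N w' u'"
      using step.IH unfolding linked_def by auto
    have "linked' M N u' v'" using uv(3) linked_step linked_sym by blast
    then show ?thesis using uv(2) w' linked_trans unfolding linked_def[symmetric] by blast
  qed
qed

lemma flips_ordered:
  assumes c: "c = 1 \<or> c = - 1" and F: "flips c i w (Some w')" and w: "w \<in> mon M N" "ordered w"
  shows "w' \<in> mon M N" "ordered w'"
    "\<exists>k hs ns. w = hs @ ns \<and> (\<forall>x\<in>set hs. is_half x) \<and> (\<forall>x\<in>set ns. \<not> is_half x) \<and>
      (if c = 1 then trail else lead) (half_word i hs) k \<and> w' = flip_nth c k hs @ ns"
proof -
  obtain k where k: "(if c = 1 then trail else lead) (half_word i w) k" "w' = flip_nth c k w" using F unfolding flips_def by blast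
  show "w' \<in> mon M N" unfolding k(2) by (rule flip_nth_monomials[OF w(1) c])
  obtain hs ns where h: "w = hs @ ns" "\<forall>x\<in>set hs. is_half x" "\<forall>x\<in>set ns. \<not> is_half x"
     "sorted_wrt (<) (straight 0 hs)" "sorted_wrt (<) (straight 0 ns)" using w(2) ordered_def by blast
  have hw: "half_word i w = half_word i hs" using h(1,3) by (simp add: half_word_def)
  have near: "near c (half_word i hs) k" using flips_near[OF w(1) c k(1)] hw by simp
  then have "k < length (filter is_half hs)" by (simp add: near_def half_word_def)
  then have w': "w' = flip_nth c k hs @ ns" unfolding k(2) h(1) flip_nth_append by simp
  then show "\<exists>k hs ns. w = hs @ ns \<and> (\<forall>x\<in>set hs. is_half x) \<and> (\<forall>x\<in>set ns. \<not> is_half x) \<and>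
      (if c = 1 then trail else lead) (half_word i hs) k \<and> w' = flip_nth c k hs @ ns"
    using h(1,2,3) k(1) hw by (intro exI[of _ k] exI[of _ hs] exI[of _ ns]) simp
  have "straight 0 (flip_nth c k hs) = map (\<lambda>u. u + (if k = 0 then c else 0)) (straight 0 hs)"
    by (rule straight_flip[OF _ near]) (use h mon_particles[OF w(1)] in auto)
  then have "sorted_wrt (<) (straight 0 (flip_nth c k hs))" using h(4) by (simp add: sorted_wrt_map)
  moreover have "\<forall>x\<in>set (flip_nth c k hs). is_half x"
  proof -
    have "set (map is_half (flip_nth c k hs)) = set (map is_half hs)" by (simp only: flip_nth_maps)
    then show ?thesis using h(2) by (metis (mono_tags, lifting) image_iff image_set)
  qed
  ultimately show "ordered w'" unfolding ordered_def w' using h(3,5) by blast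
qed

text \<open>All representatives in the union are linked to \<open>w\<close>, hence contribute the
  same class. If \<open>F w\<close> is defined, this class is nonzero because the flipped monomial
  is again ordered.\<close>

lemma induced_cls:
  assumes c: "c = 1 \<or> c = - 1" and F: "\<And>w. w \<in> mon M N \<Longrightarrow> flips c i w (F w)" and w: "w \<in> mon M N" "ordered w"
  shows "induced F m n M N d d' (cls M N w :: (particle list \<Rightarrow>\<^sub>0 'k::field_char_0) set) = map_option (cls M N) (F w)"
proof -
  define G where "G z = (case F z of None \<Rightarrow> R M N | Some z' \<Rightarrow> (cls M N z' :: (particle list \<Rightarrow>\<^sub>0 'k) set))" for z
  have G: "G z = G w" if "z \<in> mon M N" "(cls M N z :: (particle list \<Rightarrow>\<^sub>0 'k) set) = cls M N w" for z
  proof -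
    have lk: "linked' M N z w" by (rule same_cls_linked[OF w that])
    from flips_linked[OF c F lk that(1)] show ?thesis
    proof
      assume "F z = None \<and> F w = None" then show ?thesis by (simp add: G_def)
    next
      assume "\<exists>z' w'. F z = Some z' \<and> F w = Some w' \<and> linked' M N z' w'"
      then obtain z' w' where "F z = Some z'" "F w = Some w'" "linked' M N z' w'" by blast
      then show ?thesis using linked_cls[of M N z' w', where 'a = 'k] by (simp add: G_def)
    qed
  qed
  have D: "(\<Union>z \<in> {z \<in> mon M N. signed_class (R M N) (vec z) = (cls M N w :: (particle list \<Rightarrow>\<^sub>0 'k) set)}.
                case F z of None \<Rightarrow> R M N | Some z' \<Rightarrow> signed_class (R M N) (vec z')) = G w"
    using G w(1) unfolding G_def cls_def by blast
  show ?thesis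
  proof (cases "F w")
    case None
    then show ?thesis unfolding induced_def Let_def D by (simp add: G_def)
  next
    case (Some w')
    have "ordered w'" using flips_ordered(2)[OF c _ w] F[OF w(1)] Some by simp
    then have "(cls M N w' :: (particle list \<Rightarrow>\<^sub>0 'k) set) \<noteq> R M N"
      using ordered_nonzero zero_class unfolding cls_def by blast
    then show ?thesis using Some unfolding induced_def Let_def D by (simp add: G_def)
  qed
qed

lemma monomial_f_e:
  assumes w: "w \<in> mon M N" and f: "monomial_f i w = Some w'"
  shows "w' \<in> mon M N" "monomial_e i w' = Some w"
proof -
  obtain k where k: "lead (half_word i w) k" "w' = flip_nth (- 1) k w"
    using f monomial_f_iff[OF mon_particles[OF w]] by auto
  show w': "w' \<in> mon M N" unfolding k(2) by (rule flip_nth_monomials[OF w]) simp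
  have "near (- 1) (half_word i w) k" using flips_near[OF w, of "- 1" i k] k by simp
  then have "half_word i w' = (half_word i w)[k := 1]" unfolding k(2) half_word_flip by (simp add: near_def)
  then have "trail (half_word i w') k" using lead_imp_trail[OF k(1) half_word_01[OF mon_particles[OF w]]] by simp
  moreover have "w = flip_nth 1 k w'" unfolding k(2) using flip_nth_inverse[of "- 1" k w] by simp
  ultimately show "monomial_e i w' = Some w" using monomial_e_iff[OF mon_particles[OF w']] by blast
qed

lemma monomial_e_f:
  assumes w: "w \<in> mon M N" and f: "monomial_e i w = Some w'"
  shows "w' \<in> mon M N" "monomial_f i w' = Some w"
proof -
  obtain k where k: "trail (half_word i w) k" "w' = flip_nth 1 k w"
    using f monomial_e_iff[OF mon_particles[OF w]] by auto
  show w': "w' \<in> mon M N" unfolding k(2) by (rule flip_nth_monomials[OF w]) simp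
  have "near 1 (half_word i w) k" using flips_near[OF w, of 1 i k] k by simp
  then have "half_word i w' = (half_word i w)[k := 0]" unfolding k(2) half_word_flip by (simp add: near_def)
  then have "lead (half_word i w') k" using trail_imp_lead[OF k(1) half_word_01[OF mon_particles[OF w]]] by simp
  moreover have "w = flip_nth (- 1) k w'" unfolding k(2) using flip_nth_inverse[of 1 k w] by simp
  ultimately show "monomial_f i w' = Some w" using monomial_f_iff[OF mon_particles[OF w']] by blast
qed

definition words :: "particle list set" where
  "words = {w. (\<exists>M N. w \<in> mon M N) \<and> ordered w}"

definition triple :: "particle list \<Rightarrow> nat \<times> nat \<times> (particle list \<Rightarrow>\<^sub>0 'k::field_char_0) set" where
  "triple w = (length (filter is_half w), length (filter (\<lambda>x. \<not> is_half x) w),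
     cls (length (filter is_half w)) (length (filter (\<lambda>x. \<not> is_half x) w)) w)"

lemma triple_mon: "w \<in> mon M N \<Longrightarrow> triple w = (M, N, cls M N w)"
  unfolding triple_def monomials_iff by auto

lemma particle_crystal_eq: "particle_crystal m n d d' = triple ` words"
proof (intro set_eqI iffI)
  fix x :: "nat \<times> nat \<times> (particle list \<Rightarrow>\<^sub>0 'a) set"
  assume x: "x \<in> particle_crystal m n d d'"
  obtain M N C where [simp]: "x = (M, N, C)" by (cases x)
  from x obtain w where w: "w \<in> mon M N" "ordered w" "C = cls M N w"
    by (auto simp: particle_crystal_def crystal_part_eq)
  then show "x \<in> triple ` words" by (intro image_eqI[of _ _ w]) (auto simp: triple_mon words_def)
next
  fix x :: "nat \<times> nat \<times> (particle list \<Rightarrow>\<^sub>0 'a) set"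
  assume "x \<in> triple ` words"
  then obtain w M N where w: "x = triple w" "w \<in> mon M N" "ordered w" by (auto simp: words_def)
  then show "x \<in> particle_crystal m n d d'" by (auto simp: particle_crystal_def crystal_part_eq triple_mon)
qed

lemma triple_inj:
  assumes "w \<in> words" "z \<in> words" "(triple w :: nat \<times> nat \<times> (particle list \<Rightarrow>\<^sub>0 'k::field_char_0) set) = triple z"
  shows "w = z"
  using assms ordered_cls_inj[of w z, where 'k = 'k] unfolding words_def triple_def by auto

lemma particle_f_triple:
  assumes "w \<in> words"
  shows "particle_f m n d d' i (triple w :: nat \<times> nat \<times> (particle list \<Rightarrow>\<^sub>0 'k::field_char_0) set) =
    map_option triple (monomial_f i w)"
proof -
  obtain M N where w: "w \<in> mon M N" "ordered w" using assms words_def by auto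
  have "induced (monomial_f i) m n M N d d' (cls M N w :: (particle list \<Rightarrow>\<^sub>0 'k) set) = map_option (cls M N) (monomial_f i w)"
    by (rule induced_cls[of "- 1" M N i]) (use flips_f w in auto)
  moreover have t: "(triple z :: nat \<times> nat \<times> (particle list \<Rightarrow>\<^sub>0 'k) set) = (M, N, cls M N z)"
    if "z \<in> mon M N" for z by (rule triple_mon[OF that])
  ultimately show ?thesis using monomial_f_e(1)[OF w(1), of i] w(1)
    by (cases "monomial_f i w") (auto simp: particle_f_def t)
qed

lemma particle_e_triple:
  assumes "w \<in> words"
  shows "particle_e m n d d' i (triple w :: nat \<times> nat \<times> (particle list \<Rightarrow>\<^sub>0 'k::field_char_0) set) =
    map_option triple (monomial_e i w)"
proof -
  obtain M N where w: "w \<in> mon M N" "ordered w" using assms words_def by auto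
  have "induced (monomial_e i) m n M N d d' (cls M N w :: (particle list \<Rightarrow>\<^sub>0 'k) set) = map_option (cls M N) (monomial_e i w)"
    by (rule induced_cls[of 1 M N i]) (use flips_e w in auto)
  moreover have t: "(triple z :: nat \<times> nat \<times> (particle list \<Rightarrow>\<^sub>0 'k) set) = (M, N, cls M N z)"
    if "z \<in> mon M N" for z by (rule triple_mon[OF that])
  ultimately show ?thesis using monomial_e_f(1)[OF w(1), of i] w(1)
    by (cases "monomial_e i w") (auto simp: particle_e_def t)
qed

lemma words_f: "w \<in> words \<Longrightarrow> monomial_f i w = Some w' \<Longrightarrow> w' \<in> words"
proof -
  assume "w \<in> words" and f: "monomial_f i w = Some w'"
  then obtain M N where w: "w \<in> mon M N" "ordered w" using words_def by auto
  have "flips (- 1) i w (Some w')" using flips_f[OF w(1), of i] f by simp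
  then show "w' \<in> words" using flips_ordered(1,2)[of "- 1" i w w', OF _ _ w] by (auto simp: words_def)
qed

lemma words_e: "w \<in> words \<Longrightarrow> monomial_e i w = Some w' \<Longrightarrow> w' \<in> words"
proof -
  assume "w \<in> words" and f: "monomial_e i w = Some w'"
  then obtain M N where w: "w \<in> mon M N" "ordered w" using words_def by auto
  have "flips 1 i w (Some w')" using flips_e[OF w(1), of i] f by simp
  then show "w' \<in> words" using flips_ordered(1,2)[of 1 i w w', OF _ _ w] by (auto simp: words_def)
qed

lemma crystal_words: "crystal words monomial_e monomial_f"
  unfolding crystal_def
proof (intro ballI conjI allI impI)
  fix i x y assume x: "x \<in> words"
  then obtain M N where w: "x \<in> mon M N" using words_def by auto
  show "y \<in> words" "monomial_e i y = Some x" if "monomial_f i x = Some y"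
    using words_f[OF x that] monomial_f_e[OF w that] by auto
  show "y \<in> words" "monomial_f i y = Some x" if "monomial_e i x = Some y"
    using words_e[OF x that] monomial_e_f[OF w that] by auto
qed

end

section \<open>Ordered monomials and configurations\<close>

text \<open>The order condition for separately ordered sequences. It is transitive, so imposing it
  on neighbours or on all pairs amounts to the same.\<close>

definition before :: "particle \<Rightarrow> particle \<Rightarrow> bool" where
  "before x y \<longleftrightarrow> kap x < kap y \<or> x = y"

lemma transp_before: "transp before"
  by (auto simp: transp_def before_def)

text \<open>By the parity constraints, \<open>kap y - kap x\<close> is odd exactly if
  \<open>nu x y = 1\<close>. So the bound permits \<open>kap x \<ge> kap y\<close> only for equal
  indices with \<open>nu x y = 2\<close>, and then the particles coincide.\<close>

lemma straight_before:
  assumes "is_particle x" "is_particle y" "is_half x = is_half y"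
  shows "kap x < kap y + nu x y \<longleftrightarrow> before x y"
proof -
  have e: "even (kap y - kap x) \<longleftrightarrow> nu x y \<noteq> 1"
    using assms by (cases x; cases y) (auto simp: nu_def delta_def parity_sign_def split: if_splits)
  have b: "0 \<le> nu x y" "nu x y \<le> 2" by (auto simp: nu_def delta_def)
  have eq: "x = y" if "nu x y = 2" "kap x = kap y"
    using that assms(3) by (intro particle_eqI) (auto simp: nu_def delta_def split: if_splits)
  have self: "nu x x = 2" by (simp add: nu_def delta_def)
  consider "nu x y = 0" | "nu x y = 1" | "nu x y = 2" using b by linarith
  then show ?thesis
  proof cases
    case 1 then show ?thesis using self by (auto simp: before_def)
  next
    case 2
    then have "kap x \<noteq> kap y" using e by auto
    then show ?thesis using 2 self by (auto simp: before_def)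
  next
    case 3
    then have "even (kap y - kap x)" using e by simp
    then have "kap y - kap x \<noteq> - 1" by presburger
    then have "kap x < kap y + 2 \<longleftrightarrow> kap x < kap y \<or> kap x = kap y" by presburger
    then show ?thesis using 3 eq by (auto simp: before_def)
  qed
qed

lemma sorted_straight_iff:
  "\<forall>x\<in>set w. is_particle x \<Longrightarrow> (\<forall>x\<in>set w. is_half x = h) \<Longrightarrow>
    sorted_wrt (<) (straight c w) \<longleftrightarrow> sorted_wrt before w"
proof (induction w arbitrary: c)
  case (Cons x w)
  show ?case
  proof (cases w)
    case Nil then show ?thesis by simp
  next
    case w: (Cons y v)
    have two: "sorted_wrt (<) (p # q # r) \<longleftrightarrow> p < q \<and> sorted_wrt (<) (q # r)" for p q :: int and r by auto
    have st: "straight (c + nu x y) w = (kap y + (c + nu x y)) # tl (straight (c + nu x y) w)"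
      using w by (cases v) auto
    have "straight c (x # w) = (kap x + c) # straight (c + nu x y) w" using w by simp
    then have "sorted_wrt (<) (straight c (x # w)) \<longleftrightarrow>
        kap x + c < kap y + (c + nu x y) \<and> sorted_wrt (<) (straight (c + nu x y) w)"
      using two st by metis
    also have "kap x + c < kap y + (c + nu x y) \<longleftrightarrow> before x y"
      using straight_before[of x y] Cons.prems w by simp
    also have "sorted_wrt (<) (straight (c + nu x y) w) \<longleftrightarrow> sorted_wrt before w"
      using Cons by simp
    finally show ?thesis using w sorted_wrt2[OF transp_before, of x y v] by simp
  qed
qed simp

lemma sorted_filter_split:
  "sorted_wrt before w \<Longrightarrow> w = filter (\<lambda>h. kap h < k) w @ filter (\<lambda>h. k \<le> kap h) w"
proof (induction w)
  case (Cons x w)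
  show ?case
  proof (cases "kap x < k")
    case True then show ?thesis using Cons by simp
  next
    case False
    then have "\<forall>y\<in>set w. k \<le> kap y" using Cons.prems by (auto simp: before_def)
    then have "filter (\<lambda>h. kap h < k) w = []" "filter (\<lambda>h. k \<le> kap h) w = w" by (auto simp: filter_empty_conv)
    then show ?thesis using False by simp
  qed
qed simp

definition config :: "int \<Rightarrow> particle list \<Rightarrow> int \<Rightarrow> int" where
  "config c w k = c + drift (filter (\<lambda>h. k \<le> kap h) w)"

definition jump :: "particle list \<Rightarrow> int \<Rightarrow> int" where
  "jump w k = drift (filter (\<lambda>h. kap h = k) w)"

lemma config_jump: "config c w k - config c w (k + 1) = jump w k"
proof -
  have "drift (filter (\<lambda>h. k \<le> kap h) w) = drift (filter (\<lambda>h. k + 1 \<le> kap h) w) + drift (filter (\<lambda>h. kap h = k) w)"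
    by (induction w) auto
  then show ?thesis by (simp add: config_def jump_def)
qed

lemma config_left: "(\<And>h. h \<in> set w \<Longrightarrow> k \<le> kap h) \<Longrightarrow> config c w k = c + drift w"
  by (simp add: config_def filter_id_conv)

lemma config_right: "(\<And>h. h \<in> set w \<Longrightarrow> kap h < k) \<Longrightarrow> config c w k = c"
proof -
  assume "\<And>h. h \<in> set w \<Longrightarrow> kap h < k"
  then have "filter (\<lambda>h. k \<le> kap h) w = []" by (force simp: filter_empty_conv)
  then show ?thesis by (simp add: config_def)
qed

lemma kap_bounds: "\<exists>K. \<forall>h\<in>set w. - K < kap h \<and> kap h < K"
proof (induction w)
  case (Cons x w)
  then obtain K where "\<forall>h\<in>set w. - K < kap h \<and> kap h < K" by blast
  then show ?case by (intro exI[of _ "max K (\<bar>kap x\<bar> + 1)"]) auto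
qed simp

lemma sum_steps:
  assumes "E = map g w" "j \<le> length w"
  shows "rise E j = sum_list (map (\<lambda>h. if g h = 0 then 1 else - 1) (take j w))"
  using assms(2)
proof (induction j)
  case (Suc j)
  then have "take (Suc j) w = take j w @ [w ! j]" by (simp add: take_Suc_conv_app_nth)
  then show ?case using Suc assms(1) by (simp add: rise_Suc)
qed (simp add: rise_def)

text \<open>The constraint tying sign, \<epsilon> and \<kappa> expresses the letter by sign and
  index. On the particle side this is the origin of the alternating sign in
  \<open>config_f\<close>.\<close>

lemma letter_step:
  assumes "is_particle h" "is_half h" "i \<in> {0, 1}"
  shows "(if half_letter i h = 0 then 1 else - 1) = crystal_sign i * parity_sign (kap h) * sg h"
  using assms by (cases h) (auto simp: crystal_sign_def parity_sign_def split: if_splits)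

text \<open>Heights of the letter word at the cuts between different indices; cuts between particles
  of equal index are left out.\<close>

definition config_heights :: "nat \<Rightarrow> particle list \<Rightarrow> int \<Rightarrow> int" where
  "config_heights i w k = sum_list (map (\<lambda>h. if half_letter i h = 0 then 1 else - 1) (filter (\<lambda>h. kap h < k) w))"

lemma config_heights_step:
  assumes "\<forall>h\<in>set w. is_particle h \<and> is_half h" "i \<in> {0, 1}"
  shows "config_heights i w (k + 1) = config_heights i w k +
    crystal_sign i * parity_sign k * (config c w k - config c w (k + 1))"
proof -
  have "config_heights i w (k + 1) = config_heights i w k +
      sum_list (map (\<lambda>h. if half_letter i h = 0 then 1 else - 1) (filter (\<lambda>h. kap h = k) w))"
    unfolding config_heights_def by (induction w) auto
  also have "sum_list (map (\<lambda>h. if half_letter i h = 0 then 1 else - 1) (filter (\<lambda>h. kap h = k) w)) =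
      crystal_sign i * parity_sign k * drift (filter (\<lambda>h. kap h = k) w)"
    using assms(1)
  proof (induction w)
    case (Cons h w)
    then show ?case using letter_step[of h i] assms(2) by (auto simp: distrib_left)
  qed simp
  finally show ?thesis unfolding config_jump jump_def .
qed

lemma config_heights_rise:
  assumes s: "sorted_wrt before w" and h: "\<forall>h\<in>set w. is_half h"
  shows "config_heights i w k = rise (half_word i w) (length (filter (\<lambda>h. kap h < k) w))"
proof -
  define u v where "u = filter (\<lambda>h. kap h < k) w" and "v = filter (\<lambda>h. k \<le> kap h) w"
  have w: "w = u @ v" using sorted_filter_split[OF s, of k] by (simp add: u_def v_def)
  have "half_word i w = map (half_letter i) w" using h by (simp add: half_word_def filter_id_conv)
  then have "rise (half_word i w) (length u) = sum_list (map (\<lambda>h. if half_letter i h = 0 then 1 else - 1) (take (length u) w))"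
    using w by (intro sum_steps) auto
  moreover have "take (length u) w = u" using w by simp
  ultimately show ?thesis unfolding config_heights_def u_def[symmetric] by presburger
qed

text \<open>In an ordered word, spin-1/2 particles with equal index coincide and carry the same
  letter, so nothing is lost at the omitted cuts. The letter before the last minimum differs from
  the one behind it, so the minimum stands in front of all particles with that index.\<close>

lemma lead_last_min:
  assumes s: "sorted_wrt before w" and h: "\<forall>h\<in>set w. is_half h \<and> is_particle h" and L: "lead (half_word i w) j"
  shows "last_min (config_heights i w) (kap (w ! j))"
proof -
  have hw: "half_word i w = map (half_letter i) w" using h by (simp add: half_word_def filter_id_conv)
  have j: "j < length w" using L hw by (simp add: lead_def)
  have near: "near (- 1) (half_word i w) j" by (rule lead_near[OF L half_word_01]) (use h in blast)
  have w: "w = take j w @ w ! j # drop (Suc j) w" using j by (rule id_take_nth_drop)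
  have right: "kap (w ! j) \<le> kap (w ! t)" if "j \<le> t" "t < length w" for t
    using sorted_wrt_nth_less[OF s, of j t] that by (cases "j = t") (auto simp: before_def)
  have left: "kap (w ! t) < kap (w ! j)" if "t < j" for t
  proof -
    have p: "kap (w ! t) \<le> kap (w ! (j - 1))"
    proof (cases "t = j - 1")
      case False
      then have "t < j - 1" "j - 1 < length w" using that j by linarith+
      from sorted_wrt_nth_less[OF s this] show ?thesis by (auto simp: before_def)
    qed simp
    have "half_letter i (w ! (j - 1)) = 1" "half_letter i (w ! j) = 0"
      using near that j by (auto simp: near_def hw)
    then have "w ! (j - 1) \<noteq> w ! j" by auto
    moreover have "before (w ! (j - 1)) (w ! j)" using sorted_wrt_nth_less[OF s, of "j - 1" j] that j by simp
    ultimately show ?thesis using p by (simp add: before_def)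
  qed
  have card: "length (filter (\<lambda>h. kap h < k) w) \<le> length w" for k by simp
  have cut: "length (filter (\<lambda>h. kap h < kap (w ! j)) w) = j"
  proof -
    have "filter (\<lambda>h. kap h < kap (w ! j)) (take j w) = take j w"
      using left j by (auto simp: filter_id_conv in_set_conv_nth)
    moreover have "filter (\<lambda>h. kap h < kap (w ! j)) (drop j w) = []"
      using right by (auto simp: filter_empty_conv in_set_conv_nth) (metis le_add1 linorder_not_le nat_add_left_cancel_less less_diff_conv add.commute)
    moreover have "filter (\<lambda>h. kap h < kap (w ! j)) w = filter (\<lambda>h. kap h < kap (w ! j)) (take j w) @ filter (\<lambda>h. kap h < kap (w ! j)) (drop j w)"
      by (metis append_take_drop_id filter_append)
    ultimately show ?thesis using j by simp
  qed
  have more: "j < length (filter (\<lambda>h. kap h < k) w)" if "kap (w ! j) < k" for k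
  proof -
    have "filter (\<lambda>h. kap h < k) (take (Suc j) w) = take (Suc j) w"
    proof -
      have "kap (w ! t) < k" if "t < Suc j" for t using left[of t] that \<open>kap (w ! j) < k\<close> by (cases "t = j") auto
      then show ?thesis using j by (auto simp: filter_id_conv in_set_conv_nth)
    qed
    moreover have "filter (\<lambda>h. kap h < k) w = filter (\<lambda>h. kap h < k) (take (Suc j) w) @ filter (\<lambda>h. kap h < k) (drop (Suc j) w)"
      by (metis append_take_drop_id filter_append)
    ultimately have "length (filter (\<lambda>h. kap h < k) w) = Suc j + length (filter (\<lambda>h. kap h < k) (drop (Suc j) w))" using j by simp
    then show ?thesis by simp
  qed
  have r: "config_heights i w k = rise (half_word i w) (length (filter (\<lambda>h. kap h < k) w))" for k
    by (rule config_heights_rise[OF s]) (use h in blast)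
  have "rise (half_word i w) j \<le> rise (half_word i w) t \<and> (j < t \<longrightarrow> rise (half_word i w) j < rise (half_word i w) t)"
    if "t \<le> length w" for t using L that by (simp add: lead_def hw)
  then show ?thesis unfolding last_min_def r cut using card more by blast
qed

lemma exists_lead:
  "(\<exists>j. lead E j) \<or> (\<forall>t\<le>length E. rise E (length E) \<le> rise E t)"
proof -
  let ?T = "{t. t \<le> length E \<and> (\<forall>t'\<le>length E. rise E t \<le> rise E t')}"
  have "\<exists>t. t \<le> length E \<and> (\<forall>t'\<le>length E. rise E t \<le> rise E t')"
  proof -
    obtain c where "\<forall>k\<le>length E. c \<le> rise E k" using rise_bounded by blast
    then show ?thesis
      using ex_has_least_nat[of "\<lambda>t. t \<le> length E" 0 "\<lambda>t. nat (rise E t - c)"] by fastforce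
  qed
  then have ne: "?T \<noteq> {}" by blast
  have fin: "finite ?T" by simp
  define t where "t = Max ?T"
  have t: "t \<in> ?T" "\<And>t'. t' \<in> ?T \<Longrightarrow> t' \<le> t" unfolding t_def using Max_in[OF fin ne] Max_ge[OF fin] by auto
  show ?thesis
  proof (cases "t = length E")
    case True then show ?thesis using t(1) by auto
  next
    case False
    have "rise E t < rise E t'" if "t' \<le> length E" "t < t'" for t'
    proof (rule ccontr)
      assume "\<not> rise E t < rise E t'"
      then have "t' \<in> ?T" using t(1) that(1) by fastforce
      then show False using t(2) that(2) by fastforce
    qed
    then have "lead E t" using t(1) False by (auto simp: lead_def)
    then show ?thesis by blast
  qed
qed

lemma heights_differ_const:
  assumes "\<And>t. \<mu> (t + 1) = \<mu> t + e t" "\<And>t. \<mu>' (t + 1) = \<mu>' t + e t"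
  shows "\<mu>' t = \<mu> t + (\<mu>' 0 - \<mu> (0::int) :: int)"
proof -
  have "\<mu>' (t + 1) - \<mu> (t + 1) = \<mu>' t - \<mu> t" for t using assms by simp
  then have "\<mu>' t - \<mu> t = \<mu>' 0 - \<mu> 0" for t
    by (induction t rule: int_induct[of _ 0]) (auto, metis diff_add_cancel)
  then show ?thesis by (simp add: algebra_simps)
qed

text \<open>Without a lead the final height of the word is a global minimum; it is attained at all
  large indices, so there is no last minimum.\<close>

lemma config_f_lead:
  assumes s: "sorted_wrt before w" and h: "\<forall>h\<in>set w. is_half h \<and> is_particle h" and i: "i \<in> {0, 1}"
    and f: "config_f (crystal_sign i) (config c w) A'"
  shows "\<exists>j. lead (half_word i w) j"
proof (rule ccontr)
  assume "\<nexists>j. lead (half_word i w) j"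
  then have min: "\<forall>t\<le>length (half_word i w). rise (half_word i w) (length (half_word i w)) \<le> rise (half_word i w) t"
    using exists_lead by blast
  obtain \<mu> s where \<mu>: "\<And>t. \<mu> (t + 1) = \<mu> t + crystal_sign i * parity_sign t * (config c w t - config c w (t + 1))"
    "last_min \<mu> s" using f config_f_def by auto
  have "config_heights i w (t + 1) = config_heights i w t +
      crystal_sign i * parity_sign t * (config c w t - config c w (t + 1))" for t
    by (rule config_heights_step) (use h i in auto)
  then obtain D where D: "\<And>t. config_heights i w t = \<mu> t + D" using heights_differ_const[of \<mu>, OF \<mu>(1)] by blast
  have lm: "last_min (config_heights i w) s" using \<mu>(2) unfolding last_min_def D by simp
  obtain K where K: "\<forall>h\<in>set w. kap h < K" using kap_bounds by blast
  define k where "k = max K (s + 1)"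
  have "filter (\<lambda>h. kap h < k) w = w" using K by (auto simp: filter_id_conv k_def)
  moreover have hw: "length (half_word i w) = length w" using h by (simp add: half_word_def filter_id_conv)
  moreover have r: "config_heights i w k = rise (half_word i w) (length (filter (\<lambda>h. kap h < k) w))" for k
    by (rule config_heights_rise[OF \<open>sorted_wrt before w\<close>]) (use h in blast)
  ultimately have "config_heights i w k \<le> config_heights i w s" using min by simp
  moreover have "config_heights i w s < config_heights i w k" using lm by (simp add: last_min_def k_def)
  ultimately show False by simp
qed

text \<open>A particle counts for all thresholds up to its index, so lowering the index by one
  affects a single threshold.\<close>

lemma config_flip:
  assumes j: "j < length w" and h: "\<forall>h\<in>set w. is_half h"
  shows "config c (flip_nth (- 1) j w) = (config c w)(kap (w ! j) := config c w (kap (w ! j)) - sg (w ! j))"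
proof
  fix k
  have "filter is_half (take j w) = take j w" using h by (auto simp: filter_id_conv dest: in_set_takeD)
  then have f: "flip_nth (- 1) j w = w[j := flip_half (- 1) (w ! j)]"
    using flip_nth_update[of j w "- 1"] j h by simp
  have w: "w = take j w @ w ! j # drop (Suc j) w" using j by (rule id_take_nth_drop)
  have w': "w[j := flip_half (- 1) (w ! j)] = take j w @ flip_half (- 1) (w ! j) # drop (Suc j) w"
    using j by (rule upd_conv_take_nth_drop)
  have "config c w k = c + drift (filter (\<lambda>h. k \<le> kap h) (take j w)) + (if k \<le> kap (w ! j) then sg (w ! j) else 0)
      + drift (filter (\<lambda>h. k \<le> kap h) (drop (Suc j) w))" for k
  proof -
    have "config c (take j w @ w ! j # drop (Suc j) w) k = c + drift (filter (\<lambda>h. k \<le> kap h) (take j w)) + (if k \<le> kap (w ! j) then sg (w ! j) else 0)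
      + drift (filter (\<lambda>h. k \<le> kap h) (drop (Suc j) w))" by (simp add: config_def)
    then show ?thesis using w by simp
  qed
  moreover have "config c (flip_nth (- 1) j w) k = c + drift (filter (\<lambda>h. k \<le> kap h) (take j w)) +
      (if k \<le> kap (w ! j) - 1 then sg (w ! j) else 0) + drift (filter (\<lambda>h. k \<le> kap h) (drop (Suc j) w))"
    unfolding f w' using h j by (simp add: config_def)
  ultimately show "config c (flip_nth (- 1) j w) k = ((config c w)(kap (w ! j) := config c w (kap (w ! j)) - sg (w ! j))) k"
    by auto
qed

lemma config_f_flip:
  assumes s: "sorted_wrt before w" and h: "\<forall>h\<in>set w. is_half h \<and> is_particle h" and i: "i \<in> {0, 1}"
    and L: "lead (half_word i w) j"
  shows "config_f (crystal_sign i) (config c w) (config c (flip_nth (- 1) j w))"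
proof -
  have hw: "half_word i w = map (half_letter i) w" using h by (simp add: half_word_def filter_id_conv)
  have j: "j < length w" using L hw by (simp add: lead_def)
  have near: "near (- 1) (half_word i w) j" by (rule lead_near[OF L half_word_01]) (use h in blast)
  then have "half_letter i (w ! j) = 0" using j by (simp add: near_def hw)
  then have "1 = crystal_sign i * parity_sign (kap (w ! j)) * sg (w ! j)"
    using letter_step[of "w ! j" i] h j i by simp
  moreover have "signed (w ! j)" using h j is_particle_signed by simp
  moreover have "crystal_sign i = 1 \<or> crystal_sign i = - 1" by (simp add: crystal_sign_def)
  ultimately have sg: "sg (w ! j) = crystal_sign i * parity_sign (kap (w ! j))"
    using parity_sign_cases[of "kap (w ! j)"] by auto
  have "\<forall>t. config_heights i w (t + 1) = config_heights i w t +
      crystal_sign i * parity_sign t * (config c w t - config c w (t + 1))"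
    using config_heights_step[of w i] h i by blast
  moreover have "last_min (config_heights i w) (kap (w ! j))" by (rule lead_last_min[OF s h L])
  moreover have "config c (flip_nth (- 1) j w) = (config c w)(kap (w ! j) := config c w (kap (w ! j)) - crystal_sign i * parity_sign (kap (w ! j)))"
    using config_flip[OF j, of c] h sg by simp
  ultimately show ?thesis unfolding config_f_def by blast
qed

text \<open>Particles of equal index are equal, so a jump is a positive multiple of one sign and
  gives both the sign and the number of copies. The letter then follows from the parity
  constraint.\<close>

lemma jump_inj:
  "sorted_wrt before w \<Longrightarrow> sorted_wrt before z \<Longrightarrow> \<forall>h\<in>set w. is_half h \<and> is_particle h \<Longrightarrow>
    \<forall>h\<in>set z. is_half h \<and> is_particle h \<Longrightarrow> (\<And>k. jump w k = jump z k) \<Longrightarrow> w = z"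
proof (induction w arbitrary: z)
  have head: "jump (x # u) k = 0" if "sorted_wrt before (x # u)" "k < kap x" for x u k
  proof -
    have "filter (\<lambda>h. kap h = k) (x # u) = []" using that by (auto simp: filter_empty_conv before_def)
    then show ?thesis by (simp add: jump_def)
  qed
  have head': "\<exists>p > 0. jump (x # u) (kap x) = p * sg x" if "sorted_wrt before (x # u)" for x u
  proof -
    have "\<forall>h\<in>set (filter (\<lambda>h. kap h = kap x) u). h = x" using that by (auto simp: before_def)
    then have "drift (filter (\<lambda>h. kap h = kap x) u) = int (length (filter (\<lambda>h. kap h = kap x) u)) * sg x"
      by (induction u) (auto simp: algebra_simps)
    then show ?thesis
      by (intro exI[of _ "1 + int (length (filter (\<lambda>h. kap h = kap x) u))"]) (simp add: jump_def distrib_right)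
  qed
  {
    case Nil
    show ?case
    proof (cases z)
      case (Cons y v)
      obtain p where "p > 0" "jump z (kap y) = p * sg y" using head'[of y v] Nil Cons by auto
      moreover have "jump z (kap y) = 0" using Nil(5)[of "kap y"] by (simp add: jump_def)
      moreover have "signed y" using Nil Cons is_particle_signed by auto
      ultimately show ?thesis by auto
    qed simp
  next
    case (Cons x u)
    have sx: "signed x" using Cons.prems is_particle_signed by auto
    obtain p where p: "p > 0" "jump (x # u) (kap x) = p * sg x" using head' Cons.prems by blast
    show ?case
    proof (cases z)
      case Nil
      then show ?thesis using p sx Cons.prems(5)[of "kap x"] by (auto simp: jump_def)
    next
      case z: (Cons y v)
      have sy: "signed y" using Cons.prems z is_particle_signed by auto
      obtain q where q: "q > 0" "jump (y # v) (kap y) = q * sg y" using head' Cons.prems z by blast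
      have k: "kap x = kap y"
      proof (rule ccontr)
        assume "kap x \<noteq> kap y"
        then consider "kap x < kap y" | "kap y < kap x" by linarith
        then show False
        proof cases
          case 1
          then have "jump (x # u) (kap x) = 0" using head[of y v "kap x"] Cons.prems z by simp
          then show False using p sx by auto
        next
          case 2
          then have "jump (y # v) (kap y) = 0" using head[of x u "kap y"] Cons.prems z by simp
          then show False using q sy by auto
        qed
      qed
      have "p * sg x = q * sg y" using p q k Cons.prems(5)[of "kap x"] z by simp
      then have sg: "sg x = sg y" using p q sx sy by auto
      have "is_half x" "is_half y" "is_particle x" "is_particle y" using Cons.prems z by auto
      then have "x = y" using k sg by (cases x; cases y) (auto simp: parity_sign_def split: if_splits)
      moreover have "u = v"
      proof (rule Cons.IH)
        show "jump u k = jump v k" for k using Cons.prems(5)[of k] z \<open>x = y\<close> by (auto simp: jump_def split: if_splits)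
      qed (use Cons.prems z in auto)
      ultimately show ?thesis using z by simp
    qed
  }
qed

lemma inside_replicate:
  assumes h: "h = Half s \<epsilon> \<kappa>" "s = 1 \<or> s = - 1" and b: "0 \<le> b" "b \<le> n" and x: "0 \<le> x" "x \<le> m - n"
  shows "0 \<le> x + int k * s \<Longrightarrow> x + int k * s \<le> m - n \<Longrightarrow>
    inside (domains m n) (x, b) (replicate k h) \<and> foldr move (replicate k h) (x, b) = (x + int k * s, b)"
proof (induction k)
  case 0 then show ?case using b x by (simp add: domains_def)
next
  case (Suc k)
  have "0 \<le> x + int k * s" "x + int k * s \<le> m - n" using Suc.prems x h(2) by (auto simp: algebra_simps)
  from Suc.IH[OF this] show ?case using Suc.prems h b by (simp add: domains_def algebra_simps)
qed

text \<open>Built from the right end towards lower indices, with \<open>j\<close> the number of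
  indices treated. Each jump of \<open>A\<close> is realised by copies of a single particle, and the
  copies move monotonically between two values of \<open>A\<close>, so the walk stays
  inside.\<close>

lemma exists_halves:
  assumes A: "\<And>s. 0 \<le> A s \<and> A s \<le> m - n" and b: "0 \<le> b" "b \<le> n" and R: "\<And>s. sR \<le> s \<Longrightarrow> A s = c"
  shows "\<exists>w. (\<forall>h\<in>set w. is_half h \<and> is_particle h \<and> sR - int j \<le> kap h) \<and> sorted_wrt before w \<and>
    inside (domains m n) (c, b) w \<and> foldr move w (c, b) = (A (sR - int j), b) \<and>
    (\<forall>k\<ge>sR - int j. config c w k = A k)"
proof (induction j)
  case 0
  show ?case using A[of sR] R[of sR] R b by (intro exI[of _ "[]"]) (auto simp: domains_def config_def)
next
  case (Suc j)
  then obtain w where w: "\<forall>h\<in>set w. is_half h \<and> is_particle h \<and> sR - int j \<le> kap h" "sorted_wrt before w"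
    "inside (domains m n) (c, b) w" "foldr move w (c, b) = (A (sR - int j), b)" "\<And>k. k\<ge>sR - int j \<Longrightarrow> config c w k = A k"
    by blast
  define k0 where "k0 = sR - int (Suc j)"
  have k1: "sR - int j = k0 + 1" by (simp add: k0_def)
  define D where "D = A k0 - A (k0 + 1)"
  define s :: int where "s = (if D < 0 then - 1 else 1)"
  \<comment> \<open>The letter is forced by sign and index.\<close>
  define h where "h = Half s (if s = parity_sign k0 then 0 else 1) k0"
  define u where "u = replicate (nat \<bar>D\<bar>) h"
  have hp: "is_half h" "is_particle h" "kap h = k0" "sg h = s"
    using parity_sign_cases[of k0] by (auto simp: h_def s_def parity_sign_simps)
  have D: "int (nat \<bar>D\<bar>) * s = D" by (simp add: s_def)
  have u: "inside (domains m n) (A (k0 + 1), b) u \<and> foldr move u (A (k0 + 1), b) = (A k0, b)"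
  proof -
    have "A (k0 + 1) + int (nat \<bar>D\<bar>) * s = A k0" using D by (simp add: D_def)
    then show ?thesis
      using inside_replicate[of h s "if s = parity_sign k0 then 0 else 1" k0 b n "A (k0 + 1)" m "nat \<bar>D\<bar>"] A[of k0] A[of "k0 + 1"] b
      by (simp add: h_def u_def s_def)
  qed
  have du: "drift u = D"
  proof -
    have "drift (replicate k h) = int k * s" for k using hp by (induction k) (auto simp: algebra_simps)
    then show ?thesis using D by (simp add: u_def)
  qed
  have mem_u: "x = h" if "x \<in> set u" for x using that by (auto simp: u_def)
  have 1: "\<forall>h\<in>set (u @ w). is_half h \<and> is_particle h \<and> k0 \<le> kap h"
    using w(1) hp mem_u k1 by fastforce
  have 2: "sorted_wrt before (u @ w)"
  proof -
    have "sorted_wrt before (replicate k h)" for k by (induction k) (auto simp: before_def)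
    then have "sorted_wrt before u" by (simp add: u_def)
    moreover have "before x y" if "x \<in> set u" "y \<in> set w" for x y
      using mem_u[OF that(1)] w(1) that(2) hp(3) k1 by (force simp: before_def)
    ultimately show ?thesis using w(2) by (simp add: sorted_wrt_append)
  qed
  have 3: "inside (domains m n) (c, b) (u @ w) \<and> foldr move (u @ w) (c, b) = (A k0, b)"
    using u w(3,4) k1 by (simp add: inside_append)
  have 4: "config c (u @ w) k = A k" if "k0 \<le> k" for k
  proof (cases "k = k0")
    case True
    have "filter (\<lambda>h. k0 \<le> kap h) u = u" using mem_u hp(3) by (auto simp: filter_id_conv)
    moreover have "filter (\<lambda>h. k0 \<le> kap h) w = filter (\<lambda>h. k0 + 1 \<le> kap h) w"
      using w(1) k1 by (intro filter_cong) auto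
    ultimately have "config c (u @ w) k0 = D + config c w (k0 + 1)" using du by (simp add: config_def)
    then show ?thesis using w(5)[of "k0 + 1"] k1 True by (simp add: D_def)
  next
    case False
    then have "filter (\<lambda>h. k \<le> kap h) u = []" using mem_u hp(3) that by (force simp: filter_empty_conv)
    then have "config c (u @ w) k = config c w k" by (simp add: config_def)
    then show ?thesis using w(5)[of k] k1 that False by simp
  qed
  show ?case unfolding k0_def[symmetric] using 1 2 3 4 by blast
qed

section \<open>Ordered monomials with fixed end domains: spin-1/2 part, spin-0 part and
  configuration\<close>

abbreviation nulls :: "particle list \<Rightarrow> particle list" where "nulls \<equiv> filter (\<lambda>x. \<not> is_half x)"

locale particle_words =
  fixes m n a b a' b' :: int
  assumes n_pos: "0 < n" and n_less: "n < m" and b_range: "0 \<le> b" "b \<le> n"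
    and a_range': "0 \<le> a'" "a' \<le> m - n" and b_range': "0 \<le> b'" "b' \<le> n"

sublocale particle_words \<subseteq> particle_space m n "(a, b)" "(a', b')"
  by unfold_locales (use n_less in linarith)

context particle_words
begin

text \<open>The two parts of an ordered monomial meet at the domain \<open>(c, b)\<close>, whose
  second coordinate is already the terminal one because spin-1/2 particles do not change it.\<close>

definition halfseqs :: "int \<Rightarrow> particle list set" where
  "halfseqs c = {hs. (\<forall>x\<in>set hs. is_half x \<and> is_particle x) \<and> sorted_wrt before hs \<and>
     inside (domains m n) (c, b) hs \<and> foldr move hs (c, b) = (a, b)}"

definition nullseqs :: "int \<Rightarrow> particle list set" where
  "nullseqs c = {ns. (\<forall>x\<in>set ns. \<not> is_half x \<and> is_particle x) \<and> sorted_wrt before ns \<and>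
     inside (domains m n) (a', b') ns \<and> foldr move ns (a', b') = (c, b)}"

lemma nullseq_drift: "ns \<in> nullseqs c \<Longrightarrow> a' + drift ns = c"
  using fst_foldr_move[of ns "(a', b')"] by (simp add: nullseqs_def)

lemma halfseq_filter: "hs \<in> halfseqs c \<Longrightarrow> filter is_half hs = hs \<and> nulls hs = []"
  by (auto simp: halfseqs_def filter_id_conv filter_empty_conv)

lemma nullseq_filter: "ns \<in> nullseqs c \<Longrightarrow> nulls ns = ns \<and> filter is_half ns = []"
  by (auto simp: nullseqs_def filter_id_conv filter_empty_conv)

lemma snd_halves: "\<forall>x\<in>set hs. is_half x \<Longrightarrow> snd (foldr move hs e) = snd e"
proof (induction hs)
  case (Cons x hs)
  have "snd (move x e') = snd e'" if "is_half x" for e' using that by (cases x; cases e') auto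
  then show ?case using Cons by simp
qed simp

lemma words_iff: "w \<in> words \<longleftrightarrow> (\<exists>c. \<exists>hs\<in>halfseqs c. \<exists>ns\<in>nullseqs c. w = hs @ ns)"
proof
  assume "w \<in> words"
  then obtain M N where w: "w \<in> mon M N" "ordered w" by (auto simp: words_def)
  then obtain hs ns where h: "w = hs @ ns" "\<forall>x\<in>set hs. is_half x" "\<forall>x\<in>set ns. \<not> is_half x"
    "sorted_wrt (<) (straight 0 hs)" "sorted_wrt (<) (straight 0 ns)" unfolding ordered_def by blast
  have p: "\<forall>x\<in>set hs. is_particle x" "\<forall>x\<in>set ns. is_particle x" using mon_particles[OF w(1)] h(1) by auto
  have i: "inside (domains m n) (a', b') ns" "inside (domains m n) (foldr move ns (a', b')) hs"
    "foldr move hs (foldr move ns (a', b')) = (a, b)"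
    using w(1) h(1) by (auto simp: monomials_iff inside_append)
  obtain c y where c: "foldr move ns (a', b') = (c, y)" by (cases "foldr move ns (a', b')")
  have "y = b" using snd_halves[OF h(2), of "(c, y)"] i(3) c by simp
  then have "hs \<in> halfseqs c" "ns \<in> nullseqs c"
    using i c h(2-5) p sorted_straight_iff[of hs True 0] sorted_straight_iff[of ns False 0]
    by (auto simp: halfseqs_def nullseqs_def)
  then show "\<exists>c. \<exists>hs\<in>halfseqs c. \<exists>ns\<in>nullseqs c. w = hs @ ns" using h(1) by blast
next
  assume "\<exists>c. \<exists>hs\<in>halfseqs c. \<exists>ns\<in>nullseqs c. w = hs @ ns"
  then obtain c hs ns where h: "hs \<in> halfseqs c" "ns \<in> nullseqs c" "w = hs @ ns" by blast
  have "w \<in> mon (length (filter is_half w)) (length (nulls w))"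
    using h by (auto simp: monomials_iff inside_append halfseqs_def nullseqs_def)
  moreover have "ordered w" unfolding ordered_def
    by (rule exI[of _ hs], rule exI[of _ ns])
       (use h sorted_straight_iff[of hs True 0] sorted_straight_iff[of ns False 0] in \<open>auto simp: halfseqs_def nullseqs_def\<close>)
  ultimately show "w \<in> words" unfolding words_def by blast
qed

definition conf :: "particle list \<Rightarrow> int \<Rightarrow> int" where
  "conf w = config (a' + drift (nulls w)) (filter is_half w)"

lemma conf_append: "hs \<in> halfseqs c \<Longrightarrow> ns \<in> nullseqs c \<Longrightarrow> conf (hs @ ns) = config c hs"
  using halfseq_filter nullseq_filter nullseq_drift by (simp add: conf_def)

lemma nullseq_parity:
  assumes "ns \<in> nullseqs c" shows "even (c + b + a' + b')"
proof -
  have "\<forall>x\<in>set ns. is_particle x \<Longrightarrow> \<forall>x\<in>set ns. \<not> is_half x \<Longrightarrow>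
      even (fst (foldr move ns e) + snd (foldr move ns e) + fst e + snd e)" for ns e
  proof (induction ns)
    case (Cons x ns)
    obtain s t k where x: "x = Null s t k" using Cons.prems(2) by (cases x) simp_all
    have "is_particle x" using Cons.prems(1) by simp
    then have st: "even (s + t)" unfolding x by auto
    obtain p q where pq: "foldr move ns e = (p, q)" by fastforce
    have "\<forall>x\<in>set ns. is_particle x" "\<forall>x\<in>set ns. \<not> is_half x" using Cons.prems by simp_all
    from Cons.IH[OF this] have "even (p + q + fst e + snd e)" unfolding pq fst_conv snd_conv .
    then have "even ((p + s) + (q + t) + fst e + snd e)" using st by presburger
    moreover have "foldr move (x # ns) e = (p + s, q + t)" by (simp add: x pq)
    ultimately show ?case by (simp only: fst_conv snd_conv)
  qed simp
  from this[of ns "(a', b')"] assms show ?thesis by (simp add: nullseqs_def add.assoc)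
qed

lemma config_limits:
  obtains K where "\<And>k. k \<le> - K \<Longrightarrow> config c hs k = c + drift hs" "\<And>k. K \<le> k \<Longrightarrow> config c hs k = c"
proof -
  obtain K where K: "\<forall>h\<in>set hs. - K < kap h \<and> kap h < K" using kap_bounds by blast
  show ?thesis by (rule that[of K]) (use K in \<open>fastforce intro!: config_left config_right\<close>)+
qed

lemma halfseq_config:
  assumes h: "hs \<in> halfseqs c" and c: "even (c + b + a' + b')"
  shows "config c hs \<in> configs m n (a, b) (a', b')"
proof -
  have hs: "\<forall>x\<in>set hs. is_half x \<and> is_particle x" "sorted_wrt before hs" "inside (domains m n) (c, b) hs"
    "foldr move hs (c, b) = (a, b)" using h by (auto simp: halfseqs_def)
  have a: "c + drift hs = a" using fst_foldr_move[of hs "(c, b)"] hs(4) by simp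
  have range: "0 \<le> config c hs k \<and> config c hs k \<le> m - n" for k
  proof -
    define v where "v = filter (\<lambda>h. k \<le> kap h) hs"
    have "inside (domains m n) (c, b) (filter (\<lambda>h. kap h < k) hs @ v)"
      using hs(3) sorted_filter_split[OF hs(2), of k] by (simp add: v_def)
    then have "foldr move v (c, b) \<in> domains m n" by (simp add: inside_append inside_start)
    then have "0 \<le> c + drift v \<and> c + drift v \<le> m - n"
      using fst_foldr_move[of v "(c, b)"] by (cases "foldr move v (c, b)") (simp add: domains_def)
    then show ?thesis by (simp add: config_def v_def)
  qed
  obtain K where K: "\<And>k. k \<le> - K \<Longrightarrow> config c hs k = c + drift hs" "\<And>k. K \<le> k \<Longrightarrow> config c hs k = c"
    using config_limits by blast
  have "\<exists>sL. \<forall>s\<le>sL. config c hs s = a" using K(1) a by blast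
  moreover have "\<exists>c' sR. (\<forall>s\<ge>sR. config c hs s = c') \<and> even (c' + b + a' + b')" using K(2) c by blast
  ultimately show ?thesis using range by (simp add: configs_def)
qed

lemma exists_halfseq:
  assumes A: "A \<in> configs m n (a, b) (a', b')" and R: "\<And>s. sR \<le> s \<Longrightarrow> A s = c"
  shows "\<exists>hs\<in>halfseqs c. config c hs = A"
proof -
  have r: "\<And>s. 0 \<le> A s \<and> A s \<le> m - n" using A by (auto simp: configs_def)
  obtain sL where L: "\<And>s. s \<le> sL \<Longrightarrow> A s = a" using A by (auto simp: configs_def)
  define j where "j = nat (sR - sL)"
  have j: "sR - int j \<le> sL" by (simp add: j_def)
  obtain w where w: "\<forall>h\<in>set w. is_half h \<and> is_particle h \<and> sR - int j \<le> kap h" "sorted_wrt before w"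
    "inside (domains m n) (c, b) w" "foldr move w (c, b) = (A (sR - int j), b)" "\<forall>k\<ge>sR - int j. config c w k = A k"
    using exists_halves[of A m n b sR c j, OF r b_range] R by blast
  have fm: "foldr move w (c, b) = (a, b)" using w(4) L[OF j] by simp
  then have d: "c + drift w = a" using fst_foldr_move[of w "(c, b)"] by simp
  have "config c w k = A k" for k
  proof (cases "sR - int j \<le> k")
    case False
    then have "config c w k = c + drift w" using w(1) by (intro config_left) force
    then show ?thesis using d L[of k] False j by simp
  qed (use w(5) in simp)
  then have "config c w = A" by blast
  moreover have "w \<in> halfseqs c" using w(1-3) fm unfolding halfseqs_def by blast
  ultimately show ?thesis by blast
qed

lemma halfseq_inj: "hs \<in> halfseqs c \<Longrightarrow> zs \<in> halfseqs c \<Longrightarrow> config c hs = config c zs \<Longrightarrow> hs = zs"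
  by (rule jump_inj) (auto simp: halfseqs_def config_jump[of c, symmetric])

lemma conf_configs: "w \<in> words \<Longrightarrow> conf w \<in> configs m n (a, b) (a', b')"
  unfolding words_iff using halfseq_config nullseq_parity by (auto simp: conf_append)

lemma conf_inj:
  assumes "w \<in> words" "z \<in> words" "conf w = conf z" "nulls w = nulls z"
  shows "w = z"
proof -
  obtain c hs ns where w: "hs \<in> halfseqs c" "ns \<in> nullseqs c" "w = hs @ ns" using assms(1) words_iff by blast
  obtain c' hs' ns' where z: "hs' \<in> halfseqs c'" "ns' \<in> nullseqs c'" "z = hs' @ ns'" using assms(2) words_iff by blast
  have "ns = ns'" using assms(4) w z halfseq_filter nullseq_filter by simp
  moreover from this have "c = c'" using nullseq_drift w(2) z(2) by blast
  moreover have "config c hs = config c' hs'" using assms(3) w z conf_append by simp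
  ultimately show ?thesis using halfseq_inj w z by simp
qed

lemma half_word_words: "hs \<in> halfseqs c \<Longrightarrow> ns \<in> nullseqs c \<Longrightarrow> half_word i (hs @ ns) = half_word i hs"
  using nullseq_filter by (simp add: half_word_def)

lemma monomial_f_conf:
  assumes w: "w \<in> words" and i: "i \<in> {0, 1}" and f: "monomial_f i w = Some w'"
  shows "w' \<in> words" "config_f (crystal_sign i) (conf w) (conf w')" "nulls w' = nulls w"
proof -
  obtain c hs ns where h: "hs \<in> halfseqs c" "ns \<in> nullseqs c" "w = hs @ ns" using w words_iff by blast
  obtain M N where wm: "w \<in> mon M N" "ordered w" using w by (auto simp: words_def)
  obtain k where k: "lead (half_word i w) k" "w' = flip_nth (- 1) k w"
    using f monomial_f_iff[OF mon_particles[OF wm(1)]] by blast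
  have "flips (- 1) i w (Some w')" using flips_f[OF wm(1), of i] f by simp
  from flips_ordered(1,2)[OF _ this wm] show w': "w' \<in> words" unfolding words_def by auto
  have lead: "lead (half_word i hs) k" using k(1) half_word_words[OF h(1,2)] h(3) by simp
  have "k < length (filter is_half hs)" using lead by (simp add: lead_def half_word_def)
  then have w'_eq: "w' = flip_nth (- 1) k hs @ ns" using k(2) h(3) flip_nth_append by simp
  have maps: "map is_half (flip_nth (- 1) k hs) = map is_half hs" by (rule flip_nth_maps)
  have half: "\<forall>x\<in>set (flip_nth (- 1) k hs). is_half x"
  proof -
    have "\<forall>y\<in>set (map is_half hs). y" using h(1) by (auto simp: halfseqs_def)
    then show ?thesis unfolding maps[symmetric] by simp
  qed
  have nulls: "nulls (flip_nth (- 1) k hs) = []" "filter is_half (flip_nth (- 1) k hs) = flip_nth (- 1) k hs"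
    using half by (auto simp: filter_empty_conv filter_id_conv)
  show n: "nulls w' = nulls w" using w'_eq h nulls halfseq_filter[OF h(1)] by simp
  have "conf w' = config c (flip_nth (- 1) k hs)"
    using w'_eq nulls nullseq_filter[OF h(2)] nullseq_drift[OF h(2)] by (simp add: conf_def)
  moreover have "conf w = config c hs" using conf_append h by simp
  moreover have "config_f (crystal_sign i) (config c hs) (config c (flip_nth (- 1) k hs))"
    by (rule config_f_flip) (use h(1) i lead in \<open>auto simp: halfseqs_def\<close>)
  ultimately show "config_f (crystal_sign i) (conf w) (conf w')" by simp
qed

lemma conf_f_exists:
  assumes w: "w \<in> words" and i: "i \<in> {0, 1}" and f: "config_f (crystal_sign i) (conf w) A'"
  shows "\<exists>w'. monomial_f i w = Some w'"
proof -
  obtain c hs ns where h: "hs \<in> halfseqs c" "ns \<in> nullseqs c" "w = hs @ ns" using w words_iff by blast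
  obtain M N where wm: "w \<in> mon M N" using w by (auto simp: words_def)
  have "config_f (crystal_sign i) (config c hs) A'" using f conf_append h by simp
  then have "\<exists>j. lead (half_word i hs) j"
    using config_f_lead[OF _ _ i] h(1) unfolding halfseqs_def by blast
  then show ?thesis using half_word_words h monomial_f_iff[OF mon_particles[OF wm]] by metis
qed

lemma right_limit_config:
  assumes "hs \<in> halfseqs c" "\<And>s. sR \<le> s \<Longrightarrow> config c hs s = c'"
  shows "c = c'"
proof -
  obtain K where "\<And>k. K \<le> k \<Longrightarrow> config c hs k = c" using config_limits by blast
  from this[of "max K sR"] assms(2)[of "max K sR"] show ?thesis by simp
qed

text \<open>Over \<open>A\<close> the spin-1/2 part exists and is unique, which leaves the choice of
  the spin-0 part; this choice depends on \<open>A\<close> only through its value at the right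
  end.\<close>

lemma nulls_fibre:
  assumes A: "A \<in> configs m n (a, b) (a', b')" and R: "\<And>s. sR \<le> s \<Longrightarrow> A s = c"
  shows "nulls ` {w \<in> words. conf w = A} = nullseqs c"
proof (intro set_eqI iffI)
  fix ns assume "ns \<in> nulls ` {w \<in> words. conf w = A}"
  then obtain w where w: "w \<in> words" "conf w = A" "ns = nulls w" by blast
  then obtain c' hs ns' where h: "hs \<in> halfseqs c'" "ns' \<in> nullseqs c'" "w = hs @ ns'" using words_iff by blast
  have "config c' hs = A" using conf_append h w by simp
  then have "c' = c" using right_limit_config[OF h(1), of sR c] R by simp
  then show "ns \<in> nullseqs c" using h w halfseq_filter nullseq_filter by simp
next
  fix ns assume ns: "ns \<in> nullseqs c"
  obtain hs where hs: "hs \<in> halfseqs c" "config c hs = A" using exists_halfseq[OF A R] by blast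
  have "hs @ ns \<in> words" using words_iff hs ns by blast
  moreover have "conf (hs @ ns) = A" "nulls (hs @ ns) = ns" using conf_append hs ns halfseq_filter nullseq_filter by auto
  ultimately show "ns \<in> nulls ` {w \<in> words. conf w = A}" by force
qed

text \<open>The operator changes \<open>A\<close> at a single place, hence not its value at the
  right end.\<close>

lemma nulls_fibre_f:
  assumes A: "A \<in> configs m n (a, b) (a', b')" "A' \<in> configs m n (a, b) (a', b')" and f: "config_f \<theta> A A'"
  shows "nulls ` {w \<in> words. conf w = A} = nulls ` {w \<in> words. conf w = A'}"
proof -
  obtain c sR where R: "\<And>s. sR \<le> s \<Longrightarrow> A s = c" using A(1) by (auto simp: configs_def)
  obtain s where A': "A' = A(s := A s - \<theta> * parity_sign s)" using f unfolding config_f_def by blast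
  define sR' where "sR' = max sR (s + 1)"
  have "A t = c" "A' t = c" if "sR' \<le> t" for t using R[of t] that by (auto simp: A' sR'_def)
  then show ?thesis using nulls_fibre[OF A(1), of sR' c] nulls_fibre[OF A(2), of sR' c] by simp
qed

lemma infinite_nullseqs:
  assumes c: "0 \<le> c" "c \<le> m - n" "even (c + b + a' + b')"
  shows "infinite (nullseqs c)"
proof -
  have "1 \<le> m - n" "1 \<le> n" using n_pos n_less by auto
  then obtain v :: "nat \<Rightarrow> domain" and J where v: "v 0 = (c, b)" "1 \<le> J" "v J = (a', b')"
    "\<And>j. j < J \<Longrightarrow> diagonal_step (m - n) n (v j) (v (Suc j))"
    using diagonal_walk[of "m - n" n c b a' b'] c a_range' b_range b_range' by (metis order_refl)
  \<comment> \<open>Products act from the right, so the \<open>j\<close>-th particle leads from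
    \<open>v (Suc j)\<close> back to \<open>v j\<close>. The summand 1 for \<open>s = t\<close>
    gives the index parity required for spin 0, the spacing 2 makes the indices increase strictly,
    and \<open>4 * r\<close> translates without changing parity.\<close>
  define x :: "int \<Rightarrow> nat \<Rightarrow> particle" where
    "x r j = (let s = fst (v j) - fst (v (Suc j)); t = snd (v j) - snd (v (Suc j)) in
       Null s t (4 * r + 2 * int j + (if s = t then 1 else 0)))" for r j
  have x: "\<not> is_half (x r j) \<and> is_particle (x r j) \<and> move (x r j) (v (Suc j)) = v j" if "j < J" for r j
  proof -
    obtain p q p' q' where pq: "v j = (p, q)" "v (Suc j) = (p', q')" by fastforce
    have "\<bar>p' - p\<bar> = 1" "\<bar>q' - q\<bar> = 1" using v(4)[OF that] pq by (auto simp: diagonal_step_def)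
    then have "p - p' = 1 \<or> p - p' = - 1" "q - q' = 1 \<or> q - q' = - 1" by linarith+
    then show ?thesis by (auto simp: x_def Let_def pq parity_sign_def)
  qed
  have kx: "4 * r + 2 * int j \<le> kap (x r j)" "kap (x r j) \<le> 4 * r + 2 * int j + 1" for r j
    by (auto simp: x_def Let_def)
  have dom: "v j \<in> domains m n" if "j \<le> J" for j
    using v(4)[of j] v(4)[of "j - 1"] that v(2) by (cases "j < J") (auto simp: diagonal_step_def domains_def)
  define ns where "ns r = map (x r) [0..<J]" for r
  have tail: "inside (domains m n) (a', b') (map (x r) [j..<J]) \<and> foldr move (map (x r) [j..<J]) (a', b') = v j" if "j \<le> J" for r j
    using that
  proof (induction j rule: inc_induct)
    case base then show ?case using v(3) dom[of J] by simp
  next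
    case (step j)
    then have "map (x r) [j..<J] = x r j # map (x r) [Suc j..<J]" by (simp add: upt_conv_Cons)
    then show ?case using step x[of j r] dom[of j] by simp
  qed
  have "sorted_wrt before (ns r)" for r
    unfolding sorted_wrt_iff_nth_less
  proof (intro allI impI)
    fix j k assume jk: "j < k" "k < length (ns r)"
    then have "kap (x r j) < kap (x r k)" using kx(2)[of r j] kx(1)[of r k] by linarith
    then show "before (ns r ! j) (ns r ! k)" using jk by (simp add: ns_def before_def)
  qed
  then have mem: "ns r \<in> nullseqs c" for r
    using tail[of 0 r] x v(1) by (auto simp: nullseqs_def ns_def)
  have "inj ns"
  proof (rule injI)
    fix r r' assume "ns r = ns r'"
    then have "ns r ! 0 = ns r' ! 0" by simp
    then have "x r 0 = x r' 0" using v(2) by (simp add: ns_def)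
    then have "kap (x r 0) = kap (x r' 0)" by simp
    then show "r = r'" by (simp add: x_def Let_def)
  qed
  moreover have "range ns \<subseteq> nullseqs c" using mem by blast
  ultimately show ?thesis using finite_imageD[of ns UNIV] finite_subset infinite_UNIV_int by blast
qed

lemma infinite_nulls:
  assumes A: "A \<in> configs m n (a, b) (a', b')"
  shows "infinite (nulls ` {w \<in> words. conf w = A})"
proof -
  obtain c sR where R: "\<And>s. sR \<le> s \<Longrightarrow> A s = c" and c: "even (c + b + a' + b')" using A by (auto simp: configs_def)
  have "0 \<le> A sR \<and> A sR \<le> m - n" using A by (auto simp: configs_def)
  then have "infinite (nullseqs c)" using infinite_nullseqs[OF _ _ c] R[of sR] by simp
  moreover have "nulls ` {w \<in> words. conf w = A} = nullseqs c" by (rule nulls_fibre[OF A]) (rule R)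
  ultimately show ?thesis by simp
qed

end

lemma countable_particles: "countable (UNIV :: particle set)"
proof -
  have "UNIV = (\<lambda>(s, t, k). Half s t k) ` UNIV \<union> (\<lambda>(s, t, k). Null s t k) ` UNIV"
  proof (intro set_eqI iffI)
    fix x :: particle
    have "Half s t k \<in> (\<lambda>(s, t, k). Half s t k) ` UNIV" "Null s t k \<in> (\<lambda>(s, t, k). Null s t k) ` UNIV" for s t k
      by (rule image_eqI[of _ _ "(s, t, k)"]; simp)+
    then show "x \<in> (\<lambda>(s, t, k). Half s t k) ` UNIV \<union> (\<lambda>(s, t, k). Null s t k) ` UNIV" by (cases x) blast+
  qed simp
  moreover have "countable ((\<lambda>(s, t, k). Half s t k) ` UNIV \<union> (\<lambda>(s, t, k). Null s t k) ` UNIV)"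
    by (intro countable_Un countable_image) auto
  ultimately show ?thesis by simp
qed

lemma countable_particle_lists: "countable (S :: particle list set)"
  using countable_subset[OF _ countable_lists[OF countable_particles]] by auto

section \<open>Fibred crystals\<close>

text \<open>It suffices to match \<open>f\<close>, because in a crystal \<open>e\<close> is the
  partial inverse of \<open>f\<close>.\<close>

lemma crystal_iso_of_relation:
  assumes B: "crystal B e f" and B': "crystal B' e' f'"
    and \<iota>: "bij_betw \<iota> B W" and \<iota>': "bij_betw \<iota>' B' W"
    and f: "\<And>i x y. i \<in> {0, 1} \<Longrightarrow> x \<in> B \<Longrightarrow> y \<in> B \<Longrightarrow> f i x = Some y \<longleftrightarrow> G i (\<iota> x) (\<iota> y)"
    and f': "\<And>i x y. i \<in> {0, 1} \<Longrightarrow> x \<in> B' \<Longrightarrow> y \<in> B' \<Longrightarrow> f' i x = Some y \<longleftrightarrow> G i (\<iota>' x) (\<iota>' y)"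
  shows "crystal_iso B e f B' e' f' (inv_into B' \<iota>' \<circ> \<iota>)"
proof -
  define \<phi> where "\<phi> = inv_into B' \<iota>' \<circ> \<iota>"
  have bij: "bij_betw \<phi> B B'"
    unfolding \<phi>_def by (rule bij_betw_trans[OF \<iota> bij_betw_inv_into[OF \<iota>']])
  have mem: "\<phi> x \<in> B'" if "x \<in> B" for x using bij that by (rule bij_betwE[rule_format])
  have \<phi>: "\<iota>' (\<phi> x) = \<iota> x" if "x \<in> B" for x
    using bij_betw_inv_into_right[OF \<iota>'] bij_betwE[OF \<iota>] that by (simp add: \<phi>_def)
  have ff: "f' i (\<phi> x) = Some (\<phi> y) \<longleftrightarrow> f i x = Some y" if "i \<in> {0, 1}" "x \<in> B" "y \<in> B" for i x y
    using f[OF that] f'[OF that(1) mem[OF that(2)] mem[OF that(3)]] \<phi>[OF that(2)] \<phi>[OF that(3)] by simp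
  have fe: "f i x = Some y \<longleftrightarrow> e i y = Some x" if "i \<in> {0, 1}" "x \<in> B" "y \<in> B" for i x y
    using B that unfolding crystal_def by blast
  have fe': "f' i x = Some y \<longleftrightarrow> e' i y = Some x" if "i \<in> {0, 1}" "x \<in> B'" "y \<in> B'" for i x y
    using B' that unfolding crystal_def by blast
  have ee: "e' i (\<phi> x) = Some (\<phi> y) \<longleftrightarrow> e i x = Some y" if "i \<in> {0, 1}" "x \<in> B" "y \<in> B" for i x y
    using ff[OF that(1,3,2)] fe[OF that(1,3,2)] fe'[OF that(1) mem[OF that(3)] mem[OF that(2)]] by simp
  have lift: "g' = map_option \<phi> g"
    if "\<And>y. g = Some y \<Longrightarrow> y \<in> B" "\<And>z. g' = Some z \<Longrightarrow> z \<in> B'"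
      "\<And>y. y \<in> B \<Longrightarrow> g' = Some (\<phi> y) \<longleftrightarrow> g = Some y" for g g'
  proof (cases g)
    case None
    have False if g': "g' = Some z" for z
    proof -
      have "z \<in> \<phi> ` B" using \<open>\<And>z. g' = Some z \<Longrightarrow> z \<in> B'\<close>[OF g'] bij by (simp add: bij_betw_imp_surj_on)
      then obtain y where "y \<in> B" "z = \<phi> y" by blast
      then show False using \<open>\<And>y. y \<in> B \<Longrightarrow> g' = Some (\<phi> y) \<longleftrightarrow> g = Some y\<close>[of y] g' None by simp
    qed
    then show ?thesis using None by (cases g') auto
  next
    case (Some y)
    then show ?thesis using that(1)[of y] that(3)[of y] by simp
  qed
  have "e' i (\<phi> x) = map_option \<phi> (e i x) \<and> f' i (\<phi> x) = map_option \<phi> (f i x)" if ix: "i \<in> {0, 1}" "x \<in> B" for i x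
  proof
    have x': "\<phi> x \<in> B'" by (rule mem[OF ix(2)])
    show "e' i (\<phi> x) = map_option \<phi> (e i x)"
      by (rule lift[OF _ _ ee[OF ix]]) (use B B' ix x' in \<open>unfold crystal_def, blast+\<close>)
    show "f' i (\<phi> x) = map_option \<phi> (f i x)"
      by (rule lift[OF _ _ ff[OF ix]]) (use B B' ix x' in \<open>unfold crystal_def, blast+\<close>)
  qed
  then show ?thesis unfolding crystal_iso_def \<phi>_def[symmetric] using B B' bij by blast
qed

lemma crystal_iso_trans:
  assumes "crystal_iso B e f B' e' f' \<phi>" "crystal_iso B' e' f' B'' e'' f'' \<psi>"
  shows "crystal_iso B e f B'' e'' f'' (\<psi> \<circ> \<phi>)"
proof -
  have b: "bij_betw \<phi> B B'" "bij_betw \<psi> B' B''" using assms by (auto simp: crystal_iso_def)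
  have "\<phi> x \<in> B'" if "x \<in> B" for x using b(1) that by (rule bij_betwE[rule_format])
  then show ?thesis using assms bij_betw_trans[OF b] unfolding crystal_iso_def by (simp add: option.map_comp)
qed

text \<open>
  A crystal whose operators are governed by a relation on a base \<open>Z\<close> and which is determined by the
  base point and a conserved label.  If all fibres of labels are countably infinite, only \<open>Z\<close> and the
  relation matter.
\<close>

locale fibred_crystal =
  fixes B :: "'x set" and e f :: "nat \<Rightarrow> 'x \<Rightarrow> 'x option" and base :: "'x \<Rightarrow> 'z" and label :: "'x \<Rightarrow> 'q"
    and Z :: "'z set" and F :: "nat \<Rightarrow> 'z \<Rightarrow> 'z \<Rightarrow> bool"
  assumes crystal: "crystal B e f"
    and base: "x \<in> B \<Longrightarrow> base x \<in> Z"
    and inj: "x \<in> B \<Longrightarrow> y \<in> B \<Longrightarrow> base x = base y \<Longrightarrow> label x = label y \<Longrightarrow> x = y"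
    and f_base: "i \<in> {0, 1} \<Longrightarrow> x \<in> B \<Longrightarrow> f i x = Some y \<Longrightarrow> F i (base x) (base y)"
    and f_label: "i \<in> {0, 1} \<Longrightarrow> x \<in> B \<Longrightarrow> f i x = Some y \<Longrightarrow> label y = label x"
    and f_exists: "i \<in> {0, 1} \<Longrightarrow> x \<in> B \<Longrightarrow> F i (base x) z \<Longrightarrow> \<exists>y. f i x = Some y"
    and functional: "F i z z' \<Longrightarrow> F i z z'' \<Longrightarrow> z' = z''"
    and countable_labels: "z \<in> Z \<Longrightarrow> countable (label ` {x \<in> B. base x = z})"
    and infinite_labels: "z \<in> Z \<Longrightarrow> infinite (label ` {x \<in> B. base x = z})"
    and same_labels: "i \<in> {0, 1} \<Longrightarrow> z \<in> Z \<Longrightarrow> z' \<in> Z \<Longrightarrow> F i z z' \<Longrightarrow>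
      label ` {x \<in> B. base x = z} = label ` {x \<in> B. base x = z'}"
begin

abbreviation labels where "labels z \<equiv> label ` {x \<in> B. base x = z}"

text \<open>The enumeration depends only on the set of labels over the base point. By
  \<open>same_labels\<close> this set is constant along \<open>F\<close>, so the number of a
  conserved label is conserved as well.\<close>

definition coordinates :: "'x \<Rightarrow> 'z \<times> nat" where
  "coordinates x = (base x, to_nat_on (labels (base x)) (label x))"

lemma bij_labels: "z \<in> Z \<Longrightarrow> bij_betw (to_nat_on (labels z)) (labels z) UNIV"
  by (rule to_nat_on_infinite[OF countable_labels infinite_labels])

lemma bij_coordinates: "bij_betw coordinates B (Z \<times> UNIV)"
proof (rule bij_betw_imageI)
  show "inj_on coordinates B"
  proof (rule inj_onI)
    fix x y assume xy: "x \<in> B" "y \<in> B" "coordinates x = coordinates y"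
    then have "base x = base y" "to_nat_on (labels (base x)) (label x) = to_nat_on (labels (base x)) (label y)"
      by (auto simp: coordinates_def)
    moreover have "inj_on (to_nat_on (labels (base x))) (labels (base x))"
      using bij_labels[OF base[OF xy(1)]] by (rule bij_betw_imp_inj_on)
    moreover have "label x \<in> labels (base x)" "label y \<in> labels (base y)" using xy by blast+
    ultimately show "x = y" using inj[OF xy(1,2)] by (simp add: inj_on_eq_iff)
  qed
  show "coordinates ` B = Z \<times> UNIV"
  proof (intro equalityI subsetI)
    fix p assume "p \<in> coordinates ` B"
    then show "p \<in> Z \<times> UNIV" using base by (auto simp: coordinates_def)
  next
    fix p :: "'z \<times> nat" assume "p \<in> Z \<times> UNIV"
    then obtain z k where p: "p = (z, k)" "z \<in> Z" by blast
    have "k \<in> to_nat_on (labels z) ` labels z" using bij_labels[OF p(2)] by (simp add: bij_betw_imp_surj_on)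
    then obtain x where "x \<in> B" "base x = z" "k = to_nat_on (labels z) (label x)" by blast
    then show "p \<in> coordinates ` B" using p by (intro image_eqI[of _ _ x]) (auto simp: coordinates_def)
  qed
qed

text \<open>For the converse, \<open>f\<close> is defined at \<open>x\<close> by
  \<open>f_exists\<close>, and its value has the base point and the label of \<open>y\<close>, hence
  equals \<open>y\<close>.\<close>

lemma f_coordinates:
  assumes i: "i \<in> {0, 1}" and x: "x \<in> B" and y: "y \<in> B"
  shows "f i x = Some y \<longleftrightarrow>
    F i (fst (coordinates x)) (fst (coordinates y)) \<and> snd (coordinates x) = snd (coordinates y)"
proof
  assume s: "f i x = Some y"
  have F: "F i (base x) (base y)" by (rule f_base[OF i x s])
  have "labels (base x) = labels (base y)" by (rule same_labels[OF i base[OF x] base[OF y] F])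
  then show "F i (fst (coordinates x)) (fst (coordinates y)) \<and> snd (coordinates x) = snd (coordinates y)"
    using F f_label[OF i x s] by (simp add: coordinates_def)
next
  assume a: "F i (fst (coordinates x)) (fst (coordinates y)) \<and> snd (coordinates x) = snd (coordinates y)"
  then have F: "F i (base x) (base y)" by (simp add: coordinates_def)
  have L: "labels (base x) = labels (base y)" by (rule same_labels[OF i base[OF x] base[OF y] F])
  then have "to_nat_on (labels (base x)) (label x) = to_nat_on (labels (base x)) (label y)"
    using a by (simp add: coordinates_def)
  moreover have "label x \<in> labels (base x)" "label y \<in> labels (base x)" unfolding L using x y L by blast+
  moreover have "inj_on (to_nat_on (labels (base x))) (labels (base x))"
    using bij_labels[OF base[OF x]] by (rule bij_betw_imp_inj_on)
  ultimately have l: "label x = label y" by (simp add: inj_on_eq_iff)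
  obtain y' where y': "f i x = Some y'" using f_exists[OF i x F] by blast
  have "y' \<in> B" using crystal i x y' unfolding crystal_def by blast
  moreover have "base y' = base y" by (rule functional[OF f_base[OF i x y'] F])
  moreover have "label y' = label y" using f_label[OF i x y'] l by simp
  ultimately show "f i x = Some y" using inj y y' by blast
qed

end

lemma fibred_crystals_iso:
  assumes "fibred_crystal B e f base label Z F" "fibred_crystal B' e' f' base' label' Z F"
  shows "\<exists>\<phi>. crystal_iso B e f B' e' f' \<phi>"
proof -
  interpret x: fibred_crystal B e f base label Z F by fact
  interpret y: fibred_crystal B' e' f' base' label' Z F by fact
  show ?thesis
    using crystal_iso_of_relation[OF x.crystal y.crystal x.bij_coordinates y.bij_coordinates,
      of "\<lambda>i p q. F i (fst p) (fst q) \<and> snd p = snd q"] x.f_coordinates y.f_coordinates by blast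
qed

section \<open>Both pictures as fibred crystals over the same base\<close>

context path_crystal
begin

definition limit_of :: "(int \<Rightarrow> int) \<Rightarrow> int \<Rightarrow> int" where "limit_of p = (THE A. limitA p A)"

text \<open>The label is the equivalence class itself, as a set of paths, so that labels are
  compared by equality and no representative is chosen.\<close>

definition agreement :: "(int \<Rightarrow> int) \<Rightarrow> (int \<Rightarrow> int) set" where
  "agreement p = {p' \<in> P. agree (state_of n p) (state_of n p')}"

lemma limit_of_eq: "limitA p A \<Longrightarrow> limit_of p = A"
  unfolding limit_of_def by (rule the_equality) (use limitA_unique in blast)+

lemma limit_of: "p \<in> P \<Longrightarrow> limitA p (limit_of p) \<and> limit_of p \<in> configs m n (a, b) (a', b')"
  using exists_limitA limit_of_eq by metis

lemma agreement_eq: "agree (state_of n p) (state_of n p') \<Longrightarrow> agreement p = agreement p'"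
  unfolding agreement_def using agree_sym agree_trans by blast

lemma path_f_mem: "i \<in> {0, 1} \<Longrightarrow> p \<in> P \<Longrightarrow> path_f m n i p = Some p' \<Longrightarrow> p' \<in> P"
  using crystal_paths unfolding crystal_def by blast

lemma path_f_limit_of:
  assumes "i \<in> {0, 1}" "p \<in> P" "path_f m n i p = Some p'"
  shows "config_f (crystal_sign i) (limit_of p) (limit_of p')" "agreement p' = agreement p"
  using limitA_f[OF assms, of "limit_of p"] limit_of[OF assms(2)] limit_of_eq agreement_eq by metis+

lemma limit_of_inj:
  assumes p: "p \<in> P" "p' \<in> P" "limit_of p = limit_of p'" "agreement p = agreement p'"
  shows "p = p'"
proof -
  have "p' \<in> agreement p" using p(2,4) agree_refl by (simp add: agreement_def)
  then have "agree (state_of n p) (state_of n p')" by (simp add: agreement_def)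
  moreover have "limitA p (limit_of p)" "limitA p' (limit_of p)" using limit_of[OF p(1)] limit_of[OF p(2)] p(3) by simp_all
  ultimately show ?thesis using limitA_agree_inj by blast
qed

text \<open>Equality of the label sets over \<open>z\<close> and \<open>z'\<close> uses both
  directions: \<open>f\<close> carries a class from the fibre over \<open>z\<close> to that over
  \<open>z'\<close>, and \<open>limitA_f_lift\<close> leads back.\<close>

lemma fibred_paths:
  "fibred_crystal P (path_e m n) (path_f m n) limit_of agreement (configs m n (a, b) (a', b'))
    (\<lambda>i. config_f (crystal_sign i))"
proof
  show "crystal P (path_e m n) (path_f m n)" by (rule crystal_paths)
  show "limit_of p \<in> configs m n (a, b) (a', b')" if "p \<in> P" for p using limit_of[OF that] by blast
  show "p = p'" if "p \<in> P" "p' \<in> P" "limit_of p = limit_of p'" "agreement p = agreement p'" for p p'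
    using limit_of_inj that by blast
  fix i :: nat and z z' :: "int \<Rightarrow> int"
  show "config_f (crystal_sign i) (limit_of p) (limit_of p')" "agreement p' = agreement p"
    if "i \<in> {0, 1}" "p \<in> P" "path_f m n i p = Some p'" for p p' by (fact path_f_limit_of[OF that])+
  show "\<exists>p'. path_f m n i p = Some p'" if "i \<in> {0, 1}" "p \<in> P" "config_f (crystal_sign i) (limit_of p) z" for p
    by (rule limitA_f_exists[OF that(1,2) _ that(3)]) (use limit_of[OF that(2)] in blast)
  show "z' = z''" if "config_f (crystal_sign i) z z'" "config_f (crystal_sign i) z z''" for z''
    by (rule config_f_functional[OF that])
  show "countable (agreement ` {p \<in> P. limit_of p = z})"
    by (rule countable_image[OF countable_subset[OF _ countable_paths]]) blast
  show "infinite (agreement ` {p \<in> P. limit_of p = z})" if "z \<in> configs m n (a, b) (a', b')"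
  proof -
    have "{p \<in> P. limit_of p = z} = {p \<in> P. limitA p z}" using limit_of limit_of_eq by blast
    then have "infinite {p \<in> P. limit_of p = z}" using infinite_fibre[OF that] by simp
    moreover have "inj_on agreement {p \<in> P. limit_of p = z}" by (rule inj_onI) (use limit_of_inj in blast)
    ultimately show ?thesis using finite_imageD by blast
  qed
  show "agreement ` {p \<in> P. limit_of p = z} = agreement ` {p \<in> P. limit_of p = z'}"
    if i: "i \<in> {0, 1}" and F: "config_f (crystal_sign i) z z'"
  proof (intro equalityI subsetI)
    fix L assume "L \<in> agreement ` {p \<in> P. limit_of p = z}"
    then obtain p where p: "p \<in> P" "limit_of p = z" "L = agreement p" by blast
    then obtain p' where p': "path_f m n i p = Some p'"
      using limitA_f_exists[OF i p(1) _ F] limit_of[OF p(1)] by blast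
    have "limit_of p' = z'" using path_f_limit_of(1)[OF i p(1) p'] config_f_functional[OF _ F] p(2) by blast
    then show "L \<in> agreement ` {p \<in> P. limit_of p = z'}"
      using path_f_mem[OF i p(1) p'] path_f_limit_of(2)[OF i p(1) p'] p(3) by blast
  next
    fix L assume "L \<in> agreement ` {p \<in> P. limit_of p = z'}"
    then obtain p' where p': "p' \<in> P" "limit_of p' = z'" "L = agreement p'" by blast
    then obtain p where p: "p \<in> P" "path_f m n i p = Some p'" "limitA p z"
      using limitA_f_lift[OF i p'(1) _ F] limit_of[OF p'(1)] by blast
    then show "L \<in> agreement ` {p \<in> P. limit_of p = z}"
      using path_f_limit_of(2)[OF i p(1,2)] limit_of_eq[OF p(3)] p'(3) by blast
  qed
qed

end

context particle_words
begin

lemma fibred_words: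
  "fibred_crystal words monomial_e monomial_f conf nulls (configs m n (a, b) (a', b'))
    (\<lambda>i. config_f (crystal_sign i))"
proof
  show "crystal words monomial_e monomial_f" by (rule crystal_words)
  show "conf w \<in> configs m n (a, b) (a', b')" if "w \<in> words" for w by (rule conf_configs[OF that])
  show "w = z" if "w \<in> words" "z \<in> words" "conf w = conf z" "nulls w = nulls z" for w z by (rule conf_inj[OF that])
  fix i :: nat and z z' :: "int \<Rightarrow> int"
  show "config_f (crystal_sign i) (conf w) (conf w')" if "i \<in> {0, 1}" "w \<in> words" "monomial_f i w = Some w'" for w w'
    by (rule monomial_f_conf(2)[OF that(2,1,3)])
  show "nulls w' = nulls w" if "i \<in> {0, 1}" "w \<in> words" "monomial_f i w = Some w'" for w w'
    by (rule monomial_f_conf(3)[OF that(2,1,3)])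
  show "\<exists>w'. monomial_f i w = Some w'" if "i \<in> {0, 1}" "w \<in> words" "config_f (crystal_sign i) (conf w) z" for w
    by (rule conf_f_exists[OF that(2,1,3)])
  show "z' = z''" if "config_f (crystal_sign i) z z'" "config_f (crystal_sign i) z z''" for z''
    by (rule config_f_functional[OF that])
  show "countable (nulls ` {w \<in> words. conf w = z})" by (rule countable_particle_lists)
  show "infinite (nulls ` {w \<in> words. conf w = z})" if "z \<in> configs m n (a, b) (a', b')"
    by (rule infinite_nulls[OF that])
  show "nulls ` {w \<in> words. conf w = z} = nulls ` {w \<in> words. conf w = z'}"
    if "z \<in> configs m n (a, b) (a', b')" "z' \<in> configs m n (a, b) (a', b')" "config_f (crystal_sign i) z z'"
    by (rule nulls_fibre_f[OF that])
qed

text \<open>Ordered monomials represent the nonzero classes uniquely, so the crystal structure on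
  monomials is transported along the bijection; the pair of particle numbers makes the union over
  \<open>M\<close> and \<open>N\<close> disjoint.\<close>

lemma triple_iso:
  "crystal_iso words monomial_e monomial_f (particle_crystal m n (a, b) (a', b'))
     (particle_e m n (a, b) (a', b')) (particle_f m n (a, b) (a', b'))
     (triple :: particle list \<Rightarrow> nat \<times> nat \<times> (particle list \<Rightarrow>\<^sub>0 'k::field_char_0) set)"
proof -
  let ?t = "triple :: particle list \<Rightarrow> nat \<times> nat \<times> (particle list \<Rightarrow>\<^sub>0 'k) set"
  let ?e = "particle_e m n (a, b) (a', b') :: nat \<Rightarrow> nat \<times> nat \<times> (particle list \<Rightarrow>\<^sub>0 'k) set \<Rightarrow> _"
  let ?f = "particle_f m n (a, b) (a', b') :: nat \<Rightarrow> nat \<times> nat \<times> (particle list \<Rightarrow>\<^sub>0 'k) set \<Rightarrow> _"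
  have C: "particle_crystal m n (a, b) (a', b') = ?t ` words" by (rule particle_crystal_eq)
  have inj: "inj_on ?t words" by (rule inj_onI) (rule triple_inj)
  have e: "?e i (?t w) = map_option ?t (monomial_e i w)" if "w \<in> words" for i w by (rule particle_e_triple[OF that])
  have f: "?f i (?t w) = map_option ?t (monomial_f i w)" if "w \<in> words" for i w by (rule particle_f_triple[OF that])
  have "crystal (?t ` words) ?e ?f"
    unfolding crystal_def
  proof (intro ballI conjI allI impI)
    fix i :: nat and x y assume i: "i \<in> {0, 1}" and "x \<in> ?t ` words"
    then obtain w where w: "w \<in> words" "x = ?t w" by blast
    show "y \<in> ?t ` words" "?e i y = Some x" if fx: "?f i x = Some y"
    proof -
      obtain z where z: "monomial_f i w = Some z" "y = ?t z" using fx f[OF w(1)] w(2) by auto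
      have zw: "z \<in> words" "monomial_e i z = Some w" using crystal_words i w(1) z(1) unfolding crystal_def by blast+
      then show "y \<in> ?t ` words" "?e i y = Some x" using z(2) w(2) e[OF zw(1)] by auto
    qed
    show "y \<in> ?t ` words" "?f i y = Some x" if ex: "?e i x = Some y"
    proof -
      obtain z where z: "monomial_e i w = Some z" "y = ?t z" using ex e[OF w(1)] w(2) by auto
      have zw: "z \<in> words" "monomial_f i z = Some w" using crystal_words i w(1) z(1) unfolding crystal_def by blast+
      then show "y \<in> ?t ` words" "?f i y = Some x" using z(2) w(2) f[OF zw(1)] by auto
    qed
  qed
  then show ?thesis
    unfolding crystal_iso_def C using crystal_words e f inj_on_imp_bij_betw[OF inj] by blast
qed

end

theorem theorem7p8:
  fixes m n a b a' b' :: int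
  assumes "0 < n" and "n < m"
    and "0 \<le> a" and "a \<le> m - n" and "0 \<le> a'" and "a' \<le> m - n"
    and "0 \<le> b" and "b \<le> n" and "0 \<le> b'" and "b' \<le> n"
  shows "\<exists>\<phi> :: (int \<Rightarrow> int) \<Rightarrow> nat \<times> nat \<times> (particle list \<Rightarrow>\<^sub>0 'k::field_char_0) set.
    crystal_iso
      (paths m n (a, b) (a', b')) (path_e m n) (path_f m n)
      (particle_crystal m n (a, b) (a', b'))
      (particle_e m n (a, b) (a', b')) (particle_f m n (a, b) (a', b'))
      \<phi>"
proof -
  interpret path_crystal m n a b a' b' by unfold_locales (use assms in auto)
  interpret words: particle_words m n a b a' b' by unfold_locales (use assms in auto)
  show ?thesis
    using fibred_crystals_iso[OF fibred_paths words.fibred_words] crystal_iso_trans[OF _ words.triple_iso] by blast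
qed

end
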